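(* Let $\Lambda$ be a finite-dimensional elementary $k$-algebra with complete set of primitive orthogonal idempotents $1=e_1+e_2$ and $e_2\Lambda e_1=0$ (equivalently $\Sigma(\Lambda)\in\mathsf{Fan}^{+-}_{\rm sc}(2)$). Let $T\in\{\mu_1^+(\Lambda[1]),\mu_2^-(\Lambda)\}$. Then there exists a finite-dimensional elementary $k$-algebra $\Gamma$ of rank $2$ (with a complete set of primitive orthogonal idempotents) such that $\Sigma(\Gamma)=D_{C(T)}(\Sigma(\Lambda))$.
   Context: $k$ is a field; elementary means $\Lambda/J_\Lambda$ is a product of copies of $k$. In $K^b(\operatorname{proj}\Lambda)$: a complex is 2-term if concentrated in degrees $-1,0$, presilting if $\operatorname{Hom}(T,T[\ell])=0$ for $\ell>0$, and (for rank 2) silting if moreover it has two non-isomorphic indecomposable summands. $[T]=[T^0]-[T^{-1}]$, $C(T)=\operatorname{cone}\{[T_i]\}$ over indecomposable summands, $\Sigma(\Lambda)$ the set of all such $C(T)$ for basic 2-term presilting $T$, in $\mathbb{R}^2$ via $[e_1\Lambda]\mapsto(1,0)$, $[e_2\Lambda]\mapsto(0,1)$. Partial order on basic 2-term silting complexes: $T\ge U$ iff $\operatorname{Hom}(T,U[\ell])=0$ for $\ell>0$. For a basic 2-term silting $T=T_1\oplus T_2$, the mutation at $T_i$ is the unique other basic 2-term silting complex $T'_i\oplus T_j$ ($j\ne i$, $T'_i\not\cong T_i$); it is written $\mu_i^+(T)$ if it is $>T$ and $\mu_i^-(T)$ if it is $<T$. Here $\Lambda[1]=e_1\Lambda[1]\oplus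 e_2\Lambda[1]$ and $\Lambda=e_1\Lambda\oplus e_2\Lambda$, index $i$ referring to the summand $e_i\Lambda[1]$, resp. $e_i\Lambda$. Explicitly, with $r$ (resp. $\ell$) the minimal number of generators of $e_1\Lambda e_2$ as a right $e_2\Lambda e_2$-module (resp. left $e_1\Lambda e_1$-module), $C(\mu_1^+(\Lambda[1]))=\operatorname{cone}\{(0,-1),(1,-r)\}$ and $C(\mu_2^-(\Lambda))=\operatorname{cone}\{(1,0),(\ell,-1)\}$. Subdivision: for a nonsingular fan $\Sigma$ in $\mathbb{R}^2$ and a 2-dimensional cone $\sigma=\operatorname{cone}\{u,v\}$ ($u,v$ primitive), $D_\sigma(\Sigma)$ has rays $\Sigma_1\cup\{\mathbb{R}_{\ge0}(u+v)\}$ and 2-dimensional cones $(\Sigma_2\setminus\{\sigma\})\cup\{\operatorname{cone}\{u,u+v\},\operatorname{cone}\{v,u+v\}\}$. *)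

theory Defs
  imports "HOL-Analysis.Analysis"
begin

record ('k, 'a) kalg =
  acar  :: "'a set"
  aadd  :: "'a \<Rightarrow> 'a \<Rightarrow> 'a"
  amul  :: "'a \<Rightarrow> 'a \<Rightarrow> 'a"
  azero :: "'a"
  aone  :: "'a"
  asmul :: "'k \<Rightarrow> 'a \<Rightarrow> 'a"

definition kalgebra :: "('k::field, 'a) kalg \<Rightarrow> bool" where
  "kalgebra L \<longleftrightarrow>
     azero L \<in> acar L \<and> aone L \<in> acar L \<and>
     (\<forall>x\<in>acar L. \<forall>y\<in>acar L. aadd L x y \<in> acar L \<and> amul L x y \<in> acar L) \<and>
     (\<forall>c. \<forall>x\<in>acar L. asmul L c x \<in> acar L) \<and>
     (\<forall>x\<in>acar L. \<forall>y\<in>acar L. \<forall>z\<in>acar L.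
        aadd L (aadd L x y) z = aadd L x (aadd L y z) \<and>
        amul L (amul L x y) z = amul L x (amul L y z) \<and>
        amul L x (aadd L y z) = aadd L (amul L x y) (amul L x z) \<and>
        amul L (aadd L x y) z = aadd L (amul L x z) (amul L y z)) \<and>
     (\<forall>x\<in>acar L. \<forall>y\<in>acar L. aadd L x y = aadd L y x) \<and>
     (\<forall>x\<in>acar L. aadd L (azero L) x = x \<and> amul L (aone L) x = x \<and> amul L x (aone L) = x) \<and>
     (\<forall>x\<in>acar L. \<exists>y\<in>acar L. aadd L x y = azero L) \<and>
     (\<forall>c d. \<forall>x\<in>acar L. \<forall>y\<in>acar L.
        asmul L c (aadd L x y) = aadd L (asmul L c x) (asmul L c y) \<and>
        asmul L (c + d) x = aadd L (asmul L c x) (asmul L d x) \<and>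
        asmul L (c * d) x = asmul L c (asmul L d x) \<and>
        asmul L c (amul L x y) = amul L (asmul L c x) y \<and>
        asmul L c (amul L x y) = amul L x (asmul L c y)) \<and>
     (\<forall>x\<in>acar L. asmul L 1 x = x)"

inductive_set lincomb :: "('k, 'a) kalg \<Rightarrow> 'a set \<Rightarrow> 'a set" for L B where
  lc_zero: "azero L \<in> lincomb L B"
| lc_step: "x \<in> lincomb L B \<Longrightarrow> b \<in> B \<Longrightarrow> aadd L (asmul L c b) x \<in> lincomb L B"

definition fd_algebra :: "('k::field, 'a) kalg \<Rightarrow> bool" where
  "fd_algebra L \<longleftrightarrow> kalgebra L \<and>
     (\<exists>B. finite B \<and> B \<subseteq> acar L \<and> acar L \<subseteq> lincomb L B)"

definition right_ideal :: "('k, 'a) kalg \<Rightarrow> 'a set \<Rightarrow> bool" where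
  "right_ideal L I \<longleftrightarrow> I \<subseteq> acar L \<and> azero L \<in> I \<and>
     (\<forall>x\<in>I. \<forall>y\<in>I. aadd L x y \<in> I) \<and>
     (\<forall>x\<in>I. \<exists>y\<in>I. aadd L x y = azero L) \<and>
     (\<forall>x\<in>I. \<forall>a\<in>acar L. amul L x a \<in> I)"

definition maximal_right_ideal :: "('k, 'a) kalg \<Rightarrow> 'a set \<Rightarrow> bool" where
  "maximal_right_ideal L I \<longleftrightarrow> right_ideal L I \<and> I \<noteq> acar L \<and>
     (\<forall>K. right_ideal L K \<and> I \<subseteq> K \<and> K \<noteq> acar L \<longrightarrow> K = I)"

definition jacobson :: "('k, 'a) kalg \<Rightarrow> 'a set" where
  "jacobson L = acar L \<inter> \<Inter> {I. maximal_right_ideal L I}"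

text \<open>Elementary: \<open>\<Lambda>/J\<close> is isomorphic, as a k-algebra, to a finite product \<open>k^m\<close>
  (realised as the functions \<open>nat \<Rightarrow> k\<close> vanishing outside \<open>{..<m}\<close> with
  componentwise operations): there is a surjective k-algebra homomorphism
  \<open>\<Lambda> \<rightarrow> k^m\<close> whose kernel is the Jacobson radical.\<close>

definition elementary :: "('k::field, 'a) kalg \<Rightarrow> bool" where
  "elementary L \<longleftrightarrow> (\<exists>(m::nat) (\<phi>::'a \<Rightarrow> nat \<Rightarrow> 'k).
     (\<forall>x\<in>acar L. \<forall>i\<ge>m. \<phi> x i = 0) \<and>
     (\<forall>v. (\<forall>i\<ge>m. v i = 0) \<longrightarrow> (\<exists>x\<in>acar L. \<phi> x = v)) \<and>
     (\<forall>x\<in>acar L. \<forall>y\<in>acar L. \<forall>i<m.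
        \<phi> (aadd L x y) i = \<phi> x i + \<phi> y i \<and> \<phi> (amul L x y) i = \<phi> x i * \<phi> y i) \<and>
     (\<forall>c. \<forall>x\<in>acar L. \<forall>i<m. \<phi> (asmul L c x) i = c * \<phi> x i) \<and>
     (\<forall>i<m. \<phi> (aone L) i = 1) \<and>
     {x\<in>acar L. \<forall>i<m. \<phi> x i = 0} = jacobson L)"

definition idempotent :: "('k, 'a) kalg \<Rightarrow> 'a \<Rightarrow> bool" where
  "idempotent L x \<longleftrightarrow> x \<in> acar L \<and> amul L x x = x"

definition primitive_idem :: "('k, 'a) kalg \<Rightarrow> 'a \<Rightarrow> bool" where
  "primitive_idem L x \<longleftrightarrow> idempotent L x \<and> x \<noteq> azero L \<and>
     \<not> (\<exists>f g. idempotent L f \<and> idempotent L g \<and> f \<noteq> azero L \<and> g \<noteq> azero L \<and>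
             amul L f g = azero L \<and> amul L g f = azero L \<and> aadd L f g = x)"

definition complete_poi2 :: "('k, 'a) kalg \<Rightarrow> (nat \<Rightarrow> 'a) \<Rightarrow> bool" where
  "complete_poi2 L e \<longleftrightarrow> primitive_idem L (e 1) \<and> primitive_idem L (e 2) \<and>
     amul L (e 1) (e 2) = azero L \<and> amul L (e 2) (e 1) = azero L \<and>
     aadd L (e 1) (e 2) = aone L"

text \<open>A finitely generated projective right module is a direct sum
  \<open>e_{i_1}\<Lambda> \<oplus> ... \<oplus> e_{i_n}\<Lambda>\<close>, encoded by the list \<open>[i_1,...,i_n]\<close> (entries in {1,2}).
  A morphism \<open>P \<rightarrow> Q\<close> is a matrix \<open>M\<close> with \<open>M r c \<in> e_{Q!r} \<Lambda> e_{P!c}\<close>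
  (\<open>Hom(e_i\<Lambda>, e_j\<Lambda>) = e_j\<Lambda>e_i\<close> by left multiplication).\<close>

type_synonym 'a mat = "nat \<Rightarrow> nat \<Rightarrow> 'a"

definition is_proj :: "nat list \<Rightarrow> bool" where
  "is_proj P \<longleftrightarrow> set P \<subseteq> {1, 2}"

definition is_map :: "('k, 'a) kalg \<Rightarrow> (nat \<Rightarrow> 'a) \<Rightarrow> nat list \<Rightarrow> nat list \<Rightarrow> 'a mat \<Rightarrow> bool" where
  "is_map L e P Q M \<longleftrightarrow> (\<forall>r<length Q. \<forall>c<length P.
     M r c \<in> acar L \<and> amul L (amul L (e (Q!r)) (M r c)) (e (P!c)) = M r c)"

definition meq :: "nat list \<Rightarrow> nat list \<Rightarrow> 'a mat \<Rightarrow> 'a mat \<Rightarrow> bool" where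
  "meq P Q M N \<longleftrightarrow> (\<forall>r<length Q. \<forall>c<length P. M r c = N r c)"

fun asum :: "('k, 'a) kalg \<Rightarrow> (nat \<Rightarrow> 'a) \<Rightarrow> nat \<Rightarrow> 'a" where
  "asum L f 0 = azero L"
| "asum L f (Suc n) = aadd L (asum L f n) (f n)"

definition mcomp :: "('k, 'a) kalg \<Rightarrow> nat \<Rightarrow> 'a mat \<Rightarrow> 'a mat \<Rightarrow> 'a mat" where
  "mcomp L n N M = (\<lambda>r c. asum L (\<lambda>s. amul L (N r s) (M s c)) n)"

definition madd :: "('k, 'a) kalg \<Rightarrow> 'a mat \<Rightarrow> 'a mat \<Rightarrow> 'a mat" where
  "madd L M N = (\<lambda>r c. aadd L (M r c) (N r c))"

definition mid :: "('k, 'a) kalg \<Rightarrow> (nat \<Rightarrow> 'a) \<Rightarrow> nat list \<Rightarrow> 'a mat" where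
  "mid L e P = (\<lambda>r c. if r = c then e (P!r) else azero L)"

record 'a cx =
  cs :: "nat list"   \<comment> \<open>\<open>T^{-1}\<close>\<close>
  ct :: "nat list"   \<comment> \<open>\<open>T^0\<close>\<close>
  cd :: "'a mat"

definition cx_valid :: "('k, 'a) kalg \<Rightarrow> (nat \<Rightarrow> 'a) \<Rightarrow> 'a cx \<Rightarrow> bool" where
  "cx_valid L e T \<longleftrightarrow> is_proj (cs T) \<and> is_proj (ct T) \<and> is_map L e (cs T) (ct T) (cd T)"

text \<open>\<open>Hom_{K^b(proj \<Lambda>)}(T, U[1]) = 0\<close>: every \<open>f : T^{-1} \<rightarrow> U^0\<close> is null-homotopic,
  i.e. of the form \<open>d_U a + b d_T\<close>. (For 2-term complexes \<open>Hom(T,U[l]) = 0\<close> automatically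
  for \<open>l \<ge> 2\<close>.)\<close>

definition hom_shift_zero :: "('k, 'a) kalg \<Rightarrow> (nat \<Rightarrow> 'a) \<Rightarrow> 'a cx \<Rightarrow> 'a cx \<Rightarrow> bool" where
  "hom_shift_zero L e T U \<longleftrightarrow> (\<forall>f. is_map L e (cs T) (ct U) f \<longrightarrow>
     (\<exists>a b. is_map L e (cs T) (cs U) a \<and> is_map L e (ct T) (ct U) b \<and>
        meq (cs T) (ct U) f
          (madd L (mcomp L (length (cs U)) (cd U) a) (mcomp L (length (ct T)) b (cd T)))))"

definition chain_map :: "('k, 'a) kalg \<Rightarrow> (nat \<Rightarrow> 'a) \<Rightarrow> 'a cx \<Rightarrow> 'a cx \<Rightarrow> 'a mat \<times> 'a mat \<Rightarrow> bool" where
  "chain_map L e T U f \<longleftrightarrow>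
     is_map L e (cs T) (cs U) (fst f) \<and> is_map L e (ct T) (ct U) (snd f) \<and>
     meq (cs T) (ct U) (mcomp L (length (cs U)) (cd U) (fst f))
                       (mcomp L (length (ct T)) (snd f) (cd T))"

definition homotopic :: "('k, 'a) kalg \<Rightarrow> (nat \<Rightarrow> 'a) \<Rightarrow> 'a cx \<Rightarrow> 'a cx \<Rightarrow> 'a mat \<times> 'a mat \<Rightarrow> 'a mat \<times> 'a mat \<Rightarrow> bool" where
  "homotopic L e T U f g \<longleftrightarrow> (\<exists>h. is_map L e (ct T) (cs U) h \<and>
     meq (cs T) (cs U) (fst f) (madd L (fst g) (mcomp L (length (ct T)) h (cd T))) \<and>
     meq (ct T) (ct U) (snd f) (madd L (snd g) (mcomp L (length (cs U)) (cd U) h)))"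

definition chain_comp :: "('k, 'a) kalg \<Rightarrow> 'a cx \<Rightarrow> 'a mat \<times> 'a mat \<Rightarrow> 'a mat \<times> 'a mat \<Rightarrow> 'a mat \<times> 'a mat" where
  "chain_comp L U g f = (mcomp L (length (cs U)) (fst g) (fst f), mcomp L (length (ct U)) (snd g) (snd f))"

definition cx_iso :: "('k, 'a) kalg \<Rightarrow> (nat \<Rightarrow> 'a) \<Rightarrow> 'a cx \<Rightarrow> 'a cx \<Rightarrow> bool" where
  "cx_iso L e T U \<longleftrightarrow> (\<exists>f g. chain_map L e T U f \<and> chain_map L e U T g \<and>
     homotopic L e T T (chain_comp L U g f) (mid L e (cs T), mid L e (ct T)) \<and>
     homotopic L e U U (chain_comp L T f g) (mid L e (cs U), mid L e (ct U)))"

definition cx_zero :: "('k, 'a) kalg \<Rightarrow> 'a cx" where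
  "cx_zero L = \<lparr>cs = [], ct = [], cd = (\<lambda>_ _. azero L)\<rparr>"

definition dsum :: "('k, 'a) kalg \<Rightarrow> 'a cx \<Rightarrow> 'a cx \<Rightarrow> 'a cx" where
  "dsum L T U = \<lparr>cs = cs T @ cs U, ct = ct T @ ct U,
     cd = (\<lambda>r c. if r < length (ct T) \<and> c < length (cs T) then cd T r c
                 else if length (ct T) \<le> r \<and> length (cs T) \<le> c
                 then cd U (r - length (ct T)) (c - length (cs T))
                 else azero L)\<rparr>"

definition indecomposable :: "('k, 'a) kalg \<Rightarrow> (nat \<Rightarrow> 'a) \<Rightarrow> 'a cx \<Rightarrow> bool" where
  "indecomposable L e T \<longleftrightarrow> cx_valid L e T \<and> \<not> cx_iso L e T (cx_zero L) \<and>
     (\<forall>U V. cx_valid L e U \<and> cx_valid L e V \<and> cx_iso L e T (dsum L U V) \<longrightarrow>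
        cx_iso L e U (cx_zero L) \<or> cx_iso L e V (cx_zero L))"

definition ind_summand :: "('k, 'a) kalg \<Rightarrow> (nat \<Rightarrow> 'a) \<Rightarrow> 'a cx \<Rightarrow> 'a cx \<Rightarrow> bool" where
  "ind_summand L e T U \<longleftrightarrow> indecomposable L e U \<and>
     (\<exists>V. cx_valid L e V \<and> cx_iso L e T (dsum L U V))"

definition basic :: "('k, 'a) kalg \<Rightarrow> (nat \<Rightarrow> 'a) \<Rightarrow> 'a cx \<Rightarrow> bool" where
  "basic L e T \<longleftrightarrow> cx_valid L e T \<and> (\<exists>Ts.
     (\<forall>U\<in>set Ts. indecomposable L e U) \<and>
     (\<forall>i<length Ts. \<forall>j<length Ts. i \<noteq> j \<longrightarrow> \<not> cx_iso L e (Ts!i) (Ts!j)) \<and>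
     cx_iso L e T (foldr (dsum L) Ts (cx_zero L)))"

definition presilting :: "('k, 'a) kalg \<Rightarrow> (nat \<Rightarrow> 'a) \<Rightarrow> 'a cx \<Rightarrow> bool" where
  "presilting L e T \<longleftrightarrow> cx_valid L e T \<and> hom_shift_zero L e T T"

definition silting2 :: "('k, 'a) kalg \<Rightarrow> (nat \<Rightarrow> 'a) \<Rightarrow> 'a cx \<Rightarrow> bool" where
  "silting2 L e T \<longleftrightarrow> presilting L e T \<and>
     (\<exists>U V. ind_summand L e T U \<and> ind_summand L e T V \<and> \<not> cx_iso L e U V)"

text \<open>\<open>[T] = [T^0] - [T^{-1}]\<close> with \<open>[e_1\<Lambda>] = (1,0)\<close>, \<open>[e_2\<Lambda>] = (0,1)\<close>.\<close>

definition gvec :: "'a cx \<Rightarrow> real \<times> real" where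
  "gvec T = (real (count_list (ct T) 1) - real (count_list (cs T) 1),
             real (count_list (ct T) 2) - real (count_list (cs T) 2))"

definition Ccone :: "('k, 'a) kalg \<Rightarrow> (nat \<Rightarrow> 'a) \<Rightarrow> 'a cx \<Rightarrow> (real \<times> real) set" where
  "Ccone L e T = convex_cone hull {gvec U | U. ind_summand L e T U}"

definition SigmaFan :: "('k, 'a) kalg \<Rightarrow> (nat \<Rightarrow> 'a) \<Rightarrow> (real \<times> real) set set" where
  "SigmaFan L e = {Ccone L e T | T. basic L e T \<and> presilting L e T}"

definition silt_geq :: "('k, 'a) kalg \<Rightarrow> (nat \<Rightarrow> 'a) \<Rightarrow> 'a cx \<Rightarrow> 'a cx \<Rightarrow> bool" where
  "silt_geq L e T U \<longleftrightarrow> hom_shift_zero L e T U"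

definition is_mutation :: "('k, 'a) kalg \<Rightarrow> (nat \<Rightarrow> 'a) \<Rightarrow> 'a cx \<Rightarrow> 'a cx \<Rightarrow> 'a cx \<Rightarrow> bool" where
  "is_mutation L e Ti Tj U \<longleftrightarrow> basic L e U \<and> silting2 L e U \<and>
     (\<exists>T'. indecomposable L e T' \<and> \<not> cx_iso L e T' Ti \<and> cx_iso L e U (dsum L T' Tj))"

definition mu_plus :: "('k, 'a) kalg \<Rightarrow> (nat \<Rightarrow> 'a) \<Rightarrow> 'a cx \<Rightarrow> 'a cx \<Rightarrow> 'a cx \<Rightarrow> bool" where
  "mu_plus L e Ti Tj U \<longleftrightarrow> is_mutation L e Ti Tj U \<and>
     silt_geq L e U (dsum L Ti Tj) \<and> \<not> cx_iso L e U (dsum L Ti Tj)"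

definition mu_minus :: "('k, 'a) kalg \<Rightarrow> (nat \<Rightarrow> 'a) \<Rightarrow> 'a cx \<Rightarrow> 'a cx \<Rightarrow> 'a cx \<Rightarrow> bool" where
  "mu_minus L e Ti Tj U \<longleftrightarrow> is_mutation L e Ti Tj U \<and>
     silt_geq L e (dsum L Ti Tj) U \<and> \<not> cx_iso L e U (dsum L Ti Tj)"

definition Pcx :: "('k, 'a) kalg \<Rightarrow> nat \<Rightarrow> 'a cx" where
  "Pcx L i = \<lparr>cs = [], ct = [i], cd = (\<lambda>_ _. azero L)\<rparr>"

definition Pshift :: "('k, 'a) kalg \<Rightarrow> nat \<Rightarrow> 'a cx" where
  "Pshift L i = \<lparr>cs = [i], ct = [], cd = (\<lambda>_ _. azero L)\<rparr>"

definition primitive_vec :: "real \<times> real \<Rightarrow> bool" where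
  "primitive_vec u \<longleftrightarrow> (\<exists>a b :: int. u = (of_int a, of_int b) \<and> gcd a b = 1)"

definition subdiv :: "(real \<times> real) set set \<Rightarrow> (real \<times> real) set \<Rightarrow> (real \<times> real) set set" where
  "subdiv \<Sigma> \<sigma> = (let (u, v) = (SOME (u, v). primitive_vec u \<and> primitive_vec v \<and>
                                     \<sigma> = convex_cone hull {u, v})
     in {{0}} \<union> {c \<in> \<Sigma>. dim c = 1} \<union> {convex_cone hull {u + v}} \<union>
        ({c \<in> \<Sigma>. dim c = 2} - {\<sigma>}) \<union>
        {convex_cone hull {u, u + v}, convex_cone hull {v, u + v}})"

end

theory Submission
 imports Defs "HOL-Library.Function_Algebras"
begin

text \<open>Let \<open>A = e\<^sub>1\<Lambda>e\<^sub>1\<close>, let \<open>l\<close> be the minimal number of generators of \<open>e\<^sub>1\<Lambda>e\<^sub>2\<close> over \<open>A\<close>, and let \<open>\<Gamma> = \<Lambda> \<oplus> W\<close>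
 be the trivial extension by the bimodule \<open>W\<close> dual to \<open>e\<^sub>1\<Lambda>/J\<^sub>Ae\<^sub>1\<Lambda>\<close>. The dual \<open>y \<in> e\<^sub>1\<Gamma>e\<^sub>2\<close> of the class of \<open>e\<^sub>1\<close>
 is one more minimal generator, so that the cone \<open>\<sigma>\<close> of \<open>(1,0), (l,-1)\<close> is cut by the ray of \<open>(l+1,-1)\<close>. For a
 presilting complex \<open>T\<close> over \<open>\<Lambda>\<close>, either every map \<open>T\<^sup>-\<^sup>1 \<rightarrow> T\<^sup>0\<close> with values in \<open>W\<close> is null-homotopic, and
 \<open>T\<close> stays presilting over \<open>\<Gamma>\<close>, or \<open>Hom(T, P\<^sub>1[1]) = 0\<close>, and the indecomposable summands of \<open>T\<close> are among \<open>P\<^sub>1\<close>,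
 \<open>P\<^sub>2\<close> and the approximation \<open>P\<^sub>2 \<rightarrow> P\<^sub>1\<^sup>l\<close>; hence no cone other than \<open>\<sigma>\<close> changes. The case of \<open>\<mu>\<^sub>1\<^sup>+(\<Lambda>[1])\<close> is
 reduced to that of \<open>\<mu>\<^sub>2\<^sup>-(\<Lambda>)\<close> by transposing complexes over the opposite algebra, which sends a g-vector
 \<open>(a,b)\<close> to \<open>(-b,-a)\<close>.\<close>

section \<open>Rings of endomorphisms, of finite matrices, and of pairs\<close>

text \<open>Why \<open>W\<close> is a dual: beside y it contains elements v_j of e_2 W with x_i v_j
  = y for i = j and 0 otherwise. Through them every \<open>W\<close>-valued map from copies of P_2
  to P_1^l factors through the old approximation, which therefore stays presilting; but y itself is
  no left A-combination of the x_i, so the old approximation and P_1 cease to be compatible. This is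
  what cuts the cone. The dichotomy is linear algebra: in a minimal presilting complex P_2^m ->
  P_1^n, write the differential in coordinates modulo J_A. If its rows are independent, a right
  inverse matrix together with the v_j makes the \<open>W\<close>-valued maps null-homotopic; if
  they are dependent, the presilting condition and Nakayama's lemma give Hom(T, P_1[1]) = 0.
  Algebras are given as records with a carrier, where identities cannot be checked by ring
  normalisation; so they are represented faithfully in a type of class \<open>ring\<close>, and
  homotopies become matrix identities.\<close>

typedef (overloaded) 'v aend = "{f :: 'v::ab_group_add => 'v. ALL x y. f (x + y) = f x + f y}"
 morphisms app Aend by (rule exI[of _ "%x. x"]) simp

lemma app_Aend: "(!!x y. f (x + y) = f x + f y) ==> app (Aend f) = f" by (simp add: Aend_inverse)

lemma app_add: "app f (x + y) = app f x + app f y" using app[of f] by simp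

lemma aend_eqI: "(!!x. app f x = app g x) ==> f = g" using app_inject by blast

instantiation aend :: (ab_group_add) ring
begin

definition "0 = Aend (%x. 0)"
definition "f + g = Aend (%x. app f x + app g x)"
definition "- f = Aend (%x. - app f x)"
definition "f - g = Aend (%x. app f x - app g x)"
definition "f * g = Aend (%x. app f (app g x))"

lemma app_simps [simp]:
 "app 0 x = 0" "app (f + g) x = app f x + app g x" "app (- f) x = - app f x"
 "app (f - g) x = app f x - app g x" "app (f * g) x = app f (app g x)"
 by (simp_all add: zero_aend_def plus_aend_def uminus_aend_def minus_aend_def times_aend_def
  app_Aend app_add algebra_simps)

instance by standard (rule aend_eqI; simp add: app_add algebra_simps)+

end

text \<open>One type for matrices of all sizes: finite support replaces a size parameter. The
  resulting ring has no unit, so identities exist only locally, as the matrices \<open>ob P\<close>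
  below.\<close>

typedef (overloaded) 'r fmat = "{M :: nat => nat => 'r::zero. EX n. ALL r c. M r c ~= 0 \<longrightarrow> r < n & c < n}"
 morphisms ent Fmat by (rule exI[of _ "%_ _. 0"]) simp

lemma ent_Fmat: "(!!r c. M r c ~= 0 ==> r < n & c < n) ==> ent (Fmat M) = M" by (rule Fmat_inverse) auto

lemma ent_bound: "EX n. ALL r c. r >= n | c >= n \<longrightarrow> ent M r c = 0"
proof -
 obtain n where "ALL r c. ent M r c ~= 0 \<longrightarrow> r < n & c < n" using ent[of M] by auto
 thus ?thesis by (meson linorder_not_le)
qed

lemma fmat_eqI: "(!!r c. ent M r c = ent N r c) ==> M = N" using ent_inject by blast

instantiation fmat :: (ring) ring
begin

definition "0 = Fmat (%_ _. 0)"
definition "M + N = Fmat (%r c. ent M r c + ent N r c)"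
definition "- M = Fmat (%r c. - ent M r c)"
definition "M - N = Fmat (%r c. ent M r c - ent N r c)"
text \<open>Summing over the support of row \<open>r\<close> avoids the choice of a common size;
  \<open>ent_times\<close> replaces it by any sufficiently long initial segment.\<close>

definition "M * N = Fmat (%r c. \<Sum>s\<in>{s. ent M r s ~= 0}. ent M r s * ent N s c)"

lemma ent_simps [simp]:
 fixes M N :: "'a fmat"
 shows "ent 0 r c = (0 :: 'a)" "ent (M + N) r c = ent M r c + ent N r c"
  "ent (- M) r c = - ent M r c" "ent (M - N) r c = ent M r c - ent N r c"
proof -
 obtain m where m: "!!r c. r >= m | c >= m ==> ent M r c = 0" using ent_bound[of M] by blast
 obtain n where n: "!!r c. r >= n | c >= n ==> ent N r c = 0" using ent_bound[of N] by blast
 have "ent M r c = 0" "ent N r c = 0" if "~ (r < max m n & c < max m n)" for r c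
  using that m[of r c] n[of r c] by (auto simp: not_less)
 hence le: "r < max m n & c < max m n"
  if "ent M r c + ent N r c ~= 0 | - ent M r c ~= 0 | ent M r c - ent N r c ~= 0" for r c using that by force
 show "ent (0::'a fmat) r c = 0" unfolding zero_fmat_def by (subst ent_Fmat[of _ 0]) auto
 show "ent (M + N) r c = ent M r c + ent N r c"
  unfolding plus_fmat_def by (rule ent_Fmat[THEN fun_cong, THEN fun_cong]) (rule le, simp)
 show "ent (- M) r c = - ent M r c"
  unfolding uminus_fmat_def by (rule ent_Fmat[THEN fun_cong, THEN fun_cong]) (rule le, simp)
 show "ent (M - N) r c = ent M r c - ent N r c"
  unfolding minus_fmat_def by (rule ent_Fmat[THEN fun_cong, THEN fun_cong]) (rule le, simp)
qed

lemma ent_times_raw: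
 fixes M N :: "'a fmat"
 shows "ent (M * N) r c = (\<Sum>s\<in>{s. ent M r s ~= 0}. ent M r s * ent N s c)"
proof -
 obtain m where m: "!!r c. r >= m | c >= m ==> ent M r c = 0" using ent_bound[of M] by blast
 obtain n where n: "!!r c. r >= n | c >= n ==> ent N r c = 0" using ent_bound[of N] by blast
 have "r < max m n & c < max m n" if nz: "(\<Sum>s\<in>{s. ent M r s ~= 0}. ent M r s * ent N s c) ~= 0" for r c
 proof -
  obtain s where "ent M r s * ent N s c ~= 0" using nz by (rule sum.not_neutral_contains_not_neutral)
  hence "ent M r s ~= 0" "ent N s c ~= 0" by auto
  hence "~ m <= r" "~ n <= c" using m[of r s] n[of s c] by auto
  thus ?thesis by auto
 qed
 thus ?thesis unfolding times_fmat_def by (rule ent_Fmat[THEN fun_cong, THEN fun_cong])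
qed

lemma ent_times:
 fixes M N :: "'a fmat"
 assumes "!!s. s >= n ==> ent M r s = 0 | ent N s c = 0"
 shows "ent (M * N) r c = (\<Sum>s<n. ent M r s * ent N s c)"
proof -
 obtain m where m: "!!r c. r >= m | c >= m ==> ent M r c = 0" using ent_bound[of M] by blast
 have fin: "finite {s. ent M r s ~= 0}"
  by (rule finite_subset[of _ "{..<m}"]) (use m in \<open>auto simp: not_le intro: leI\<close>)
 have "(\<Sum>s\<in>{s. ent M r s ~= 0}. ent M r s * ent N s c)
  = (\<Sum>s\<in>{s. ent M r s ~= 0} \<union> {..<n}. ent M r s * ent N s c)"
  by (rule sum.mono_neutral_left) (use fin in auto)
 also have "... = (\<Sum>s<n. ent M r s * ent N s c)"
 proof (rule sum.mono_neutral_right)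
  show "ALL i:{s. ent M r s ~= 0} \<union> {..<n} - {..<n}. ent M r i * ent N i c = 0"
  proof
  fix i assume "i : {s. ent M r s ~= 0} \<union> {..<n} - {..<n}"
  hence "n <= i" by simp
  thus "ent M r i * ent N i c = 0" using assms[of i] by auto
  qed
 qed (use fin in auto)
 finally show ?thesis by (simp add: ent_times_raw)
qed

instance
proof
 fix A B C :: "'a fmat"
 show "A * B * C = A * (B * C)"
 proof (rule fmat_eqI)
  fix r c
  obtain m where m: "!!r c. r >= m | c >= m ==> ent A r c = 0" using ent_bound[of A] by blast
  obtain n where n: "!!r c. r >= n | c >= n ==> ent B r c = 0" using ent_bound[of B] by blast
  have AB: "ent (A * B) r s = (\<Sum>t<m. ent A r t * ent B t s)" for r s by (rule ent_times) (use m in auto)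
  have BC: "ent (B * C) t c = (\<Sum>s<n. ent B t s * ent C s c)" for t c by (rule ent_times) (use n in auto)
  have "ent (A * B * C) r c = (\<Sum>s<n. ent (A * B) r s * ent C s c)"
  by (rule ent_times) (use n in \<open>auto simp: AB\<close>)
  moreover have "ent (A * (B * C)) r c = (\<Sum>t<m. ent A r t * ent (B * C) t c)"
  by (rule ent_times) (use m in auto)
  ultimately show "ent (A * B * C) r c = ent (A * (B * C)) r c"
  by (simp add: AB BC sum_distrib_left sum_distrib_right mult.assoc sum.swap[of _ "{..<m}"])
 qed
 show "(A + B) * C = A * C + B * C"
 proof (rule fmat_eqI)
  fix r c
  obtain m where m: "!!r c. r >= m | c >= m ==> ent C r c = 0" using ent_bound[of C] by blast
  have "ent (X * C) r c = (\<Sum>s<m. ent X r s * ent C s c)" for X by (rule ent_times) (use m in auto)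
  thus "ent ((A + B) * C) r c = ent (A * C + B * C) r c" by (simp add: distrib_right sum.distrib)
 qed
 show "A * (B + C) = A * B + A * C"
 proof (rule fmat_eqI)
  fix r c
  obtain m where m: "!!r c. r >= m | c >= m ==> ent A r c = 0" using ent_bound[of A] by blast
  have "ent (A * X) r c = (\<Sum>s<m. ent A r s * ent X s c)" for X by (rule ent_times) (use m in auto)
  thus "ent (A * (B + C)) r c = ent (A * B + A * C) r c" by (simp add: distrib_left sum.distrib)
 qed
qed (rule fmat_eqI; simp add: algebra_simps)+

end

text \<open>Chain maps of two-term complexes are pairs composed degreewise; with this product they
  too live in one ring.\<close>

instantiation prod :: (times, times) times
begin
definition "x * y = (fst x * fst y, snd x * snd y)"
instance ..
end

lemma pair_times [simp]: "(a, b) * (c, d) = (a * c, b * d)" by (simp add: times_prod_def)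

instance prod :: (ring, ring) ring by standard (auto simp: times_prod_def algebra_simps)

section \<open>Additive categories modulo an ideal\<close>

text \<open>The morphisms of all Hom sets live in one ring, so that identities between them can be
 checked by ring normalisation; \<open>Nl\<close> is the ideal of morphisms to be identified with zero.\<close>

locale addcat =
 fixes Ob :: "'o set" and Hm Nl :: "'o => 'o => 'c::ring set" and un :: "'o => 'c"
  and ds :: "'o => 'o => 'o" and zr :: 'o and j1 j2 q1 q2 :: "'o => 'o => 'c"
 assumes Hm_add: "f : Hm T U ==> g : Hm T U ==> f + g : Hm T U"
  and Hm_comp: "f : Hm T U ==> g : Hm U V ==> g * f : Hm T V" and un_in: "T : Ob ==> un T : Hm T T"
  and un_l: "f : Hm T U ==> un U * f = f" and un_r: "f : Hm T U ==> f * un T = f"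
  and Nl_add: "f : Nl T U ==> g : Nl T U ==> f + g : Nl T U" and Nl_minus: "f : Nl T U ==> - f : Nl T U"
  and Nl_zero: "0 : Nl T U" and Nl_l: "f : Nl T U ==> g : Hm U V ==> g * f : Nl T V"
  and Nl_r: "f : Hm T U ==> g : Nl U V ==> g * f : Nl T V" and ds_Ob: "T : Ob ==> U : Ob ==> ds T U : Ob"
  and j1_in: "T : Ob ==> U : Ob ==> j1 T U : Hm T (ds T U)"
  and j2_in: "T : Ob ==> U : Ob ==> j2 T U : Hm U (ds T U)"
  and q1_in: "T : Ob ==> U : Ob ==> q1 T U : Hm (ds T U) T"
  and q2_in: "T : Ob ==> U : Ob ==> q2 T U : Hm (ds T U) U"
  and q1j1: "T : Ob ==> U : Ob ==> q1 T U * j1 T U = un T" and q2j2: "T : Ob ==> U : Ob ==> q2 T U * j2 T U = un U"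
  and jq: "T : Ob ==> U : Ob ==> j1 T U * q1 T U + j2 T U * q2 T U = un (ds T U)" and zr_Ob: "zr : Ob"
  and un_zr: "un zr = 0"
begin

definition ic :: "'o => 'o => bool" where
 "ic T U \<longleftrightarrow> (EX f:Hm T U. EX g:Hm U T. g * f - un T : Nl T T & f * g - un U : Nl U U)"

text \<open>A biproduct decomposition by equations modulo the ideal. Unlike an isomorphism with
  \<open>ds U V\<close>, this form is carried over directly by a functor. The orthogonality of the
  two summands follows, see \<open>bip_orth\<close>.\<close>

definition bip :: "'o => 'o => 'o => bool" where
 "bip T U V \<longleftrightarrow> (EX i:Hm U T. EX p:Hm T U. EX j:Hm V T. EX q:Hm T V.
  p * i - un U : Nl U U & q * j - un V : Nl V V & i * p + j * q - un T : Nl T T)"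

definition ret :: "'o => 'o => bool" where
 "ret T U \<longleftrightarrow> (EX i:Hm U T. EX p:Hm T U. p * i - un U : Nl U U)"

lemma Nl_sub: "f : Nl T U ==> g : Nl T U ==> f - g : Nl T U" using Nl_add[of f T U "- g"] Nl_minus by simp

text \<open>A composite congruent to an identity may be cancelled between any two morphisms. The
  congruences for transitivity and for biproducts are sums of instances of this.\<close>

lemma sandwich:
 assumes "p * i - un U : Nl U U" and "f : Hm V U" and "g : Hm U W"
 shows "g * p * i * f - g * f : Nl V W"
proof -
 have "g * ((p * i - un U) * f) : Nl V W" using Nl_l[OF Nl_r[OF assms(2,1)] assms(3)] by simp
 moreover have "un U * f = f" using un_l[OF assms(2)] .
 ultimately show ?thesis by (simp add: algebra_simps)
qed

lemma ic_refl: "T : Ob ==> ic T T" unfolding ic_def by (rule bexI[of _ "un T"], rule bexI[of _ "un T"])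
  (auto simp: un_in un_l[OF un_in] Nl_zero)

lemma ic_sym: "ic T U ==> ic U T" unfolding ic_def by blast

lemma ic_trans: assumes "ic T U" and "ic U V" shows "ic T V"
proof -
 obtain f g where fg: "f : Hm T U" "g : Hm U T" "g * f - un T : Nl T T" "f * g - un U : Nl U U"
  using assms(1) unfolding ic_def by blast
 obtain h k where hk: "h : Hm U V" "k : Hm V U" "k * h - un U : Nl U U" "h * k - un V : Nl V V"
  using assms(2) unfolding ic_def by blast
 have "(g * k) * (h * f) - un T : Nl T T"
  using Nl_add[OF sandwich[OF hk(3) fg(1) fg(2)] fg(3)] by (simp add: mult.assoc)
 moreover have "(h * f) * (g * k) - un V : Nl V V"
  using Nl_add[OF sandwich[OF fg(4) hk(2) hk(1)] hk(4)] by (simp add: mult.assoc)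
 ultimately show ?thesis unfolding ic_def using Hm_comp[OF fg(1) hk(1)] Hm_comp[OF hk(2) fg(2)] by blast
qed

lemma bip_ds: "U : Ob ==> V : Ob ==> bip (ds U V) U V" unfolding bip_def
 by (rule bexI[OF _ j1_in], rule bexI[OF _ q1_in], rule bexI[OF _ j2_in], rule bexI[OF _ q2_in])
  (auto simp: q1j1 q2j2 jq Nl_zero)

lemma bip_sym: "bip T U V ==> bip T V U" unfolding bip_def by (metis add.commute)

lemma bip_ret: "bip T U V ==> ret T U" unfolding bip_def ret_def by blast

lemma ic_ret: "ic T U ==> ret T U" unfolding ic_def ret_def by blast

lemma ret_trans: assumes "ret T U" and "ret U V" shows "ret T V"
proof -
 obtain i p where ip: "i : Hm U T" "p : Hm T U" "p * i - un U : Nl U U" using assms(1) unfolding ret_def by blast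
 obtain j q where jq: "j : Hm V U" "q : Hm U V" "q * j - un V : Nl V V" using assms(2) unfolding ret_def by blast
 have "(q * p) * (i * j) - un V : Nl V V"
  using Nl_add[OF sandwich[OF ip(3) jq(1) jq(2)] jq(3)] by (simp add: mult.assoc)
 thus ?thesis unfolding ret_def using Hm_comp[OF jq(1) ip(1)] Hm_comp[OF ip(2) jq(2)] by blast
qed

lemma bip_ic:
 assumes "ic T T'" and "ic U U'" and "ic V V'" and "bip T U V"
 shows "bip T' U' V'"
proof -
 obtain t t' where t: "t : Hm T T'" "t' : Hm T' T" "t' * t - un T : Nl T T" "t * t' - un T' : Nl T' T'"
  using assms(1) unfolding ic_def by blast
 obtain u u' where u: "u : Hm U U'" "u' : Hm U' U" "u' * u - un U : Nl U U" "u * u' - un U' : Nl U' U'"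
  using assms(2) unfolding ic_def by blast
 obtain v v' where v: "v : Hm V V'" "v' : Hm V' V" "v' * v - un V : Nl V V" "v * v' - un V' : Nl V' V'"
  using assms(3) unfolding ic_def by blast
 obtain i p j q where b: "i : Hm U T" "p : Hm T U" "j : Hm V T" "q : Hm T V"
  "p * i - un U : Nl U U" "q * j - un V : Nl V V" "i * p + j * q - un T : Nl T T"
  using assms(4) unfolding bip_def by blast
 note H = Hm_comp
 have c1: "(u * p * t') * (t * i * u') - un U' : Nl U' U'"
  using Nl_add[OF sandwich[OF t(3) H[OF u(2) b(1)] H[OF b(2) u(1)]]
  Nl_add[OF sandwich[OF b(5) u(2) u(1)] u(4)]] by (simp add: mult.assoc)
 have c2: "(v * q * t') * (t * j * v') - un V' : Nl V' V'"
  using Nl_add[OF sandwich[OF t(3) H[OF v(2) b(3)] H[OF b(4) v(1)]]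
  Nl_add[OF sandwich[OF b(6) v(2) v(1)] v(4)]] by (simp add: mult.assoc)
 have "t * (i * p + j * q - un T) * t' : Nl T' T'" using Nl_r[OF t(2) Nl_l[OF b(7) t(1)]] by simp
 moreover have "t * un T = t" by (rule un_r[OF t(1)])
 ultimately have d: "t * i * p * t' + t * j * q * t' - t * t' : Nl T' T'" by (simp add: algebra_simps)
 have e1: "t * i * u' * u * p * t' - t * i * p * t' : Nl T' T'"
  using sandwich[OF u(3) H[OF t(2) b(2)] H[OF b(1) t(1)]] by (simp add: mult.assoc)
 have e2: "t * j * v' * v * q * t' - t * j * q * t' : Nl T' T'"
  using sandwich[OF v(3) H[OF t(2) b(4)] H[OF b(3) t(1)]] by (simp add: mult.assoc)
 have c3: "(t * i * u') * (u * p * t') + (t * j * v') * (v * q * t') - un T' : Nl T' T'"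
  using Nl_add[OF Nl_add[OF e1 e2] Nl_add[OF d t(4)]] by (simp add: algebra_simps)
 show ?thesis unfolding bip_def using c1 c2 c3 H[OF u(2) H[OF b(1) t(1)]] H[OF t(2) H[OF b(2) u(1)]]
  H[OF v(2) H[OF b(3) t(1)]] H[OF t(2) H[OF b(4) v(1)]] by (metis mult.assoc)
qed

text \<open>Modulo the ideal, the completeness relation multiplied by \<open>q\<close> on the left
  and \<open>i\<close> on the right reads q i + q i - q i, because \<open>p * i\<close> and
  \<open>q * j\<close> are identities; this is \<open>q * i\<close> itself.\<close>

lemma bip_orth:
 assumes i: "i : Hm U T" "p : Hm T U" "j : Hm V T" "q : Hm T V"
  "p * i - un U : Nl U U" "q * j - un V : Nl V V" "i * p + j * q - un T : Nl T T"
 shows "q * i : Nl U V"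
proof -
 have a: "q * (i * p + j * q - un T) * i : Nl U V" using Nl_r[OF i(1) Nl_l[OF i(7) i(4)]] by simp
 have b: "q * i * (p * i - un U) : Nl U V" using Nl_l[OF i(5) Hm_comp[OF i(1) i(4)]] by simp
 have c: "(q * j - un V) * (q * i) : Nl U V" using Nl_r[OF Hm_comp[OF i(1) i(4)] i(6)] by simp
 have e: "un T * i = i" "q * un T = q" "i * un U = i" "un V * q = q"
  using un_l[OF i(1)] un_r[OF i(4)] un_r[OF i(1)] un_l[OF i(4)] by auto
 have "q * (i * p + j * q - un T) * i - q * i * (p * i - un U) - (q * j - un V) * (q * i)
  = q * (i * un U) + (un V * q) * i - (q * un T) * i" by (simp add: algebra_simps)
 also have "... = q * i" unfolding e by (simp add: algebra_simps)
 finally show ?thesis using Nl_sub[OF Nl_sub[OF a b] c] by simp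
qed

lemma bip_unique:
 assumes "bip T U V" and "bip T' U V"
 shows "ic T T'"
proof -
 obtain i p j q where b: "i : Hm U T" "p : Hm T U" "j : Hm V T" "q : Hm T V"
  "p * i - un U : Nl U U" "q * j - un V : Nl V V" "i * p + j * q - un T : Nl T T"
  using assms(1) unfolding bip_def by blast
 obtain i' p' j' q' where b': "i' : Hm U T'" "p' : Hm T' U" "j' : Hm V T'" "q' : Hm T' V"
  "p' * i' - un U : Nl U U" "q' * j' - un V : Nl V V" "i' * p' + j' * q' - un T' : Nl T' T'"
  using assms(2) unfolding bip_def by blast
 \<comment> \<open>Stated for arbitrary decompositions so that it gives both composites; the mixed
   terms \<open>q2 * i2\<close> and \<open>p2 * j2\<close> disappear by orthogonality.\<close>
 have key: "(i1 * p2 + j1 * q2) * (i2 * p1 + j2 * q1) - un T1 : Nl T1 T1"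
  if a1: "i1 : Hm U T1" "p1 : Hm T1 U" "j1 : Hm V T1" "q1 : Hm T1 V"
  "i1 * p1 + j1 * q1 - un T1 : Nl T1 T1" and a2: "i2 : Hm U T2" "p2 : Hm T2 U" "j2 : Hm V T2" "q2 : Hm T2 V"
  "p2 * i2 - un U : Nl U U" "q2 * j2 - un V : Nl V V" "i2 * p2 + j2 * q2 - un T2 : Nl T2 T2"
  for T1 i1 p1 j1 q1 T2 i2 p2 j2 q2
 proof -
  have o1: "q2 * i2 : Nl U V" by (rule bip_orth[OF a2])
  have o2: "p2 * j2 : Nl V U"
  by (rule bip_orth[OF a2(3,4,1,2,6,5)]) (use a2(7) in \<open>simp add: add.commute\<close>)
  have n1: "j1 * (q2 * i2) * p1 : Nl T1 T1" using Nl_r[OF a1(2) Nl_l[OF o1 a1(3)]] by simp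
  have n2: "i1 * (p2 * j2) * q1 : Nl T1 T1" using Nl_r[OF a1(4) Nl_l[OF o2 a1(1)]] by simp
  show ?thesis using Nl_add[OF Nl_add[OF n1 n2] Nl_add[OF a1(5) Nl_add[OF sandwich[OF a2(5) a1(2) a1(1)]
  sandwich[OF a2(6) a1(4) a1(3)]]]] by (simp add: algebra_simps)
 qed
 have "i * p' + j * q' : Hm T' T" "i' * p + j' * q : Hm T T'" using b b' by (auto intro: Hm_add Hm_comp)
 moreover have "(i * p' + j * q') * (i' * p + j' * q) - un T : Nl T T" by (rule key) (use b b' in auto)
 moreover have "(i' * p + j' * q) * (i * p' + j * q') - un T' : Nl T' T'" by (rule key) (use b b' in auto)
 ultimately show ?thesis unfolding ic_def by blast
qed

lemma bip_Ob:
 assumes "T : Ob" and "U : Ob" and "V : Ob"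
 shows "ic T (ds U V) \<longleftrightarrow> bip T U V" using bip_unique[OF _ bip_ds[OF assms(2,3)]]
  bip_ic[OF ic_sym ic_refl[OF assms(2)] ic_refl[OF assms(3)] bip_ds[OF assms(2,3)]] by blast

lemma ic_zr: assumes "T : Ob" shows "ic T zr \<longleftrightarrow> un T : Nl T T"
proof
 assume "ic T zr"
 then obtain f g where fg: "f : Hm T zr" "g : Hm zr T" "g * f - un T : Nl T T" unfolding ic_def by blast
 have "f = 0" using un_l[OF fg(1)] by (simp add: un_zr)
 thus "un T : Nl T T" using Nl_minus[OF fg(3)] by simp
next
 assume a: "un T : Nl T T"
 let ?f = "q1 zr T * j1 zr T"
 have z: "un zr : Hm zr zr" by (rule un_in[OF zr_Ob])
 \<comment> \<open>The locale does not postulate zero morphisms. The mixed composites through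
   \<open>ds zr T\<close> provide them, since \<open>un zr = 0\<close> forces every morphism into or
   out of \<open>zr\<close> to be 0.\<close>
 have 1: "q1 zr T * j2 zr T : Hm T zr" "q2 zr T * j1 zr T : Hm zr T"
  using Hm_comp j1_in j2_in q1_in q2_in assms zr_Ob by meson+
 have "q1 zr T * j2 zr T = 0" using un_l[OF 1(1)] by (simp add: un_zr)
 moreover have "q2 zr T * j1 zr T = 0" using un_r[OF 1(2)] by (simp add: un_zr)
 ultimately have "0 : Hm T zr" "0 : Hm zr T" using 1 by auto
 thus "ic T zr" unfolding ic_def using Nl_minus[OF a] Nl_zero by (force simp: un_zr)
qed

lemma bip_zr:
 assumes "V : Ob" and "ic V zr" and "bip T U V"
 shows "ic T U"
proof -
 obtain i p j q where b: "i : Hm U T" "p : Hm T U" "j : Hm V T" "q : Hm T V"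
  "p * i - un U : Nl U U" "q * j - un V : Nl V V" "i * p + j * q - un T : Nl T T"
  using assms(3) unfolding bip_def by blast
 have "un V : Nl V V" using assms(2) ic_zr[OF assms(1)] by blast
 hence "j * un V * q : Nl T T" using Nl_r[OF b(4) Nl_l[OF _ b(3)]] by simp
 hence "j * q : Nl T T" using un_r[OF b(3)] by simp
 from Nl_sub[OF b(7) this] have "i * p - un T : Nl T T" by (simp add: algebra_simps)
 thus ?thesis unfolding ic_def using b by blast
qed

end

section \<open>The cones attached to a presilting theory\<close>

text \<open>These five definitions repeat those for raw complexes with objects, isomorphism, sum and
  zero as parameters, so that passing to matrices or to the opposite algebra is one application of
  \<open>transport\<close>.\<close>

definition indecP :: "'o set => ('o => 'o => bool) => ('o => 'o => 'o) => 'o => 'o => bool" where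
 "indecP Ob ic ds zr T \<longleftrightarrow> T : Ob & ~ ic T zr &
  (ALL U V. U : Ob & V : Ob & ic T (ds U V) \<longrightarrow> ic U zr | ic V zr)"

definition isumP :: "'o set => ('o => 'o => bool) => ('o => 'o => 'o) => 'o => 'o => 'o => bool" where
 "isumP Ob ic ds zr T U \<longleftrightarrow> indecP Ob ic ds zr U & (EX V. V : Ob & ic T (ds U V))"

definition basicP :: "'o set => ('o => 'o => bool) => ('o => 'o => 'o) => 'o => 'o => bool" where
 "basicP Ob ic ds zr T \<longleftrightarrow> T : Ob & (EX Ts. (ALL U:set Ts. indecP Ob ic ds zr U) &
  (ALL i<length Ts. ALL j<length Ts. i ~= j \<longrightarrow> ~ ic (Ts!i) (Ts!j)) & ic T (foldr ds Ts zr))"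

definition coneP :: "'o set => ('o => 'o => bool) => ('o => 'o => 'o) => 'o => ('o => real \<times> real) => 'o
  => (real \<times> real) set" where
 "coneP Ob ic ds zr gv T = convex_cone hull {gv U | U. isumP Ob ic ds zr T U}"

definition SFP :: "'o set => ('o => 'o => bool) => ('o => 'o => 'o) => 'o => ('o => bool)
  => ('o => real \<times> real) => (real \<times> real) set set" where
 "SFP Ob ic ds zr ps gv = {coneP Ob ic ds zr gv T | T. basicP Ob ic ds zr T & ps T}"

text \<open>Only objects are mapped, and isomorphism is preserved and reflected. This suffices
  because summands, basicness and cones are expressed by isomorphism and direct sum alone; a
  contravariant duality therefore qualifies as well.\<close>

locale transport =
 fixes Ob :: "'o set" and ic ds zr and Ob' :: "'p set" and ic' ds' zr' and Phi :: "'o => 'p"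
 assumes Phi_Ob: "T : Ob ==> Phi T : Ob'" and Phi_surj: "T' : Ob' ==> EX T:Ob. Phi T = T'"
  and Phi_ic: "T : Ob ==> U : Ob ==> ic' (Phi T) (Phi U) \<longleftrightarrow> ic T U"
  and ds_Ob: "T : Ob ==> U : Ob ==> ds T U : Ob"
  and Phi_ds: "T : Ob ==> U : Ob ==> Phi (ds T U) = ds' (Phi T) (Phi U)"
  and zr_Ob: "zr : Ob" and Phi_zr: "Phi zr = zr'"
begin

lemma Phi_indec: assumes "T : Ob" shows "indecP Ob' ic' ds' zr' (Phi T) \<longleftrightarrow> indecP Ob ic ds zr T"
proof -
 have z: "ic' (Phi U) zr' \<longleftrightarrow> ic U zr" if "U : Ob" for U
  using Phi_ic[OF that zr_Ob] Phi_zr by simp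
 have s: "ic' (Phi T) (ds' (Phi U) (Phi V)) \<longleftrightarrow> ic T (ds U V)" if "U : Ob" "V : Ob" for U V
  using Phi_ic[OF assms ds_Ob[OF that]] Phi_ds[OF that] by simp
 show ?thesis unfolding indecP_def using z[OF assms] z s assms Phi_Ob by (metis Phi_surj)
qed

lemma Phi_isum:
 assumes "T : Ob" and "U : Ob"
 shows "isumP Ob' ic' ds' zr' (Phi T) (Phi U) \<longleftrightarrow> isumP Ob ic ds zr T U"
proof -
 have s: "ic' (Phi T) (ds' (Phi U) (Phi V)) \<longleftrightarrow> ic T (ds U V)" if "V : Ob" for V
  using Phi_ic[OF assms(1) ds_Ob[OF assms(2) that]] Phi_ds[OF assms(2) that] by simp
 show ?thesis unfolding isumP_def Phi_indec[OF assms(2)] using s Phi_Ob by (metis Phi_surj)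
qed

lemma Phi_foldr:
 "set Ts \<subseteq> Ob ==> foldr ds Ts zr : Ob & Phi (foldr ds Ts zr) = foldr ds' (map Phi Ts) zr'"
 by (induction Ts) (auto simp: zr_Ob Phi_zr ds_Ob Phi_ds)

lemma Phi_basic: assumes "T : Ob" shows "basicP Ob' ic' ds' zr' (Phi T) \<longleftrightarrow> basicP Ob ic ds zr T"
proof
 assume "basicP Ob ic ds zr T"
 then obtain Ts where Ts: "ALL U:set Ts. indecP Ob ic ds zr U"
  "ALL i<length Ts. ALL j<length Ts. i ~= j \<longrightarrow> ~ ic (Ts!i) (Ts!j)" "ic T (foldr ds Ts zr)"
  unfolding basicP_def by blast
 have sub: "set Ts \<subseteq> Ob" using Ts(1) by (auto simp: indecP_def)
 have m: "Ts ! i : Ob" if "i < length Ts" for i using sub that by auto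
 have "ALL U:set (map Phi Ts). indecP Ob' ic' ds' zr' U" using Ts(1) sub Phi_indec by auto
 moreover have "ALL i<length (map Phi Ts). ALL j<length (map Phi Ts). i ~= j \<longrightarrow>
  ~ ic' (map Phi Ts!i) (map Phi Ts!j)" using Ts(2) m Phi_ic by simp
 moreover have "ic' (Phi T) (foldr ds' (map Phi Ts) zr')"
  using Phi_foldr[OF sub] Phi_ic[OF assms, of "foldr ds Ts zr"] Ts(3) by simp
 ultimately show "basicP Ob' ic' ds' zr' (Phi T)" unfolding basicP_def using Phi_Ob[OF assms] by blast
next
 assume "basicP Ob' ic' ds' zr' (Phi T)"
 then obtain Ts' where Ts': "ALL U:set Ts'. indecP Ob' ic' ds' zr' U"
  "ALL i<length Ts'. ALL j<length Ts'. i ~= j \<longrightarrow> ~ ic' (Ts'!i) (Ts'!j)" "ic' (Phi T) (foldr ds' Ts' zr')"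
  unfolding basicP_def by blast
 have "ALL U:set Ts'. EX V:Ob. Phi V = U" using Ts'(1) Phi_surj by (auto simp: indecP_def)
 then obtain \<Psi> where \<Psi>: "ALL U:set Ts'. \<Psi> U : Ob & Phi (\<Psi> U) = U" by metis
 define Ts where "Ts = map \<Psi> Ts'"
 have eq: "Ts' = map Phi Ts" using \<Psi> unfolding Ts_def by (simp add: map_idI)
 have sub: "set Ts \<subseteq> Ob" using \<Psi> unfolding Ts_def by auto
 have m: "Ts ! i : Ob" if "i < length Ts" for i using sub that by auto
 have "ALL U:set Ts. indecP Ob ic ds zr U" using Ts'(1) sub Phi_indec unfolding eq by auto
 moreover have "ALL i<length Ts. ALL j<length Ts. i ~= j \<longrightarrow> ~ ic (Ts!i) (Ts!j)"
  using Ts'(2) m Phi_ic unfolding eq by simp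
 moreover have "ic T (foldr ds Ts zr)"
  using Phi_foldr[OF sub] Phi_ic[OF assms, of "foldr ds Ts zr"] Ts'(3) unfolding eq by simp
 ultimately show "basicP Ob ic ds zr T" unfolding basicP_def using assms by blast
qed

lemma Phi_cone:
 assumes "T : Ob" and gv: "!!T. T : Ob ==> gv' (Phi T) = phi (gv T)" and phi: "linear phi"
 shows "coneP Ob' ic' ds' zr' gv' (Phi T) = phi ` coneP Ob ic ds zr gv T"
proof -
 have "{gv' U' | U'. isumP Ob' ic' ds' zr' (Phi T) U'} = phi ` {gv U | U. isumP Ob ic ds zr T U}"
  (is "?A = ?B")
 proof
  show "?A \<subseteq> ?B"
  proof
  fix x assume "x : ?A"
  then obtain U' where U': "x = gv' U'" "isumP Ob' ic' ds' zr' (Phi T) U'" by blast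
  hence "U' : Ob'" by (auto simp: isumP_def indecP_def)
  then obtain U where "U : Ob" "Phi U = U'" using Phi_surj by blast
  thus "x : ?B" using U' Phi_isum[OF assms(1)] gv by blast
  qed
  show "?B \<subseteq> ?A"
  proof
  fix x assume "x : ?B"
  then obtain U where U: "x = phi (gv U)" "isumP Ob ic ds zr T U" by blast
  hence "U : Ob" by (auto simp: isumP_def indecP_def)
  hence "x = gv' (Phi U)" "isumP Ob' ic' ds' zr' (Phi T) (Phi U)" using U Phi_isum[OF assms(1)] gv by auto
  thus "x : ?A" by blast
  qed
 qed
 thus ?thesis unfolding coneP_def by (simp add: convex_cone_hull_linear_image[OF phi])
qed

lemma Phi_SFP:
 assumes gv: "!!T. T : Ob ==> gv' (Phi T) = phi (gv T)" and phi: "linear phi"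
  and ps: "!!T. T : Ob ==> ps' (Phi T) \<longleftrightarrow> ps T"
 shows "SFP Ob' ic' ds' zr' ps' gv' = (`) phi ` SFP Ob ic ds zr ps gv"
proof
 show "SFP Ob' ic' ds' zr' ps' gv' \<subseteq> (`) phi ` SFP Ob ic ds zr ps gv"
 proof
  fix c assume "c : SFP Ob' ic' ds' zr' ps' gv'"
  then obtain T' where T': "c = coneP Ob' ic' ds' zr' gv' T'" "basicP Ob' ic' ds' zr' T'" "ps' T'"
  unfolding SFP_def by blast
  obtain T where T: "T : Ob" "T' = Phi T" using T'(2) Phi_surj by (auto simp: basicP_def)
  hence "c = phi ` coneP Ob ic ds zr gv T" using T'(1) Phi_cone[of T gv' phi gv, OF T(1) gv phi] by simp
  moreover have "coneP Ob ic ds zr gv T : SFP Ob ic ds zr ps gv"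
  unfolding SFP_def using T T'(2,3) Phi_basic[OF T(1)] ps[OF T(1)] by blast
  ultimately show "c : (`) phi ` SFP Ob ic ds zr ps gv" by blast
 qed
 show "(`) phi ` SFP Ob ic ds zr ps gv \<subseteq> SFP Ob' ic' ds' zr' ps' gv'"
 proof
  fix c assume "c : (`) phi ` SFP Ob ic ds zr ps gv"
  then obtain T where T: "c = phi ` coneP Ob ic ds zr gv T" "basicP Ob ic ds zr T" "ps T"
  unfolding SFP_def by blast
  have o: "T : Ob" using T(2) by (simp add: basicP_def)
  hence "c = coneP Ob' ic' ds' zr' gv' (Phi T)" using T(1) Phi_cone[of T gv' phi gv, OF o gv phi] by simp
  thus "c : SFP Ob' ic' ds' zr' ps' gv'" unfolding SFP_def using T(2,3) Phi_basic[OF o] ps[OF o] by blast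
 qed
qed

end

section \<open>Two-term complexes of projectives\<close>

locale peirce =
 fixes S :: "'r::ring set" and ep :: "nat => 'r"
 assumes S_add: "x : S ==> y : S ==> x + y : S" and S_uminus: "x : S ==> - x : S"
  and S_mult: "x : S ==> y : S ==> x * y : S" and ep_in: "ep i : S" and ep_idem: "ep i * ep i = ep i"
begin

lemma S_zero: "0 : S" using S_add[OF ep_in[of 0] S_uminus[OF ep_in[of 0]]] by simp

lemma S_minus: "x : S ==> y : S ==> x - y : S" using S_add[of x "- y"] S_uminus by simp

lemma S_sum: "(!!i. i : I ==> f i : S) ==> sum f I : S"
 by (induction I rule: infinite_finite_induct) (auto simp: S_zero S_add)

definition dia :: "nat list => nat => 'r" where
 "dia P r = (if r < length P then ep (P ! r) else 0)"

lemma dia_in: "dia P r : S" by (simp add: dia_def ep_in S_zero)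

lemma dia_idem [simp]: "dia P r * dia P r = dia P r" by (simp add: dia_def ep_idem)

lemma dia_append: "dia (P @ Q) r = (if r < length P then dia P r else dia Q (r - length P))"
 by (auto simp: dia_def nth_append)

text \<open>The inclusion of \<open>Q\<close> as the block starting at row \<open>n\<close>;
  \<open>shd\<close> is the matching projection. For \<open>n = 0\<close> this is the identity of
  \<open>Q\<close>.\<close>

definition shu :: "nat => nat list => 'r fmat" where
 "shu n Q = Fmat (%r c. if r = c + n then dia Q c else 0)"

definition shd :: "nat => nat list => 'r fmat" where
 "shd n Q = Fmat (%r c. if c = r + n then dia Q r else 0)"

definition ob :: "nat list => 'r fmat" where
 "ob P = shu 0 P"

lemma ent_shu: "ent (shu n Q) r c = (if r = c + n then dia Q c else 0)" unfolding shu_def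
 by (rule ent_Fmat[of _ "length Q + n", THEN fun_cong, THEN fun_cong])
  (auto simp: dia_def split: if_splits)

lemma ent_shd: "ent (shd n Q) r c = (if c = r + n then dia Q r else 0)" unfolding shd_def
 by (rule ent_Fmat[of _ "length Q + n", THEN fun_cong, THEN fun_cong])
  (auto simp: dia_def split: if_splits)

lemma ent_ob: "ent (ob P) r c = (if r = c then dia P r else 0)" by (simp add: ob_def ent_shu)

lemma ent_shu_l: "ent (shu n Q * M) r c = (if n <= r then dia Q (r - n) * ent M (r - n) c else 0)"
proof -
 have "ent (shu n Q * M) r c = (\<Sum>s<Suc r. ent (shu n Q) r s * ent M s c)"
  by (rule ent_times) (simp add: ent_shu)
 also have "... = (\<Sum>s<Suc r. if s = r - n then (if n <= r then dia Q (r - n) * ent M (r - n) c else 0) else 0)"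
  by (rule sum.cong) (auto simp: ent_shu)
 also have "... = (if n <= r then dia Q (r - n) * ent M (r - n) c else 0)" by (subst sum.delta) auto
 finally show ?thesis .
qed

lemma ent_shd_l: "ent (shd n Q * M) r c = dia Q r * ent M (r + n) c"
proof -
 have "ent (shd n Q * M) r c = (\<Sum>s<Suc (r + n). ent (shd n Q) r s * ent M s c)"
  by (rule ent_times) (simp add: ent_shd)
 also have "... = (\<Sum>s<Suc (r + n). if s = r + n then dia Q r * ent M (r + n) c else 0)"
  by (rule sum.cong) (auto simp: ent_shd)
 also have "... = dia Q r * ent M (r + n) c" by (subst sum.delta) auto
 finally show ?thesis .
qed

lemma ent_shu_r: "ent (M * shu n Q) r c = ent M r (c + n) * dia Q c"
proof -
 have "ent (M * shu n Q) r c = (\<Sum>s<Suc (c + n). ent M r s * ent (shu n Q) s c)"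
  by (rule ent_times) (simp add: ent_shu)
 also have "... = (\<Sum>s<Suc (c + n). if s = c + n then ent M r (c + n) * dia Q c else 0)"
  by (rule sum.cong) (auto simp: ent_shu)
 also have "... = ent M r (c + n) * dia Q c" by (subst sum.delta) auto
 finally show ?thesis .
qed

lemma ent_shd_r: "ent (M * shd n Q) r c = (if n <= c then ent M r (c - n) * dia Q (c - n) else 0)"
proof -
 have "ent (M * shd n Q) r c = (\<Sum>s<Suc c. ent M r s * ent (shd n Q) s c)"
  by (rule ent_times) (simp add: ent_shd)
 also have "... = (\<Sum>s<Suc c. if s = c - n then (if n <= c then ent M r (c - n) * dia Q (c - n) else 0) else 0)"
  by (rule sum.cong) (auto simp: ent_shd)
 also have "... = (if n <= c then ent M r (c - n) * dia Q (c - n) else 0)" by (subst sum.delta) auto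
 finally show ?thesis .
qed

lemma ent_ob_l: "ent (ob Q * M) r c = dia Q r * ent M r c" by (simp add: ob_def ent_shu_l)

lemma ent_ob_r: "ent (M * ob P) r c = ent M r c * dia P c" by (simp add: ob_def ent_shu_r)

definition hm :: "nat list => nat list => 'r fmat set" where
 "hm P Q = {M. (ALL r c. ent M r c : S) & ob Q * M = M & M * ob P = M}"

lemma hm_iff: "M : hm P Q \<longleftrightarrow>
 (ALL r c. ent M r c : S & dia Q r * ent M r c = ent M r c & ent M r c * dia P c = ent M r c)"
proof -
 have "ob Q * M = M \<longleftrightarrow> (ALL r c. dia Q r * ent M r c = ent M r c)" by (metis ent_ob_l fmat_eqI)
 moreover have "M * ob P = M \<longleftrightarrow> (ALL r c. ent M r c * dia P c = ent M r c)"
  by (metis ent_ob_r fmat_eqI)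
 ultimately show ?thesis unfolding hm_def by blast
qed

lemma hm_S: "M : hm P Q ==> ent M r c : S" by (simp add: hm_iff)

lemma hm_l: "M : hm P Q ==> ob Q * M = M" by (simp add: hm_def)

lemma hm_r: "M : hm P Q ==> M * ob P = M" by (simp add: hm_def)

lemma hm_out: "M : hm P Q ==> r >= length Q | c >= length P ==> ent M r c = 0"
 unfolding hm_iff dia_def by (metis linorder_not_le mult_zero_left mult_zero_right)

lemma hm_add: "M : hm P Q ==> N : hm P Q ==> M + N : hm P Q" by (simp add: hm_def S_add algebra_simps)

lemma hm_uminus: "M : hm P Q ==> - M : hm P Q" by (simp add: hm_def S_uminus)

lemma hm_zero: "0 : hm P Q" by (simp add: hm_def S_zero)

lemma hm_minus: "M : hm P Q ==> N : hm P Q ==> M - N : hm P Q" using hm_add[of M P Q "- N"] hm_uminus by simp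

lemma hm_sum: "(!!i. i : I ==> f i : hm P Q) ==> sum f I : hm P Q"
 by (induction I rule: infinite_finite_induct) (auto simp: hm_zero hm_add)

lemma ent_comp: "M : hm P Q ==> ent (N * M) r c = (\<Sum>s<length Q. ent N r s * ent M s c)"
 by (rule ent_times) (simp add: hm_out)

lemma hm_comp:
 assumes "M : hm P Q" and "N : hm Q R"
 shows "N * M : hm P R" unfolding hm_def
proof (intro CollectI conjI allI)
 show "ent (N * M) r c : S" for r c
  unfolding ent_comp[OF assms(1)] by (rule S_sum) (simp add: S_mult hm_S[OF assms(1)] hm_S[OF assms(2)])
 show "ob R * (N * M) = N * M" using hm_l[OF assms(2)] by (simp flip: mult.assoc)
 show "N * M * ob P = N * M" using hm_r[OF assms(1)] by (simp add: mult.assoc)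
qed

lemma ob_in: "ob P : hm P P" unfolding hm_iff by (auto simp: ent_ob dia_in S_zero)

text \<open>The single matrix \<open>ob P\<close> is the identity of \<open>P\<close>, its inclusion
  as first block and the projection back onto it. This is why \<open>idc T\<close> fills two roles
  in the interpretation of \<open>addcat\<close>.\<close>

lemma ob_inl: "ob P : hm P (P @ Q)" and ob_inr: "ob P : hm (P @ Q) P"
 unfolding hm_iff by (auto simp: ent_ob dia_in S_zero dia_append) (auto simp: dia_def)

lemma shu_in: "shu (length P) Q : hm Q (P @ Q)" unfolding hm_iff by (auto simp: ent_shu dia_in S_zero dia_append)

lemma shd_in: "shd (length P) Q : hm (P @ Q) Q" unfolding hm_iff by (auto simp: ent_shd dia_in S_zero dia_append)

lemma shd_shu: "shd n Q * shu n Q = ob Q" by (rule fmat_eqI) (simp add: ent_shd_l ent_shu ent_ob)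

lemma ob_shu: "ob P * shu (length P) Q = 0" by (rule fmat_eqI) (simp add: ent_ob_l ent_shu dia_def)

lemma shd_ob: "shd (length P) Q * ob P = 0" by (rule fmat_eqI) (simp add: ent_shd_l ent_ob dia_def)

lemma ob_append: "ob P + shu (length P) Q * shd (length P) Q = ob (P @ Q)"
 by (rule fmat_eqI) (auto simp: ent_shu_l ent_shd ent_ob dia_append, auto simp: dia_def)

lemma ob_Nil [simp]: "ob [] = 0" by (rule fmat_eqI) (simp add: ent_ob dia_def)

lemma hm_Nil1: "M : hm [] Q \<longleftrightarrow> M = 0" and hm_Nil2: "M : hm P [] \<longleftrightarrow> M = 0"
 using hm_zero by (auto simp: hm_def)

end

type_synonym 'h tcx = "nat list \<times> nat list \<times> 'h"

abbreviation cS :: "'h tcx => nat list" where "cS T \<equiv> fst T"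
abbreviation cT :: "'h tcx => nat list" where "cT T \<equiv> fst (snd T)"
abbreviation cD :: "'h tcx => 'h" where "cD T \<equiv> snd (snd T)"

definition gvc :: "'h tcx => real \<times> real" where
 "gvc T = (real (count_list (cT T) 1) - real (count_list (cS T) 1),
  real (count_list (cT T) 2) - real (count_list (cS T) 2))"

context peirce
begin

definition Obj :: "'r fmat tcx set" where
 "Obj = {T. is_proj (cS T) & is_proj (cT T) & cD T : hm (cS T) (cT T)}"

definition Chm :: "'r fmat tcx => 'r fmat tcx => ('r fmat \<times> 'r fmat) set" where
 "Chm T U = {f. fst f : hm (cS T) (cS U) & snd f : hm (cT T) (cT U) & cD U * fst f = snd f * cD T}"

definition Nul :: "'r fmat tcx => 'r fmat tcx => ('r fmat \<times> 'r fmat) set" where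
 "Nul T U = {(h * cD T, cD U * h) | h. h : hm (cT T) (cS U)}"

definition idc :: "'r fmat tcx => 'r fmat \<times> 'r fmat" where
 "idc T = (ob (cS T), ob (cT T))"

text \<open>The block diagonal differential: the block of \<open>T\<close> is already in place, only
  that of \<open>U\<close> has to be shifted.\<close>

definition dsc :: "'r fmat tcx => 'r fmat tcx => 'r fmat tcx" where
 "dsc T U = (cS T @ cS U, cT T @ cT U,
  cD T + shu (length (cT T)) (cT U) * cD U * shd (length (cS T)) (cS U))"

definition zrc :: "'r fmat tcx" where
 "zrc = ([], [], 0)"

definition jj :: "'r fmat tcx => 'r fmat tcx => 'r fmat \<times> 'r fmat" where
 "jj T U = (shu (length (cS T)) (cS U), shu (length (cT T)) (cT U))"

definition qq :: "'r fmat tcx => 'r fmat tcx => 'r fmat \<times> 'r fmat" where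
 "qq T U = (shd (length (cS T)) (cS U), shd (length (cT T)) (cT U))"

lemma ObjD: "T : Obj ==> cD T : hm (cS T) (cT T)" by (simp add: Obj_def)

lemma dsc_hm:
 assumes "T : Obj" and "U : Obj"
 shows "cD (dsc T U) : hm (cS T @ cS U) (cT T @ cT U)"
proof -
 have "ob (cT T) * cD T * ob (cS T) : hm (cS T @ cS U) (cT T @ cT U)"
  by (intro hm_comp[OF ob_inr] hm_comp[OF _ ob_inl] hm_comp[OF ObjD[OF assms(1)]])
  (metis ObjD assms(1) hm_comp hm_l ob_in ob_inl)
 hence "cD T : hm (cS T @ cS U) (cT T @ cT U)" using hm_l[OF ObjD[OF assms(1)]] hm_r[OF ObjD[OF assms(1)]] by simp
 thus ?thesis unfolding dsc_def snd_conv by (intro hm_add hm_comp[OF shd_in] hm_comp[OF ObjD[OF assms(2)]] shu_in)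
qed

text \<open>The homotopy category of two-term complexes: the ideal consists of the null-homotopic
  chain maps, so \<open>K.ic\<close> is homotopy equivalence.\<close>

sublocale K: addcat Obj Chm Nul idc dsc zrc "%T U. idc T" jj "%T U. idc T" qq
proof
 show "f : Chm T U ==> g : Chm T U ==> f + g : Chm T U" for f g T U by (simp add: Chm_def hm_add algebra_simps)
 show "g * f : Chm T V" if "f : Chm T U" "g : Chm U V" for f g T U V
 proof -
  have e: "cD V * fst g = snd g * cD U" "cD U * fst f = snd f * cD T" using that by (auto simp: Chm_def)
  have "cD V * (fst g * fst f) = snd g * (cD U * fst f)" by (simp only: e(1) mult.assoc[symmetric])
  also have "... = snd g * snd f * cD T" by (simp only: e(2) mult.assoc)
  finally show ?thesis using that by (auto simp: Chm_def times_prod_def intro: hm_comp)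
 qed
 show "T : Obj ==> idc T : Chm T T" for T by (simp add: Chm_def idc_def ob_in hm_l[OF ObjD] hm_r[OF ObjD])
 show "f : Chm T U ==> idc U * f = f" for f T U
  by (auto simp: Chm_def idc_def times_prod_def prod_eq_iff intro: hm_l)
 show "f : Chm T U ==> f * idc T = f" for f T U
  by (auto simp: Chm_def idc_def times_prod_def prod_eq_iff intro: hm_r)
 show "f + g : Nul T U" if "f : Nul T U" "g : Nul T U" for f g T U
 proof -
  obtain h k where "h : hm (cT T) (cS U)" "k : hm (cT T) (cS U)"
  "f = (h * cD T, cD U * h)" "g = (k * cD T, cD U * k)"
  using \<open>f : Nul T U\<close> \<open>g : Nul T U\<close> unfolding Nul_def by blast
  thus ?thesis unfolding Nul_def by (auto intro!: exI[of _ "h + k"] hm_add simp: algebra_simps)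
 qed
 show "- f : Nul T U" if "f : Nul T U" for f T U
 proof -
  obtain h where "h : hm (cT T) (cS U)" "f = (h * cD T, cD U * h)"
  using \<open>f : Nul T U\<close> unfolding Nul_def by blast
  thus ?thesis unfolding Nul_def by (auto intro!: exI[of _ "- h"] hm_uminus)
 qed
 show "0 : Nul T U" for T U unfolding Nul_def by (auto intro!: exI[of _ 0] hm_zero simp: zero_prod_def)
 show "g * f : Nul T V" if "f : Nul T U" "g : Chm U V" for f g T U V
 proof -
  obtain h where h: "h : hm (cT T) (cS U)" "f = (h * cD T, cD U * h)"
  using \<open>f : Nul T U\<close> unfolding Nul_def by blast
  have "fst g * h : hm (cT T) (cS V)" using hm_comp[OF h(1)] that by (simp add: Chm_def)
  moreover have "snd g * (cD U * h) = cD V * (fst g * h)" using that by (simp add: Chm_def flip: mult.assoc)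
  ultimately show ?thesis
  unfolding Nul_def using h by (intro CollectI exI[of _ "fst g * h"]) (simp add: times_prod_def mult.assoc)
 qed
 show "g * f : Nul T V" if "f : Chm T U" "g : Nul U V" for f g T U V
 proof -
  obtain h where h: "h : hm (cT U) (cS V)" "g = (h * cD U, cD V * h)"
  using \<open>g : Nul U V\<close> unfolding Nul_def by blast
  have "h * snd f : hm (cT T) (cS V)" using hm_comp[OF _ h(1)] that by (simp add: Chm_def)
  moreover have "h * cD U * fst f = h * snd f * cD T" using that by (simp add: Chm_def mult.assoc)
  ultimately show ?thesis
  unfolding Nul_def using h by (intro CollectI exI[of _ "h * snd f"]) (simp add: times_prod_def mult.assoc)
 qed
 show "dsc T U : Obj" if "T : Obj" "U : Obj" for T U
  using dsc_hm[OF that] that by (auto simp: Obj_def dsc_def is_proj_def)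
 note ids = ob_shu shd_ob shd_shu ob_append
 have l: "shd (length P) Q * (ob P * X) = 0" "ob P * (shu (length P) Q * X) = 0"
  "shd n Q * (shu n Q * X) = ob Q * X" for P Q n X using shd_ob ob_shu shd_shu by (simp_all flip: mult.assoc)
 show "idc T : Chm T (dsc T U)" if "T : Obj" "U : Obj" for T U
  using hm_l[OF ObjD[OF that(1)]] hm_r[OF ObjD[OF that(1)]]
  by (simp add: Chm_def idc_def dsc_def ob_inl algebra_simps shd_ob)
 show "jj T U : Chm U (dsc T U)" if "T : Obj" "U : Obj" for T U
 proof -
  have "cD T * shu (length (cS T)) (cS U) = cD T * ob (cS T) * shu (length (cS T)) (cS U)"
  using hm_r[OF ObjD[OF that(1)]] by simp
  hence "cD T * shu (length (cS T)) (cS U) = 0" by (simp add: mult.assoc ob_shu)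
  thus ?thesis using hm_l[OF ObjD[OF that(2)]] hm_r[OF ObjD[OF that(2)]]
  by (simp add: Chm_def jj_def dsc_def shu_in algebra_simps shd_shu)
 qed
 show "idc T : Chm (dsc T U) T" if "T : Obj" "U : Obj" for T U
  using hm_l[OF ObjD[OF that(1)]] hm_r[OF ObjD[OF that(1)]]
  by (simp add: Chm_def idc_def dsc_def ob_inr algebra_simps l)
 show "qq T U : Chm (dsc T U) U" if "T : Obj" "U : Obj" for T U
 proof -
  have "shd (length (cT T)) (cT U) * cD T = shd (length (cT T)) (cT U) * (ob (cT T) * cD T)"
  using hm_l[OF ObjD[OF that(1)]] by simp
  hence "shd (length (cT T)) (cT U) * cD T = 0" by (simp add: l)
  moreover have "ob (cT U) * (cD U * X) = cD U * X" for X
  using hm_l[OF ObjD[OF that(2)]] by (simp flip: mult.assoc)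
  ultimately show ?thesis by (simp add: Chm_def qq_def dsc_def shd_in distrib_left mult.assoc l)
 qed
 show "idc T * idc T = idc T" for T by (simp add: idc_def hm_l[OF ob_in])
 show "qq T U * jj T U = idc U" for T U by (simp add: qq_def jj_def idc_def shd_shu)
 show "idc T * idc T + jj T U * qq T U = idc (dsc T U)" for T U
  by (simp add: idc_def hm_l[OF ob_in] jj_def qq_def dsc_def ob_append)
 show "zrc : Obj" by (simp add: Obj_def zrc_def is_proj_def hm_zero)
 show "idc zrc = 0" by (simp add: idc_def zrc_def zero_prod_def)
qed

definition hz :: "'r fmat tcx => 'r fmat tcx => bool" where
 "hz T U \<longleftrightarrow> (ALL f:hm (cS T) (cT U). EX a:hm (cS T) (cS U). EX b:hm (cT T) (cT U).
  f = cD U * a + b * cD T)"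

text \<open>Hom(-, -[1]) is functorial in both arguments, so its vanishing passes to retracts. In
  matrices the retractions are identities only up to the homotopies \<open>h\<close> and
  \<open>k\<close>, which explains the correction terms.\<close>

lemma hz_ret:
 assumes "K.ret T T'" and "K.ret U U'" and "hz T U" and "T : Obj" "U : Obj" "T' : Obj" "U' : Obj"
 shows "hz T' U'" unfolding hz_def
proof
 fix f assume f: "f : hm (cS T') (cT U')"
 obtain i p where ip: "i : Chm T' T" "p : Chm T T'" "p * i - idc T' : Nul T' T'"
  using assms(1) unfolding K.ret_def by blast
 obtain j q where jq: "j : Chm U' U" "q : Chm U U'" "q * j - idc U' : Nul U' U'"
  using assms(2) unfolding K.ret_def by blast
 obtain i1 i2 p1 p2 j1 j2 q1 q2 where c: "i = (i1, i2)" "p = (p1, p2)" "j = (j1, j2)" "q = (q1, q2)" by fastforce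
 obtain h where h: "h : hm (cT T') (cS T')" "p1 * i1 - ob (cS T') = h * cD T'"
  using ip(3) unfolding Nul_def c idc_def by auto
 obtain k where k: "k : hm (cT U') (cS U')" "q2 * j2 - ob (cT U') = cD U' * k"
  using jq(3) unfolding Nul_def c idc_def by auto
 have m: "i1 : hm (cS T') (cS T)" "i2 : hm (cT T') (cT T)" "cD T * i1 = i2 * cD T'"
  "p1 : hm (cS T) (cS T')" "j2 : hm (cT U') (cT U)" "q1 : hm (cS U) (cS U')"
  "q2 : hm (cT U) (cT U')" "cD U' * q1 = q2 * cD U" using ip jq unfolding Chm_def c by auto
 have "j2 * f * p1 : hm (cS T) (cT U)" using f m by (intro hm_comp)
 then obtain a b where ab: "a : hm (cS T) (cS U)" "b : hm (cT T) (cT U)"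
  "j2 * f * p1 = cD U * a + b * cD T" using assms(3) unfolding hz_def by blast
 \<comment> \<open>Expand \<open>f\<close> between the two identities rewritten through
   \<open>k\<close> and \<open>h\<close>, and replace \<open>j2 * f * p1\<close> by
   \<open>cD U * a + b * cD T\<close>. Terms ending in \<open>cD T'\<close> are collected in
   \<open>?B\<close>, the others in \<open>?A\<close>.\<close>
 let ?A = "q1 * a * i1 - k * f * p1 * i1"
 let ?B = "q2 * b * i2 - q2 * j2 * f * h + cD U' * k * f * h"
 have "?A : hm (cS T') (cS U')" "?B : hm (cT T') (cT U')"
  using m ab f h k ObjD[OF assms(7)] by (auto intro!: hm_add hm_minus hm_comp)
 moreover have "f = cD U' * ?A + ?B * cD T'"
 proof -
  have e: "ob (cT U') = q2 * j2 - cD U' * k" "ob (cS T') = p1 * i1 - h * cD T'"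
  using h k by (auto simp: algebra_simps)
  have "f = ob (cT U') * f * ob (cS T')" using hm_l[OF f] hm_r[OF f] by simp
  also have "... = q2 * (j2 * f * p1) * i1 - cD U' * k * f * p1 * i1
  - q2 * j2 * f * h * cD T' + cD U' * k * f * h * cD T'" unfolding e by (simp add: algebra_simps)
  also have "q2 * (j2 * f * p1) * i1 = (q2 * cD U) * a * i1 + q2 * b * (cD T * i1)"
  unfolding ab(3) by (simp add: algebra_simps)
  also have "... = cD U' * q1 * a * i1 + q2 * b * (i2 * cD T')" unfolding m(3) m(8)[symmetric] ..
  finally show ?thesis by (simp add: algebra_simps)
 qed
 ultimately show "EX a:hm (cS T') (cS U'). EX b:hm (cT T') (cT U'). f = cD U' * a + b * cD T'" by blast
qed

end

section \<open>Minimal complexes and g-vectors over an elementary algebra\<close>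

text \<open>Gaussian elimination in column \<open>j\<close>: a pivot row \<open>p\<close> clears the
  column, and the relation found among the other rows is extended by the coefficient
  \<open>c\<close> of the pivot row.\<close>

lemma left_null_vector:
 fixes A :: "'i => 'j => 'k::field"
 assumes "finite J" and "finite I" and "card J < card I"
 shows "EX x. (EX i:I. x i ~= 0) & (ALL j:J. (\<Sum>i\<in>I. x i * A i j) = 0)" using assms
proof (induction J arbitrary: I A rule: finite_induct)
 case empty
 then obtain i where "i : I" by (metis card.empty card_gt_0_iff equals0I)
 thus ?case by (intro exI[of _ "%_. 1"]) auto
next
 case (insert j J)
 show ?case
 proof (cases "ALL i:I. A i j = 0")
  case True
  have "card J < card I" using insert by simp
  from insert.IH[OF insert.prems(1) this, of A] True show ?thesis by auto
 next
  case False
  then obtain p where p: "p : I" "A p j ~= 0" by blast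
  let ?I = "I - {p}" and ?A = "%i t. A i t - A i j / A p j * A p t"
  have "finite ?I" "card J < card ?I" using insert p by auto
  from insert.IH[OF this, of ?A] obtain x where
  x: "EX i:?I. x i ~= 0" "ALL t:J. (\<Sum>i\<in>?I. x i * ?A i t) = 0" by blast
  define c where "c = - (\<Sum>i\<in>?I. x i * (A i j / A p j))"
  let ?y = "x(p := c)"
  have s: "(\<Sum>i\<in>I. ?y i * A i t) = c * A p t + (\<Sum>i\<in>?I. x i * A i t)" for t
  using insert.prems(1) p(1) by (simp add: sum.remove)
  have "(\<Sum>i\<in>I. ?y i * A i t) = 0" if "t : J" for t
  proof -
  have "0 = (\<Sum>i\<in>?I. x i * A i t - x i * (A i j / A p j) * A p t)"
  using x(2) that by (simp add: algebra_simps)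
  also have "... = (\<Sum>i\<in>?I. x i * A i t) + c * A p t" by (simp add: sum_subtractf c_def sum_distrib_right)
  finally show ?thesis using s by (simp add: add.commute)
  qed
  moreover have "(\<Sum>i\<in>I. ?y i * A i j) = 0"
  proof -
  have "c * A p j = - (\<Sum>i\<in>?I. x i * A i j)" unfolding c_def using p(2) by (simp add: sum_distrib_right)
  thus ?thesis using s by simp
  qed
  moreover have "EX i:I. ?y i ~= 0" using x(1) by auto
  ultimately show ?thesis by (intro exI[of _ ?y]) auto
 qed
qed

lemma right_inverse_card_le:
 fixes A :: "'i => 'j => 'k::field"
 assumes "finite I" and "finite J"
  and inv: "!!i i'. i : I ==> i' : I ==> (\<Sum>j\<in>J. A i j * B j i') = (if i = i' then 1 else 0)"
 shows "card I <= card J"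
proof (rule ccontr)
 assume "~ card I <= card J"
 then obtain x where x: "EX i:I. x i ~= 0" "ALL j:J. (\<Sum>i\<in>I. x i * A i j) = 0"
  using left_null_vector[OF assms(2,1), of A] by auto
 have "x i' = 0" if "i' : I" for i'
 proof -
  have "x i' = (\<Sum>i\<in>I. x i * (if i = i' then 1 else 0))"
  using assms(1) that by (simp add: if_distrib[of "(*) _"] cong: if_cong)
  also have "... = (\<Sum>i\<in>I. \<Sum>j\<in>J. x i * A i j * B j i')"
  using inv that by (simp add: sum_distrib_left[symmetric] mult.assoc)
  also have "... = (\<Sum>j\<in>J. (\<Sum>i\<in>I. x i * A i j) * B j i')"
  by (subst sum.swap) (simp add: sum_distrib_right)
  also have "... = 0" using x(2) by simp
  finally show ?thesis .
 qed
 with x(1) show False by blast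
qed

text \<open>\<open>ch i\<close> is the character at the i-th simple module. Assumption
  \<open>qr\<close> says that the corner at \<open>i\<close> is local: the kernel of
  \<open>ch i\<close> is quasi-regular there. Assumption \<open>tri\<close> says that there is no
  nonzero map from P_1 to P_2.\<close>

locale ealg = peirce S ep for S :: "'r::ring set" and ep +
 fixes ch :: "nat => 'r => 'k::field" and sc :: "'k => 'r"
 assumes ep_orth: "i ~= j ==> ep i * ep j = 0" and unit_l: "s : S ==> (ep 1 + ep 2) * s = s"
  and unit_r: "s : S ==> s * (ep 1 + ep 2) = s" and tri: "s : S ==> ep 2 * s * ep 1 = 0"
  and ch_add: "i : {1, 2} ==> s : S ==> t : S ==> ch i (s + t) = ch i s + ch i t"
  and ch_mult: "i : {1, 2} ==> s : S ==> t : S ==> ch i (s * t) = ch i s * ch i t"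
  and ch_ep: "i : {1, 2} ==> ch i (ep i) = 1" and sc_in: "sc c : S" and sc_central: "s : S ==> sc c * s = s * sc c"
  and ch_sc: "i : {1, 2} ==> ch i (sc c) = c"
  and qr: "i : {1, 2} ==> s : S ==> ep i * s = s ==> s * ep i = s ==> ch i s = 0 ==>
  EX t:S. ep i * t = t & t * ep i = t & t * (ep i - s) = ep i & (ep i - s) * t = ep i"
begin

lemma hm_el: assumes "M : hm P Q" and "r < length Q" shows "ep (Q ! r) * ent M r c = ent M r c"
proof -
 have "dia Q r * ent M r c = ent M r c" using assms(1) unfolding hm_iff by blast
 thus ?thesis using assms(2) by (simp add: dia_def)
qed

lemma hm_er: assumes "M : hm P Q" and "c < length P" shows "ent M r c * ep (P ! c) = ent M r c"
proof -
 have "ent M r c * dia P c = ent M r c" using assms(1) unfolding hm_iff by blast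
 thus ?thesis using assms(2) by (simp add: dia_def)
qed

lemma ch_zero: "i : {1, 2} ==> ch i 0 = 0" by (metis S_zero add.right_neutral add_left_imp_eq ch_add)

lemma ch_uminus: "i : {1, 2} ==> s : S ==> ch i (- s) = - ch i s"
 using ch_add[of i s "- s"] S_uminus[of s] ch_zero by (simp add: eq_neg_iff_add_eq_0 add.commute)

lemma ch_minus: "i : {1, 2} ==> s : S ==> t : S ==> ch i (s - t) = ch i s - ch i t"
 using ch_add[of i s "- t"] S_uminus[of t] ch_uminus by simp

lemma ch_sum: "i : {1, 2} ==> (!!j. j : I ==> f j : S) ==> ch i (sum f I) = (\<Sum>j\<in>I. ch i (f j))"
 by (induction I rule: infinite_finite_induct) (auto simp: ch_zero ch_add S_sum)

lemma ch_off: "i : {1, 2} ==> i ~= j ==> ch i (ep j) = 0"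
 using ch_mult[OF _ ep_in ep_in, of i i j] ep_orth[of i j] ch_ep[of i] ch_zero[of i] by simp

text \<open>The reduction of a matrix at the \<open>i\<close>-th simple module.\<close>

definition cx :: "nat => 'r fmat => nat => nat => 'k" where
 "cx i M r c = ch i (ent M r c)"

lemma cx_out:
 assumes "i : {1, 2}" and "M : hm P Q" and "~ (r < length Q & Q ! r = i & c < length P & P ! c = i)"
 shows "cx i M r c = 0"
proof (cases "r < length Q & c < length P")
 case True
 have e: "ep (Q ! r) * ent M r c = ent M r c" "ent M r c * ep (P ! c) = ent M r c"
  using hm_el[OF assms(2)] hm_er[OF assms(2)] True by auto
 have s: "ent M r c : S" using hm_S[OF assms(2)] .
 have "ch i (ent M r c) = ch i (ep (Q ! r)) * ch i (ent M r c)"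
  "ch i (ent M r c) = ch i (ent M r c) * ch i (ep (P ! c))"
  using ch_mult[OF assms(1) ep_in s, of "Q ! r"] ch_mult[OF assms(1) s ep_in, of "P ! c"] e by simp_all
 moreover have "Q ! r ~= i | P ! c ~= i" using assms(3) True by auto
 ultimately show ?thesis unfolding cx_def using ch_off[OF assms(1)] by auto
next
 case False
 hence "ent M r c = 0" using hm_out[OF assms(2)] by (meson not_less)
 thus ?thesis using ch_zero[OF assms(1)] by (simp add: cx_def)
qed

lemma cx_ob: "i : {1, 2} ==> cx i (ob P) r c = (if r = c & r < length P & P ! r = i then 1 else 0)"
 by (auto simp: cx_def ent_ob dia_def ch_zero ch_ep ch_off)

lemma cx_add: "i : {1, 2} ==> M : hm P Q ==> N : hm P Q ==> cx i (M + N) r c = cx i M r c + cx i N r c"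
 by (simp add: cx_def ch_add hm_S)

lemma cx_minus: "i : {1, 2} ==> M : hm P Q ==> N : hm P Q ==> cx i (M - N) r c = cx i M r c - cx i N r c"
 by (simp add: cx_def ch_minus hm_S)

lemma cx_comp:
 assumes "i : {1, 2}" and "M : hm P Q" and "N : hm Q R"
 shows "cx i (N * M) r c = (\<Sum>s<length Q. cx i N r s * cx i M s c)" unfolding cx_def ent_comp[OF assms(2)]
 by (subst ch_sum[OF assms(1)])
  (auto intro!: S_mult hm_S[OF assms(2)] hm_S[OF assms(3)] sum.cong
  simp: ch_mult[OF assms(1) hm_S[OF assms(3)] hm_S[OF assms(2)]])

text \<open>The corner is local: after scaling by the inverse of its residue, the entry is
  \<open>ep i\<close> minus an element of the kernel of \<open>ch i\<close>, which \<open>qr\<close>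
  inverts.\<close>

lemma hm1_inverse:
 assumes i: "i : {1, 2}" and "M : hm [i] [i]" and "cx i M 0 0 ~= 0"
 shows "EX N:hm [i] [i]. N * M = ob [i] & M * N = ob [i]"
proof -
 let ?a = "ent M 0 0" and ?c = "cx i M 0 0"
 have a: "?a : S" "ep i * ?a = ?a" "?a * ep i = ?a"
  using hm_S[OF assms(2)] hm_el[OF assms(2), of 0] hm_er[OF assms(2), of 0] by auto
 let ?b = "sc (1 / ?c)"
 let ?s = "ep i - ?b * ?a"
 have c: "ep i * (?b * x) = ?b * (ep i * x)" for x by (simp only: mult.assoc[symmetric] sc_central[OF ep_in])
 have s: "?s : S" "ep i * ?s = ?s" "?s * ep i = ?s"
  using a ep_in sc_in by (auto intro!: S_minus S_mult simp: algebra_simps ep_idem c)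
 have "ch i ?s = 0" using assms(3) ch_minus[OF i ep_in S_mult[OF sc_in a(1)]] ch_mult[OF i sc_in a(1)] ch_sc[OF i]
  ch_ep[OF i] by (simp add: cx_def)
 from qr[OF i s this] obtain t where t: "t : S" "ep i * t = t" "t * ep i = t"
  "t * (?b * ?a) = ep i" "?b * ?a * t = ep i" by auto
 define n where "n = ?b * t"
 have n: "n : S" "ep i * n = n" "n * ep i = n" using t c sc_in by (auto simp: n_def S_mult mult.assoc)
 have na: "n * ?a = ep i" "?a * n = ep i" using t(4) by (simp only: n_def sc_central[OF t(1)] mult.assoc)
  (use t(5) in \<open>simp only: n_def mult.assoc[symmetric] sc_central[OF a(1), symmetric]\<close>)
 define N where "N = Fmat (%r c. if r = 0 & c = 0 then n else 0)"
 have N: "ent N r c = (if r = 0 & c = 0 then n else 0)" for r c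
  unfolding N_def by (rule ent_Fmat[of _ 1, THEN fun_cong, THEN fun_cong]) (auto split: if_splits)
 have NN: "N : hm [i] [i]" unfolding hm_iff using n by (auto simp: N dia_def S_zero)
 moreover have "N * M = ob [i]" by (rule fmat_eqI) (use na hm_out[OF assms(2)] in
  \<open>auto simp: ent_comp[OF assms(2)] N ent_ob dia_def\<close>)
 moreover have "M * N = ob [i]" by (rule fmat_eqI) (use na hm_out[OF assms(2)] in
  \<open>auto simp: ent_comp[OF NN] N ent_ob dia_def\<close>)
 ultimately show ?thesis by blast
qed

lemma cx1_mult: "i : {1, 2} ==> M : hm [i] [i] ==> N : hm [i] [i] ==>
  cx i (N * M) 0 0 = cx i N 0 0 * cx i M 0 0" using cx_comp[of i M "[i]" "[i]" N "[i]" 0 0] by simp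

lemma hm1_idem:
 assumes i: "i : {1, 2}" and e: "e : hm [i] [i]" and "e * e = e"
 shows "e = 0 | e = ob [i]"
proof (cases "cx i e 0 0 = 0")
 case False
 then obtain n where n: "n * e = ob [i]" using hm1_inverse[OF i e] by blast
 have "e = ob [i] * e" using hm_l[OF e] by simp
 also have "... = n * (e * e)" using n by (simp add: mult.assoc[symmetric])
 also have "... = ob [i]" using n assms(3) by simp
 finally show ?thesis by simp
next
 case True
 hence "cx i (ob [i] - e) 0 0 ~= 0" using cx_minus[OF i ob_in e] cx_ob[OF i, of "[i]"] by simp
 then obtain n where n: "n * (ob [i] - e) = ob [i]" using hm1_inverse[OF i hm_minus[OF ob_in e]] by blast
 have "e = ob [i] * e" using hm_l[OF e] by simp
 also have "... = n * ((ob [i] - e) * e)" using n by (simp add: mult.assoc[symmetric])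
 also have "(ob [i] - e) * e = 0" using assms(3) hm_l[OF e] by (simp add: left_diff_distrib)
 finally show ?thesis by simp
qed

lemma inc_in: "r < length P ==> shu r [P ! r] : hm [P ! r] P"
 and prj_in: "r < length P ==> shd r [P ! r] : hm P [P ! r]"
 unfolding hm_iff by (auto simp: ent_shu ent_shd ep_in ep_idem S_zero dia_def)

lemma sum_inc_prj: "(\<Sum>r<length P. shu r [P ! r] * shd r [P ! r]) = ob P"
proof (rule fmat_eqI)
 fix r c
 have es: "ent (sum f I) r c = (\<Sum>i\<in>I. ent (f i) r c)" for f :: "nat => 'r fmat" and I
  by (induction I rule: infinite_finite_induct) auto
 have "ent (\<Sum>s<length P. shu s [P ! s] * shd s [P ! s]) r c
  = (\<Sum>s<length P. if s = r then (if r = c then ep (P ! r) else 0) else 0)"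
  unfolding es by (rule sum.cong) (auto simp: ent_shu_l ent_shd dia_def ep_idem)
 thus "ent (\<Sum>s<length P. shu s [P ! s] * shd s [P ! s]) r c = ent (ob P) r c" by (auto simp: ent_ob dia_def)
qed

text \<open>\<open>P'\<close> is \<open>P\<close> without position \<open>c\<close>, and
  \<open>u'\<close>, \<open>v'\<close> identify it with the complement of that position. Thus a
  single entry can be cancelled anywhere in a list without permuting it.\<close>

lemma split_off_entry:
 assumes "c < length P" and "P ! c = i"
 obtains P' u' v' where "u' : hm P' P" "v' : hm P P'" "v' * u' = ob P'"
  "shd c [i] * u' = 0" "v' * shu c [i] = 0" "shu c [i] * shd c [i] + u' * v' = ob P"
  "!!x. count_list P x = count_list P' x + (if x = i then 1 else 0)"
  "set P' \<subseteq> set P" "length P = Suc (length P')"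
proof -
 define A B where "A = take c P" and "B = drop (Suc c) P"
 have P: "P = A @ [i] @ B" and A: "length A = c"
  using id_take_nth_drop[OF assms(1)] assms by (auto simp: A_def B_def)
 let ?u = "ob A + shu (Suc c) B * shd c B" and ?v = "ob A + shu c B * shd (Suc c) B"
 have Bu: "shu (Suc c) B : hm B P" and Bd: "shd (Suc c) B : hm P B"
  using shu_in[of "A @ [i]" B] shd_in[of "A @ [i]" B] A P by auto
 have z: "shd (Suc c) B * ob A = 0" "ob A * shu (Suc c) B = 0"
  "shd c B * ob A = 0" "ob A * shu c B = 0"
  "shd c [i] * ob A = 0" "ob A * shu c [i] = 0"
  "shd c [i] * shu (Suc c) B = 0" "shd (Suc c) B * shu c [i] = 0"
  by (rule fmat_eqI, auto simp: ent_shd_l ent_ob_l ent_shu ent_ob dia_def A)+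
 have oA: "ob A * ob A = ob A" using hm_l[OF ob_in] .
 have x: "ob A * (shu (Suc c) B * X) = 0" "ob A * (shu c B * X) = 0"
  "shd c B * (shu c B * X) = ob B * X" "shd (Suc c) B * (shu (Suc c) B * X) = ob B * X"
  "shd c [i] * (shu (Suc c) B * X) = 0" for X using z shd_shu by (simp_all flip: mult.assoc)
 have oB: "ob B * shd c B = shd c B" "ob B * shd (Suc c) B = shd (Suc c) B"
  by (rule fmat_eqI; auto simp: ent_ob_l ent_shd mult.assoc[symmetric])+
 show thesis
 proof (rule that)
  have "ob A : hm (A @ B) P" "ob A : hm P (A @ B)" using hm_comp[OF ob_inr[of A B] ob_inl[of A "[i] @ B"]]
  hm_comp[OF ob_inr[of A "[i] @ B"] ob_inl[of A B]] oA by (simp_all add: P)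
  moreover have "shu (Suc c) B * shd c B : hm (A @ B) P" "shu c B * shd (Suc c) B : hm P (A @ B)"
  using hm_comp[OF shd_in[of A B] Bu[unfolded A[symmetric]]]
  hm_comp[OF Bd[unfolded A[symmetric]] shu_in[of A B]] by (simp_all add: A)
  ultimately show "?u : hm (A @ B) P" "?v : hm P (A @ B)" by (auto intro: hm_add)
  show "?v * ?u = ob (A @ B)" using ob_append[of A B] A by (simp add: algebra_simps z x oA oB)
  show "shd c [i] * ?u = 0" "?v * shu c [i] = 0" by (auto simp: algebra_simps z x)
  have "?u * ?v = ob A + shu (Suc c) B * shd (Suc c) B" by (simp add: algebra_simps z x oA oB)
  moreover have "shu c [i] * shd c [i] + (ob A + shu (Suc c) B * shd (Suc c) B) = ob P"
  unfolding P by (rule fmat_eqI)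
  (auto simp: ent_shu_l ent_shd ent_ob dia_append A, auto simp: dia_def ep_idem A)
  ultimately show "shu c [i] * shd c [i] + ?u * ?v = ob P" by simp
 qed (auto simp: P)
qed

text \<open>An isomorphism between summands \<open>I\<close> of both terms is a contractible direct
  summand. Removing it leaves the Schur complement \<open>d'\<close> of the invertible block
  \<open>z * d * u\<close>; the homotopy is minus the inverse block, regarded as a map from
  \<open>Q\<close> to \<open>P\<close>.\<close>

lemma gauss_elimination:
 assumes T: "(P, Q, d) : Obj" and P: "u : hm I P" "v : hm P I" "u' : hm P' P" "v' : hm P P'" "v' * u' = ob P'"
  "v' * u = 0" "u * v + u' * v' = ob P"
  and Q: "y : hm I Q" "z : hm Q I" "y' : hm Q' Q" "z' : hm Q Q'" "z' * y' = ob Q'"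
  "z * y' = 0" "y * z + y' * z' = ob Q" and w: "w : hm I I" "w * (z * d * u) = ob I" "z * d * u * w = ob I"
  and proj: "is_proj P'" "is_proj Q'"
 defines "d' \<equiv> z' * d * u' - z' * d * u * w * z * d * u'"
 shows "(P', Q', d') : Obj" and "K.ic (P, Q, d) (P', Q', d')"
proof -
 have d: "d : hm P Q" using T by (simp add: Obj_def)
 have d': "d' : hm P' Q'" unfolding d'_def using d P Q w by (intro hm_minus hm_comp)
 thus "(P', Q', d') : Obj" using proj by (simp add: Obj_def)
 have uv: "u' * v' = ob P - u * v" "y' * z' = ob Q - y * z" using P(7) Q(7) by (auto simp: algebra_simps)
 have a: "w * (z * (d * u)) = ob I" "z * (d * (u * w)) = ob I" using w by (simp_all add: mult.assoc)
 have r: "u' * (v' * X) = ob P * X - u * (v * X)" "y' * (z' * X) = ob Q * X - y * (z * X)"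
  "w * (z * (d * (u * X))) = ob I * X" "z * (d * (u * (w * X))) = ob I * X"
  "d * (ob P * X) = d * X" "ob Q * (d * X) = d * X" "ob I * (v * X) = v * X" "u * (ob I * X) = u * X"
  "v' * (u * X) = 0" "v' * (u' * X) = ob P' * X" "ob I * (z * X) = z * X" "y * (ob I * X) = y * X" for X
  using uv a hm_r[OF d] hm_l[OF d] hm_l[OF P(2)] hm_r[OF P(1)] P(5,6) hm_l[OF Q(2)] hm_r[OF Q(1)]
  by (simp_all add: left_diff_distrib flip: mult.assoc)
 have m: "d * ob P = d" "ob Q * d = d" "ob I * v = v" "u * ob I = u" "v' * u' = ob P'" "v' * u = 0"
  "z' * y' = ob Q'" "z * y' = 0" "z' * ob Q = z'" "ob P * u' = u'" "ob P * u = u" "z * ob Q = z"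
  using hm_r[OF d] hm_l[OF d] hm_l[OF P(2)] hm_r[OF P(1)] P(5,6) Q(5,6) hm_r[OF Q(4)] hm_l[OF P(3)]
  hm_l[OF P(1)] hm_r[OF Q(2)] by auto
 define f g where "f = (v', z' - z' * d * u * w * z)" and "g = (u' - u * w * z * d * u', y')"
 have "z' - z' * d * u * w * z : hm Q Q'" using P Q w d by (intro hm_minus hm_comp)
 moreover have "u' - u * w * z * d * u' : hm P' P" using P Q w d by (intro hm_minus hm_comp)
 ultimately have f: "f : Chm (P, Q, d) (P', Q', d')" and g: "g : Chm (P', Q', d') (P, Q, d)" using P(4) Q(3)
  by (simp_all add: Chm_def f_def g_def d'_def algebra_simps uv r m a)
 let ?h = "- (u * w * z)"
 have h: "?h : hm Q P" using P Q w by (auto intro!: hm_uminus hm_comp)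
 have "g * f - idc (P, Q, d) = (?h * d, d * ?h)"
  unfolding f_def g_def idc_def by (simp add: algebra_simps uv r m a)
 hence "g * f - idc (P, Q, d) : Nul (P, Q, d) (P, Q, d)"
  unfolding Nul_def using h by (intro CollectI exI[of _ ?h]) simp
 moreover have "f * g = idc (P', Q', d')" unfolding f_def g_def idc_def by (simp add: algebra_simps uv r m a)
 hence "f * g - idc (P', Q', d') : Nul (P', Q', d') (P', Q', d')" using K.Nl_zero by simp
 ultimately show "K.ic (P, Q, d) (P', Q', d')" unfolding K.ic_def using f g by blast
qed

text \<open>Minimality of the complex: the differential vanishes modulo the radical. Only entries
  between equal projectives are restricted, as the others reduce to 0 by
  \<open>cx_out\<close>.\<close>

definition rad :: "'r fmat tcx => bool" where
 "rad T \<longleftrightarrow> (ALL i:{1, 2}. ALL r c. cx i (cD T) r c = 0)"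

lemma minimal_form:
 assumes "T : Obj"
 shows "EX U:Obj. K.ic T U & gvc U = gvc T & rad U" using assms
proof (induction "length (cS T)" arbitrary: T rule: less_induct)
 case less
 show ?case
 proof (cases "rad T")
  case True
  thus ?thesis using less.prems K.ic_refl by blast
 next
  case False
  obtain P Q d where T: "T = (P, Q, d)" by (cases T)
  have d: "d : hm P Q" using less.prems by (simp add: T Obj_def)
  obtain i r c where i: "i : {1, 2}" and rc: "cx i d r c ~= 0" using False unfolding rad_def T by auto
  have pos: "r < length Q" "Q ! r = i" "c < length P" "P ! c = i" using cx_out[OF i d, of r c] rc by blast+
  obtain P' u' v' where P': "u' : hm P' P" "v' : hm P P'" "v' * u' = ob P'"
  "shd c [i] * u' = 0" "v' * shu c [i] = 0" "shu c [i] * shd c [i] + u' * v' = ob P"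
  "!!x. count_list P x = count_list P' x + (if x = i then 1 else 0)"
  "set P' \<subseteq> set P" "length P = Suc (length P')" by (rule split_off_entry[OF pos(3,4)]) (rule that)
  obtain Q' y' z' where Q': "y' : hm Q' Q" "z' : hm Q Q'" "z' * y' = ob Q'"
  "shd r [i] * y' = 0" "z' * shu r [i] = 0" "shu r [i] * shd r [i] + y' * z' = ob Q"
  "!!x. count_list Q x = count_list Q' x + (if x = i then 1 else 0)"
  "set Q' \<subseteq> set Q" "length Q = Suc (length Q')" by (rule split_off_entry[OF pos(1,2)]) (rule that)
  have in4: "shu c [i] : hm [i] P" "shd c [i] : hm P [i]" "shu r [i] : hm [i] Q" "shd r [i] : hm Q [i]"
  using inc_in[OF pos(1)] prj_in[OF pos(1)] inc_in[OF pos(3)] prj_in[OF pos(3)] pos(2,4) by simp_all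
  have m: "shd r [i] * d * shu c [i] : hm [i] [i]" using in4 d by (intro hm_comp)
  have "ent (shd r [i] * d * shu c [i]) 0 0 = ep (Q ! r) * ent d r c * ep (P ! c)"
  by (simp add: mult.assoc ent_shd_l ent_shu_r dia_def pos)
  also have "... = ent d r c" using hm_el[OF d pos(1)] hm_er[OF d pos(3)] by simp
  finally have "cx i (shd r [i] * d * shu c [i]) 0 0 ~= 0" using rc by (simp add: cx_def)
  then obtain w where w: "w : hm [i] [i]" "w * (shd r [i] * d * shu c [i]) = ob [i]"
  "shd r [i] * d * shu c [i] * w = ob [i]" using hm1_inverse[OF i m] by blast
  have pr: "is_proj P'" "is_proj Q'" using less.prems P'(8) Q'(8) by (auto simp: T Obj_def is_proj_def)
  note ge = gauss_elimination[OF less.prems[unfolded T] in4(1,2) P'(1-3) P'(5,6) in4(3,4) Q'(1-4) Q'(6) w pr]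
  let ?T' = "(P', Q', z' * d * u' - z' * d * shu c [i] * w * shd r [i] * d * u')"
  have "length (cS ?T') < length (cS T)" using P'(9) T by simp
  from less.hyps[OF this ge(1)] obtain U where
  U: "U : Obj" "K.ic ?T' U" "gvc U = gvc ?T'" "rad U" by blast
  have "gvc ?T' = gvc T" unfolding gvc_def T using P'(7)[of 1] P'(7)[of 2] Q'(7)[of 1] Q'(7)[of 2] i by auto
  thus ?thesis using U K.ic_trans[OF ge(2) U(2)] T by auto
 qed
qed

lemma count_le_of_retract:
 assumes i: "i : {1, 2}" and n: "!!r c. cx i (g * f - ob P) r c = 0" and f: "f : hm P P'" and g: "g : hm P' P"
 shows "count_list P i <= count_list P' i"
proof -
 let ?I = "{r. r < length P & P ! r = i}" and ?J = "{r. r < length P' & P' ! r = i}"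
 have gf: "g * f : hm P P" using f g by (rule hm_comp)
 have "(\<Sum>j\<in>?J. cx i g r j * cx i f j c) = (if r = c then 1 else 0)" if "r : ?I" "c : ?I" for r c
 proof -
  have "cx i (g * f) r c = (if r = c then 1 else 0)"
  using n[of r c] cx_minus[OF i gf ob_in, of r c] cx_ob[OF i, of P r c] that by auto
  moreover have "cx i (g * f) r c = (\<Sum>j\<in>?J. cx i g r j * cx i f j c)"
  unfolding cx_comp[OF i f g] using cx_out[OF i f] by (intro sum.mono_neutral_right) auto
  ultimately show ?thesis by simp
 qed
 hence "card ?I <= card ?J" by (intro right_inverse_card_le[of ?I ?J "cx i g" "cx i f"]) auto
 thus ?thesis by (simp add: count_list_eq_length_filter length_filter_conv_card eq_commute)
qed

text \<open>Null-homotopic endomorphisms of a minimal complex reduce to 0, so a homotopy equivalence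
  of minimal complexes is invertible modulo the radical in each degree and the multiplicities of the
  projectives agree.\<close>

lemma gvc_ic:
 assumes "T : Obj" and "U : Obj" and "K.ic T U"
 shows "gvc T = gvc U"
proof -
 obtain T' where T': "T' : Obj" "K.ic T T'" "gvc T' = gvc T" "rad T'" using minimal_form[OF assms(1)] by blast
 obtain U' where U': "U' : Obj" "K.ic U U'" "gvc U' = gvc U" "rad U'" using minimal_form[OF assms(2)] by blast
 have key: "count_list (cS T) i <= count_list (cS U) i & count_list (cT T) i <= count_list (cT U) i"
  if a: "i : {1, 2}" "K.ic T U" "rad T" "T : Obj" for i T U
 proof -
  obtain f g where fg: "f : Chm T U" "g : Chm U T" "g * f - idc T : Nul T T" using a unfolding K.ic_def by blast
  obtain f1 f2 g1 g2 where c: "f = (f1, f2)" "g = (g1, g2)" by fastforce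
  obtain h where h: "h : hm (cT T) (cS T)" "g1 * f1 - ob (cS T) = h * cD T" "g2 * f2 - ob (cT T) = cD T * h"
  using fg(3) unfolding Nul_def c idc_def by auto
  have m: "f1 : hm (cS T) (cS U)" "f2 : hm (cT T) (cT U)" "g1 : hm (cS U) (cS T)" "g2 : hm (cT U) (cT T)"
  using fg unfolding Chm_def c by auto
  have z: "ALL r c. cx i (cD T) r c = 0" using a unfolding rad_def by blast
  have d: "cD T : hm (cS T) (cT T)" using ObjD[OF a(4)] .
  have "cx i (h * cD T) r c = 0" "cx i (cD T * h) r c = 0" for r c
  unfolding cx_comp[OF a(1) d h(1)] cx_comp[OF a(1) h(1) d] using z by simp_all
  hence "count_list (cS T) i <= count_list (cS U) i" "count_list (cT T) i <= count_list (cT U) i"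
  using count_le_of_retract[OF a(1) _ m(1,3)] count_le_of_retract[OF a(1) _ m(2,4)] h by auto
  thus ?thesis by blast
 qed
 have i: "K.ic T' U'" using assms(3) T' U' K.ic_trans K.ic_sym by metis
 have "count_list (cS T') i = count_list (cS U') i & count_list (cT T') i = count_list (cT U') i"
  if "i : {1, 2}" for i using key[OF that i T'(4,1)] key[OF that K.ic_sym[OF i] U'(4,1)] by auto
 hence "gvc T' = gvc U'" by (simp add: gvc_def)
 thus ?thesis using T' U' by simp
qed

definition psl :: "'r fmat tcx => bool" where
 "psl T \<longleftrightarrow> T : Obj & hz T T"

text \<open>A common summand yields a matrix unit \<open>?f\<close> from degree -1 to degree 0 with
  residue 1, whereas \<open>cD T * a + b * cD T\<close> has residue 0 for a radical
  differential.\<close>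

lemma psl_rad_disjoint:
 assumes "psl T" and "rad T" and i: "i : {1, 2}"
 shows "~ (i : set (cS T) & i : set (cT T))"
proof
 assume "i : set (cS T) & i : set (cT T)"
 then obtain r c where rc: "c < length (cS T)" "cS T ! c = i" "r < length (cT T)" "cT T ! r = i"
  by (auto simp: in_set_conv_nth)
 have d: "cD T : hm (cS T) (cT T)" and z: "ALL r c. cx i (cD T) r c = 0"
  using assms unfolding psl_def rad_def by (auto dest: ObjD)
 let ?f = "shu r [i] * shd c [i]"
 have "?f : hm (cS T) (cT T)" using prj_in[OF rc(1)] inc_in[OF rc(3)] rc by (auto intro: hm_comp)
 then obtain a b where ab: "a : hm (cS T) (cS T)" "b : hm (cT T) (cT T)" "?f = cD T * a + b * cD T"
  using assms(1) unfolding psl_def hz_def by blast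
 have "cx i ?f r c = 0" unfolding ab(3) cx_add[OF i hm_comp[OF ab(1) d] hm_comp[OF d ab(2)]]
  cx_comp[OF i ab(1) d] cx_comp[OF i d ab(2)] using z by simp
 moreover have "cx i ?f r c = 1" by (simp add: cx_def ent_shu_l ent_shd dia_def ep_idem ch_ep[OF i])
 ultimately show False by simp
qed

end

section \<open>Presilting summands and the triangular case\<close>

text \<open>Nakayama's lemma for finitely many elements modulo \<open>N\<close>, by eliminating one
  generator at a time: the coefficient of \<open>z k\<close> in its own relation is quasi-regular,
  so the relation is solved for \<open>z k\<close> and substituted in the others. \<open>A\<close>
  plays the role of a corner ring with unit \<epsilon> and radical \<open>J\<close>.\<close>

lemma nakayama:
 fixes z :: "'i => 'r::ring"
 assumes "finite I" and A_mult: "!!a b. a : A ==> b : A ==> a * b : A"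
  and J_A: "J \<subseteq> A" and J_add: "!!a b. a : J ==> b : J ==> a + b : J"
  and A_J: "!!a b. a : A ==> b : J ==> a * b : J"
  and inv: "!!a. a : J ==> EX b:A. b * (\<epsilon> - a) = \<epsilon>"
  and N0: "0 : N" and N_add: "!!m n. m : N ==> n : N ==> m + n : N" and A_N: "!!a n. a : A ==> n : N ==> a * n : N"
  and z: "!!i. i : I ==> \<epsilon> * z i = z i"
  and gen: "!!i. i : I ==> EX a. (ALL j:I. a j : J) & z i - (\<Sum>j\<in>I. a j * z j) : N"
 shows "ALL i:I. z i : N" using assms(1) z gen
proof (induction I rule: finite_induct)
 case empty
 thus ?case by simp
next
 case (insert k I)
 obtain a where a: "ALL j:insert k I. a j : J" "z k - (\<Sum>j\<in>insert k I. a j * z j) : N"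
  using insert.prems(2)[of k] by blast
 obtain b where b: "b : A" "b * (\<epsilon> - a k) = \<epsilon>" using inv a(1) by blast
 have "b * (z k - (\<Sum>j\<in>insert k I. a j * z j)) = b * (\<epsilon> - a k) * z k - (\<Sum>j\<in>I. b * a j * z j)"
  using insert.hyps insert.prems(1)[of k] by (simp add: algebra_simps sum_distrib_left)
 also have "... = z k - (\<Sum>j\<in>I. b * a j * z j)" using b(2) insert.prems(1)[of k] by simp
 finally have k: "z k - (\<Sum>j\<in>I. b * a j * z j) : N" using A_N[OF b(1) a(2)] by simp
 have step: "EX a. (ALL j:I. a j : J) & z i - (\<Sum>j\<in>I. a j * z j) : N" if i: "i : I" for i
 proof -
  obtain c where c: "ALL j:insert k I. c j : J" "z i - (\<Sum>j\<in>insert k I. c j * z j) : N"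
  using insert.prems(2)[of i] i by blast
  let ?a = "%j. c j + c k * (b * a j)"
  have "z i - (\<Sum>j\<in>I. ?a j * z j)
  = (z i - (\<Sum>j\<in>insert k I. c j * z j)) + c k * (z k - (\<Sum>j\<in>I. b * a j * z j))"
  using insert.hyps by (simp add: algebra_simps sum_distrib_left sum.distrib)
  also have "... : N" using c k J_A by (intro N_add A_N) auto
  finally show ?thesis using a c b J_A by (intro exI[of _ ?a]) (auto intro!: J_add A_J)
 qed
 have I: "ALL i:I. z i : N" using insert.IH[OF _ step] insert.prems(1) by blast
 have "ALL j:I. b * a j * z j : N" using I a b J_A by (auto intro!: A_N A_mult)
 with insert.hyps(1) have "(\<Sum>j\<in>I. b * a j * z j) : N"
  by (induction I rule: finite_induct) (auto simp: N0 N_add)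
 from N_add[OF k this] have "z k : N" by simp
 with I show ?case by simp
qed

context ealg
begin

section \<open>Indecomposable summands, cones and sums of presilting complexes\<close>

abbreviation "indec \<equiv> indecP Obj K.ic dsc zrc"
abbreviation "isum \<equiv> isumP Obj K.ic dsc zrc"
abbreviation "basc \<equiv> basicP Obj K.ic dsc zrc"
abbreviation "CC \<equiv> coneP Obj K.ic dsc zrc gvc"
abbreviation "SF \<equiv> SFP Obj K.ic dsc zrc psl gvc"

lemma indec_Obj: "indec T ==> T : Obj" by (simp add: indecP_def)

lemma isum_iff: "T : Obj ==> isum T U \<longleftrightarrow> indec U & (EX V:Obj. K.bip T U V)"
 unfolding isumP_def using K.bip_Ob indec_Obj by blast

lemma indec_bip: "indec T ==> U : Obj ==> V : Obj ==> K.bip T U V ==> K.ic U zrc | K.ic V zrc"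
 unfolding indecP_def using K.bip_Ob by blast

lemma isum_Obj: "isum T U ==> U : Obj" and isum_is_indec: "isum T U ==> indec U"
 unfolding isumP_def using indec_Obj by auto

lemma isum_ret: "T : Obj ==> isum T U ==> K.ret T U" using isum_iff K.bip_ret by blast

lemma isum_indec: assumes "indec T" "isum T U" shows "K.ic T U"
proof -
 obtain V where V: "V : Obj" "K.bip T U V" using isum_iff[OF indec_Obj[OF assms(1)]] assms(2) by blast
 have "~ K.ic U zrc" using isum_is_indec[OF assms(2)] unfolding indecP_def by blast
 hence "K.ic V zrc" using indec_bip[OF assms(1) isum_Obj[OF assms(2)] V] by blast
 thus ?thesis using K.bip_zr[OF V(1) _ V(2)] by blast
qed

lemma isum_ic:
 assumes "T : Obj" "T' : Obj" "K.ic T T'" "isum T U"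
 shows "isum T' U"
proof -
 obtain V where V: "V : Obj" "K.bip T U V" using isum_iff[OF assms(1)] assms(4) by blast
 have "K.bip T' U V" using K.bip_ic[OF assms(3) K.ic_refl K.ic_refl V(2)] V(1) isum_Obj[OF assms(4)] by blast
 thus ?thesis using isum_iff[OF assms(2)] isum_is_indec[OF assms(4)] V(1) by blast
qed

lemma isum_iff_ic: "T : Obj ==> T' : Obj ==> K.ic T T' ==> isum T U \<longleftrightarrow> isum T' U"
 using isum_ic K.ic_sym by blast

lemma CC_ic: "T : Obj ==> T' : Obj ==> K.ic T T' ==> CC T = CC T'" unfolding coneP_def using isum_iff_ic by simp

lemma indec_ic:
 assumes "indec T" "T' : Obj" "K.ic T T'"
 shows "indec T'" unfolding indecP_def
proof (intro conjI allI impI)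
 show "~ K.ic T' zrc" using assms K.ic_trans unfolding indecP_def by blast
 show "K.ic U zrc | K.ic V zrc" if "U : Obj & V : Obj & K.ic T' (dsc U V)" for U V
  using assms(1,3) that K.ic_trans unfolding indecP_def by blast
qed (use assms in auto)

lemma hz_isum: "psl T ==> isum T U ==> isum T V ==> hz U V"
 unfolding psl_def using hz_ret isum_ret isum_Obj by blast

lemma psl_isum: "psl T ==> isum T U ==> psl U" using hz_isum isum_Obj unfolding psl_def by blast

lemma psl_ret: "psl T ==> K.ret T U ==> U : Obj ==> psl U" unfolding psl_def using hz_ret by blast

lemma hz_ic: "T : Obj ==> U : Obj ==> T' : Obj ==> U' : Obj ==> K.ic T T' ==> K.ic U U' ==>
  hz T U ==> hz T' U'" using hz_ret K.ic_ret by blast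

text \<open>Without nonzero null-homotopic endomorphisms, the endomorphism \<open>i * p\<close>
  given by a decomposition is strictly idempotent, hence 0 or the identity; then one of the summands
  has a null-homotopic identity.\<close>

lemma indecI:
 assumes T: "T : Obj" and N: "Nul T T \<subseteq> {0}" and nz: "idc T ~= 0"
  and e: "!!e. e : Chm T T ==> e * e = e ==> e = 0 | e = idc T"
 shows "indec T" unfolding indecP_def
proof (intro conjI allI impI)
 show "~ K.ic T zrc" using K.ic_zr[OF T] N nz by blast
 show "K.ic U zrc | K.ic V zrc" if UV: "U : Obj & V : Obj & K.ic T (dsc U V)" for U V
 proof -
  obtain i p j q where b: "i : Chm U T" "p : Chm T U" "j : Chm V T" "q : Chm T V"
  "p * i - idc U : Nul U U" "q * j - idc V : Nul V V" "i * p + j * q - idc T : Nul T T"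
  using UV K.bip_Ob[OF T] unfolding K.bip_def by blast
  have s: "i * p + j * q = idc T" using b(7) N by auto
  have "i * (p * i - idc U) * p : Nul T T" using K.Nl_r[OF b(2) K.Nl_l[OF b(5,1)]] .
  hence "i * (p * i - idc U) * p = 0" using N by blast
  moreover have "i * (p * i - idc U) * p = (i * p) * (i * p) - i * p"
  using K.un_r[OF b(1)] by (simp add: algebra_simps flip: mult.assoc)
  ultimately have "(i * p) * (i * p) = i * p" by simp
  then consider "i * p = 0" | "i * p = idc T" using e K.Hm_comp[OF b(2,1)] by blast
  thus ?thesis
  proof cases
  case 1
  have "p * i * (p * i - idc U) : Nul U U" using K.Nl_l[OF b(5) K.Hm_comp[OF b(1,2)]] by simp
  moreover have "p * i * (p * i) = 0"
  proof -
  have "p * i * (p * i) = p * (i * p) * i" by (simp only: mult.assoc)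
  thus ?thesis by (simp only: 1 mult_zero_left mult_zero_right)
  qed
  ultimately have "- (p * i) : Nul U U"
  using K.un_r[OF K.Hm_comp[OF b(1,2)]] by (simp only: right_diff_distrib diff_0)
  from K.Nl_minus[OF this] have "p * i : Nul U U" by simp
  from K.Nl_sub[OF this b(5)] have "idc U : Nul U U" by simp
  thus ?thesis using K.ic_zr UV by blast
  next
  case 2
  hence jq: "j * q = 0" using s by simp
  have "q * j * (q * j - idc V) : Nul V V" using K.Nl_l[OF b(6) K.Hm_comp[OF b(3,4)]] by simp
  moreover have "q * j * (q * j) = 0"
  proof -
  have "q * j * (q * j) = q * (j * q) * j" by (simp only: mult.assoc)
  thus ?thesis by (simp only: jq mult_zero_left mult_zero_right)
  qed
  ultimately have "- (q * j) : Nul V V"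
  using K.un_r[OF K.Hm_comp[OF b(3,4)]] by (simp only: right_diff_distrib diff_0)
  from K.Nl_minus[OF this] have "q * j : Nul V V" by simp
  from K.Nl_sub[OF this b(6)] have "idc V : Nul V V" by simp
  thus ?thesis using K.ic_zr UV by blast
  qed
 qed
qed (rule T)

lemma dsc_zrc: "dsc T zrc = T" by (cases T) (simp add: dsc_def zrc_def)

lemma basc_zrc: "basc zrc"
 unfolding basicP_def using K.ic_refl[OF K.zr_Ob] K.zr_Ob by (intro conjI exI[of _ "[]"]) auto

lemma basc_single: "indec T ==> basc T" unfolding basicP_def using K.ic_refl[OF indec_Obj] indec_Obj
 by (intro conjI exI[of _ "[T]"]) (auto simp: dsc_zrc)

lemma basc_pair:
 assumes "indec A" "indec B" "~ K.ic A B"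
 shows "basc (dsc A B)"
proof -
 have o: "dsc A B : Obj" using assms K.ds_Ob indec_Obj by blast
 have "~ K.ic B A" using assms(3) K.ic_sym by blast
 hence "ALL i<length [A, B]. ALL j<length [A, B]. i ~= j \<longrightarrow> ~ K.ic ([A, B] ! i) ([A, B] ! j)"
  using assms(3) by (auto simp: less_Suc_eq)
 moreover have "K.ic (dsc A B) (foldr dsc [A, B] zrc)" using K.ic_refl[OF o] by (simp add: dsc_zrc)
 moreover have "ALL U:set [A, B]. indec U" using assms by simp
 ultimately show ?thesis unfolding basicP_def using o by blast
qed

lemma isum_dsc: "indec A ==> B : Obj ==> isum (dsc A B) A" "indec B ==> A : Obj ==> isum (dsc A B) B"
proof -
 assume a: "indec A" "B : Obj"
 note o = indec_Obj[OF a(1)] a(2)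
 show "isum (dsc A B) A" unfolding isum_iff[OF K.ds_Ob[OF o]] using a K.bip_ds[OF o] by blast
next
 assume a: "indec B" "A : Obj"
 note o = a(2) indec_Obj[OF a(1)]
 show "isum (dsc A B) B" unfolding isum_iff[OF K.ds_Ob[OF o]] using a K.bip_sym[OF K.bip_ds[OF o]] by blast
qed

lemma hz_Nil: "cS T = [] ==> hz T U" unfolding hz_def using hm_zero by (force simp: hm_Nil1)

lemma psl_zrc: "psl zrc" unfolding psl_def using K.zr_Ob hz_Nil[of zrc zrc] by (simp add: zrc_def)

lemma isum_zrc: "~ isum zrc U"
proof
 assume a: "isum zrc U"
 then obtain i p where ip: "i : Chm U zrc" "p : Chm zrc U" "p * i - idc U : Nul U U"
  using isum_ret[OF K.zr_Ob] unfolding K.ret_def by blast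
 have "p = 0" using K.un_r[OF ip(2)] K.un_zr by simp
 hence "idc U : Nul U U" using K.Nl_minus[OF ip(3)] by simp
 thus False using isum_is_indec[OF a] K.ic_zr[OF isum_Obj[OF a]] unfolding indecP_def by blast
qed

lemma SF_zero: "{0} : SF"
proof -
 have "CC zrc = {0}" unfolding coneP_def by (simp add: isum_zrc)
 thus ?thesis unfolding SFP_def using basc_zrc psl_zrc by blast
qed

lemma SF_single:
 assumes "indec A" "psl A"
 shows "convex_cone hull {gvc A} : SF"
proof -
 have o: "A : Obj" using indec_Obj[OF assms(1)] .
 have "gvc U : {gvc A}" if "isum A U" for U
  using gvc_ic[OF o isum_Obj[OF that] isum_indec[OF assms(1) that]] by simp
 moreover have "isum A A" using isum_dsc(1)[OF assms(1) K.zr_Ob] by (simp add: dsc_zrc)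
 ultimately have "{gvc U |U. isum A U} = {gvc A}" by blast
 hence "convex_cone hull {gvc A} = CC A" unfolding coneP_def by simp
 thus ?thesis unfolding SFP_def using basc_single[OF assms(1)] assms(2) by blast
qed

lemma SF_pair:
 assumes "indec A" "indec B" "~ K.ic A B" "psl (dsc A B)"
  and sub: "!!U. isum (dsc A B) U ==> gvc U : {gvc A, gvc B}"
 shows "convex_cone hull {gvc A, gvc B} : SF"
proof -
 have "isum (dsc A B) A" "isum (dsc A B) B" using isum_dsc indec_Obj assms(1,2) by auto
 hence "{gvc U |U. isum (dsc A B) U} = {gvc A, gvc B}" using sub by blast
 hence "convex_cone hull {gvc A, gvc B} = CC (dsc A B)" unfolding coneP_def by simp
 thus ?thesis unfolding SFP_def using basc_pair[OF assms(1-3)] assms(4) by blast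
qed

lemma cross_zero:
 "X : hm P R ==> X * shu (length P) Q = 0" "X : hm R P ==> shd (length P) Q * X = 0"
proof -
 assume "X : hm P R"
 from hm_r[OF this] have "X * shu (length P) Q = X * ob P * shu (length P) Q" by simp
 thus "X * shu (length P) Q = 0" by (simp add: mult.assoc ob_shu)
next
 assume "X : hm R P"
 from hm_l[OF this] have "shd (length P) Q * X = shd (length P) Q * (ob P * X)" by simp
 thus "shd (length P) Q * X = 0" by (simp add: shd_ob flip: mult.assoc)
qed

lemma hm_ext: "X : hm P R ==> X : hm (P @ Q) R" "X : hm R P ==> X : hm R (P @ Q)"
 using hm_comp[OF ob_inr[of P Q], of X R] hm_comp[OF _ ob_inl[of P Q], of X R] hm_r[of X P R] hm_l[of X R P]
 by simp_all

lemma hz_dsc_l: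
 assumes "A : Obj" "B : Obj" "hz A T" "hz B T"
 shows "hz (dsc A B) T" unfolding hz_def
proof
 fix f assume "f : hm (cS (dsc A B)) (cT T)"
 hence f: "f : hm (cS A @ cS B) (cT T)" by (simp add: dsc_def)
 let ?u = "shu (length (cS A)) (cS B)" and ?d = "shd (length (cS A)) (cS B)"
 let ?u' = "shu (length (cT A)) (cT B)" and ?d' = "shd (length (cT A)) (cT B)"
 obtain a1 b1 where 1: "a1 : hm (cS A) (cS T)" "b1 : hm (cT A) (cT T)" "f * ob (cS A) = cD T * a1 + b1 * cD A"
  using assms(3) hm_comp[OF ob_inl f] unfolding hz_def by blast
 obtain a2 b2 where 2: "a2 : hm (cS B) (cS T)" "b2 : hm (cT B) (cT T)" "f * ?u = cD T * a2 + b2 * cD B"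
  using assms(4) hm_comp[OF shu_in f] unfolding hz_def by blast
 have "a1 + a2 * ?d : hm (cS (dsc A B)) (cS T)" "b1 + b2 * ?d' : hm (cT (dsc A B)) (cT T)"
  using hm_add[OF hm_ext(1)[OF 1(1)] hm_comp[OF shd_in 2(1)]]
  hm_add[OF hm_ext(1)[OF 1(2)] hm_comp[OF shd_in 2(2)]] by (simp_all add: dsc_def)
 moreover have "f = cD T * (a1 + a2 * ?d) + (b1 + b2 * ?d') * cD (dsc A B)"
 proof -
  have z: "b1 * (?u' * X) = 0" "?d' * cD A = 0" "?d' * (?u' * X) = ob (cT B) * X"
  "b2 * (ob (cT B) * X) = b2 * X" for X
  using cross_zero(1)[OF 1(2), of "cT B"] cross_zero(2)[OF ObjD[OF assms(1)], of "cT B"] hm_r[OF 2(2)]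
  by (simp_all add: shd_shu flip: mult.assoc)
  have "f = f * (ob (cS A) + ?u * ?d)" using hm_r[OF f] ob_append by simp
  also have "... = f * ob (cS A) + f * ?u * ?d" by (simp add: distrib_left mult.assoc)
  also have "... = cD T * a1 + b1 * cD A + cD T * a2 * ?d + b2 * cD B * ?d"
  unfolding 1(3) 2(3) by (simp add: algebra_simps)
  also have "... = cD T * (a1 + a2 * ?d) + (b1 + b2 * ?d') * cD (dsc A B)"
  unfolding dsc_def by (simp add: algebra_simps z)
  finally show ?thesis .
 qed
 ultimately show "EX a:hm (cS (dsc A B)) (cS T). EX b:hm (cT (dsc A B)) (cT T).
  f = cD T * a + b * cD (dsc A B)" by blast
qed

lemma hz_dsc_r:
 assumes "A : Obj" "B : Obj" "hz T A" "hz T B"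
 shows "hz T (dsc A B)" unfolding hz_def
proof
 fix f assume "f : hm (cS T) (cT (dsc A B))"
 hence f: "f : hm (cS T) (cT A @ cT B)" by (simp add: dsc_def)
 let ?u = "shu (length (cS A)) (cS B)" and ?d = "shd (length (cS A)) (cS B)"
 let ?u' = "shu (length (cT A)) (cT B)" and ?d' = "shd (length (cT A)) (cT B)"
 obtain a1 b1 where 1: "a1 : hm (cS T) (cS A)" "b1 : hm (cT T) (cT A)" "ob (cT A) * f = cD A * a1 + b1 * cD T"
  using assms(3) hm_comp[OF f ob_inr] unfolding hz_def by blast
 obtain a2 b2 where 2: "a2 : hm (cS T) (cS B)" "b2 : hm (cT T) (cT B)" "?d' * f = cD B * a2 + b2 * cD T"
  using assms(4) hm_comp[OF f shd_in] unfolding hz_def by blast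
 have "a1 + ?u * a2 : hm (cS T) (cS (dsc A B))" "b1 + ?u' * b2 : hm (cT T) (cT (dsc A B))"
  using hm_add[OF hm_ext(2)[OF 1(1)] hm_comp[OF 2(1) shu_in]]
  hm_add[OF hm_ext(2)[OF 1(2)] hm_comp[OF 2(2) shu_in]] by (simp_all add: dsc_def)
 moreover have "f = cD (dsc A B) * (a1 + ?u * a2) + (b1 + ?u' * b2) * cD T"
 proof -
  have z: "cD A * (?u * X) = 0" "?d * a1 = 0" "?d * (?u * a2) = a2" for X
  using cross_zero(1)[OF ObjD[OF assms(1)], of "cS B"] cross_zero(2)[OF 1(1), of "cS B"] shd_shu[of "length (cS A)" "cS B"] hm_l[OF 2(1)]
  by (simp_all flip: mult.assoc)
  have "f = (ob (cT A) + ?u' * ?d') * f" using hm_l[OF f] ob_append by simp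
  also have "... = ob (cT A) * f + ?u' * (?d' * f)" by (simp add: distrib_right mult.assoc)
  also have "... = cD (dsc A B) * (a1 + ?u * a2) + (b1 + ?u' * b2) * cD T"
  unfolding dsc_def 1(3) 2(3) by (simp add: algebra_simps z)
  finally show ?thesis .
 qed
 ultimately show "EX a:hm (cS T) (cS (dsc A B)). EX b:hm (cT T) (cT (dsc A B)).
  f = cD (dsc A B) * a + b * cD T" by blast
qed

lemma psl_dsc:
 assumes "psl A" "psl B" "hz A B" "hz B A"
 shows "psl (dsc A B)" using assms unfolding psl_def by (auto intro!: K.ds_Ob hz_dsc_l hz_dsc_r)

section \<open>Projectives in degree 0, and consequences of Hom(P_1, P_2) = 0\<close>

definition PP :: "nat => 'r fmat tcx" where
 "PP i = ([], [i], 0)"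

lemma PP_in: "i : {1, 2} ==> PP i : Obj" by (auto simp: PP_def Obj_def is_proj_def hm_zero)

lemma psl_PP: "i : {1, 2} ==> psl (PP i)" using PP_in hz_Nil by (simp add: psl_def PP_def)

lemma ob1_nz: "i : {1, 2} ==> ob [i] ~= 0" using cx_ob[of i "[i]" 0 0] ch_zero[of i] by (auto simp: cx_def)

lemma Nul_PP: "Nul T (PP i) \<subseteq> {0}" unfolding Nul_def PP_def by (auto simp: hm_Nil2 zero_prod_def)

lemma indec_PP: assumes i: "i : {1, 2}" shows "indec (PP i)"
proof (rule indecI[OF PP_in[OF i] Nul_PP])
 show "idc (PP i) ~= 0" using ob1_nz[OF i] by (simp add: idc_def PP_def zero_prod_def)
 fix e assume e: "e : Chm (PP i) (PP i)" "e * e = e"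
 obtain e1 e2 where c: "e = (e1, e2)" by fastforce
 have "e1 = 0" "e2 : hm [i] [i]" "e2 * e2 = e2" using e by (auto simp: c Chm_def PP_def hm_Nil1)
 thus "e = 0 | e = idc (PP i)" using hm1_idem[OF i] by (auto simp: c idc_def PP_def zero_prod_def)
qed

lemma gvc_PP: "gvc (PP 1) = (1, 0)" "gvc (PP 2) = (0, 1)" by (simp_all add: gvc_def PP_def)

lemma not_ic_PP: "~ K.ic (PP 1) (PP 2)" using gvc_ic[OF PP_in PP_in, of 1 2] gvc_PP by auto

lemma ent_tri: assumes "M : hm P Q" "c < length P" "P ! c = 1" "r < length Q" "Q ! r = 2" shows "ent M r c = 0"
proof -
 have "ep 2 * ent M r c * ep 1 = ent M r c" using hm_el[OF assms(1,4)] hm_er[OF assms(1,2)] assms(3,5) by simp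
 thus ?thesis using tri[OF hm_S[OF assms(1)]] by simp
qed

lemma hm_1_2: assumes "M : hm P Q" "set P \<subseteq> {1}" "set Q \<subseteq> {2}" shows "M = 0"
proof (rule fmat_eqI)
 fix r c
 show "ent M r c = ent 0 r c"
 proof (cases "r < length Q & c < length P")
  case True
  hence "P ! c = 1" "Q ! r = 2" using assms nth_mem by blast+
  thus ?thesis using ent_tri[OF assms(1)] True by simp
 qed (use hm_out[OF assms(1)] in \<open>auto simp: not_less\<close>)
qed

text \<open>As \<open>PP 1\<close> is zero in degree -1, the hypothesis says that every map from
  T^-1 to P_1 factors through the differential. Maps to a power of P_1 are treated row by
  row.\<close>

lemma hz_PP1_rows:
 assumes "hz T (PP 1)" and "set R \<subseteq> {1}" and M: "M : hm (cS T) R"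
 shows "EX b:hm (cT T) R. M = b * cD T"
proof -
 have R: "R ! r = 1" if "r < length R" for r using assms(2) that nth_mem by blast
 have "EX b:hm (cT T) [1]. shd r [1] * M = b * cD T" if r: "r < length R" for r
 proof -
  have "shd r [1] * M : hm (cS T) [1]" using hm_comp[OF M prj_in[OF r]] R[OF r] by simp
  thus ?thesis using assms(1) unfolding hz_def PP_def by fastforce
 qed
 then obtain b where b: "!!r. r < length R ==> b r : hm (cT T) [1] & shd r [1] * M = b r * cD T" by metis
 have "(\<Sum>r<length R. shu r [1] * b r) : hm (cT T) R"
 proof (rule hm_sum)
  fix r assume "r : {..<length R}"
  hence r: "r < length R" by simp
  show "shu r [1] * b r : hm (cT T) R" using hm_comp[OF _ inc_in[OF r]] b[OF r] R[OF r] by simp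
 qed
 moreover have "M = (\<Sum>r<length R. shu r [1] * b r) * cD T"
 proof -
  have "M = (\<Sum>r<length R. shu r [R ! r] * shd r [R ! r]) * M" using hm_l[OF M] sum_inc_prj by simp
  also have "... = (\<Sum>r<length R. shu r [1] * b r) * cD T"
  unfolding sum_distrib_right using b R by (intro sum.cong) (auto simp: mult.assoc)
  finally show ?thesis .
 qed
 ultimately show ?thesis by blast
qed

text \<open>The projection onto a summand P_1 of T^-1 would factor through a radical differential,
  yet its residue is 1.\<close>

lemma hz_PP1_rad:
 assumes "T : Obj" and "hz T (PP 1)" and "rad T"
 shows "set (cS T) \<subseteq> {2}"
proof -
 have "1 ~: set (cS T)"
 proof
  assume "1 : set (cS T)"
  then obtain c where c: "c < length (cS T)" "cS T ! c = 1" by (auto simp: in_set_conv_nth)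
  have p: "shd c [1] : hm (cS T) [1]" using prj_in[OF c(1)] c(2) by simp
  then obtain b where b: "b : hm (cT T) [1]" "shd c [1] = b * cD T"
  using hz_PP1_rows[OF assms(2), of "[1]"] by auto
  have "cx 1 (b * cD T) 0 c = 0" using cx_comp[OF _ ObjD[OF assms(1)] b(1)] assms(3) unfolding rad_def by simp
  moreover have "cx 1 (shd c [1]) 0 c = 1" by (simp add: cx_def ent_shd dia_def ch_ep)
  ultimately show False using b(2) by simp
 qed
 thus ?thesis using assms(1) by (auto simp: Obj_def is_proj_def)
qed

end

declare One_nat_def [simp del]

text \<open>The elements \<open>x\<^sub>0, ...\<close> are minimal generators of the left module \<open>e\<^sub>1\<Lambda>e\<^sub>2\<close> over
 \<open>A = e\<^sub>1\<Lambda>e\<^sub>1\<close>, and \<open>ka\<close> are the coordinates modulo \<open>J\<^sub>A e\<^sub>1\<Lambda>e\<^sub>2\<close>.\<close>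

locale trix = ealg S ep ch sc for S :: "'r::ring set" and ep and ch :: "nat => 'r => 'k::field" and sc +
 fixes l :: nat and x :: "nat => 'r" and ka :: "nat => 'r => 'k"
 assumes x_in: "i < l ==> x i : S & ep 1 * x i = x i & x i * ep 2 = x i"
  and gen: "s : S ==> ep 1 * s = s ==> s * ep 2 = s ==>
  EX a. (ALL i<l. a i : S & ep 1 * a i = a i & a i * ep 1 = a i) & s = (\<Sum>i<l. a i * x i)"
  and ka_add: "s : S ==> ep 1 * s = s ==> s * ep 2 = s ==>
  t : S ==> ep 1 * t = t ==> t * ep 2 = t ==> ka i (s + t) = ka i s + ka i t"
  and ka_mult: "a : S ==> ep 1 * a = a ==> a * ep 1 = a ==>
  s : S ==> ep 1 * s = s ==> s * ep 2 = s ==> ka i (a * s) = ch 1 a * ka i s"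
  and ka_x: "i < l ==> j < l ==> ka j (x i) = (if i = j then 1 else 0)"
begin

abbreviation "R1 \<equiv> replicate l (1::nat)"

definition xc :: "'r fmat" where
 "xc = Fmat (%r c. if r < l & c = 0 then x r else 0)"

text \<open>The minimal left approximation of P_2 by powers of P_1, viewed as a complex: the summand
  that replaces P_2 in the left mutation.\<close>

definition LL :: "'r fmat tcx" where
 "LL = ([2], R1, xc)"

lemma ent_xc: "ent xc r c = (if r < l & c = 0 then x r else 0)"
 unfolding xc_def by (rule ent_Fmat[of _ "Suc l", THEN fun_cong, THEN fun_cong]) (auto split: if_splits)

lemma xc_in: "xc : hm [2] R1" unfolding hm_iff using x_in by (auto simp: ent_xc dia_def S_zero)

lemma LL_Obj: "LL : Obj" using xc_in by (simp add: LL_def Obj_def is_proj_def set_replicate_conv_if)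

lemma gvc_LL: "gvc LL = (real l, -1)"
proof -
 have "count_list (replicate n y) z = (if y = z then n else 0)" for n and y z :: nat by (induction n) auto
 thus ?thesis by (simp add: LL_def gvc_def)
qed

lemma gen_mat:
 assumes "set Q \<subseteq> {1}" and M: "M : hm [2] Q"
 shows "EX alp:hm R1 Q. M = alp * xc"
proof -
 have Q: "Q ! r = 1" if "r < length Q" for r using assms(1) that nth_mem by blast
 have "EX a. (ALL i<l. a i : S & ep 1 * a i = a i & a i * ep 1 = a i) & ent M r 0 = (\<Sum>i<l. a i * x i)"
  if r: "r < length Q" for r
  using gen[of "ent M r 0"] hm_S[OF M] hm_el[OF M r, of 0] hm_er[OF M, of 0 r] Q[OF r] by simp
 then obtain a where a: "!!r i. r < length Q ==> i < l ==> a r i : S & ep 1 * a r i = a r i & a r i * ep 1 = a r i"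
  "!!r. r < length Q ==> ent M r 0 = (\<Sum>i<l. a r i * x i)" by metis
 define alp where "alp = Fmat (%r c. if r < length Q & c < l then a r c else 0)"
 have ea: "ent alp r c = (if r < length Q & c < l then a r c else 0)" for r c
  unfolding alp_def by (rule ent_Fmat[of _ "length Q + l", THEN fun_cong, THEN fun_cong]) (auto split: if_splits)
 have alp: "alp : hm R1 Q" unfolding hm_iff using a(1) Q by (auto simp: ea dia_def S_zero)
 have "M = alp * xc"
 proof (rule fmat_eqI)
  fix r c
  show "ent M r c = ent (alp * xc) r c"
  proof (cases "r < length Q & c = 0")
  case True
  thus ?thesis using a(2) by (simp add: ent_comp[OF xc_in] ea ent_xc)
  next
  case False
  hence "ent M r c = 0" "ent (alp * xc) r c = 0"
  using hm_out[OF M, of r c] hm_out[OF hm_comp[OF xc_in alp], of r c] by auto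
  thus ?thesis by simp
  qed
 qed
 with alp show ?thesis by blast
qed

lemma ka_zero: "ka i 0 = 0"
 using ka_add[of 0 0 i] S_zero by (metis add.right_neutral add_left_imp_eq mult_zero_left mult_zero_right)

lemma ka_sum:
 "(!!j. j : I ==> f j : S & ep 1 * f j = f j & f j * ep 2 = f j) ==> ka i (sum f I) = (\<Sum>j\<in>I. ka i (f j))"
proof (induction I rule: infinite_finite_induct)
 case (insert k I)
 have "sum f I : S" using insert.prems by (intro S_sum) auto
 moreover have "ep 1 * sum f I = sum f I" "sum f I * ep 2 = sum f I"
  unfolding sum_distrib_left sum_distrib_right using insert.prems by (auto intro: sum.cong)
 ultimately have "ka i (f k + sum f I) = ka i (f k) + ka i (sum f I)" using ka_add insert.prems by simp
 thus ?case using insert by simp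
qed (auto simp: ka_zero)

text \<open>Compare the coordinates of \<open>x r\<close> in \<open>u * xc = xc\<close>: since the
  generators form a basis modulo the radical, the residue matrix of \<open>u\<close> is the
  identity.\<close>

lemma stabiliser_reduction:
 assumes u: "u : hm R1 R1" and ux: "u * xc = xc" and rt: "r < l" "t < l"
 shows "cx 1 u r t = (if r = t then 1 else 0)"
proof -
 have e: "ent u r s : S" "ep 1 * ent u r s = ent u r s" "ent u r s * ep 1 = ent u r s" if "s < l" for s
  using hm_S[OF u] hm_el[OF u, of r s] hm_er[OF u, of s r] rt that by auto
 have "x r = ent (u * xc) r 0" using rt(1) by (simp add: ux ent_xc)
 also have "... = (\<Sum>s<l. ent u r s * x s)" by (simp add: ent_comp[OF xc_in] ent_xc)
 finally have "ka t (x r) = ka t (\<Sum>s<l. ent u r s * x s)" by simp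
 also have "... = (\<Sum>s<l. ka t (ent u r s * x s))"
 proof (rule ka_sum)
  fix s assume "s : {..<l}"
  hence s: "s < l" by simp
  show "ent u r s * x s : S & ep 1 * (ent u r s * x s) = ent u r s * x s & ent u r s * x s * ep 2 = ent u r s * x s"
  using e[OF s] x_in[OF s] by (simp add: S_mult mult.assoc) (simp flip: mult.assoc)
 qed
 also have "... = (\<Sum>s<l. ch 1 (ent u r s) * (if s = t then 1 else 0))"
  using e x_in ka_mult ka_x rt(2) by (intro sum.cong) auto
 also have "... = (\<Sum>s<l. if s = t then ch 1 (ent u r s) else 0)" by (rule sum.cong) auto
 also have "... = cx 1 u r t" using rt(2) by (simp add: cx_def)
 finally show ?thesis using ka_x[OF rt] by simp
qed

text \<open>Left minimality of the approximation. As \<open>ob R1 - u\<close> is radical, the rows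
  of the identity are radical combinations of themselves modulo left multiples of \<open>u\<close>,
  so by Nakayama they are left multiples of \<open>u\<close>.\<close>

lemma stabiliser_left_inverse:
 assumes u: "u : hm R1 R1" and ux: "u * xc = xc"
 shows "EX w:hm R1 R1. w * u = ob R1"
proof -
 have R: "R1 ! r = 1" if "r < l" for r using that by simp
 have pr: "shd r [1] : hm R1 [1]" "shu r [1] : hm [1] R1" if "r < l" for r
  using prj_in[of r R1] inc_in[of r R1] that by auto
 have s1: "(\<Sum>j<l. shu j [1] * shd j [1]) = ob R1" using sum_inc_prj[of R1] by simp
 let ?N = "{v * u | v. v : hm R1 [1]}" and ?J = "{a \<in> hm [1] [1]. cx 1 a 0 0 = 0}"
 have "ALL r:{..<l}. shd r [1] : ?N"
 proof (rule nakayama[where A = "hm [1] [1]" and J = ?J and \<epsilon> = "ob [1]"])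
  show "a * b : ?J" if "a : hm [1] [1]" "b : ?J" for a b using that by (auto intro: hm_comp simp: cx1_mult)
  show "a + b : ?J" if "a : ?J" "b : ?J" for a b
  using that cx_add[of 1 a "[1]" "[1]" b 0 0] by (auto intro: hm_add)
  show "EX b:hm [1] [1]. b * (ob [1] - a) = ob [1]" if "a : ?J" for a
  proof -
  have "cx 1 (ob [1] - a) 0 0 ~= 0" using that cx_minus[of 1 "ob [1]" "[1]" "[1]" a 0 0] ob_in by (simp add: cx_ob)
  thus ?thesis using hm1_inverse[of 1 "ob [1] - a"] that by (auto intro: hm_minus ob_in)
  qed
  show "m + n : ?N" if "m : ?N" "n : ?N" for m n
  proof -
  obtain v v' where "v : hm R1 [1]" "v' : hm R1 [1]" "m = v * u" "n = v' * u"
  using \<open>m : ?N\<close> \<open>n : ?N\<close> by blast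
  thus ?thesis using hm_add[of v R1 "[1]" v'] by (auto simp: distrib_right[symmetric])
  qed
  show "a * n : ?N" if "a : hm [1] [1]" "n : ?N" for a n
  proof -
  obtain v where v: "v : hm R1 [1]" "n = v * u" using \<open>n : ?N\<close> by blast
  have "a * n = (a * v) * u" by (simp add: v(2) mult.assoc)
  thus ?thesis using hm_comp[OF v(1) that(1)] by blast
  qed
  show "0 : ?N" using hm_zero by force
  show "ob [1] * shd r [1] = shd r [1]" if "r : {..<l}" for r using that hm_l[OF pr(1)] by simp
  show "EX a. (ALL j:{..<l}. a j : ?J) & shd r [1] - (\<Sum>j<l. a j * shd j [1]) : ?N" if r': "r : {..<l}" for r
  proof -
  have r: "r < l" using r' by simp
  let ?a = "%j. shd r [1] * (ob R1 - u) * shu j [1]"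
  have "?a j : ?J" if j: "j < l" for j
  proof -
  have "?a j : hm [1] [1]" using hm_comp[OF pr(2)[OF j] hm_comp[OF hm_minus[OF ob_in u] pr(1)[OF r]]] .
  moreover have "ent (?a j) 0 0 = ep 1 * ent (ob R1 - u) r j * ep 1"
  by (simp add: mult.assoc ent_shd_l ent_shu_r dia_def)
  moreover have "ep 1 * ent (ob R1 - u) r j * ep 1 = ent (ob R1 - u) r j"
  using hm_el[OF hm_minus[OF ob_in u], of r j] hm_er[OF hm_minus[OF ob_in u], of j r] r j by (simp del: ent_simps)
  moreover have "cx 1 (ob R1 - u) r j = 0"
  using cx_minus[OF _ ob_in u] cx_ob[of 1 R1 r j] stabiliser_reduction[OF u ux r j] r by simp
  ultimately show ?thesis by (simp add: cx_def)
  qed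
  moreover have "shd r [1] - (\<Sum>j<l. ?a j * shd j [1]) = shd r [1] * u"
  proof -
  have "(\<Sum>j<l. ?a j * shd j [1]) = shd r [1] * (ob R1 - u) * (\<Sum>j<l. shu j [1] * shd j [1])"
  by (simp add: sum_distrib_left mult.assoc)
  also have "... = shd r [1] - shd r [1] * u"
  unfolding s1 using hm_r[OF u] hm_r[OF pr(1)[OF r]] hm_l[OF ob_in[of R1]]
  by (simp add: right_diff_distrib left_diff_distrib mult.assoc)
  finally show ?thesis by simp
  qed
  ultimately show ?thesis using pr(1)[OF r] by (intro exI[of _ ?a]) auto
  qed
 qed (auto intro: hm_comp)
 hence "ALL r<l. EX v. v : hm R1 [1] & shd r [1] = v * u" by auto
 then obtain v where v: "!!r. r < l ==> v r : hm R1 [1] & shd r [1] = v r * u" by metis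
 have "(\<Sum>r<l. shu r [1] * v r) : hm R1 R1" using v pr by (intro hm_sum hm_comp[of _ _ "[1]"]) auto
 moreover have "(\<Sum>r<l. shu r [1] * v r) * u = (\<Sum>r<l. shu r [1] * shd r [1])"
  unfolding sum_distrib_right using v by (intro sum.cong) (auto simp: mult.assoc)
 ultimately show ?thesis using s1 by auto
qed

lemma set_R1: "set R1 \<subseteq> {1}" by (simp add: set_replicate_conv_if)

section \<open>The approximation is indecomposable and presilting\<close>

lemma LL_nz: "~ K.ic LL zrc"
proof
 assume "K.ic LL zrc"
 hence "idc LL : Nul LL LL" using K.ic_zr[OF LL_Obj] by blast
 then obtain h where h: "h : hm R1 [2]" "ob [2] = h * xc" unfolding Nul_def idc_def LL_def by auto
 have "h = 0" using hm_1_2[OF h(1) set_R1] by simp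
 thus False using h(2) ob1_nz[of 2] by simp
qed

lemma hz_LL_PP1: "hz LL (PP 1)" unfolding hz_def
proof
 fix f assume "f : hm (cS LL) (cT (PP 1))"
 then obtain alp where "alp : hm R1 [1]" "f = alp * xc" using gen_mat[of "[1]" f] by (auto simp: LL_def PP_def)
 thus "EX a:hm (cS LL) (cS (PP 1)). EX b:hm (cT LL) (cT (PP 1)). f = cD (PP 1) * a + b * cD LL"
  using hm_zero by (intro bexI[of _ 0] bexI[of _ alp]) (auto simp: LL_def PP_def)
qed

lemma psl_LL: "psl LL" unfolding psl_def hz_def
proof (intro conjI LL_Obj ballI)
 fix f assume "f : hm (cS LL) (cT LL)"
 then obtain alp where "alp : hm R1 R1" "f = alp * xc" using gen_mat[OF set_R1, of f] by (auto simp: LL_def)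
 thus "EX a:hm (cS LL) (cS LL). EX b:hm (cT LL) (cT LL). f = cD LL * a + b * cD LL"
  using hm_zero[of "[2]" "[2]"] by (intro bexI[of _ 0] bexI[of _ alp]) (auto simp: LL_def)
qed

text \<open>The identity of P_2 would factor through P_1^l, from which only the zero map goes to
  P_2.\<close>

lemma not_hz_LL_PP2: "~ hz LL (PP 2)"
proof
 assume "hz LL (PP 2)"
 then obtain a b where b: "b : hm R1 [2]" "ob [2] = 0 * a + b * xc"
  using ob_in[of "[2]"] unfolding hz_def LL_def PP_def by auto
 have "b = 0" using hm_1_2[OF b(1) set_R1] by simp
 thus False using b(2) ob1_nz[of 2] by simp
qed

lemma Nul_LL: "Nul LL LL \<subseteq> {0}"
proof
 fix n assume "n : Nul LL LL"
 then obtain h where h: "h : hm R1 [2]" "n = (h * xc, xc * h)" unfolding Nul_def LL_def by auto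
 have "h = 0" using hm_1_2[OF h(1) set_R1] by simp
 thus "n : {0}" using h by (simp add: zero_prod_def)
qed

lemma idem_fix_xc:
 assumes e: "e : hm R1 R1" "e * e = e" "e * xc = xc"
 shows "e = ob R1"
proof -
 obtain w where w: "w : hm R1 R1" "w * e = ob R1" using stabiliser_left_inverse[OF e(1,3)] by blast
 have "e = ob R1 * e" using hm_l[OF e(1)] by simp
 also have "... = w * (e * e)" using w(2) by (simp flip: mult.assoc)
 also have "... = ob R1" using w(2) e(2) by simp
 finally show ?thesis .
qed

text \<open>An idempotent acts as 0 or 1 on P_2. Accordingly \<open>ob R1 - e2\<close> or
  \<open>e2\<close> is an idempotent that fixes \<open>xc\<close>, hence the identity by left
  minimality.\<close>

lemma indec_LL: "indec LL"
proof (rule indecI[OF LL_Obj Nul_LL])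
 show "idc LL ~= 0" using ob1_nz[of 2] by (simp add: idc_def LL_def zero_prod_def)
 fix e assume e: "e : Chm LL LL" "e * e = e"
 obtain e1 e2 where c: "e = (e1, e2)" by fastforce
 have h: "e1 : hm [2] [2]" "e2 : hm R1 R1" "xc * e1 = e2 * xc" "e1 * e1 = e1" "e2 * e2 = e2"
  using e by (auto simp: c Chm_def LL_def)
 have o: "ob R1 * ob R1 = ob R1" "ob R1 * e2 = e2" "e2 * ob R1 = e2" "ob R1 * xc = xc"
  using hm_l[OF ob_in[of R1]] hm_l[OF h(2)] hm_r[OF h(2)] hm_l[OF xc_in] by auto
 consider "e1 = 0" | "e1 = ob [2]" using hm1_idem[OF _ h(1,4)] by auto
 thus "e = 0 | e = idc LL"
 proof cases
  case 1
  have "ob R1 - e2 = ob R1"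
  proof (rule idem_fix_xc)
  show "(ob R1 - e2) * (ob R1 - e2) = ob R1 - e2" by (simp add: algebra_simps o h(5))
  show "(ob R1 - e2) * xc = xc" using 1 h(3) by (simp add: left_diff_distrib o)
  qed (intro hm_minus ob_in h(2))
  thus ?thesis using 1 by (simp add: c zero_prod_def)
 next
  case 2
  have "e2 * xc = xc" using 2 h(3) hm_r[OF xc_in] by simp
  thus ?thesis using 2 idem_fix_xc[OF h(2,5)] by (simp add: c idc_def LL_def)
 qed
qed

text \<open>The complement of the retract \<open>LL\<close> is the cone of \<open>LL \<rightarrow> T\<close>, from which the
 summand \<open>P\<^sub>2\<close> in degree \<open>-1\<close> has been cancelled.\<close>

lemma retract_LL:
 assumes T: "indec (P, Q, d)" and Q: "set Q \<subseteq> {1}" and P': "is_proj P'"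
  and m: "i : hm [2] P" "q : hm P [2]" "i' : hm P' P" "q' : hm P P'"
  and b: "q * i = ob [2]" "q' * i' = ob P'" "q * i' = 0" "q' * i = 0" "i * q + i' * q' = ob P"
  and bet: "bet : hm Q R1" "xc * q = bet * d"
 shows "K.ic (P, Q, d) LL"
proof -
 have TO: "(P, Q, d) : Obj" using indec_Obj[OF T] .
 hence d: "d : hm P Q" and pr: "is_proj P" "is_proj Q" by (auto simp: Obj_def)
 \<comment> \<open>\<open>(i, a)\<close> is a chain map from \<open>LL\<close> and
   \<open>(q, bet)\<close> one to \<open>LL\<close>. Their composite in degree 0 fixes
   \<open>xc\<close>, so it has a left inverse \<open>w\<close>, which turns \<open>bet\<close> into
   a retraction \<open>g\<close> of \<open>a\<close>.\<close>
 obtain a where a: "a : hm R1 Q" "d * i = a * xc" using gen_mat[OF Q hm_comp[OF m(1) d]] by blast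
 have u: "bet * a : hm R1 R1" using hm_comp[OF a(1) bet(1)] .
 have ux: "bet * a * xc = xc"
 proof -
  have "bet * a * xc = (bet * d) * i" by (simp only: mult.assoc a(2)[symmetric])
  also have "... = xc * (q * i)" by (simp only: bet(2)[symmetric] mult.assoc)
  finally show ?thesis using b(1) hm_r[OF xc_in] by simp
 qed
 obtain w where w: "w : hm R1 R1" "w * (bet * a) = ob R1" using stabiliser_left_inverse[OF u ux] by blast
 have wx: "w * xc = xc"
 proof -
  have "w * xc = w * (bet * a * xc)" by (simp only: ux)
  also have "... = ob R1 * xc" using w(2) by (simp flip: mult.assoc)
  finally show ?thesis using hm_l[OF xc_in] by simp
 qed
 define g where "g = w * bet"
 have g: "g : hm Q R1" "g * a = ob R1" "g * d = xc * q"
 proof -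
  show "g : hm Q R1" unfolding g_def using hm_comp[OF bet(1) w(1)] .
  show "g * a = ob R1" using w(2) by (simp add: g_def mult.assoc)
  have "g * d = w * xc * q" by (simp only: g_def mult.assoc bet(2))
  thus "g * d = xc * q" using wx by simp
 qed
 let ?n = "length P'"
 define V where "V = (P' @ R1, Q, d * i' + a * shd ?n R1)"
 have dV: "d * i' + a * shd ?n R1 : hm (P' @ R1) Q"
  using hm_add[OF hm_ext(1)[OF hm_comp[OF m(3) d]] hm_comp[OF shd_in a(1)]] .
 have VO: "V : Obj" using dV P' pr by (auto simp: V_def Obj_def is_proj_def set_replicate_conv_if)
 have iq: "i * q = ob P - i' * q'" using b(5) by (simp add: algebra_simps)
 have r: "d * (i * X) = a * (xc * X)" "g * (a * X) = ob R1 * X" "g * (d * X) = xc * (q * X)"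
  "q * (i' * X) = 0" "ob R1 * (xc * X) = xc * X" "ob R1 * (g * X) = g * X" "a * (ob R1 * X) = a * X"
  "ob Q * (a * X) = a * X" "ob Q * (d * X) = d * X" for X
  using a(2) g(2,3) b(3) hm_l[OF xc_in] hm_l[OF g(1)] hm_r[OF a(1)] hm_l[OF a(1)] hm_l[OF d] by (simp_all flip: mult.assoc)
 have o: "d * ob P = d" "ob Q * d = d" "ob R1 * g = g" "a * ob R1 = a" "ob Q * a = a" "g * ob Q = g"
  "i' * ob P' = i'" "ob P' * q' = q'" "ob R1 * shd ?n R1 = shd ?n R1" "shd ?n R1 * shu ?n R1 = ob R1"
  "shd ?n R1 * ob P' = 0" "ob Q * ob Q = ob Q"
  using hm_r[OF d] hm_l[OF d] hm_l[OF g(1)] hm_r[OF a(1)] hm_l[OF a(1)] hm_r[OF g(1)]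
  hm_r[OF m(3)] hm_l[OF m(4)] hm_l[OF shd_in[of P' R1]] shd_shu shd_ob hm_l[OF ob_in] by auto
 have aX: "shd ?n R1 * q' = 0" using cross_zero(2)[OF m(4)] .
 have p1: "(i, a) : Chm LL (P, Q, d)" "(q, g) : Chm (P, Q, d) LL" using m a g by (auto simp: Chm_def LL_def)
 have mq: "ob Q - a * g : hm Q Q" using hm_minus[OF ob_in hm_comp[OF g(1) a(1)]] .
 have p2: "(i', ob Q - a * g) : Chm V (P, Q, d)"
 proof -
  have "(ob Q - a * g) * (d * i' + a * shd ?n R1) = d * i'" using g(2,3) by (simp add: algebra_simps r o b(3))
  thus ?thesis using hm_ext(1)[OF m(3)] mq by (simp add: Chm_def V_def)
 qed
 have p3: "(q', ob Q - a * g) : Chm (P, Q, d) V"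
 proof -
  have "d * (i' * q') = d - a * g * d"
  proof -
  have "d * (i' * q') = d * ob P - d * i * q" using b(5) by (simp add: algebra_simps flip: b(5))
  thus ?thesis using a(2) g(3) o by (simp add: mult.assoc)
  qed
  thus ?thesis using hm_ext(2)[OF m(4)] mq by (simp add: Chm_def V_def algebra_simps aX o)
 qed
 have "K.bip (P, Q, d) LL V" unfolding K.bip_def
 proof (intro bexI[OF _ p1(1)] bexI[OF _ p1(2)] bexI[OF _ p2] bexI[OF _ p3] conjI)
  show "(q, g) * (i, a) - idc LL : Nul LL LL"
  using b(1) g(2) K.Nl_zero by (simp add: idc_def LL_def zero_prod_def[symmetric])
  have sq: "(ob Q - a * g) * (ob Q - a * g) = ob Q - a * g" using g(2) o by (simp add: algebra_simps r)
  thus "(i, a) * (q, g) + (i', ob Q - a * g) * (q', ob Q - a * g) - idc (P, Q, d) : Nul (P, Q, d) (P, Q, d)"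
  using b(5) K.Nl_zero by (simp add: idc_def zero_prod_def[symmetric])
  \<comment> \<open>The composite differs from the identity of \<open>V\<close> by the block
    \<open>R1\<close> in degree -1 and by \<open>a * g\<close> in degree 0; this homotopy accounts
    for both.\<close>
  let ?h = "- (shu ?n R1 * g)"
  have h: "?h : hm (cT V) (cS V)" using hm_uminus[OF hm_comp[OF g(1) shu_in]] by (simp add: V_def)
  have "g * (d * i' + a * shd ?n R1) = shd ?n R1" using g(2,3) by (simp add: algebra_simps r o b(3))
  hence h1: "?h * cD V = - (shu ?n R1 * shd ?n R1)" by (simp add: V_def mult.assoc)
  have "(d * i' + a * shd ?n R1) * shu ?n R1 = a"
  using cross_zero(1)[OF m(3), of R1] o by (simp add: distrib_right mult.assoc)
  hence h2: "cD V * ?h = - (a * g)" by (simp add: V_def flip: mult.assoc)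
  have "(q', ob Q - a * g) * (i', ob Q - a * g) - idc V = (?h * cD V, cD V * ?h)"
  unfolding h1 h2 using b(2) sq ob_append[of P' R1] by (simp add: idc_def V_def algebra_simps)
  thus "(q', ob Q - a * g) * (i', ob Q - a * g) - idc V : Nul V V" unfolding Nul_def using h by blast
 qed
 hence bp: "K.bip (P, Q, d) LL V" .
 hence "K.ic V zrc" using indec_bip[OF T LL_Obj VO] LL_nz by blast
 thus ?thesis using K.bip_zr[OF VO _ bp] by blast
qed

lemma nil_source_cases:
 assumes T: "indec T" and "cS T = []"
 shows "K.ic T (PP 1) | K.ic T (PP 2)"
proof -
 obtain Q d where c: "T = ([], Q, d)" using assms(2) by (cases T) auto
 have TO: "T : Obj" using indec_Obj[OF T] .
 hence d0: "d = 0" and prQ: "is_proj Q" by (auto simp: Obj_def c hm_Nil1)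
 have "Q ~= []"
 proof
  assume "Q = []"
  hence "T = zrc" using d0 by (simp add: c zrc_def)
  thus False using T K.ic_refl[OF K.zr_Ob] by (simp add: indecP_def)
 qed
 then obtain j Q' where Q: "Q = j # Q'" by (cases Q) auto
 have j: "j : {1, 2}" using prQ by (auto simp: Q is_proj_def)
 have O: "([], Q', 0) : Obj" using prQ by (auto simp: Q Obj_def is_proj_def hm_zero)
 have "T = dsc (PP j) ([], Q', 0)" by (simp add: c d0 dsc_def PP_def Q)
 hence bp: "K.bip T (PP j) ([], Q', 0)" using K.bip_ds[OF PP_in[OF j] O] by simp
 hence "K.ic ([], Q', 0) zrc" using indec_bip[OF T PP_in[OF j] O] indec_PP[OF j] by (auto simp: indecP_def)
 hence "K.ic T (PP j)" using K.bip_zr[OF O _ bp] by blast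
 thus ?thesis using j by auto
qed

text \<open>In minimal form T^-1 is a power of P_2, and if it is not zero, disjointness makes T^0 a
  power of P_1. Then the projection onto the first P_2 followed by \<open>xc\<close> factors through
  the differential, which is the chain map to \<open>LL\<close> required by
  \<open>retract_LL\<close>.\<close>

lemma hz_PP1_cases:
 assumes T: "indec T" "psl T" "hz T (PP 1)"
 shows "K.ic T (PP 1) | K.ic T (PP 2) | K.ic T LL"
proof -
 have TO: "T : Obj" using indec_Obj[OF T(1)] .
 obtain U where U: "U : Obj" "K.ic T U" "rad U" using minimal_form[OF TO] by blast
 have iU: "indec U" using indec_ic[OF T(1) U(1,2)] .
 have pU: "psl U" using psl_ret[OF T(2) K.ic_ret[OF U(2)] U(1)] .
 have hU: "hz U (PP 1)" using hz_ic[OF TO PP_in U(1) PP_in U(2) K.ic_refl[OF PP_in] T(3)] by auto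
 obtain P Q d where c: "U = (P, Q, d)" by (cases U) auto
 have "K.ic U (PP 1) | K.ic U (PP 2) | K.ic U LL"
 proof (cases P)
  case Nil
  thus ?thesis using nil_source_cases[OF iU] by (auto simp: c)
 next
  case (Cons j P')
  have "set P \<subseteq> {2}" using hz_PP1_rad[OF U(1) hU U(3)] by (simp add: c)
  hence P: "P = [2] @ P'" using Cons by simp
  have "2 ~: set Q" using psl_rad_disjoint[OF pU U(3), of 2] P by (simp add: c)
  hence Q: "set Q \<subseteq> {1}" using U(1) by (auto simp: c Obj_def is_proj_def)
  have P': "is_proj P'" using U(1) P by (auto simp: c Obj_def is_proj_def)
  have l1: "length [2::nat] = 1" by simp
  have q: "ob [2] : hm P [2]" unfolding P by (rule ob_inr)
  have "xc * ob [2] : hm P R1" using hm_comp[OF q xc_in] .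
  then obtain bet where bet: "bet : hm Q R1" "xc * ob [2] = bet * d"
  using hz_PP1_rows[OF hU set_R1, of "xc * ob [2]"] by (auto simp: c)
  have "K.ic (P, Q, d) LL"
  proof (rule retract_LL[OF _ Q P' _ q _ _ _ _ _ _ _ bet])
  show "ob [2] : hm [2] P" unfolding P by (rule ob_inl)
  show "shu 1 P' : hm P' P" "shd 1 P' : hm P P'" "ob [2] * shu 1 P' = 0" "shd 1 P' * ob [2] = 0"
  "ob [2] * ob [2] + shu 1 P' * shd 1 P' = ob P"
  using shu_in[of "[2]" P'] shd_in[of "[2]" P'] ob_shu[of "[2]" P'] shd_ob[of "[2]" P'] ob_append[of "[2]" P']
  hm_l[OF ob_in[of "[2]"]] unfolding l1 P by simp_all
  show "ob [2] * ob [2] = ob [2]" using hm_l[OF ob_in] .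
  show "shd 1 P' * shu 1 P' = ob P'" by (rule shd_shu)
  qed (use iU c in simp)
  thus ?thesis by (simp add: c)
 qed
 thus ?thesis using K.ic_trans[OF U(2)] by blast
qed

section \<open>Compatibility of P_1, P_2 and the approximation, and the cones they span\<close>

lemma isum_not_PP2_LL:
 assumes T: "psl T" and U: "isum T U" "K.ic U (PP 2)" and V: "isum T V" "K.ic V LL"
 shows False
proof -
 have "hz V U" using hz_isum[OF T V(1) U(1)] .
 hence "hz LL (PP 2)" using hz_ic[OF isum_Obj[OF V(1)] isum_Obj[OF U(1)] LL_Obj PP_in V(2) U(2)] by auto
 thus False using not_hz_LL_PP2 by blast
qed

lemma CC_hz_PP1:
 assumes T: "psl T" "hz T (PP 1)"
 shows "EX X. CC T = convex_cone hull X & (X \<subseteq> {(1, 0), (0, 1)} \<or> X \<subseteq> {(1, 0), (real l, -1)})"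
proof (intro exI conjI)
 let ?X = "{gvc U | U. isum T U}"
 show "CC T = convex_cone hull ?X" by (simp add: coneP_def)
 have TO: "T : Obj" using T(1) by (simp add: psl_def)
 have cases: "K.ic U (PP 1) | K.ic U (PP 2) | K.ic U LL" if "isum T U" for U
 proof (rule hz_PP1_cases[OF isum_is_indec[OF that] psl_isum[OF T(1) that]])
  show "hz U (PP 1)"
  using hz_ret[OF isum_ret[OF TO that] K.ic_ret[OF K.ic_refl] T(2) TO PP_in isum_Obj[OF that] PP_in]
  PP_in[of 1] by auto
 qed
 have g: "K.ic U (PP 1) ==> gvc U = (1, 0)" "K.ic U (PP 2) ==> gvc U = (0, 1)"
  "K.ic U LL ==> gvc U = (real l, -1)" if "isum T U" for U
  using gvc_ic[OF isum_Obj[OF that] PP_in[of 1]] gvc_ic[OF isum_Obj[OF that] PP_in[of 2]]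
  gvc_ic[OF isum_Obj[OF that] LL_Obj] gvc_PP gvc_LL by auto
 show "?X \<subseteq> {(1, 0), (0, 1)} \<or> ?X \<subseteq> {(1, 0), (real l, -1)}"
 proof (cases "EX U. isum T U & K.ic U LL")
  case True
  then obtain V where V: "isum T V" "K.ic V LL" by blast
  have "gvc U : {(1, 0), (real l, -1)}" if "isum T U" for U
  using cases[OF that] g[OF that] isum_not_PP2_LL[OF T(1) that _ V] by auto
  thus ?thesis by blast
 next
  case False
  have "gvc U : {(1, 0), (0, 1)}" if "isum T U" for U using cases[OF that] g(1,2)[OF that] False that by blast
  thus ?thesis by blast
 qed
qed

lemma not_ic_PP_LL: "~ K.ic (PP 1) LL" "~ K.ic (PP 2) LL"
 using gvc_ic[OF PP_in LL_Obj, of 1] gvc_ic[OF PP_in LL_Obj, of 2] gvc_PP gvc_LL by auto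

lemma SF_PP: "convex_cone hull {(1, 0)} : SF" "convex_cone hull {(0, 1)} : SF"
 "convex_cone hull {(1, 0), (0, 1)} : SF"
proof -
 show "convex_cone hull {(1, 0)} : SF" "convex_cone hull {(0, 1)} : SF"
  using SF_single[OF indec_PP psl_PP, of 1] SF_single[OF indec_PP psl_PP, of 2] gvc_PP by auto
 let ?D = "dsc (PP 1) (PP 2)"
 have nil: "cS ?D = []" by (simp add: dsc_def PP_def)
 have D: "psl ?D" using psl_dsc[OF psl_PP psl_PP] hz_Nil by (simp add: PP_def)
 have "gvc U : {gvc (PP 1), gvc (PP 2)}" if U: "isum ?D U" for U
 proof -
  have "K.ic U (PP 1) | K.ic U (PP 2) | K.ic U LL"
  using hz_PP1_cases[OF isum_is_indec[OF U] psl_isum[OF D U]] hz_isum[OF D U isum_dsc(1)[OF indec_PP PP_in]]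
  by auto
  moreover have "~ K.ic U LL"
  using isum_not_PP2_LL[OF D isum_dsc(2)[OF indec_PP PP_in] K.ic_refl[OF PP_in] U] by auto
  ultimately show ?thesis using gvc_ic[OF isum_Obj[OF U] PP_in[of 1]] gvc_ic[OF isum_Obj[OF U] PP_in[of 2]] by auto
 qed
 from SF_pair[OF indec_PP indec_PP not_ic_PP D this]
 show "convex_cone hull {(1, 0), (0, 1)} : SF" using gvc_PP by auto
qed

lemma SF_LL: "convex_cone hull {(real l, -1)} : SF" using SF_single[OF indec_LL psl_LL] gvc_LL by simp

lemma psl_PP1_LL: "psl (dsc (PP 1) LL)" using psl_dsc[OF psl_PP psl_LL] hz_LL_PP1 hz_Nil by (simp add: PP_def)

lemma isum_PP1_LL:
 assumes "isum (dsc (PP 1) LL) U"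
 shows "K.ic U (PP 1) | K.ic U LL"
proof -
 note D = psl_PP1_LL
 have "K.ic U (PP 1) | K.ic U (PP 2) | K.ic U LL"
  using hz_PP1_cases[OF isum_is_indec[OF assms] psl_isum[OF D assms]]
  hz_isum[OF D assms isum_dsc(1)[OF indec_PP LL_Obj]] by auto
 moreover have "~ K.ic U (PP 2)"
  using isum_not_PP2_LL[OF D assms _ isum_dsc(2)[OF indec_LL PP_in] K.ic_refl[OF LL_Obj]] by auto
 ultimately show ?thesis by blast
qed

lemma SF_PP1_LL: "convex_cone hull {(1, 0), (real l, -1)} : SF"
proof -
 have "gvc U : {gvc (PP 1), gvc LL}" if U: "isum (dsc (PP 1) LL) U" for U
  using isum_PP1_LL[OF U] gvc_ic[OF isum_Obj[OF U] PP_in[of 1]] gvc_ic[OF isum_Obj[OF U] LL_Obj] by auto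
 from SF_pair[OF indec_PP indec_LL not_ic_PP_LL(1) psl_PP1_LL this]
 show ?thesis using gvc_PP gvc_LL by auto
qed

text \<open>The identity of P_2, in degree 0 or in degree -1, would have to pass through P_1 + P_1
  in degree 0 or through the zero term in degree -1.\<close>

lemma ret_PP1_PP1:
 assumes "K.ret (dsc (PP 1) (PP 1)) U" and "K.ic U (PP 2) | K.ic U LL"
 shows False
proof -
 let ?D = "dsc (PP 1) (PP 1)"
 have D: "cS ?D = []" "cT ?D = [1, 1]" by (simp_all add: dsc_def PP_def)
 have "K.ret ?D (PP 2) | K.ret ?D LL" using assms K.ret_trans K.ic_ret by blast
 thus False
 proof
  assume "K.ret ?D (PP 2)"
  then obtain i p where ip: "i : Chm (PP 2) ?D" "p : Chm ?D (PP 2)" "p * i - idc (PP 2) = 0"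
  using Nul_PP unfolding K.ret_def by blast
  have "snd p = 0" using hm_1_2[of "snd p" "[1, 1]" "[2]"] ip(2) D by (simp add: Chm_def PP_def)
  hence "ob [2] = 0" using ip(3) by (simp add: idc_def PP_def times_prod_def zero_prod_def)
  thus False using ob1_nz[of 2] by simp
 next
  assume "K.ret ?D LL"
  then obtain i p where ip: "i : Chm LL ?D" "p : Chm ?D LL" "p * i - idc LL = 0"
  using Nul_LL unfolding K.ret_def by blast
  have "fst p = 0" using ip(2) D by (simp add: Chm_def hm_Nil1)
  hence "ob [2] = 0" using ip(3) by (simp add: idc_def LL_def times_prod_def zero_prod_def)
  thus False using ob1_nz[of 2] by simp
 qed
qed

text \<open>As a summand next to P_1, \<open>T'\<close> is P_1, P_2 or the approximation. P_2 is
  excluded by hypothesis, and P_1 because all indecomposable summands of \<open>T\<close> would then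
  be isomorphic, against the choice of \<open>U\<close> and \<open>V\<close>.\<close>

lemma mutation_cone:
 assumes T: "psl T" and T': "indec T'" "~ K.ic T' (PP 2)" "K.ic T (dsc T' (PP 1))"
  and UV: "isum T U" "isum T V" "~ K.ic U V"
 shows "CC T = convex_cone hull {(1, 0), (real l, -1)}"
proof -
 have TO: "T : Obj" using T by (simp add: psl_def)
 have T'O: "T' : Obj" using indec_Obj[OF T'(1)] .
 have DO: "dsc T' (PP 1) : Obj" using K.ds_Ob[OF T'O PP_in] by simp
 have pD: "psl (dsc T' (PP 1))" using psl_ret[OF T K.ic_ret[OF T'(3)] DO] .
 have s1: "isum (dsc T' (PP 1)) (PP 1)" "isum (dsc T' (PP 1)) T'"
  using isum_dsc(2)[OF indec_PP T'O] isum_dsc(1)[OF T'(1) PP_in] by auto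
 have hT': "hz T' (PP 1)" using hz_isum[OF pD s1(2,1)] .
 have sT: "isum T W \<longleftrightarrow> isum (dsc T' (PP 1)) W" for W using isum_iff_ic[OF TO DO T'(3)] .
 have cases: "K.ic W (PP 1) | K.ic W (PP 2) | K.ic W LL" if "isum T W" for W
  using hz_PP1_cases[OF isum_is_indec[OF that] psl_isum[OF T that]] hz_isum[OF T that] s1 sT by blast
 have "~ K.ic T' (PP 1)"
 proof
  assume a: "K.ic T' (PP 1)"
  have "K.bip T (PP 1) (PP 1)"
  using K.bip_ic[OF K.ic_sym[OF T'(3)] a K.ic_refl[OF PP_in] K.bip_ds[OF T'O PP_in]] by auto
  hence "K.ic T (dsc (PP 1) (PP 1))" using K.bip_Ob[OF TO PP_in PP_in] by auto
  hence r: "K.ret (dsc (PP 1) (PP 1)) W" if "isum T W" for W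
  using K.ret_trans[OF K.ic_ret[OF K.ic_sym] isum_ret[OF TO that]] by blast
  have "K.ic W (PP 1)" if "isum T W" for W using cases[OF that] ret_PP1_PP1[OF r[OF that]] by blast
  hence "K.ic U V" using UV(1,2) K.ic_trans K.ic_sym by blast
  thus False using UV(3) by blast
 qed
 hence L: "K.ic T' LL" using hz_PP1_cases[OF T'(1) psl_isum[OF pD s1(2)] hT'] T'(2) by blast
 have g: "gvc W : {(1, 0), (real l, -1)}" if W: "isum T W" for W
 proof -
  have "~ K.ic W (PP 2)" using isum_not_PP2_LL[OF T W _ _ L] s1(2) sT by blast
  thus ?thesis
  using cases[OF W] gvc_ic[OF isum_Obj[OF W] PP_in[of 1]] gvc_ic[OF isum_Obj[OF W] LL_Obj] gvc_PP gvc_LL by auto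
 qed
 have "isum T (PP 1)" "isum T T'" using s1 sT by blast+
 moreover have "gvc (PP 1) = (1, 0)" "gvc T' = (real l, -1)" using gvc_PP gvc_ic[OF T'O LL_Obj L] gvc_LL by auto
 ultimately have "{(1, 0), (real l, -1)} \<subseteq> {gvc W | W. isum T W}"
  by (smt (verit) empty_subsetI insert_subset mem_Collect_eq)
 hence "{gvc W | W. isum T W} = {(1, 0), (real l, -1)}" using g by blast
 thus ?thesis by (simp add: coneP_def)
qed

end

section \<open>Functors induced by ring homomorphisms\<close>

locale pfun = A: peirce S ep + B: peirce S' ep' for S :: "'r::ring set" and ep and S' :: "'q::ring set" and ep' +
 fixes f :: "'r => 'q"
 assumes f_in: "s : S ==> f s : S'" and f_add: "s : S ==> t : S ==> f (s + t) = f s + f t"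
  and f_mult: "s : S ==> t : S ==> f (s * t) = f s * f t" and f_ep: "f (ep i) = ep' i"
begin

lemma f_zero: "f 0 = 0" using f_add[OF A.S_zero A.S_zero] by simp

lemma f_uminus: "s : S ==> f (- s) = - f s"
 using f_add[of s "- s"] A.S_uminus[of s] f_zero by (simp add: eq_neg_iff_add_eq_0 add.commute)

lemma f_sum: "(!!i. i : I ==> g i : S) ==> f (sum g I) = (\<Sum>i\<in>I. f (g i))"
 by (induction I rule: infinite_finite_induct) (auto simp: f_zero f_add A.S_sum)

definition fm :: "'r fmat => 'q fmat" where
 "fm M = Fmat (%r c. f (ent M r c))"

lemma ent_fm [simp]: "ent (fm M) r c = f (ent M r c)"
proof -
 obtain n where "ALL r c. r >= n | c >= n \<longrightarrow> ent M r c = 0" using ent_bound by blast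
 hence "r < n & c < n" if "f (ent M r c) ~= 0" for r c using that f_zero by (metis not_less)
 thus ?thesis unfolding fm_def by (rule ent_Fmat[THEN fun_cong, THEN fun_cong])
qed

lemma fm_add: "M : A.hm P Q ==> N : A.hm P Q ==> fm (M + N) = fm M + fm N"
 by (rule fmat_eqI) (simp add: f_add A.hm_S)

lemma fm_uminus: "M : A.hm P Q ==> fm (- M) = - fm M" by (rule fmat_eqI) (simp add: f_uminus A.hm_S)

lemma fm_minus: "M : A.hm P Q ==> N : A.hm P Q ==> fm (M - N) = fm M - fm N"
 using fm_add[of M P Q "- N"] fm_uminus[of N P Q] A.hm_uminus[of N P Q] by simp

lemma fm_zero [simp]: "fm 0 = 0" by (rule fmat_eqI) (simp add: f_zero)

lemma dia_f: "f (A.dia P r) = B.dia P r" by (simp add: A.dia_def B.dia_def f_ep f_zero)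

lemma fm_shu: "fm (A.shu n Q) = B.shu n Q" and fm_shd: "fm (A.shd n Q) = B.shd n Q"
 by (rule fmat_eqI; simp add: A.ent_shu B.ent_shu A.ent_shd B.ent_shd dia_f f_zero)+

lemma fm_ob: "fm (A.ob P) = B.ob P" by (simp add: A.ob_def B.ob_def fm_shu)

lemma fm_in: assumes "M : A.hm P Q" shows "fm M : B.hm P Q"
proof -
 have "f (A.dia Q r * ent M r c) = f (A.dia Q r) * f (ent M r c)"
  "f (ent M r c * A.dia P c) = f (ent M r c) * f (A.dia P c)" for r c
  using f_mult A.dia_in A.hm_S[OF assms] by auto
 thus ?thesis using assms f_in unfolding A.hm_iff B.hm_iff by (simp add: dia_f)
qed

lemma fm_mult:
 assumes "M : A.hm P Q" and "N : A.hm Q R"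
 shows "fm (N * M) = fm N * fm M" by (rule fmat_eqI)
  (simp add: A.ent_comp[OF assms(1)] B.ent_comp[OF fm_in[OF assms(1)]] f_sum f_mult A.S_mult
  A.hm_S[OF assms(1)] A.hm_S[OF assms(2)])

definition FT :: "'r fmat tcx => 'q fmat tcx" where
 "FT T = (cS T, cT T, fm (cD T))"

lemma FT_sel [simp]: "cS (FT T) = cS T" "cT (FT T) = cT T" "cD (FT T) = fm (cD T)" by (simp_all add: FT_def)

lemma gvc_FT [simp]: "gvc (FT T) = gvc T" by (simp add: gvc_def)

lemma FT_Obj: "T : A.Obj ==> FT T : B.Obj" by (simp add: A.Obj_def B.Obj_def fm_in)

lemma FT_zrc: "FT A.zrc = B.zrc" by (simp add: FT_def A.zrc_def B.zrc_def)

lemma FT_dsc: assumes "T : A.Obj" "U : A.Obj" shows "FT (A.dsc T U) = B.dsc (FT T) (FT U)"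
proof -
 have 1: "A.shu (length (cT T)) (cT U) * cD U : A.hm (cS U) (cT T @ cT U)"
  using A.hm_comp[OF A.ObjD[OF assms(2)] A.shu_in] .
 have 2: "A.shu (length (cT T)) (cT U) * cD U * A.shd (length (cS T)) (cS U) : A.hm (cS T @ cS U) (cT T @ cT U)"
  using A.hm_comp[OF A.shd_in 1] .
 have 3: "cD T : A.hm (cS T @ cS U) (cT T @ cT U)"
  using A.hm_minus[OF A.dsc_hm[OF assms] 2] by (simp add: A.dsc_def)
 show ?thesis by (simp add: FT_def A.dsc_def B.dsc_def fm_add[OF 3 2] fm_mult[OF A.shd_in 1]
  fm_mult[OF A.ObjD[OF assms(2)] A.shu_in] fm_shu fm_shd)
qed

lemma FT_foldr:
 "set Ts \<subseteq> A.Obj ==> foldr A.dsc Ts A.zrc : A.Obj & FT (foldr A.dsc Ts A.zrc) = foldr B.dsc (map FT Ts) B.zrc"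
 by (induction Ts) (auto simp: FT_zrc A.K.zr_Ob A.K.ds_Ob FT_dsc)

definition FC :: "'r fmat \<times> 'r fmat => 'q fmat \<times> 'q fmat" where
 "FC g = (fm (fst g), fm (snd g))"

lemma FC_Chm:
 assumes "T : A.Obj" "U : A.Obj" "g : A.Chm T U"
 shows "FC g : B.Chm (FT T) (FT U)"
proof -
 have g: "fst g : A.hm (cS T) (cS U)" "snd g : A.hm (cT T) (cT U)" "cD U * fst g = snd g * cD T"
  using assms(3) by (auto simp: A.Chm_def)
 have "fm (cD U) * fm (fst g) = fm (snd g) * fm (cD T)"
  using fm_mult[OF g(1) A.ObjD[OF assms(2)]] fm_mult[OF A.ObjD[OF assms(1)] g(2)] g(3) by simp
 thus ?thesis using fm_in g by (simp add: B.Chm_def FC_def)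
qed

lemma FC_Nul:
 assumes "T : A.Obj" "g : A.Nul T T"
 shows "FC g : B.Nul (FT T) (FT T)"
proof -
 obtain h where h: "h : A.hm (cT T) (cS T)" "g = (h * cD T, cD T * h)" using assms(2) unfolding A.Nul_def by blast
 have "FC g = (fm h * cD (FT T), cD (FT T) * fm h)"
  using fm_mult[OF A.ObjD[OF assms(1)] h(1)] fm_mult[OF h(1) A.ObjD[OF assms(1)]] h(2) by (simp add: FC_def)
 thus ?thesis unfolding B.Nul_def using fm_in[OF h(1)] by auto
qed

lemma FC_mult:
 assumes "g : A.Chm T U" "k : A.Chm U V"
 shows "FC (k * g) = FC k * FC g"
 using assms fm_mult[of "fst g" "cS T" "cS U" "fst k" "cS V"] fm_mult[of "snd g" "cT T" "cT U" "snd k" "cT V"]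
 by (simp add: FC_def A.Chm_def times_prod_def)

lemma FC_id: "FC (A.idc T) = B.idc (FT T)" by (simp add: FC_def A.idc_def B.idc_def fm_ob)

lemma FC_minus:
 assumes "g : A.Chm T U" "k : A.Chm T U"
 shows "FC (g - k) = FC g - FC k" "FC (g + k) = FC g + FC k"
 using assms fm_minus[of "fst g" "cS T" "cS U" "fst k"] fm_minus[of "snd g" "cT T" "cT U" "snd k"]
  fm_add[of "fst g" "cS T" "cS U" "fst k"] fm_add[of "snd g" "cT T" "cT U" "snd k"]
 by (simp_all add: FC_def A.Chm_def)

lemma FC_retr:
 assumes "T : A.Obj" "U : A.Obj" "i : A.Chm U T" "p : A.Chm T U" "p * i - A.idc U : A.Nul U U"
 shows "FC p * FC i - B.idc (FT U) : B.Nul (FT U) (FT U)"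
proof -
 have "FC (p * i - A.idc U) = FC p * FC i - B.idc (FT U)"
  using FC_minus(1)[OF A.K.Hm_comp[OF assms(3,4)] A.K.un_in[OF assms(2)]] FC_mult[OF assms(3,4)] FC_id by simp
 thus ?thesis using FC_Nul[OF assms(2,5)] by simp
qed

lemma FT_ic:
 assumes "T : A.Obj" "U : A.Obj" "A.K.ic T U"
 shows "B.K.ic (FT T) (FT U)"
proof -
 obtain g k where g: "g : A.Chm T U" "k : A.Chm U T" "k * g - A.idc T : A.Nul T T" "g * k - A.idc U : A.Nul U U"
  using assms(3) unfolding A.K.ic_def by blast
 show ?thesis unfolding B.K.ic_def using FC_Chm[OF assms(1,2) g(1)] FC_Chm[OF assms(2,1) g(2)]
  FC_retr[OF assms(2,1) g(1,2,3)] FC_retr[OF assms(1,2) g(2,1,4)] by blast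
qed

lemma FT_bip:
 assumes "T : A.Obj" "U : A.Obj" "V : A.Obj" "A.K.bip T U V"
 shows "B.K.bip (FT T) (FT U) (FT V)"
proof -
 obtain i p j q where b: "i : A.Chm U T" "p : A.Chm T U" "j : A.Chm V T" "q : A.Chm T V"
  "p * i - A.idc U : A.Nul U U" "q * j - A.idc V : A.Nul V V" "i * p + j * q - A.idc T : A.Nul T T"
  using assms(4) unfolding A.K.bip_def by blast
 note c = A.K.Hm_comp[OF b(2,1)] A.K.Hm_comp[OF b(4,3)]
 have "FC (i * p + j * q - A.idc T) = FC i * FC p + FC j * FC q - B.idc (FT T)"
  using FC_minus(1)[OF A.K.Hm_add[OF c] A.K.un_in[OF assms(1)]] FC_minus(2)[OF c]
  FC_mult[OF b(2,1)] FC_mult[OF b(4,3)] FC_id by simp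
 hence "FC i * FC p + FC j * FC q - B.idc (FT T) : B.Nul (FT T) (FT T)" using FC_Nul[OF assms(1) b(7)] by simp
 thus ?thesis unfolding B.K.bip_def
  using FC_Chm[OF assms(2,1) b(1)] FC_Chm[OF assms(1,2) b(2)] FC_Chm[OF assms(3,1) b(3)]
  FC_Chm[OF assms(1,3) b(4)] FC_retr[OF assms(1,2) b(1,2,5)] FC_retr[OF assms(1,3) b(3,4,6)] by blast
qed

lemma FT_ret:
 assumes "T : A.Obj" "U : A.Obj" "A.K.ret T U"
 shows "B.K.ret (FT T) (FT U)"
proof -
 obtain i p where b: "i : A.Chm U T" "p : A.Chm T U" "p * i - A.idc U : A.Nul U U"
  using assms(3) unfolding A.K.ret_def by blast
 show ?thesis unfolding B.K.ret_def
  using FC_Chm[OF assms(2,1) b(1)] FC_Chm[OF assms(1,2) b(2)] FC_retr[OF assms(1,2) b] by blast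
qed

end

section \<open>One-point extension of the generators\<close>

text \<open>\<open>S'\<close> is the extension of \<open>S\<close> by the square-zero ideal \<open>ker pr\<close>, which is spanned by
 \<open>y \<in> e\<^sub>1S'e\<^sub>2\<close> and by elements \<open>v\<^sub>j \<in> e\<^sub>2S'e\<^sub>2\<close> with \<open>x\<^sub>i v\<^sub>j = \<delta>\<^sub>i\<^sub>j y\<close>.\<close>

locale ext = L: trix S ep ch sc l x ka + T: trix S' ep' ch' sc' "Suc l" x' ka'
 for S :: "'r::ring set" and ep and ch :: "nat => 'r => 'k::field" and sc l x ka
  and S' :: "'q::ring set" and ep' and ch' :: "nat => 'q => 'k" and sc' x' ka' +
 fixes pr :: "'q => 'r" and inc :: "'r => 'q" and y :: 'q and v :: "nat => 'q"
 assumes pr_in: "s' : S' ==> pr s' : S" and pr_add: "s' : S' ==> t' : S' ==> pr (s' + t') = pr s' + pr t'"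
  and pr_mult: "s' : S' ==> t' : S' ==> pr (s' * t') = pr s' * pr t'" and pr_ep: "pr (ep' i) = ep i"
  and inc_in: "s : S ==> inc s : S'" and inc_add: "s : S ==> t : S ==> inc (s + t) = inc s + inc t"
  and inc_mult: "s : S ==> t : S ==> inc (s * t) = inc s * inc t" and inc_ep: "inc (ep i) = ep' i"
  and pr_inc: "s : S ==> pr (inc s) = s" and ch_pr: "i : {1, 2} ==> s' : S' ==> ch' i s' = ch i (pr s')"
  and W_square: "s' : S' ==> t' : S' ==> pr s' = 0 ==> pr t' = 0 ==> s' * t' = 0"
  and W_right: "s' : S' ==> pr s' = 0 ==> s' * ep' 2 = s'" and y_in: "y : S'" "ep' 1 * y = y" "pr y = 0"
  and W_top: "s' : S' ==> pr s' = 0 ==> ep' 1 * s' = s' ==> EX c. s' = y * sc' c"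
  and y_left: "a' : S' ==> ep' 1 * a' = a' ==> a' * ep' 1 = a' ==> a' * y = y * sc' (ch' 1 a')"
  and y_right: "a' : S' ==> ep' 2 * a' = a' ==> a' * ep' 2 = a' ==> y * a' = y * sc' (ch' 2 a')"
  and v_in: "j < l ==> v j : S' & pr (v j) = 0 & ep' 2 * v j = v j"
  and x_v: "s' : S' ==> ep' 1 * s' = s' ==> s' * ep' 2 = s' ==> j < l ==> s' * v j = y * sc' (ka j (pr s'))"
  and x_inc: "j < l ==> x' j = inc (x j)" and x_y: "x' l = y"
  and sc'_add: "sc' (c + d) = sc' c + sc' d" and sc'_mult: "sc' (c * d) = sc' c * sc' d"
begin

sublocale p: pfun S' ep' S ep pr by unfold_locales (auto simp: pr_in pr_add pr_mult pr_ep)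

sublocale i: pfun S ep S' ep' inc by unfold_locales (auto simp: inc_in inc_add inc_mult inc_ep)

abbreviation "pm \<equiv> p.fm"
abbreviation "im \<equiv> i.fm"
abbreviation "pT \<equiv> p.FT"
abbreviation "iT \<equiv> i.FT"

lemma pm_im: "M : L.hm P Q ==> pm (im M) = M" by (rule fmat_eqI) (simp add: pr_inc L.hm_S)

lemma pT_iT: "T : L.Obj ==> pT (iT T) = T" using pm_im[OF L.ObjD, of T] by (cases T) (simp add: p.FT_def i.FT_def)

lemma pm_zero_ent: "pm M = 0 ==> pr (ent M r c) = 0" using p.ent_fm[of M r c] by simp

lemma W_mult: assumes "M : T.hm P Q" "N : T.hm Q R" "pm M = 0" "pm N = 0" shows "N * M = 0" by (rule fmat_eqI)
  (simp add: T.ent_comp[OF assms(1)] W_square T.hm_S[OF assms(1)] T.hm_S[OF assms(2)]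
  pm_zero_ent[OF assms(3)] pm_zero_ent[OF assms(4)])

lemma sc'_zero: "sc' 0 = 0" using sc'_add[of 0 0] by simp

lemma sc'_sum: "sc' (sum g I) = (\<Sum>i\<in>I. sc' (g i))"
 by (induction I rule: infinite_finite_induct) (auto simp: sc'_zero sc'_add)

definition Y :: "'q fmat" where
 "Y = Fmat (%r c. if r = 0 & c = 0 then y else 0)"

lemma ent_Y: "ent Y r c = (if r = 0 & c = 0 then y else 0)"
 unfolding Y_def by (rule ent_Fmat[of _ 1, THEN fun_cong, THEN fun_cong]) (auto split: if_splits)

lemma Y_in: "Y : T.hm [2] [1]"
 unfolding T.hm_iff using y_in W_right[OF y_in(1,3)] by (auto simp: ent_Y T.dia_def T.S_zero)

lemma pm_Y: "pm Y = 0" by (rule fmat_eqI) (simp add: ent_Y y_in p.f_zero)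

text \<open>Every map from P_1 to T^0 composed with \<open>Y\<close> lifts through the differential
  by a map with entries in the kernel of \<open>pr\<close>. In this form the property passes to
  retracts, and for minimal presilting complexes it already controls all maps with entries in that
  kernel (\<open>W_lift\<close>).\<close>

definition RI :: "'q fmat tcx => bool" where
 "RI T \<longleftrightarrow> (ALL u:T.hm [1] (cT T). EX g:T.hm [2] (cS T). pm g = 0 & u * Y = cD T * g)"

lemma RI_ret:
 assumes "T.K.ret A B" "A : T.Obj" "B : T.Obj" "RI A"
 shows "RI B" unfolding RI_def
proof
 fix u assume u: "u : T.hm [1] (cT B)"
 obtain i p where ip: "i : T.Chm B A" "p : T.Chm A B" "p * i - T.idc B : T.Nul B B"
  using assms(1) unfolding T.K.ret_def by blast
 obtain i1 i2 p1 p2 where c: "i = (i1, i2)" "p = (p1, p2)" by fastforce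
 obtain h where h: "h : T.hm (cT B) (cS B)" "p2 * i2 - T.ob (cT B) = cD B * h"
  using ip(3) unfolding T.Nul_def c T.idc_def by auto
 have m: "i2 : T.hm (cT B) (cT A)" "p1 : T.hm (cS A) (cS B)" "cD B * p1 = p2 * cD A"
  using ip unfolding T.Chm_def c by auto
 obtain g where g: "g : T.hm [2] (cS A)" "pm g = 0" "i2 * u * Y = cD A * g"
  using assms(4) T.hm_comp[OF u m(1)] unfolding RI_def by blast
 have huY: "h * u * Y : T.hm [2] (cS B)" using T.hm_comp[OF Y_in T.hm_comp[OF u h(1)]] .
 have p1g: "p1 * g : T.hm [2] (cS B)" using T.hm_comp[OF g(1) m(2)] .
 have "pm (p1 * g - h * u * Y) = 0"
  using p.fm_minus[OF p1g huY] p.fm_mult[OF g(1) m(2)] p.fm_mult[OF Y_in T.hm_comp[OF u h(1)]] g(2) pm_Y by simp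
 moreover have "u * Y = cD B * (p1 * g - h * u * Y)"
 proof -
  have "T.ob (cT B) = p2 * i2 - cD B * h" using h(2) by (simp add: algebra_simps)
  hence "u * Y = (p2 * i2 - cD B * h) * u * Y" using T.hm_l[OF u] by simp
  also have "... = p2 * (i2 * u * Y) - cD B * h * u * Y" by (simp add: algebra_simps)
  also have "p2 * (i2 * u * Y) = cD B * p1 * g" by (simp only: g(3) m(3) mult.assoc[symmetric])
  finally show ?thesis by (simp add: algebra_simps)
 qed
 ultimately show "EX g:T.hm [2] (cS B). pm g = 0 & u * Y = cD B * g" using T.hm_minus[OF p1g huY] by blast
qed

text \<open>By \<open>W_top\<close>, elements of the ideal fixed by \<open>ep' 1\<close> are scalar
  multiples of y, and scalars are central; so \<open>Y\<close> is a common right factor.\<close>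

lemma W_column:
 assumes "w : T.hm [2] Q" "set Q \<subseteq> {1}" "pm w = 0"
 shows "EX u:T.hm [1] Q. w = u * Y"
proof -
 have Q: "Q ! r = 1" if "r < length Q" for r using assms(2) that nth_mem by blast
 have "EX c. ent w r 0 = y * sc' c" if r: "r < length Q" for r
  using W_top[OF T.hm_S[OF assms(1)] pm_zero_ent[OF assms(3)]] T.hm_el[OF assms(1) r] Q[OF r] by simp
 then obtain c where c: "!!r. r < length Q ==> ent w r 0 = y * sc' (c r)" by metis
 define u where "u = Fmat (%r s. if r < length Q & s = 0 then sc' (c r) * ep' 1 else 0)"
 have eu: "ent u r s = (if r < length Q & s = 0 then sc' (c r) * ep' 1 else 0)" for r s
  unfolding u_def by (rule ent_Fmat[of _ "Suc (length Q)", THEN fun_cong, THEN fun_cong]) (auto split: if_splits)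
 have "ep' 1 * (sc' d * ep' 1) = sc' d * ep' 1" for d
  using T.sc_central[OF T.ep_in[of 1], of d] T.ep_idem[of 1] by (metis mult.assoc)
 hence u: "u : T.hm [1] Q"
  unfolding T.hm_iff using Q by (auto simp: eu T.dia_def T.S_zero T.S_mult T.sc_in T.ep_in T.ep_idem mult.assoc)
 have "w = u * Y"
 proof (rule fmat_eqI)
  fix r s
  show "ent w r s = ent (u * Y) r s"
  proof (cases "r < length Q & s = 0")
  case True
  hence "ent (u * Y) r s = sc' (c r) * y" using y_in(2) by (simp add: T.ent_comp[OF Y_in] eu ent_Y mult.assoc)
  thus ?thesis using True c T.sc_central[OF y_in(1)] by simp
  next
  case False
  thus ?thesis using T.hm_out[OF assms(1), of r s] T.hm_out[OF T.hm_comp[OF Y_in u], of r s] by auto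
  qed
 qed
 with u show ?thesis by blast
qed

text \<open>Here \<open>Y\<close> becomes a common left factor; the cofactor consists of scalars and
  can therefore be taken over \<open>S\<close>, which matters when it is multiplied by maps over
  \<open>S\<close>.\<close>

lemma W_row:
 assumes "w : T.hm P [1]" "set P \<subseteq> {2}" "pm w = 0"
 shows "EX q:L.hm P [2]. w = Y * im q"
proof -
 have P: "P ! r = 2" if "r < length P" for r using assms(2) that nth_mem by blast
 have "EX c. ent w 0 m = y * sc' c" for m
  using W_top[OF T.hm_S[OF assms(1)] pm_zero_ent[OF assms(3)]] T.hm_el[OF assms(1), of 0] by simp
 then obtain c where c: "!!m. ent w 0 m = y * sc' (c m)" by metis
 define q where "q = Fmat (%r m. if r = 0 & m < length P then sc (c m) * ep 2 else 0)"
 have eq: "ent q r m = (if r = 0 & m < length P then sc (c m) * ep 2 else 0)" for r m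
  unfolding q_def by (rule ent_Fmat[of _ "Suc (length P)", THEN fun_cong, THEN fun_cong]) (auto split: if_splits)
 have c2: "ep 2 * (sc d * ep 2) = sc d * ep 2" for d
  using L.sc_central[OF L.ep_in[of 2], of d] L.ep_idem[of 2] by (metis mult.assoc)
 have sS: "sc d * ep 2 : S" for d by (simp add: L.S_mult L.sc_in L.ep_in)
 have q: "q : L.hm P [2]"
  unfolding L.hm_iff using P c2 by (auto simp: eq L.dia_def L.S_zero sS L.ep_idem mult.assoc)
 have yq: "y * inc (sc d * ep 2) = y * sc' d" for d
 proof -
  have "y * inc (sc d * ep 2) = y * sc' (ch' 2 (inc (sc d * ep 2)))"
  using inc_mult[OF L.ep_in[of 2] sS[of d]] inc_mult[OF sS[of d] L.ep_in[of 2]] c2[of d] L.ep_idem[of 2]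
  by (intro y_right inc_in sS) (simp_all add: inc_ep mult.assoc)
  also have "ch' 2 (inc (sc d * ep 2)) = d"
  using ch_pr[OF _ inc_in[OF sS]] pr_inc[OF sS] L.ch_mult[OF _ L.sc_in L.ep_in] L.ch_sc L.ch_ep by simp
  finally show ?thesis .
 qed
 have "w = Y * im q"
 proof (rule fmat_eqI)
  fix r m
  show "ent w r m = ent (Y * im q) r m"
  proof (cases "r = 0 & m < length P")
  case True
  thus ?thesis using c yq by (simp add: T.ent_comp[OF i.fm_in[OF q]] ent_Y eq)
  next
  case False
  thus ?thesis using T.hm_out[OF assms(1), of r m] T.hm_out[OF T.hm_comp[OF i.fm_in[OF q] Y_in], of r m] by auto
  qed
 qed
 with q show ?thesis by blast
qed

text \<open>Column by column. A column at P_1 vanishes, because the ideal is fixed by right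
  multiplication with \<open>ep' 2\<close>. A column at P_2 meets only rows at P_1 by disjointness,
  so it has the form \<open>u * Y\<close> and \<open>RI\<close> lifts it.\<close>

lemma W_lift:
 assumes d: "d : T.hm P Q" and RI: "RI (P, Q, d)" and dis: "~ (2 : set P & 2 : set Q)"
  and pr: "is_proj P" "is_proj Q" and n: "n : T.hm P Q" "pm n = 0"
 shows "EX g:T.hm P P. pm g = 0 & n = d * g"
proof -
 have "EX g. g : T.hm [P ! c] P & pm g = 0 & n * T.shu c [P ! c] = d * g" if c: "c < length P" for c
 proof -
  have nc: "n * T.shu c [P ! c] : T.hm [P ! c] Q" using T.hm_comp[OF T.inc_in[OF c] n(1)] .
  have pn: "pm (n * T.shu c [P ! c]) = 0" using p.fm_mult[OF T.inc_in[OF c] n(1)] n(2) by simp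
  have "P ! c : {1, 2}" using pr(1) c nth_mem unfolding is_proj_def by blast
  then consider "P ! c = 1" | "P ! c = 2" by blast
  thus ?thesis
  proof cases
  case 1
  have "n * T.shu c [P ! c] = 0"
  proof (rule fmat_eqI)
  fix r s
  let ?e = "ent (n * T.shu c [P ! c]) r s"
  show "?e = ent 0 r s"
  proof (cases "s = 0")
  case True
  have "?e = ?e * ep' 2" using W_right[OF T.hm_S[OF nc] pm_zero_ent[OF pn]] by simp
  moreover have "?e = ?e * ep' 1" using T.hm_er[OF nc, of 0] 1 True by simp
  ultimately have "?e = ?e * (ep' 1 * ep' 2)" by (metis mult.assoc)
  thus ?thesis using T.ep_orth[of 1 2] by simp
  next
  case False
  thus ?thesis using T.hm_out[OF nc, of r s] by simp
  qed
  qed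
  thus ?thesis using T.hm_zero by (intro exI[of _ 0]) simp
  next
  case 2
  hence "2 : set P" using c nth_mem by metis
  hence "set Q \<subseteq> {1}" using dis pr(2) unfolding is_proj_def by blast
  then obtain u where "u : T.hm [1] Q" "n * T.shu c [P ! c] = u * Y"
  using W_column[OF nc[unfolded 2] _ pn[unfolded 2]] 2 by auto
  thus ?thesis using RI 2 unfolding RI_def by auto
  qed
 qed
 then obtain g where g: "!!c. c < length P ==> g c : T.hm [P ! c] P & pm (g c) = 0 & n * T.shu c [P ! c] = d * g c"
  by metis
 let ?g = "\<Sum>c<length P. g c * T.shd c [P ! c]"
 have gc: "g c * T.shd c [P ! c] : T.hm P P" if "c < length P" for c
  using T.hm_comp[OF T.prj_in[OF that]] g[OF that] by blast
 have "pm ?g = 0"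
 proof -
  have "ent (pm ?g) r s = 0" for r s
  proof -
  have "pr (ent (\<Sum>c\<in>I. g c * T.shd c [P ! c]) r s) = 0 & (\<Sum>c\<in>I. g c * T.shd c [P ! c]) : T.hm P P"
  if "I \<subseteq> {..<length P}" "finite I" for I using that(2,1)
  proof (induction I rule: finite_induct)
  case (insert c I)
  have c: "c < length P" using insert by auto
  have gp: "g c : T.hm [P ! c] P" "pm (g c) = 0" using g[OF c] by auto
  have "pm (g c * T.shd c [P ! c]) = 0" using p.fm_mult[OF T.prj_in[OF c] gp(1)] gp(2) by simp
  hence "pr (ent (g c * T.shd c [P ! c]) r s) = 0" by (rule pm_zero_ent)
  moreover have s: "pr (ent (\<Sum>c\<in>I. g c * T.shd c [P ! c]) r s) = 0"
  "(\<Sum>c\<in>I. g c * T.shd c [P ! c]) : T.hm P P" using insert by auto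
  ultimately show ?case using insert.hyps pr_add[OF T.hm_S[OF gc[OF c], of r s] T.hm_S[OF s(2), of r s]]
  T.hm_add[OF gc[OF c] s(2)] by simp
  qed (simp add: p.f_zero T.hm_zero)
  from this[of "{..<length P}"] show ?thesis by simp
  qed
  thus ?thesis by (intro fmat_eqI) simp
 qed
 moreover have "?g : T.hm P P" using gc by (intro T.hm_sum) auto
 moreover have "n = d * ?g"
 proof -
  have "n = n * (\<Sum>c<length P. T.shu c [P ! c] * T.shd c [P ! c])" using T.hm_r[OF n(1)] T.sum_inc_prj by simp
  also have "... = d * ?g" unfolding sum_distrib_left using g by (intro sum.cong) (auto simp flip: mult.assoc)
  finally show ?thesis .
 qed
 ultimately show ?thesis by blast
qed

text \<open>The entries of \<open>g\<close> lie in an ideal of square zero, so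
  \<open>T.ob P + g\<close> and \<open>T.ob P - g\<close> are inverse changes of basis in degree
  -1.\<close>

lemma unipotent_iso:
 assumes O: "(P, Q, d) : T.Obj" and g: "g : T.hm P P" "pm g = 0"
 shows "(P, Q, d * (T.ob P + g)) : T.Obj" "T.K.ic (P, Q, d * (T.ob P + g)) (P, Q, d)"
proof -
 have d: "d : T.hm P Q" using O by (simp add: T.Obj_def)
 have gg: "g * g = 0" using W_mult[OF g(1) g(1) g(2) g(2)] .
 have o: "T.ob P * g = g" "g * T.ob P = g" "T.ob P * T.ob P = T.ob P" "d * T.ob P = d" "T.ob Q * d = d"
  "T.ob Q * T.ob Q = T.ob Q"
  using T.hm_l[OF g(1)] T.hm_r[OF g(1)] T.hm_l[OF T.ob_in] T.hm_r[OF d] T.hm_l[OF d] by auto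
 have o2: "T.ob Q * (d * X) = d * X" "g * (g * X) = 0" for X using o gg by (simp_all flip: mult.assoc)
 have m: "T.ob P + g : T.hm P P" "T.ob P - g : T.hm P P"
  using T.hm_add[OF T.ob_in g(1)] T.hm_minus[OF T.ob_in g(1)] by auto
 show O': "(P, Q, d * (T.ob P + g)) : T.Obj" using O T.hm_comp[OF m(1) d] by (simp add: T.Obj_def)
 have inv: "(T.ob P + g) * (T.ob P - g) = T.ob P" "(T.ob P - g) * (T.ob P + g) = T.ob P"
  by (simp_all add: algebra_simps o gg)
 have 1: "(T.ob P + g, T.ob Q) : T.Chm (P, Q, d * (T.ob P + g)) (P, Q, d)"
  using m T.ob_in by (simp add: T.Chm_def o2)
 have 2: "(T.ob P - g, T.ob Q) : T.Chm (P, Q, d) (P, Q, d * (T.ob P + g))"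
  using m T.ob_in inv o by (simp add: T.Chm_def mult.assoc)
 show "T.K.ic (P, Q, d * (T.ob P + g)) (P, Q, d)" unfolding T.K.ic_def
  using 1 2 T.K.Nl_zero by (intro bexI[OF _ 1] bexI[OF _ 2]) (simp add: inv T.idc_def o zero_prod_def[symmetric])
qed

text \<open>Under \<open>RI\<close> a complex is recovered from its reduction: the discrepancy
  \<open>?n\<close> is \<open>d * g\<close> with \<open>g\<close> in the ideal, and the change of
  basis by the identity minus \<open>g\<close> removes it.\<close>

lemma RI_iso:
 assumes "T.psl B" "RI B"
 shows "T.K.ic B (iT (pT B))"
proof -
 have BO: "B : T.Obj" using assms(1) by (simp add: T.psl_def)
 obtain U where U: "U : T.Obj" "T.K.ic B U" "T.rad U" using T.minimal_form[OF BO] by blast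
 have pU: "T.psl U" using T.psl_ret[OF assms(1) T.K.ic_ret[OF U(2)] U(1)] .
 have RU: "RI U" using RI_ret[OF T.K.ic_ret[OF U(2)] BO U(1) assms(2)] .
 obtain P Q d where c: "U = (P, Q, d)" by (cases U) auto
 have d: "d : T.hm P Q" and pr: "is_proj P" "is_proj Q" using U(1) by (auto simp: c T.Obj_def)
 have dis: "~ (2 : set P & 2 : set Q)" using T.psl_rad_disjoint[OF pU U(3), of 2] by (simp add: c)
 let ?n = "d - im (pm d)"
 have ipd: "im (pm d) : T.hm P Q" using i.fm_in[OF p.fm_in[OF d]] .
 have n: "?n : T.hm P Q" using T.hm_minus[OF d ipd] .
 have "pm ?n = 0" using p.fm_minus[OF d ipd] pm_im[OF p.fm_in[OF d]] by simp
 from W_lift[OF d RU[unfolded c] dis pr n this] obtain g where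
  g: "g : T.hm P P" "pm g = 0" "?n = d * g" by blast
 have g': "- g : T.hm P P" "pm (- g) = 0" using T.hm_uminus[OF g(1)] p.fm_uminus[OF g(1)] g(2) by auto
 have "d * (T.ob P + - g) = im (pm d)" using g(3) T.hm_r[OF d] by (simp add: algebra_simps)
 hence "T.K.ic (iT (pT U)) U" using unipotent_iso(2)[OF U(1)[unfolded c] g'] by (simp add: c i.FT_def p.FT_def)
 moreover have "T.K.ic (iT (pT U)) (iT (pT B))"
  using i.FT_ic[OF p.FT_Obj[OF U(1)] p.FT_Obj[OF BO] p.FT_ic[OF U(1) BO T.K.ic_sym[OF U(2)]]] .
 ultimately show ?thesis using U(2) T.K.ic_trans T.K.ic_sym by blast
qed

text \<open>The differentials of \<open>B\<close> and \<open>iT (pT B)\<close> differ by entries of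
  the ideal, which annihilate the entries of \<open>g\<close>; hence \<open>RI\<close> can be tested
  on the reduction.\<close>

lemma RI_iT_pT:
 assumes "B : T.Obj" "RI (iT (pT B))"
 shows "RI B" unfolding RI_def
proof
 fix u assume "u : T.hm [1] (cT B)"
 then obtain g where g: "g : T.hm [2] (cS B)" "pm g = 0" "u * Y = im (pm (cD B)) * g"
  using assms(2) unfolding RI_def by auto
 have d: "cD B : T.hm (cS B) (cT B)" using T.ObjD[OF assms(1)] .
 have ipd: "im (pm (cD B)) : T.hm (cS B) (cT B)" using i.fm_in[OF p.fm_in[OF d]] .
 have "pm (cD B - im (pm (cD B))) = 0" using p.fm_minus[OF d ipd] pm_im[OF p.fm_in[OF d]] by simp
 from W_mult[OF g(1) T.hm_minus[OF d ipd] g(2) this]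
 have "im (pm (cD B)) * g = cD B * g" by (simp add: left_diff_distrib)
 thus "EX g:T.hm [2] (cS B). pm g = 0 & u * Y = cD B * g" using g by auto
qed

lemma psl_pT: assumes "T.psl B" shows "L.psl (pT B)"
proof -
 have BO: "B : T.Obj" and h: "T.hz B B" using assms by (auto simp: T.psl_def)
 have "L.hz (pT B) (pT B)" unfolding L.hz_def
 proof
  fix f assume f: "f : L.hm (cS (pT B)) (cT (pT B))"
  then obtain a b where ab: "a : T.hm (cS B) (cS B)" "b : T.hm (cT B) (cT B)" "im f = cD B * a + b * cD B"
  using h i.fm_in[OF f] unfolding T.hz_def by auto
  have "f = pm (cD B) * pm a + pm b * pm (cD B)"
  using pm_im[OF f] ab(3) p.fm_add[OF T.hm_comp[OF ab(1) T.ObjD[OF BO]] T.hm_comp[OF T.ObjD[OF BO] ab(2)]]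
  p.fm_mult[OF ab(1) T.ObjD[OF BO]] p.fm_mult[OF T.ObjD[OF BO] ab(2)] by simp
  thus "EX a:L.hm (cS (pT B)) (cS (pT B)). EX b:L.hm (cT (pT B)) (cT (pT B)). f = cD (pT B) * a + b * cD (pT B)"
  using p.fm_in[OF ab(1)] p.fm_in[OF ab(2)] by auto
 qed
 thus ?thesis using p.FT_Obj[OF BO] by (simp add: L.psl_def)
qed

text \<open>Solve the equation for \<open>pm f\<close> over \<open>S\<close> and extend the solution
  along \<open>inc\<close>. The remaining error has entries in the ideal and is absorbed by
  \<open>W_lift\<close>.\<close>

lemma psl_iT:
 assumes "L.psl A" "RI (iT A)"
 shows "T.psl (iT A)"
proof -
 have AO: "A : L.Obj" using assms(1) by (simp add: L.psl_def)
 obtain U where U: "U : L.Obj" "L.K.ic A U" "L.rad U" using L.minimal_form[OF AO] by blast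
 have pU: "L.psl U" using L.psl_ret[OF assms(1) L.K.ic_ret[OF U(2)] U(1)] .
 have iAU: "T.K.ic (iT A) (iT U)" using i.FT_ic[OF AO U(1,2)] .
 have RU: "RI (iT U)" using RI_ret[OF T.K.ic_ret[OF iAU] i.FT_Obj[OF AO] i.FT_Obj[OF U(1)] assms(2)] .
 obtain P Q d where c: "U = (P, Q, d)" by (cases U) auto
 have d: "d : L.hm P Q" and pr: "is_proj P" "is_proj Q" using U(1) by (auto simp: c L.Obj_def)
 have dis: "~ (2 : set P & 2 : set Q)" using L.psl_rad_disjoint[OF pU U(3), of 2] by (simp add: c)
 have id: "im d : T.hm P Q" using i.fm_in[OF d] .
 have "T.hz (iT U) (iT U)" unfolding T.hz_def
 proof
  fix f assume f': "f : T.hm (cS (iT U)) (cT (iT U))"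
  hence f: "f : T.hm P Q" by (simp add: c)
  obtain a b where ab: "a : L.hm P P" "b : L.hm Q Q" "pm f = d * a + b * d"
  using pU p.fm_in[OF f] unfolding L.psl_def L.hz_def by (auto simp: c)
  let ?n = "f - im (pm f)"
  have ipf: "im (pm f) : T.hm P Q" using i.fm_in[OF p.fm_in[OF f]] .
  have "pm ?n = 0" using p.fm_minus[OF f ipf] pm_im[OF p.fm_in[OF f]] by simp
  then obtain g where g: "g : T.hm P P" "?n = im d * g"
  using W_lift[OF id _ dis pr T.hm_minus[OF f ipf]] RU by (auto simp: c i.FT_def)
  have "im (pm f) = im d * im a + im b * im d"
  unfolding ab(3) using i.fm_add[OF L.hm_comp[OF ab(1) d] L.hm_comp[OF d ab(2)]]
  i.fm_mult[OF ab(1) d] i.fm_mult[OF d ab(2)] by simp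
  hence "f = im d * (im a + g) + im b * im d" using g(2) by (simp add: algebra_simps)
  thus "EX a:T.hm (cS (iT U)) (cS (iT U)). EX b:T.hm (cT (iT U)) (cT (iT U)). f = cD (iT U) * a + b * cD (iT U)"
  using T.hm_add[OF i.fm_in[OF ab(1)] g(1)] i.fm_in[OF ab(2)] by (auto simp: c)
 qed
 hence "T.psl (iT U)" using i.FT_Obj[OF U(1)] by (simp add: T.psl_def)
 thus ?thesis using T.psl_ret[OF _ T.K.ic_ret[OF T.K.ic_sym[OF iAU]] i.FT_Obj[OF AO]] by blast
qed

end

section \<open>The dichotomy for presilting complexes\<close>

text \<open>Row by row: given a right inverse \<open>G\<close> of the first rows, \<open>e\<close>
  is what remains of the next row after subtracting its components along them. If \<open>e\<close>
  vanishes the rows are dependent; otherwise a column dual to the new row exists and corrects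
  \<open>G\<close>.\<close>

lemma left_null_or_right_inverse:
 fixes D :: "nat => 'j => 'k::field"
 assumes J: "finite J"
 shows "(EX lam. (EX r<n. lam r ~= 0) & (ALL p:J. (\<Sum>r<n. lam r * D r p) = 0)) |
  (EX G. ALL r<n. ALL r'<n. (\<Sum>p\<in>J. D r p * G p r') = (if r = r' then 1 else 0))"
proof (induction n)
 case (Suc n)
 thus ?case
 proof (elim disjE exE conjE)
  fix lam r assume "r < n" "lam r ~= 0" "ALL p:J. (\<Sum>r<n. lam r * D r p) = 0"
  thus ?thesis by (intro disjI1 exI[of _ "%r. if r < n then lam r else 0"]) (auto intro!: exI[of _ r])
 next
  fix G assume G: "ALL r<n. ALL r'<n. (\<Sum>p\<in>J. D r p * G p r') = (if r = r' then 1 else 0)"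
  define a where "a r' = (\<Sum>p\<in>J. D n p * G p r')" for r'
  define e where "e p = D n p - (\<Sum>r<n. a r * D r p)" for p
  show ?thesis
  proof (cases "ALL p:J. e p = 0")
  case True
  have "(\<Sum>r<Suc n. (if r < n then - a r else 1) * D r p) = e p" for p by (simp add: e_def sum_negf)
  thus ?thesis using True by (intro disjI1 exI[of _ "%r. if r < n then - a r else 1"]) auto
  next
  case False
  then obtain q where q: "q : J" "e q ~= 0" by blast
  \<comment> \<open>The unit column at \<open>q\<close>, made orthogonal to the first rows by means
    of \<open>G\<close> and scaled so that the new row takes the value 1 on it.\<close>
  define s where "s p = ((if p = q then 1 else 0) - (\<Sum>r<n. G p r * D r q)) / e q" for p
  have sD: "(\<Sum>p\<in>J. h p * s p) = (h q - (\<Sum>r<n. (\<Sum>p\<in>J. h p * G p r) * D r q)) / e q" for h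
  proof -
  have "(\<Sum>p\<in>J. h p * s p) = (\<Sum>p\<in>J. (if p = q then h p else 0) - (\<Sum>r<n. h p * G p r * D r q)) / e q"
  unfolding s_def sum_divide_distrib
  by (intro sum.cong) (auto simp: right_diff_distrib diff_divide_distrib sum_distrib_left mult.assoc)
  also have "(\<Sum>p\<in>J. (if p = q then h p else 0) - (\<Sum>r<n. h p * G p r * D r q))
  = h q - (\<Sum>r<n. (\<Sum>p\<in>J. h p * G p r) * D r q)"
  using q(1) J by (simp add: sum_subtractf sum_distrib_right sum.swap[of _ J])
  finally show ?thesis .
  qed
  have s0: "(\<Sum>p\<in>J. D r p * s p) = 0" if "r < n" for r
  proof -
  have "(\<Sum>r'<n. (\<Sum>p\<in>J. D r p * G p r') * D r' q) = (\<Sum>r'<n. if r' = r then D r' q else 0)"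
  using G that by (intro sum.cong) auto
  also have "... = D r q" using that by simp
  finally show ?thesis using sD[of "D r"] by simp
  qed
  have s1: "(\<Sum>p\<in>J. D n p * s p) = 1"
  using sD[of "D n"] q(2) unfolding a_def[symmetric] e_def[symmetric] by simp
  let ?G = "%p r'. if r' < n then G p r' - s p * a r' else s p"
  have "(\<Sum>p\<in>J. D r p * ?G p r') = (if r = r' then 1 else 0)" if "r < Suc n" "r' < Suc n" for r r'
  proof (cases "r' < n")
  case True
  have "(\<Sum>p\<in>J. D r p * ?G p r') = (\<Sum>p\<in>J. D r p * G p r') - (\<Sum>p\<in>J. D r p * s p) * a r'"
  using True by (simp add: right_diff_distrib sum_subtractf sum_distrib_right mult.assoc)
  thus ?thesis using True that G s0 s1 a_def[of r'] by (cases "r = n") (auto simp: less_Suc_eq)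
  next
  case False
  thus ?thesis using that s0 s1 by (cases "r = n") (auto simp: less_Suc_eq)
  qed
  thus ?thesis by (intro disjI2 exI[of _ ?G]) blast
  qed
 qed
qed simp

lemma sum_closed:
 "0 : J ==> (!!a b. a : J ==> b : J ==> a + b : J) ==> (!!i. i : I ==> f i : J) ==> sum f I : J"
 by (induction I rule: infinite_finite_induct) auto

context trix
begin

lemma ka_row:
 assumes b: "bet : hm R1 [1]" and t: "t < l"
 shows "ka t (ent (bet * xc) 0 0) = cx 1 bet 0 t"
proof -
 have e: "ent bet 0 s : S" "ep 1 * ent bet 0 s = ent bet 0 s" "ent bet 0 s * ep 1 = ent bet 0 s" if "s < l" for s
  using hm_S[OF b] hm_el[OF b, of 0 s] hm_er[OF b, of s 0] that by auto
 have "ent (bet * xc) 0 0 = (\<Sum>s<l. ent bet 0 s * x s)" by (simp add: ent_comp[OF xc_in] ent_xc)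
 hence "ka t (ent (bet * xc) 0 0) = (\<Sum>s<l. ka t (ent bet 0 s * x s))"
 proof (simp only:, intro ka_sum)
  fix s assume "s : {..<l}"
  hence s: "s < l" by simp
  show "ent bet 0 s * x s : S & ep 1 * (ent bet 0 s * x s) = ent bet 0 s * x s & ent bet 0 s * x s * ep 2 = ent bet 0 s * x s"
  using e[OF s] x_in[OF s] by (simp add: S_mult mult.assoc) (simp flip: mult.assoc)
 qed
 also have "... = (\<Sum>s<l. ch 1 (ent bet 0 s) * (if s = t then 1 else 0))"
  using e x_in ka_mult ka_x t by (intro sum.cong) auto
 also have "... = (\<Sum>s<l. if s = t then ch 1 (ent bet 0 s) else 0)" by (rule sum.cong) auto
 also have "... = cx 1 bet 0 t" using t by (simp add: cx_def)
 finally show ?thesis .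
qed

text \<open>For a power \<open>P\<close> of P_2, the map to P_1 that is \<open>x (snd p)\<close> on
  the summand number \<open>fst p\<close> and 0 on the others. By \<open>row_gens\<close> these
  generate all maps from \<open>P\<close> to P_1.\<close>

definition zz :: "nat \<times> nat => 'r fmat" where
 "zz p = shd (snd p) [1] * xc * shd (fst p) [2]"

lemma zz_in: assumes "set P \<subseteq> {2}" "p : {..<length P} \<times> {..<l}" shows "zz p : hm P [1]"
proof -
 have "fst p < length P" "P ! fst p = 2" "snd p < length R1" "R1 ! snd p = 1" using assms nth_mem by fastforce+
 thus ?thesis unfolding zz_def using hm_comp[OF _ hm_comp[OF xc_in prj_in[of "snd p" R1]], of "shd (fst p) [2]" P]
  prj_in[of "fst p" P] by simp
qed

text \<open>The residues of the coefficients are recorded because a map with vanishing coordinates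
  is thereby a combination with radical coefficients.\<close>

lemma row_gens:
 assumes P: "set P \<subseteq> {2}" and M: "M : hm P [1]"
 shows "EX alp. (ALL p:{..<length P} \<times> {..<l}. alp p : hm [1] [1] & cx 1 (alp p) 0 0 = ka (snd p) (ent M 0 (fst p))) &
  M = (\<Sum>p\<in>{..<length P} \<times> {..<l}. alp p * zz p)"
proof -
 have P2: "P ! j = 2" if "j < length P" for j using P that nth_mem by blast
 have "EX bet. bet : hm R1 [1] & M * shu j [2] = bet * xc" if "j < length P" for j
  using gen_mat[of "[1]" "M * shu j [2]"] hm_comp[OF inc_in[OF that] M] P2[OF that] by auto
 then obtain bet where bet: "!!j. j < length P ==> bet j : hm R1 [1] & M * shu j [2] = bet j * xc" by metis
 define alp where "alp p = bet (fst p) * shu (snd p) [1]" for p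
 have "alp p : hm [1] [1] & cx 1 (alp p) 0 0 = ka (snd p) (ent M 0 (fst p))" if p: "p : {..<length P} \<times> {..<l}" for p
 proof -
  obtain j s where c: "p = (j, s)" and j: "j < length P" and s: "s < l" using p by auto
  have b: "bet j : hm R1 [1]" using bet[OF j] by blast
  have "ent M 0 j = ent (M * shu j [2]) 0 0" using hm_er[OF M j, of 0] P2[OF j] by (simp add: ent_shu_r dia_def)
  also have "... = ent (bet j * xc) 0 0" using bet[OF j] by simp
  finally have "ka s (ent M 0 j) = cx 1 (bet j) 0 s" using ka_row[OF b s] by simp
  moreover have "ent (alp p) 0 0 = ent (bet j) 0 s"
  using hm_er[OF b, of s 0] s by (simp add: alp_def c ent_shu_r dia_def)
  moreover have "alp p : hm [1] [1]" unfolding alp_def c using hm_comp[OF inc_in[of s R1] b] s by simp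
  ultimately show ?thesis by (simp add: c cx_def)
 qed
 moreover have "M = (\<Sum>p\<in>{..<length P} \<times> {..<l}. alp p * zz p)"
 proof -
  have "M = M * (\<Sum>j<length P. shu j [P ! j] * shd j [P ! j])" using hm_r[OF M] sum_inc_prj by simp
  also have "... = (\<Sum>j<length P. bet j * xc * shd j [2])"
  unfolding sum_distrib_left using bet P2 by (intro sum.cong) (auto simp flip: mult.assoc)
  also have "... = (\<Sum>j<length P. \<Sum>s<l. alp (j, s) * zz (j, s))"
  proof (rule sum.cong)
  fix j assume "j : {..<length P}"
  hence b: "bet j : hm R1 [1]" using bet by simp
  have "bet j = bet j * (\<Sum>s<l. shu s [1] * shd s [1])" using hm_r[OF b] sum_inc_prj[of R1] by simp
  hence "bet j * xc * shd j [2] = bet j * (\<Sum>s<l. shu s [1] * shd s [1]) * xc * shd j [2]" by simp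
  thus "bet j * xc * shd j [2] = (\<Sum>s<l. alp (j, s) * zz (j, s))"
  by (simp add: alp_def zz_def sum_distrib_left sum_distrib_right mult.assoc)
  qed simp
  finally show ?thesis by (simp add: sum.cartesian_product')
 qed
 ultimately show ?thesis by blast
qed

text \<open>The relation \<open>lam\<close> gives a split epimorphism \<Lambda> from
  \<open>Q\<close> to P_1, with section \<open>u\<close>, such that \<open>\<Lambda> * d\<close> is
  a radical combination of the generators \<open>zz\<close>. Presilting gives
  \<open>u * zz p = d * a + b * d\<close>; applying \<Lambda>, each \<open>zz p\<close> is a radical
  combination of generators modulo left multiples of \<open>d\<close>. By Nakayama every map from
  \<open>P\<close> to P_1 factors through \<open>d\<close>.\<close>

lemma null_row_hz:
 assumes T: "psl (P, Q, d)" and P: "set P \<subseteq> {2}" and Q: "set Q \<subseteq> {1}"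
  and r0: "r0 < length Q" "lam r0 ~= 0"
  and null: "!!j s. j < length P ==> s < l ==> (\<Sum>r<length Q. lam r * ka s (ent d r j)) = 0"
 shows "hz (P, Q, d) (PP 1)"
proof -
 have d: "d : hm P Q" using T by (auto simp: psl_def Obj_def)
 have Q1: "Q ! r = 1" if "r < length Q" for r using Q that nth_mem by blast
 have P2: "P ! j = 2" if "j < length P" for j using P that nth_mem by blast
 define \<Lambda> where "\<Lambda> = Fmat (%i r. if i = 0 & r < length Q then sc (lam r) * ep 1 else 0)"
 have e\<Lambda>: "ent \<Lambda> i r = (if i = 0 & r < length Q then sc (lam r) * ep 1 else 0)" for i r
  unfolding \<Lambda>_def by (rule ent_Fmat[of _ "Suc (length Q)", THEN fun_cong, THEN fun_cong]) (auto split: if_splits)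
 have sS: "sc c * ep 1 : S" "ep 1 * (sc c * ep 1) = sc c * ep 1" "sc c * ep 1 * ep 1 = sc c * ep 1"
  "ch 1 (sc c * ep 1) = c" for c
 proof -
  show "sc c * ep 1 : S" by (simp add: S_mult sc_in ep_in)
  have "ep 1 * (sc c * ep 1) = ep 1 * sc c * ep 1" by (simp only: mult.assoc)
  also have "... = sc c * (ep 1 * ep 1)" by (simp only: sc_central[OF ep_in, symmetric] mult.assoc)
  finally show "ep 1 * (sc c * ep 1) = sc c * ep 1" by (simp add: ep_idem)
  show "sc c * ep 1 * ep 1 = sc c * ep 1" by (simp add: mult.assoc ep_idem)
  show "ch 1 (sc c * ep 1) = c" using ch_mult[OF _ sc_in ep_in] ch_sc ch_ep by simp
 qed
 have \<Lambda>: "\<Lambda> : hm Q [1]" unfolding hm_iff using Q1 sS by (auto simp: e\<Lambda> dia_def S_zero)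
 have \<Lambda>r: "\<Lambda> * shu r0 [1] : hm [1] [1]" using hm_comp[OF inc_in[OF r0(1)] \<Lambda>] Q1[OF r0(1)] by simp
 have "cx 1 (\<Lambda> * shu r0 [1]) 0 0 = lam r0"
  using sS r0(1) by (simp add: cx_def ent_shu_r dia_def e\<Lambda>)
 then obtain w where w: "w : hm [1] [1]" "\<Lambda> * shu r0 [1] * w = ob [1]"
  using hm1_inverse[OF _ \<Lambda>r] r0(2) by auto
 define u where "u = shu r0 [1] * w"
 have u: "u : hm [1] Q" "\<Lambda> * u = ob [1]"
  using hm_comp[OF w(1)] inc_in[OF r0(1)] Q1[OF r0(1)] w(2) by (simp_all add: u_def mult.assoc)
 have m: "\<Lambda> * d : hm P [1]" using hm_comp[OF d \<Lambda>] .
 have m0: "ka s (ent (\<Lambda> * d) 0 j) = 0" if j: "j < length P" and s: "s < l" for j s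
 proof -
  have e: "ent d r j : S" "ep 1 * ent d r j = ent d r j" "ent d r j * ep 2 = ent d r j" if "r < length Q" for r
  using hm_S[OF d] hm_el[OF d that, of j] hm_er[OF d j, of r] Q1[OF that] P2[OF j] by auto
  have "ent (\<Lambda> * d) 0 j = (\<Sum>r<length Q. sc (lam r) * ep 1 * ent d r j)"
  by (simp add: ent_comp[OF d] e\<Lambda>)
  hence "ka s (ent (\<Lambda> * d) 0 j) = (\<Sum>r<length Q. ka s (sc (lam r) * ep 1 * ent d r j))"
  proof (simp only:, intro ka_sum)
  fix r assume "r : {..<length Q}"
  hence r: "r < length Q" by simp
  have "ep 1 * (sc (lam r) * ep 1 * ent d r j) = ep 1 * (sc (lam r) * ep 1) * ent d r j" by (simp only: mult.assoc)
  moreover have "sc (lam r) * ep 1 * ent d r j * ep 2 = sc (lam r) * ep 1 * (ent d r j * ep 2)" by (simp only: mult.assoc)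
  ultimately show "sc (lam r) * ep 1 * ent d r j : S & ep 1 * (sc (lam r) * ep 1 * ent d r j) = sc (lam r) * ep 1 * ent d r j &
  sc (lam r) * ep 1 * ent d r j * ep 2 = sc (lam r) * ep 1 * ent d r j" using e[OF r] sS by (simp add: S_mult)
  qed
  also have "... = (\<Sum>r<length Q. lam r * ka s (ent d r j))" using e sS ka_mult by (intro sum.cong) auto
  finally show ?thesis using null[OF j s] by simp
 qed
 let ?I = "{..<length P} \<times> {..<l}"
 let ?J = "{a \<in> hm [1] [1]. cx 1 a 0 0 = 0}" and ?N = "{bet * d | bet. bet : hm Q [1]}"
 have J_add: "a + b : ?J" if "a : ?J" "b : ?J" for a b
  using that cx_add[of 1 a "[1]" "[1]" b 0 0] by (auto intro: hm_add)
 have J0: "0 : ?J" using hm_zero ch_zero[of 1] by (simp add: cx_def)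
 have N_add: "m + n : ?N" if "m : ?N" "n : ?N" for m n
 proof -
  obtain v v' where "v : hm Q [1]" "v' : hm Q [1]" "m = v * d" "n = v' * d"
  using \<open>m : ?N\<close> \<open>n : ?N\<close> by blast
  thus ?thesis using hm_add[of v Q "[1]" v'] by (auto simp: distrib_right[symmetric])
 qed
 have A_N: "a * n : ?N" if "a : hm [1] [1]" "n : ?N" for a n
 proof -
  obtain v where v: "v : hm Q [1]" "n = v * d" using \<open>n : ?N\<close> by blast
  have "a * n = (a * v) * d" by (simp add: v(2) mult.assoc)
  thus ?thesis using hm_comp[OF v(1) that(1)] by blast
 qed
 have N0: "0 : ?N" using hm_zero by force
 obtain alp where alp: "!!p. p : ?I ==> alp p : ?J" "\<Lambda> * d = (\<Sum>p\<in>?I. alp p * zz p)"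
  using row_gens[OF P m] m0 by fastforce
 have "ALL p:?I. zz p : ?N"
 proof (rule nakayama[where A = "hm [1] [1]" and J = ?J and \<epsilon> = "ob [1]"])
  show "finite ?I" by simp
  show "a * b : ?J" if "a : hm [1] [1]" "b : ?J" for a b using that by (auto intro: hm_comp simp: cx1_mult)
  show "EX b:hm [1] [1]. b * (ob [1] - a) = ob [1]" if "a : ?J" for a
  proof -
  have "cx 1 (ob [1] - a) 0 0 ~= 0" using that cx_minus[of 1 "ob [1]" "[1]" "[1]" a 0 0] ob_in by (simp add: cx_ob)
  thus ?thesis using hm1_inverse[of 1 "ob [1] - a"] that by (auto intro: hm_minus ob_in)
  qed
  show "ob [1] * zz p = zz p" if "p : ?I" for p using hm_l[OF zz_in[OF P that]] .
  show "EX a. (ALL t:?I. a t : ?J) & zz p - (\<Sum>t\<in>?I. a t * zz t) : ?N" if p: "p : ?I" for p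
  proof -
  have z: "zz p : hm P [1]" using zz_in[OF P p] .
  have "ALL f:hm P Q. EX a:hm P P. EX b:hm Q Q. f = d * a + b * d" using T by (simp add: psl_def hz_def)
  hence "EX a:hm P P. EX b:hm Q Q. u * zz p = d * a + b * d" using hm_comp[OF z u(1)] by (rule bspec)
  then obtain a b where ab: "a : hm P P" "b : hm Q Q" "u * zz p = d * a + b * d" by (elim bexE) (rule that)
  have "EX bet. (ALL t:?I. bet t : hm [1] [1]) & zz q * a = (\<Sum>t\<in>?I. bet t * zz t)" if q: "q : ?I" for q
  proof -
  obtain bet where "(ALL p:?I. bet p : hm [1] [1] & cx 1 (bet p) 0 0 = ka (snd p) (ent (zz q * a) 0 (fst p))) &
  zz q * a = (\<Sum>p\<in>?I. bet p * zz p)" using row_gens[OF P hm_comp[OF ab(1) zz_in[OF P q]]] by (rule exE)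
  thus ?thesis by (intro exI[of _ bet]) simp
  qed
  hence "EX bet. ALL q:?I. (ALL t:?I. bet q t : hm [1] [1]) & zz q * a = (\<Sum>t\<in>?I. bet q t * zz t)"
  by (intro bchoice ballI)
  then obtain bet where bet0: "ALL q:?I. (ALL t:?I. bet q t : hm [1] [1]) & zz q * a = (\<Sum>t\<in>?I. bet q t * zz t)"
  by (rule exE)
  have bet: "bet q t : hm [1] [1]" if "q : ?I" "t : ?I" for q t
  using bet0[THEN bspec, OF that(1), THEN conjunct1, THEN bspec, OF that(2)] .
  have bet2: "zz q * a = (\<Sum>t\<in>?I. bet q t * zz t)" if "q : ?I" for q
  using bet0[THEN bspec, OF that, THEN conjunct2] .
  let ?c = "%t. \<Sum>q\<in>?I. alp q * bet q t"
  have "?c t : ?J" if "t : ?I" for t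
  proof (rule sum_closed[OF J0 J_add])
  fix q assume "q : ?I"
  thus "alp q * bet q t : ?J" using alp(1)[of q] bet[of q t] that hm_comp[of "bet q t" "[1]" "[1]" "alp q" "[1]"]
  cx1_mult[of 1 "bet q t" "alp q"] by simp
  qed
  moreover have "zz p - (\<Sum>t\<in>?I. ?c t * zz t) = \<Lambda> * b * d"
  proof -
  have "zz p = \<Lambda> * (u * zz p)" using u(2) hm_l[OF z] by (simp flip: mult.assoc)
  also have "... = \<Lambda> * d * a + \<Lambda> * b * d" unfolding ab(3) by (simp add: algebra_simps)
  also have "\<Lambda> * d * a = (\<Sum>q\<in>?I. alp q * (zz q * a))"
  unfolding alp(2) sum_distrib_right by (simp only: mult.assoc)
  also have "... = (\<Sum>q\<in>?I. \<Sum>t\<in>?I. alp q * bet q t * zz t)"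
  using bet2 by (intro sum.cong) (simp_all add: sum_distrib_left mult.assoc)
  also have "... = (\<Sum>t\<in>?I. ?c t * zz t)" by (subst sum.swap) (simp add: sum_distrib_right)
  finally show ?thesis by simp
  qed
  moreover have "\<Lambda> * b * d : ?N" using hm_comp[OF ab(2) \<Lambda>] by blast
  ultimately show ?thesis by (intro exI[of _ ?c]) auto
  qed
 qed (use J_add A_N N_add N0 in \<open>auto intro: hm_comp\<close>)
 hence z: "zz p : ?N" if "p : ?I" for p using that by blast
 show ?thesis unfolding hz_def
 proof
  fix f assume "f : hm (cS (P, Q, d)) (cT (PP 1))"
  hence f: "f : hm P [1]" by (simp add: PP_def)
  obtain \<gamma> where \<gamma>': "(ALL p:?I. \<gamma> p : hm [1] [1] & cx 1 (\<gamma> p) 0 0 = ka (snd p) (ent f 0 (fst p))) &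
  f = (\<Sum>p\<in>?I. \<gamma> p * zz p)" using row_gens[OF P f] by (rule exE)
  hence \<gamma>: "ALL p:?I. \<gamma> p : hm [1] [1]" "f = (\<Sum>p\<in>?I. \<gamma> p * zz p)" by simp_all
  have "f : ?N" unfolding \<gamma>(2) using \<gamma>(1) z by (intro sum_closed[OF N0 N_add] A_N) auto
  thus "EX a:hm (cS (P, Q, d)) (cS (PP 1)). EX b:hm (cT (P, Q, d)) (cT (PP 1)). f = cD (PP 1) * a + b * cD (P, Q, d)"
  using hm_zero by (auto simp: PP_def)
 qed
qed

end

context ext
begin

text \<open>The \<open>v s\<close> are dual to the generators: since x_r v_s is y or 0, the sum of
  the \<open>v s\<close> with coefficients \<open>c s m\<close> is sent by row r of
  \<open>im L.xc\<close> to the prescribed multiple of y.\<close>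

lemma V_lift:
 assumes P: "set P \<subseteq> {2}" and w: "w : T.hm P L.R1" "pm w = 0"
 shows "EX g:T.hm P [2]. pm g = 0 & im L.xc * g = w"
proof -
 have P2: "P ! j = 2" if "j < length P" for j using P that nth_mem by blast
 have "EX c. ent w s m = y * sc' c" if "s < l" for s m
  using W_top[OF T.hm_S[OF w(1)] pm_zero_ent[OF w(2)]] T.hm_el[OF w(1), of s] that by simp
 then obtain c where c: "!!s m. s < l ==> ent w s m = y * sc' (c s m)" by metis
 let ?e = "%m. \<Sum>s<l. v s * sc' (c s m) * ep' 2"
 define g where "g = Fmat (%r m. if r = 0 & m < length P then ?e m else 0)"
 have eg: "ent g r m = (if r = 0 & m < length P then ?e m else 0)" for r m
  unfolding g_def by (rule ent_Fmat[of _ "Suc (length P)", THEN fun_cong, THEN fun_cong]) (auto split: if_splits)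
 have vS: "v s * sc' d * ep' 2 : S'" "pr (v s * sc' d * ep' 2) = 0" "ep' 2 * (v s * sc' d * ep' 2) = v s * sc' d * ep' 2"
  if "s < l" for s d
 proof -
  show S: "v s * sc' d * ep' 2 : S'" using v_in[OF that] by (simp add: T.S_mult T.sc_in T.ep_in)
  show "pr (v s * sc' d * ep' 2) = 0"
  using v_in[OF that] pr_mult[OF T.S_mult[OF _ T.sc_in] T.ep_in] pr_mult[OF _ T.sc_in] by simp
  have "ep' 2 * (v s * sc' d * ep' 2) = (ep' 2 * v s) * sc' d * ep' 2" by (simp only: mult.assoc)
  thus "ep' 2 * (v s * sc' d * ep' 2) = v s * sc' d * ep' 2" using v_in[OF that] by simp
 qed
 have eS: "?e m : S'" "pr (?e m) = 0" "ep' 2 * ?e m = ?e m" "?e m * ep' 2 = ?e m" for m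
 proof -
  show "?e m : S'" using vS(1) by (intro T.S_sum) auto
  show "pr (?e m) = 0" using vS p.f_sum[of "{..<l}" "%s. v s * sc' (c s m) * ep' 2"] by simp
  show "ep' 2 * ?e m = ?e m" unfolding sum_distrib_left using vS(3) by (intro sum.cong) auto
  show "?e m * ep' 2 = ?e m" unfolding sum_distrib_right by (simp add: mult.assoc T.ep_idem)
 qed
 have g: "g : T.hm P [2]" unfolding T.hm_iff using P2 eS by (auto simp: eg T.dia_def T.S_zero)
 have "pm g = 0" by (rule fmat_eqI) (simp add: eg eS(2) p.f_zero)
 moreover have "im L.xc * g = w"
 proof (rule fmat_eqI)
  fix r m
  show "ent (im L.xc * g) r m = ent w r m"
  proof (cases "r < l & m < length P")
  case True
  have ix: "inc (x r) : S'" "ep' 1 * inc (x r) = inc (x r)" "inc (x r) * ep' 2 = inc (x r)" "pr (inc (x r)) = x r"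
  using True L.x_in[of r] inc_in inc_mult[OF L.ep_in, of "x r" 1] inc_mult[OF _ L.ep_in, of "x r" 2] inc_ep pr_inc by auto
  have t: "inc (x r) * (v s * sc' (c s m) * ep' 2) = (if s = r then y * sc' (c s m) * ep' 2 else 0)" if "s < l" for s
  proof -
  have "inc (x r) * (v s * sc' (c s m) * ep' 2) = (inc (x r) * v s) * sc' (c s m) * ep' 2" by (simp only: mult.assoc)
  also have "inc (x r) * v s = y * sc' (ka s (x r))" using x_v[OF ix(1,2,3) that] ix(4) by simp
  also have "y * sc' (ka s (x r)) * sc' (c s m) = y * sc' (ka s (x r) * c s m)" by (simp only: sc'_mult mult.assoc)
  finally show ?thesis using L.ka_x[of r s] True that by (simp add: sc'_zero)
  qed
  have "ent (im L.xc * g) r m = inc (x r) * ?e m" using True by (simp add: T.ent_comp[OF g] eg L.ent_xc)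
  also have "... = (\<Sum>s<l. if s = r then y * sc' (c s m) * ep' 2 else 0)"
  unfolding sum_distrib_left using t by (intro sum.cong) auto
  also have "... = ent w r m * ep' 2" using True c by simp
  also have "... = ent w r m" using T.hm_er[OF w(1), of m r] True P2 by auto
  finally show ?thesis .
  next
  case False
  thus ?thesis using T.hm_out[OF w(1), of r m] T.hm_out[OF T.hm_comp[OF g i.fm_in[OF L.xc_in]], of r m] by auto
  qed
 qed
 ultimately show ?thesis using g by blast
qed

text \<open>\<open>Y\<close> sees only the residues of \<open>u\<close>. Applying \<open>G\<close>
  to them gives coefficients \<gamma>, and the \<open>v s\<close> combined with these form
  \<open>g\<close>: by \<open>x_v\<close>, the product \<open>im d * g\<close> is y times the
  coordinate matrix applied to \<gamma>, which returns the residues.\<close>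

lemma right_inverse_RI:
 assumes d: "d : L.hm P Q" and P: "set P \<subseteq> {2}" and Q: "set Q \<subseteq> {1}"
  and G: "ALL r<length Q. ALL r'<length Q.
  (\<Sum>p\<in>{..<length P} \<times> {..<l}. ka (snd p) (ent d r (fst p)) * G p r') = (if r = r' then 1 else 0)"
 shows "RI (iT (P, Q, d))" unfolding RI_def
proof
 fix u assume "u : T.hm [1] (cT (iT (P, Q, d)))"
 hence u: "u : T.hm [1] Q" by simp
 have Q1: "Q ! r = 1" if "r < length Q" for r using Q that nth_mem by blast
 have P2: "P ! j = 2" if "j < length P" for j using P that nth_mem by blast
 define \<gamma> where "\<gamma> p = (\<Sum>r<length Q. G p r * ch' 1 (ent u r 0))" for p
 let ?e = "%j. \<Sum>s<l. v s * sc' (\<gamma> (j, s)) * ep' 2"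
 define g where "g = Fmat (%j m. if j < length P & m = 0 then ?e j else 0)"
 have eg: "ent g j m = (if j < length P & m = 0 then ?e j else 0)" for j m
  unfolding g_def by (rule ent_Fmat[of _ "Suc (length P)", THEN fun_cong, THEN fun_cong]) (auto split: if_splits)
 have vS: "v s * sc' c * ep' 2 : S'" "pr (v s * sc' c * ep' 2) = 0" "ep' 2 * (v s * sc' c * ep' 2) = v s * sc' c * ep' 2"
  if "s < l" for s c
 proof -
  show S: "v s * sc' c * ep' 2 : S'" using v_in[OF that] by (simp add: T.S_mult T.sc_in T.ep_in)
  show "pr (v s * sc' c * ep' 2) = 0"
  using v_in[OF that] pr_mult[OF T.S_mult[OF _ T.sc_in] T.ep_in] pr_mult[OF _ T.sc_in] by simp
  have "ep' 2 * (v s * sc' c * ep' 2) = (ep' 2 * v s) * sc' c * ep' 2" by (simp only: mult.assoc)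
  thus "ep' 2 * (v s * sc' c * ep' 2) = v s * sc' c * ep' 2" using v_in[OF that] by simp
 qed
 have eS: "?e j : S'" "pr (?e j) = 0" "ep' 2 * ?e j = ?e j" "?e j * ep' 2 = ?e j" for j
 proof -
  show "?e j : S'" using vS(1) by (intro T.S_sum) auto
  show "pr (?e j) = 0" using vS p.f_sum[of "{..<l}" "%s. v s * sc' (\<gamma> (j, s)) * ep' 2"] by simp
  show "ep' 2 * ?e j = ?e j" unfolding sum_distrib_left using vS(3) by (intro sum.cong) auto
  show "?e j * ep' 2 = ?e j" unfolding sum_distrib_right by (simp add: mult.assoc T.ep_idem)
 qed
 have g: "g : T.hm [2] P" unfolding T.hm_iff using P2 eS by (auto simp: eg T.dia_def T.S_zero)
 have "pm g = 0" by (rule fmat_eqI) (simp add: eg eS(2) p.f_zero)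
 moreover have "u * Y = im d * g"
 proof (rule fmat_eqI)
  fix r m
  show "ent (u * Y) r m = ent (im d * g) r m"
  proof (cases "r < length Q & m = 0")
  case True
  hence r: "r < length Q" by simp
  have ix: "inc (ent d r j) : S'" "ep' 1 * inc (ent d r j) = inc (ent d r j)"
  "inc (ent d r j) * ep' 2 = inc (ent d r j)" "pr (inc (ent d r j)) = ent d r j" if "j < length P" for j
  proof -
  have e: "ent d r j : S" using L.hm_S[OF d] .
  thus "inc (ent d r j) : S'" "pr (inc (ent d r j)) = ent d r j" using inc_in pr_inc by auto
  show "ep' 1 * inc (ent d r j) = inc (ent d r j)"
  using inc_mult[OF L.ep_in[of 1] e] L.hm_el[OF d r, of j] Q1[OF r] inc_ep by simp
  show "inc (ent d r j) * ep' 2 = inc (ent d r j)"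
  using inc_mult[OF e L.ep_in[of 2]] L.hm_er[OF d that, of r] P2[OF that] inc_ep by simp
  qed
  have t: "inc (ent d r j) * (v s * sc' (\<gamma> (j, s)) * ep' 2) = y * sc' (ka s (ent d r j) * \<gamma> (j, s)) * ep' 2"
  if "j < length P" "s < l" for j s
  proof -
  have "inc (ent d r j) * (v s * sc' (\<gamma> (j, s)) * ep' 2) = (inc (ent d r j) * v s) * sc' (\<gamma> (j, s)) * ep' 2"
  by (simp only: mult.assoc)
  also have "inc (ent d r j) * v s = y * sc' (ka s (ent d r j))"
  using x_v[OF ix(1,2,3)[OF that(1)] that(2)] ix(4)[OF that(1)] by simp
  finally show ?thesis by (simp only: sc'_mult mult.assoc)
  qed
  have "ent (im d * g) r m = (\<Sum>j<length P. \<Sum>s<l. inc (ent d r j) * (v s * sc' (\<gamma> (j, s)) * ep' 2))"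
  using True by (simp add: T.ent_comp[OF g] eg sum_distrib_left)
  also have "... = (\<Sum>j<length P. \<Sum>s<l. y * sc' (ka s (ent d r j) * \<gamma> (j, s)) * ep' 2)"
  using t by (intro sum.cong) auto
  also have "... = (\<Sum>p\<in>{..<length P} \<times> {..<l}. y * sc' (ka (snd p) (ent d r (fst p)) * \<gamma> p) * ep' 2)"
  by (simp add: sum.cartesian_product')
  also have "... = y * sc' (\<Sum>p\<in>{..<length P} \<times> {..<l}. ka (snd p) (ent d r (fst p)) * \<gamma> p) * ep' 2"
  by (simp add: sc'_sum sum_distrib_left sum_distrib_right)
  also have "(\<Sum>p\<in>{..<length P} \<times> {..<l}. ka (snd p) (ent d r (fst p)) * \<gamma> p)
  = (\<Sum>r'<length Q. (\<Sum>p\<in>{..<length P} \<times> {..<l}. ka (snd p) (ent d r (fst p)) * G p r') * ch' 1 (ent u r' 0))"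
  unfolding \<gamma>_def sum_distrib_left sum_distrib_right by (subst sum.swap) (simp add: mult.assoc)
  also have "... = (\<Sum>r'<length Q. if r' = r then ch' 1 (ent u r' 0) else 0)"
  using G r by (intro sum.cong) auto
  also have "... = ch' 1 (ent u r 0)" using r by simp
  finally have e: "ent (im d * g) r m = y * sc' (ch' 1 (ent u r 0)) * ep' 2" .
  have "ent (u * Y) r m = ent u r 0 * y" using True by (simp add: T.ent_comp[OF Y_in] ent_Y)
  also have "... = y * sc' (ch' 1 (ent u r 0))"
  using T.hm_S[OF u] T.hm_el[OF u r, of 0] T.hm_er[OF u, of 0 r] Q1[OF r] by (intro y_left) auto
  finally have e': "ent (u * Y) r m = y * sc' (ch' 1 (ent u r 0))" .
  have "ent (u * Y) r m * ep' 2 = ent (u * Y) r m" using T.hm_er[OF T.hm_comp[OF Y_in u], of m r] True by simp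
  thus ?thesis using e e' by simp
  next
  case False
  thus ?thesis
  using T.hm_out[OF T.hm_comp[OF Y_in u], of r m] T.hm_out[OF T.hm_comp[OF g i.fm_in[OF d]], of r m] by auto
  qed
 qed
 ultimately show "EX g:T.hm [2] (cS (iT (P, Q, d))). pm g = 0 & u * Y = cD (iT (P, Q, d)) * g" using g by auto
qed

text \<open>For a minimal representative, disjointness leaves complexes P_2^m -> P_1^n, to whose
  coordinate matrix the linear alternative applies. If P_1 is absent from degree 0,
  \<open>RI\<close> holds since P_1 has no nonzero map to a power of P_2; if degree -1 is zero, the
  second alternative holds.\<close>

lemma RI_or_hz:
 assumes "L.psl A"
 shows "RI (iT A) | L.hz A (L.PP 1)"
proof -
 have AO: "A : L.Obj" using assms by (simp add: L.psl_def)
 obtain U where U: "U : L.Obj" "L.K.ic A U" "L.rad U" using L.minimal_form[OF AO] by blast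
 have pU: "L.psl U" using L.psl_ret[OF assms L.K.ic_ret[OF U(2)] U(1)] .
 obtain P Q d where c: "U = (P, Q, d)" by (cases U) auto
 have d: "d : L.hm P Q" and prj: "is_proj P" "is_proj Q" using U(1) by (auto simp: c L.Obj_def)
 have dis: "~ (i : set P & i : set Q)" if "i : {1, 2}" for i
  using L.psl_rad_disjoint[OF pU U(3) that] by (simp add: c)
 have "RI (iT U) | L.hz U (L.PP 1)"
 proof (cases "1 : set Q")
  case False
  hence Q: "set Q \<subseteq> {2}" using prj(2) by (auto simp: is_proj_def)
  have "u * Y = im d * 0" if "u : T.hm [1] Q" for u using T.hm_1_2[OF that _ Q] by simp
  hence "RI (iT U)" unfolding RI_def using T.hm_zero by (auto simp: c intro!: bexI[of _ 0])
  thus ?thesis ..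
 next
  case True
  hence P: "set P \<subseteq> {2}" using dis[of 1] prj(1) by (auto simp: is_proj_def)
  show ?thesis
  proof (cases "P = []")
  case True
  thus ?thesis using L.hz_Nil by (simp add: c)
  next
  case False
  hence "2 : set P" using P by (cases P) auto
  hence Q: "set Q \<subseteq> {1}" using dis[of 2] prj(2) by (auto simp: is_proj_def)
  let ?I = "{..<length P} \<times> {..<l}" and ?D = "%r p. ka (snd p) (ent d r (fst p))"
  consider lam r where "r < length Q" "lam r ~= 0" "ALL p:?I. (\<Sum>r<length Q. lam r * ?D r p) = 0"
  | G where "ALL r<length Q. ALL r'<length Q. (\<Sum>p\<in>?I. ?D r p * G p r') = (if r = r' then 1 else 0)"
  using left_null_or_right_inverse[of ?I "length Q" ?D] by blast
  thus ?thesis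
  proof cases
  case 1
  hence "L.hz U (L.PP 1)" using L.null_row_hz[OF pU[unfolded c] P Q, of r lam] by (simp add: c)
  thus ?thesis ..
  next
  case 2
  hence "RI (iT U)" using right_inverse_RI[OF d P Q] by (simp add: c)
  thus ?thesis ..
  qed
  qed
 qed
 thus ?thesis
 proof
  assume a: "RI (iT U)"
  have "T.K.ret (iT U) (iT A)" using T.K.ic_ret[OF i.FT_ic[OF U(1) AO L.K.ic_sym[OF U(2)]]] .
  thus ?thesis using RI_ret[OF _ i.FT_Obj[OF U(1)] i.FT_Obj[OF AO] a] by blast
 next
  assume "L.hz U (L.PP 1)"
  thus ?thesis using L.hz_ic[OF U(1) L.PP_in AO L.PP_in L.K.ic_sym[OF U(2)] L.K.ic_refl[OF L.PP_in]] by auto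
 qed
qed

end

section \<open>The fan of the extension\<close>

context ext
begin

lemma indec_pT:
 assumes "T.indec B" "T.K.ic B (iT (pT B))"
 shows "L.indec (pT B)" unfolding indecP_def
proof (intro conjI allI impI)
 have BO: "B : T.Obj" using T.indec_Obj[OF assms(1)] .
 show O: "pT B : L.Obj" using p.FT_Obj[OF BO] .
 show "~ L.K.ic (pT B) L.zrc"
 proof
  assume "L.K.ic (pT B) L.zrc"
  from i.FT_ic[OF O L.K.zr_Ob this] have "T.K.ic B T.zrc" using T.K.ic_trans[OF assms(2)] i.FT_zrc by simp
  thus False using assms(1) by (simp add: indecP_def)
 qed
 fix U V assume a: "U : L.Obj & V : L.Obj & L.K.ic (pT B) (L.dsc U V)"
 have "T.K.ic (iT (pT B)) (T.dsc (iT U) (iT V))" using i.FT_ic[OF O L.K.ds_Ob] i.FT_dsc a by metis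
 hence "T.K.ic (iT U) T.zrc | T.K.ic (iT V) T.zrc"
  using assms(1) T.K.ic_trans[OF assms(2)] i.FT_Obj a unfolding indecP_def by blast
 thus "L.K.ic U L.zrc | L.K.ic V L.zrc" using p.FT_ic[OF i.FT_Obj T.K.zr_Ob] p.FT_zrc pT_iT a by metis
qed

text \<open>Under \<open>RI\<close> a complex is recovered from its reduction, so reduction detects
  zero objects; this is what transfers indecomposability upwards in \<open>indec_iT\<close>.\<close>

lemma RI_zero:
 assumes "T.psl V" "RI V" "L.K.ic (pT V) L.zrc"
 shows "T.K.ic V T.zrc"
proof -
 have VO: "V : T.Obj" using assms(1) by (simp add: T.psl_def)
 have "T.K.ic (iT (pT V)) T.zrc" using i.FT_ic[OF p.FT_Obj[OF VO] L.K.zr_Ob assms(3)] i.FT_zrc by simp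
 thus ?thesis using T.K.ic_trans[OF RI_iso[OF assms(1,2)]] by blast
qed

lemma indec_iT:
 assumes "L.indec A" "L.psl A" "RI (iT A)"
 shows "T.indec (iT A)" unfolding indecP_def
proof (intro conjI allI impI)
 have AO: "A : L.Obj" using L.indec_Obj[OF assms(1)] .
 show O: "iT A : T.Obj" using i.FT_Obj[OF AO] .
 have ps: "T.psl (iT A)" using psl_iT[OF assms(2,3)] .
 show "~ T.K.ic (iT A) T.zrc"
 proof
  assume "T.K.ic (iT A) T.zrc"
  from p.FT_ic[OF O T.K.zr_Ob this] have "L.K.ic A L.zrc" using pT_iT[OF AO] p.FT_zrc by simp
  thus False using assms(1) by (simp add: indecP_def)
 qed
 fix U V assume a: "U : T.Obj & V : T.Obj & T.K.ic (iT A) (T.dsc U V)"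
 hence UV: "U : T.Obj" "V : T.Obj" by auto
 have bp: "T.K.bip (iT A) U V" using a T.K.bip_Ob[OF O UV] by blast
 have r: "T.K.ret (iT A) U" "T.K.ret (iT A) V" using T.K.bip_ret[OF bp] T.K.bip_ret[OF T.K.bip_sym[OF bp]] .
 have "L.K.bip A (pT U) (pT V)" using p.FT_bip[OF O UV bp] pT_iT[OF AO] by simp
 hence "L.K.ic (pT U) L.zrc | L.K.ic (pT V) L.zrc"
  using L.indec_bip[OF assms(1) p.FT_Obj[OF UV(1)] p.FT_Obj[OF UV(2)]] by blast
 thus "T.K.ic U T.zrc | T.K.ic V T.zrc"
  using RI_zero[OF T.psl_ret[OF ps r(1) UV(1)] RI_ret[OF r(1) O UV(1) assms(3)]]
  RI_zero[OF T.psl_ret[OF ps r(2) UV(2)] RI_ret[OF r(2) O UV(2) assms(3)]] by blast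
qed

lemma iT_PP: "iT (L.PP i) = T.PP i" and pT_PP: "pT (T.PP i) = L.PP i"
 by (simp_all add: i.FT_def p.FT_def L.PP_def T.PP_def)

lemma shd_shu_2: "T.shd j [2] * T.shu i [2] = (if i = j then T.ob [2] else 0)"
 by (rule fmat_eqI) (auto simp: T.ent_shd_l T.ent_shu T.ent_ob T.dia_def T.ep_idem)

lemma R1_Suc: "T.R1 = L.R1 @ [1]" by (simp add: replicate_append_same)

lemma xc_split: "T.xc = im L.xc + T.shu l [1] * Y"
 by (rule fmat_eqI) (auto simp: T.ent_xc L.ent_xc T.ent_shu_l ent_Y T.dia_def x_inc x_y y_in i.f_zero less_Suc_eq)

text \<open>After a unipotent change of basis the rows of the differential are the rows of
 \<open>X\<close>-type and rows \<open>y q\<close>; a non-zero row of the second kind splits off \<open>T.LL\<close>.\<close>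

lemma hz_pT_cases:
 assumes B: "T.indec B" "T.psl B" and hz: "L.hz (pT B) (L.PP 1)"
 shows "T.K.ic B (T.PP 1) | T.K.ic B (T.PP 2) | T.K.ic B (iT L.LL) | T.K.ic B T.LL"
proof -
 have BO: "B : T.Obj" using T.indec_Obj[OF B(1)] .
 obtain U where U: "U : T.Obj" "T.K.ic B U" "T.rad U" using T.minimal_form[OF BO] by blast
 have iU: "T.indec U" using T.indec_ic[OF B(1) U(1,2)] .
 have pU: "T.psl U" using T.psl_ret[OF B(2) T.K.ic_ret[OF U(2)] U(1)] .
 have UB: "L.K.ic (pT B) (pT U)" using p.FT_ic[OF BO U(1,2)] .
 have hU: "L.hz (pT U) (L.PP 1)"
  using L.hz_ic[OF p.FT_Obj[OF BO] L.PP_in p.FT_Obj[OF U(1)] L.PP_in UB L.K.ic_refl[OF L.PP_in] hz] by auto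
 obtain P Q d where c: "U = (P, Q, d)" by (cases U) auto
 have O: "(P, Q, d) : T.Obj" using U(1) c by simp
 have d: "d : T.hm P Q" and prj: "is_proj P" "is_proj Q" using O by (auto simp: T.Obj_def)
 have "L.rad (pT U)" using U(3) ch_pr T.hm_S[OF d] by (simp add: L.rad_def T.rad_def L.cx_def T.cx_def c)
 hence P: "set P \<subseteq> {2}" using L.hz_PP1_rad[OF p.FT_Obj[OF U(1)] hU] by (simp add: c)
 have P2: "P ! j = 2" if "j < length P" for j using P that nth_mem by blast
 show ?thesis
 proof (cases "P = []")
  case True
  hence "cS U = []" by (simp add: c)
  thus ?thesis using T.nil_source_cases[OF iU] T.K.ic_trans[OF U(2)] by blast
 next
  case False
  hence "2 : set P" using P by (cases P) auto
  hence "2 ~: set Q" using T.psl_rad_disjoint[OF pU U(3), of 2] by (simp add: c)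
  hence Q: "set Q \<subseteq> {1}" using prj by (auto simp: is_proj_def)
  have Q1: "Q ! r = 1" if "r < length Q" for r using Q that nth_mem by blast
  have xin: "im L.xc : T.hm [2] L.R1" using i.fm_in[OF L.xc_in] .
  have sd: "L.shd j [2] : L.hm P [2]" "T.shd j [2] : T.hm P [2]" "T.shu j [2] : T.hm [2] P"
  "L.shu j [2] : L.hm [2] P" if "j < length P" for j
  using L.prj_in[OF that] T.prj_in[OF that] T.inc_in[OF that] L.inc_in[OF that] P2[OF that] by simp_all
  have "EX b. b : L.hm Q L.R1 & L.xc * L.shd j [2] = b * pm d" if j: "j < length P" for j
  proof -
  have "L.xc * L.shd j [2] : L.hm (cS (pT U)) L.R1" using L.hm_comp[OF sd(1)[OF j] L.xc_in] by (simp add: c)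
  from L.hz_PP1_rows[OF hU L.set_R1 this] show ?thesis by (auto simp: c)
  qed
  then obtain b where b: "!!j. j < length P ==> b j : L.hm Q L.R1"
  "!!j. j < length P ==> L.xc * L.shd j [2] = b j * pm d" by metis
  \<comment> \<open>The factorisation of the rows of \<open>L.xc\<close> through the reduced
    differential, extended along \<open>inc\<close>, fails by \<open>w j\<close>, whose entries lie
    in the ideal.\<close>
  define w where "w j = im L.xc * T.shd j [2] - im (b j) * d" for j
  have w: "w j : T.hm P L.R1" "pm (w j) = 0" if j: "j < length P" for j
  proof -
  have 1: "im L.xc * T.shd j [2] : T.hm P L.R1" using T.hm_comp[OF sd(2)[OF j] xin] .
  have 2: "im (b j) * d : T.hm P L.R1" using T.hm_comp[OF d i.fm_in[OF b(1)[OF j]]] .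
  show "w j : T.hm P L.R1" unfolding w_def using T.hm_minus[OF 1 2] .
  show "pm (w j) = 0"
  unfolding w_def p.fm_minus[OF 1 2] p.fm_mult[OF sd(2)[OF j] xin] p.fm_mult[OF d i.fm_in[OF b(1)[OF j]]]
  using pm_im[OF L.xc_in] pm_im[OF b(1)[OF j]] b(2)[OF j] by (simp add: p.fm_shd)
  qed
  have "EX g. g : T.hm P [2] & pm g = 0 & im L.xc * g = w j" if j: "j < length P" for j
  using V_lift[OF P w[OF j]] by blast
  then obtain g where g: "!!j. j < length P ==> g j : T.hm P [2]" "!!j. j < length P ==> pm (g j) = 0"
  "!!j. j < length P ==> im L.xc * g j = w j" by metis
  \<comment> \<open>Assembled so that its j-th row is \<open>g j\<close>: the single change of basis
    \<open>T.ob P + G\<close> cancels all errors \<open>w j\<close> at once, as \<open>key\<close>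
    shows.\<close>
  define G where "G = (\<Sum>j<length P. T.shu j [2] * g j)"
  have Gin: "G : T.hm P P" unfolding G_def using T.hm_comp[OF g(1) sd(3)] by (intro T.hm_sum) auto
  have shdG: "T.shd j [2] * G = g j" if j: "j < length P" for j
  proof -
  have "T.shd j [2] * G = (\<Sum>k<length P. T.shd j [2] * T.shu k [2] * g k)"
  by (simp add: G_def sum_distrib_left mult.assoc)
  also have "... = (\<Sum>k<length P. if k = j then T.ob [2] * g k else 0)"
  by (intro sum.cong) (auto simp: shd_shu_2)
  also have "... = g j" using j T.hm_l[OF g(1)[OF j]] by simp
  finally show ?thesis .
  qed
  have Gz: "pm G = 0"
  proof -
  have "pm G = L.ob P * pm G" using L.hm_l[OF p.fm_in[OF Gin]] by simp
  also have "... = (\<Sum>j<length P. L.shu j [2] * (L.shd j [2] * pm G))"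
  using P2 by (simp add: L.sum_inc_prj[symmetric] sum_distrib_right mult.assoc)
  also have "... = (\<Sum>j<length P. L.shu j [2] * pm (T.shd j [2] * G))"
  using p.fm_mult[OF Gin sd(2)] by (intro sum.cong) (auto simp: p.fm_shd)
  also have "... = 0" using shdG g(2) by simp
  finally show ?thesis .
  qed
  define d0 where "d0 = d * (T.ob P + G)"
  have O0: "(P, Q, d0) : T.Obj" and ic0: "T.K.ic (P, Q, d0) (P, Q, d)"
  unfolding d0_def using unipotent_iso[OF O Gin Gz] by auto
  have d0: "d0 : T.hm P Q" using O0 by (simp add: T.Obj_def)
  have pd0: "pm d0 = pm d" unfolding d0_def p.fm_mult[OF T.hm_add[OF T.ob_in Gin] d] p.fm_add[OF T.ob_in Gin]
  using Gz L.hm_r[OF p.fm_in[OF d]] by (simp add: p.fm_ob)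
  have key: "im L.xc * T.shd j [2] = im (b j) * d0" if j: "j < length P" for j
  proof -
  have wG: "w j * G = 0" using W_mult[OF Gin w(1)[OF j] Gz w(2)[OF j]] .
  have "im (b j) * d0 = im (b j) * d * (T.ob P + G)" by (simp add: d0_def mult.assoc)
  also have "im (b j) * d = im L.xc * T.shd j [2] - w j" by (simp add: w_def)
  also have "(im L.xc * T.shd j [2] - w j) * (T.ob P + G)
  = im L.xc * (T.shd j [2] * T.ob P) - w j * T.ob P + im L.xc * (T.shd j [2] * G) - w j * G"
  by (simp add: algebra_simps)
  also have "... = im L.xc * T.shd j [2]"
  using T.hm_r[OF sd(2)[OF j]] T.hm_r[OF w(1)[OF j]] shdG[OF j] g(3)[OF j] wG by simp
  finally show ?thesis by simp
  qed
  \<comment> \<open>After the change of basis every map with entries from \<open>S\<close> into a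
    power of P_1 factors through \<open>d0\<close> over the extension. What is not under control is
    the part \<open>n\<close> of \<open>d0\<close> with entries in the ideal.\<close>
  have span: "EX bet:T.hm Q R. im m = bet * d0" if m: "m : L.hm P R" and R: "set R \<subseteq> {1}" for m R
  proof -
  have "EX a. a : L.hm L.R1 R & m * L.shu j [2] = a * L.xc" if j: "j < length P" for j
  using L.gen_mat[OF R L.hm_comp[OF sd(4)[OF j] m]] by blast
  then obtain a where a: "!!j. j < length P ==> a j : L.hm L.R1 R"
  "!!j. j < length P ==> m * L.shu j [2] = a j * L.xc" by metis
  have "im m = im m * (\<Sum>j<length P. T.shu j [P ! j] * T.shd j [P ! j])"
  using T.hm_r[OF i.fm_in[OF m]] T.sum_inc_prj by simp
  also have "... = (\<Sum>j<length P. im (m * L.shu j [2]) * T.shd j [2])"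
  unfolding sum_distrib_left using P2 i.fm_mult[OF sd(4) m] by (intro sum.cong) (auto simp: i.fm_shu mult.assoc)
  also have "... = (\<Sum>j<length P. im (a j) * im (b j) * d0)"
  proof (rule sum.cong)
  fix j assume "j : {..<length P}"
  hence j: "j < length P" by simp
  have "im (m * L.shu j [2]) * T.shd j [2] = im (a j) * (im L.xc * T.shd j [2])"
  using a(2)[OF j] i.fm_mult[OF L.xc_in a(1)[OF j]] by (simp add: mult.assoc)
  thus "im (m * L.shu j [2]) * T.shd j [2] = im (a j) * im (b j) * d0"
  unfolding key[OF j] by (simp add: mult.assoc)
  qed simp
  finally have "im m = (\<Sum>j<length P. im (a j) * im (b j)) * d0" by (simp add: sum_distrib_right)
  moreover have "(\<Sum>j<length P. im (a j) * im (b j)) : T.hm Q R"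
  using T.hm_comp[OF i.fm_in[OF b(1)] i.fm_in[OF a(1)]] by (intro T.hm_sum) auto
  ultimately show ?thesis by blast
  qed
  have BU0: "T.K.ic B (P, Q, d0)" using T.K.ic_trans[OF U(2)] T.K.ic_sym[OF ic0] c by simp
  have i0: "T.indec (P, Q, d0)" using T.indec_ic[OF B(1) O0 BU0] .
  have ipd: "im (pm d0) : T.hm P Q" using i.fm_in[OF p.fm_in[OF d0]] .
  define n where "n = d0 - im (pm d0)"
  have n: "n : T.hm P Q" "pm n = 0"
  using T.hm_minus[OF d0 ipd] p.fm_minus[OF d0 ipd] pm_im[OF p.fm_in[OF d0]] by (auto simp: n_def)
  show ?thesis
  proof (cases "n = 0")
  \<comment> \<open>The complex is extended from the smaller algebra, where
    \<open>hz_PP1_cases\<close> lists the possibilities.\<close>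
  case True
  hence "(P, Q, d0) = iT (pT U)" using pd0 by (simp add: n_def c i.FT_def p.FT_def)
  moreover have "T.K.ic (iT (pT U)) (iT (pT B))"
  using i.FT_ic[OF p.FT_Obj[OF U(1)] p.FT_Obj[OF BO] L.K.ic_sym[OF UB]] .
  ultimately have BiB: "T.K.ic B (iT (pT B))" using T.K.ic_trans[OF BU0] by simp
  have "L.K.ic (pT B) (L.PP 1) | L.K.ic (pT B) (L.PP 2) | L.K.ic (pT B) L.LL"
  using L.hz_PP1_cases[OF indec_pT[OF B(1) BiB] psl_pT[OF B(2)] hz] .
  hence "T.K.ic (iT (pT B)) (T.PP 1) | T.K.ic (iT (pT B)) (T.PP 2) | T.K.ic (iT (pT B)) (iT L.LL)"
  using i.FT_ic[OF p.FT_Obj[OF BO] L.PP_in, of 1] i.FT_ic[OF p.FT_Obj[OF BO] L.PP_in, of 2]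
  i.FT_ic[OF p.FT_Obj[OF BO] L.LL_Obj] iT_PP by auto
  thus ?thesis using T.K.ic_trans[OF BiB] by blast
  next
  case False
  have "EX r<length Q. T.shd r [1] * n ~= 0"
  proof (rule ccontr)
  assume "~ (EX r<length Q. T.shd r [1] * n ~= 0)"
  hence "(\<Sum>r<length Q. T.shu r [Q ! r] * T.shd r [Q ! r]) * n = 0"
  unfolding sum_distrib_right using Q1 by (intro sum.neutral) (auto simp: mult.assoc)
  thus False using False T.hm_l[OF n(1)] T.sum_inc_prj by simp
  qed
  then obtain r where r: "r < length Q" "T.shd r [1] * n ~= 0" by blast
  have sr: "T.shd r [1] : T.hm Q [1]" "L.shd r [1] : L.hm Q [1]"
  using T.prj_in[OF r(1)] L.prj_in[OF r(1)] Q1[OF r(1)] by simp_all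
  have "pm (T.shd r [1] * n) = 0" using p.fm_mult[OF n(1) sr(1)] n(2) by simp
  from W_row[OF T.hm_comp[OF n(1) sr(1)] P this]
  obtain q where q: "q : L.hm P [2]" "T.shd r [1] * n = Y * im q" by blast
  have iq: "im q : T.hm P [2]" using i.fm_in[OF q(1)] .
  obtain bet1 where bet1: "bet1 : T.hm Q [1]" "im (L.shd r [1] * pm d0) = bet1 * d0"
  using span[OF L.hm_comp[OF p.fm_in[OF d0] sr(2)], of ] by auto
  have "T.shd r [1] * im (pm d0) = bet1 * d0"
  using i.fm_mult[OF p.fm_in[OF d0] sr(2)] bet1(2) by (simp add: i.fm_shd)
  hence Yq: "Y * im q = (T.shd r [1] - bet1) * d0" using q(2) by (simp add: n_def algebra_simps)
  obtain bet2 where bet2: "bet2 : T.hm Q L.R1" "im (L.xc * q) = bet2 * d0"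
  using span[OF L.hm_comp[OF q(1) L.xc_in] L.set_R1] by blast
  \<comment> \<open>The chain map to \<open>T.LL\<close> whose component in degree -1 is
    \<open>im q\<close>: the old rows of \<open>T.xc\<close> are handled by \<open>bet2\<close>, and
    the last row \<open>Y * im q\<close> is row \<open>r\<close> of \<open>d0\<close> minus its part
    over \<open>S\<close>, which is \<open>bet1 * d0\<close>.\<close>
  let ?bet = "bet2 + T.shu l [1] * (T.shd r [1] - bet1)"
  have shl: "T.shu l [1] : T.hm [1] (L.R1 @ [1])" using T.shu_in[of L.R1 "[1]"] by simp
  have bet: "?bet : T.hm Q T.R1"
  unfolding R1_Suc using T.hm_add[OF T.hm_ext(2)[OF bet2(1)] T.hm_comp[OF T.hm_minus[OF sr(1) bet1(1)] shl]] .
  have betd: "T.xc * im q = ?bet * d0"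
  using i.fm_mult[OF q(1) L.xc_in] bet2(2) Yq by (simp add: xc_split distrib_right mult.assoc)
  \<comment> \<open>By \<open>y_right\<close> y sees only residues, so a nonzero
    \<open>Y * im q\<close> forces an entry of \<open>im q\<close> with nonzero residue. That entry
    is invertible and splits the projection onto P_2.\<close>
  have "EX j<length P. T.cx 2 (im q) 0 j ~= 0"
  proof (rule ccontr)
  assume a: "~ (EX j<length P. T.cx 2 (im q) 0 j ~= 0)"
  have "Y * im q = 0"
  proof (rule fmat_eqI)
  fix s m
  show "ent (Y * im q) s m = ent 0 s m"
  proof (cases "s = 0 & m < length P")
  case True
  hence m: "m < length P" by simp
  have "y * ent (im q) 0 m = y * sc' (ch' 2 (ent (im q) 0 m))"
  using T.hm_S[OF iq] T.hm_el[OF iq, of 0 m] T.hm_er[OF iq m, of 0] P2[OF m] by (intro y_right) auto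
  moreover have "ch' 2 (ent (im q) 0 m) = 0" using a m unfolding T.cx_def by blast
  ultimately have "y * ent (im q) 0 m = 0" using sc'_zero by simp
  thus ?thesis using True by (simp add: T.ent_comp[OF iq] ent_Y)
  next
  case False
  thus ?thesis using T.hm_out[OF T.hm_comp[OF iq Y_in], of s m] by auto
  qed
  qed
  thus False using r(2) q(2) by simp
  qed
  then obtain j where j: "j < length P" "T.cx 2 (im q) 0 j ~= 0" by blast
  have qs: "im q * T.shu j [2] : T.hm [2] [2]" using T.hm_comp[OF sd(3)[OF j(1)] iq] .
  have "ent (im q * T.shu j [2]) 0 0 = ent (im q) 0 j"
  using T.hm_er[OF iq j(1), of 0] P2[OF j(1)] by (simp add: T.ent_shu_r T.dia_def del: i.ent_fm)
  hence "T.cx 2 (im q * T.shu j [2]) 0 0 ~= 0" using j(2) by (simp add: T.cx_def)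
  then obtain w0 where w0: "w0 : T.hm [2] [2]" "w0 * (im q * T.shu j [2]) = T.ob [2]"
  "im q * T.shu j [2] * w0 = T.ob [2]" using T.hm1_inverse[OF _ qs] by auto
  obtain P' u' v' where P': "u' : T.hm P' P" "v' : T.hm P P'" "v' * u' = T.ob P'"
  "T.shd j [2] * u' = 0" "v' * T.shu j [2] = 0" "T.shu j [2] * T.shd j [2] + u' * v' = T.ob P"
  "!!x. count_list P x = count_list P' x + (if x = 2 then 1 else 0)"
  "set P' \<subseteq> set P" "length P = Suc (length P')"
  by (rule T.split_off_entry[OF j(1) P2[OF j(1)]]) (rule that)
  let ?i = "T.shu j [2] * w0"
  have ii: "?i : T.hm [2] P" using T.hm_comp[OF w0(1) sd(3)[OF j(1)]] .
  have qi: "im q * ?i = T.ob [2]" using w0(3) by (simp add: mult.assoc)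
  have vi: "v' * (T.shu j [2] * X) = 0" for X using P'(5) by (simp flip: mult.assoc)
  have qiX: "im q * (T.shu j [2] * (w0 * X)) = T.ob [2] * X" "w0 * (im q * (T.shu j [2] * X)) = T.ob [2] * X" for X
  using w0(2,3) by (simp_all flip: mult.assoc)
  have obq: "T.ob [2] * (im q * X) = im q * X" for X using T.hm_l[OF iq] by (simp flip: mult.assoc)
  have "T.K.ic (P, Q, d0) T.LL"
  proof (rule T.retract_LL[OF i0 Q _ ii iq _ P'(2) qi _ _ _ _ bet betd])
  show "is_proj P'" using prj(1) P'(8) by (auto simp: is_proj_def)
  show "u' - ?i * im q * u' : T.hm P' P" using T.hm_minus[OF P'(1) T.hm_comp[OF P'(1) T.hm_comp[OF iq ii]]] .
  show "v' * (u' - ?i * im q * u') = T.ob P'" using P'(3) by (simp add: right_diff_distrib mult.assoc vi)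
  show "im q * (u' - ?i * im q * u') = 0" by (simp add: right_diff_distrib mult.assoc qiX obq)
  show "v' * ?i = 0" by (simp add: vi)
  have "?i * im q * u' * v' = ?i * im q * (T.ob P - T.shu j [2] * T.shd j [2])"
  proof -
  have "u' * v' = T.ob P - T.shu j [2] * T.shd j [2]" using P'(6) by (simp add: algebra_simps)
  thus ?thesis by (simp add: mult.assoc)
  qed
  also have "... = ?i * im q - T.shu j [2] * T.shd j [2]" using T.hm_r[OF iq] T.hm_l[OF sd(2)[OF j(1)]]
  by (simp add: right_diff_distrib mult.assoc qiX)
  finally show "?i * im q + (u' - ?i * im q * u') * v' = T.ob P"
  using P'(6) by (simp add: left_diff_distrib add.commute)
  qed
  thus ?thesis using T.K.ic_trans[OF BU0] by blast
  qed
 qed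
qed

end

section \<open>Half-planes separating the cones concerned\<close>

lemma hull_halfplane:
 fixes X :: "(real \<times> real) set"
 assumes "!!p. p : X ==> 0 <= a * fst p + b * snd p" and "p : convex_cone hull X"
 shows "0 <= a * fst p + b * snd p"
proof -
 have "convex_cone {p. (a, b) \<bullet> p >= (0::real)}" by (rule convex_cone_halfspace_ge)
 moreover have "{p. (a, b) \<bullet> p >= 0} = {p. 0 <= a * fst p + b * snd p}" by (auto simp: inner_prod_def)
 ultimately have "convex_cone hull X \<subseteq> {p. 0 <= a * fst p + b * snd p}"
  using assms(1) by (intro hull_minimal) auto
 thus ?thesis using assms(2) by blast
qed

text \<open>The open lower half-plane together with the origin is a convex cone. It excludes (1, 0)
  from a hull even when no closed half-plane separates the two.\<close>

lemma hull_lower: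
 fixes X :: "(real \<times> real) set"
 assumes "!!p. p : X ==> p = 0 | snd p < 0" and "p : convex_cone hull X"
 shows "p = 0 | snd p < 0"
proof -
 have "convex_cone {p :: real \<times> real. p = 0 \<or> snd p < 0}" unfolding convex_cone_iff
  by (auto simp: zero_prod_def mult_less_0_iff order_le_less)
 hence "convex_cone hull X \<subseteq> {p. p = 0 \<or> snd p < 0}" using assms(1) by (intro hull_minimal) auto
 thus ?thesis using assms(2) by blast
qed

lemma hull_subset_pair:
 assumes "X \<subseteq> {a, b}" and "convex_cone hull {} : F" "convex_cone hull {a} : F"
  "convex_cone hull {b} : F" "X = {a, b} ==> convex_cone hull {a, b} : F"
 shows "convex_cone hull X : F"
proof -
 have "X = {} \<or> X = {a} \<or> X = {b} \<or> X = {a, b}" using assms(1) by blast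
 thus ?thesis using assms(2-5) by auto
qed

context ealg
begin

lemma ret_foldr:
 "U : set Ts ==> set Ts \<subseteq> Obj ==> K.ret (foldr dsc Ts zrc) U & foldr dsc Ts zrc : Obj"
proof (induction Ts)
 case (Cons V Ts)
 have o: "foldr dsc Ts zrc : Obj" using Cons.prems(2) by (induction Ts) (auto simp: K.zr_Ob K.ds_Ob)
 have b: "K.bip (foldr dsc (V # Ts) zrc) V (foldr dsc Ts zrc)" using K.bip_ds[OF _ o] Cons.prems(2) by simp
 show ?case
 proof (cases "U = V")
  case True
  thus ?thesis using K.bip_ret[OF b] K.ds_Ob[OF _ o] Cons.prems(2) by simp
 next
  case False
  hence "K.ret (foldr dsc Ts zrc) U" using Cons by simp
  thus ?thesis using K.ret_trans[OF K.bip_ret[OF K.bip_sym[OF b]]] K.ds_Ob[OF _ o] Cons.prems(2) by simp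
 qed
qed simp

end

context trix
begin

lemma hz_LL_any:
 assumes "set (cT U) \<subseteq> {1}"
 shows "hz LL U" unfolding hz_def
proof
 fix f assume "f : hm (cS LL) (cT U)"
 then obtain alp where "alp : hm R1 (cT U)" "f = alp * xc" using gen_mat[OF assms, of f] by (auto simp: LL_def)
 thus "EX a:hm (cS LL) (cS U). EX b:hm (cT LL) (cT U). f = cD U * a + b * cD LL"
  using hm_zero by (intro bexI[of _ 0] bexI[of _ alp]) (auto simp: LL_def)
qed

end

context ext
begin

text \<open>\<open>RI\<close> passes to all summands, so \<open>iT\<close> and \<open>pT\<close> are
  inverse to each other, up to isomorphism, on the summands of \<open>A\<close> and of
  \<open>iT A\<close>.\<close>

lemma isum_iT:
 assumes A: "L.psl A" "RI (iT A)"
 shows "L.isum A U ==> T.isum (iT A) (iT U)" and "T.isum (iT A) V ==> L.isum A (pT V)"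
proof -
 have AO: "A : L.Obj" using A(1) by (simp add: L.psl_def)
 have O: "iT A : T.Obj" using i.FT_Obj[OF AO] .
 have ps: "T.psl (iT A)" using psl_iT[OF A] .
 show "T.isum (iT A) (iT U)" if U: "L.isum A U"
 proof -
  obtain V where V: "V : L.Obj" "L.K.bip A U V" using L.isum_iff[OF AO] U by blast
  have UO: "U : L.Obj" using L.isum_Obj[OF U] .
  have "RI (iT U)" using RI_ret[OF i.FT_ret[OF AO UO L.isum_ret[OF AO U]] O i.FT_Obj[OF UO] A(2)] .
  hence "T.indec (iT U)" using indec_iT[OF L.isum_is_indec[OF U] L.psl_isum[OF A(1) U]] by blast
  moreover have "T.K.bip (iT A) (iT U) (iT V)" using i.FT_bip[OF AO UO V] .
  ultimately show ?thesis using T.isum_iff[OF O] i.FT_Obj[OF V(1)] by blast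
 qed
 show "L.isum A (pT V)" if V: "T.isum (iT A) V"
 proof -
  obtain V' where V': "V' : T.Obj" "T.K.bip (iT A) V V'" using T.isum_iff[OF O] V by blast
  have VO: "V : T.Obj" using T.isum_Obj[OF V] .
  have "RI V" using RI_ret[OF T.isum_ret[OF O V] O VO A(2)] .
  hence "L.indec (pT V)" using indec_pT[OF T.isum_is_indec[OF V] RI_iso[OF T.psl_isum[OF ps V]]] by blast
  moreover have "L.K.bip A (pT V) (pT V')" using p.FT_bip[OF O VO V'] pT_iT[OF AO] by simp
  ultimately show ?thesis using L.isum_iff[OF AO] p.FT_Obj[OF V'(1)] by blast
 qed
qed

lemma CC_iT:
 assumes "L.psl A" "RI (iT A)"
 shows "T.CC (iT A) = L.CC A"
proof -
 have "{gvc V |V. T.isum (iT A) V} = {gvc U |U. L.isum A U}"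
 proof (intro equalityI subsetI)
  fix g assume "g : {gvc V |V. T.isum (iT A) V}"
  then obtain V where "T.isum (iT A) V" "g = gvc (pT V)" by auto
  thus "g : {gvc U |U. L.isum A U}" using isum_iT(2)[OF assms] by blast
 next
  fix g assume "g : {gvc U |U. L.isum A U}"
  then obtain U where "L.isum A U" "g = gvc (iT U)" by auto
  thus "g : {gvc V |V. T.isum (iT A) V}" using isum_iT(1)[OF assms] by blast
 qed
 thus ?thesis by (simp add: coneP_def)
qed

lemma basc_iT:
 assumes "L.basc A" "L.psl A" "RI (iT A)"
 shows "T.basc (iT A)"
proof -
 have AO: "A : L.Obj" using assms(2) by (simp add: L.psl_def)
 have O: "iT A : T.Obj" using i.FT_Obj[OF AO] .
 obtain Ts where Ts: "ALL U:set Ts. L.indec U" "ALL i<length Ts. ALL j<length Ts. i ~= j \<longrightarrow> ~ L.K.ic (Ts!i) (Ts!j)"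
  "L.K.ic A (foldr L.dsc Ts L.zrc)" using assms(1) unfolding basicP_def by blast
 have sub: "set Ts \<subseteq> L.Obj" using Ts(1) L.indec_Obj by blast
 have fo: "foldr L.dsc Ts L.zrc : L.Obj" "iT (foldr L.dsc Ts L.zrc) = foldr T.dsc (map iT Ts) T.zrc"
  using i.FT_foldr[OF sub] by auto
 have "T.indec (iT U)" if U: "U : set Ts" for U
 proof -
  have UO: "U : L.Obj" using sub U by blast
  have r: "L.K.ret A U" using L.K.ret_trans[OF L.K.ic_ret[OF Ts(3)]] L.ret_foldr[OF U sub] by blast
  have "RI (iT U)" using RI_ret[OF i.FT_ret[OF AO UO r] O i.FT_Obj[OF UO] assms(3)] .
  thus ?thesis using indec_iT L.psl_ret[OF assms(2) r UO] Ts(1) U by blast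
 qed
 moreover have "~ T.K.ic (map iT Ts ! i) (map iT Ts ! j)" if ij: "i < length Ts" "j < length Ts" "i ~= j" for i j
 proof
  have o: "Ts ! i : L.Obj" "Ts ! j : L.Obj" using sub ij by auto
  assume "T.K.ic (map iT Ts ! i) (map iT Ts ! j)"
  hence "T.K.ic (iT (Ts ! i)) (iT (Ts ! j))" using ij by simp
  from p.FT_ic[OF i.FT_Obj[OF o(1)] i.FT_Obj[OF o(2)] this]
  show False using Ts(2) ij pT_iT[OF o(1)] pT_iT[OF o(2)] by auto
 qed
 moreover have "T.K.ic (iT A) (foldr T.dsc (map iT Ts) T.zrc)" using i.FT_ic[OF AO fo(1) Ts(3)] fo(2) by simp
 ultimately show ?thesis unfolding basicP_def using O by (intro conjI exI[of _ "map iT Ts"]) auto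
qed

lemma basc_pT:
 assumes "T.basc B" "T.psl B" "RI B"
 shows "L.basc (pT B)"
proof -
 have BO: "B : T.Obj" using assms(2) by (simp add: T.psl_def)
 obtain Ts where Ts: "ALL U:set Ts. T.indec U" "ALL i<length Ts. ALL j<length Ts. i ~= j \<longrightarrow> ~ T.K.ic (Ts!i) (Ts!j)"
  "T.K.ic B (foldr T.dsc Ts T.zrc)" using assms(1) unfolding basicP_def by blast
 have sub: "set Ts \<subseteq> T.Obj" using Ts(1) T.indec_Obj by blast
 have fo: "foldr T.dsc Ts T.zrc : T.Obj" "pT (foldr T.dsc Ts T.zrc) = foldr L.dsc (map pT Ts) L.zrc"
  using p.FT_foldr[OF sub] by auto
 have iso: "T.K.ic U (iT (pT U))" if U: "U : set Ts" for U
 proof -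
  have UO: "U : T.Obj" using sub U by blast
  have r: "T.K.ret B U" using T.K.ret_trans[OF T.K.ic_ret[OF Ts(3)]] T.ret_foldr[OF U sub] by blast
  show ?thesis using RI_iso[OF T.psl_ret[OF assms(2) r UO] RI_ret[OF r BO UO assms(3)]] .
 qed
 have "L.indec (pT U)" if "U : set Ts" for U using indec_pT[OF _ iso[OF that]] Ts(1) that by blast
 moreover have "~ L.K.ic (map pT Ts ! i) (map pT Ts ! j)" if ij: "i < length Ts" "j < length Ts" "i ~= j" for i j
 proof
  have o: "Ts ! i : T.Obj" "Ts ! j : T.Obj" "Ts ! i : set Ts" "Ts ! j : set Ts" using sub ij by auto
  assume "L.K.ic (map pT Ts ! i) (map pT Ts ! j)"
  hence "L.K.ic (pT (Ts ! i)) (pT (Ts ! j))" using ij by simp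
  from i.FT_ic[OF p.FT_Obj[OF o(1)] p.FT_Obj[OF o(2)] this]
  have "T.K.ic (Ts ! i) (Ts ! j)"
  using T.K.ic_trans[OF iso[OF o(3)]] T.K.ic_trans[OF _ T.K.ic_sym[OF iso[OF o(4)]]] by blast
  thus False using Ts(2) ij by auto
 qed
 moreover have "L.K.ic (pT B) (foldr L.dsc (map pT Ts) L.zrc)" using p.FT_ic[OF BO fo(1) Ts(3)] fo(2) by simp
 ultimately show ?thesis unfolding basicP_def using p.FT_Obj[OF BO] by (intro conjI exI[of _ "map pT Ts"]) auto
qed

lemma iLL_Obj: "iT L.LL : T.Obj" using i.FT_Obj[OF L.LL_Obj] .

text \<open>An instance of \<open>V_lift\<close>: here the elements v_j keep the old approximation
  presilting over the extension.\<close>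

lemma RI_iLL: "RI (iT L.LL)" unfolding RI_def
proof
 fix u assume "u : T.hm [1] (cT (iT L.LL))"
 hence u: "u : T.hm [1] L.R1" by (simp add: L.LL_def)
 have "pm (u * Y) = 0" using p.fm_mult[OF Y_in u] pm_Y by simp
 then obtain g where "g : T.hm [2] [2]" "pm g = 0" "im L.xc * g = u * Y"
  using V_lift[of "[2]", OF _ T.hm_comp[OF Y_in u]] by auto
 thus "EX g:T.hm [2] (cS (iT L.LL)). pm g = 0 & u * Y = cD (iT L.LL) * g" by (auto simp: L.LL_def)
qed

lemma psl_iLL: "T.psl (iT L.LL)" and indec_iLL: "T.indec (iT L.LL)"
 using psl_iT[OF L.psl_LL RI_iLL] indec_iT[OF L.indec_LL L.psl_LL RI_iLL] .

lemma gvc_iLL: "gvc (iT L.LL) = (real l, -1)" using L.gvc_LL by simp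

text \<open>A map from P_2 to P_1^(l+1) is treated in three parts: its reduction factors through
  \<open>L.xc\<close>, the first l rows of the remainder lift by \<open>V_lift\<close>, and the last
  row is \<open>Y * im q\<close>, which the last row of \<open>T.xc\<close> reaches.\<close>

lemma hz_iLL_LL: "T.hz (iT L.LL) T.LL" unfolding T.hz_def
proof
 have xin: "im L.xc : T.hm [2] L.R1" using i.fm_in[OF L.xc_in] .
 fix f assume "f : T.hm (cS (iT L.LL)) (cT T.LL)"
 hence f: "f : T.hm [2] T.R1" by (simp add: L.LL_def T.LL_def)
 obtain alp where alp: "alp : L.hm L.R1 T.R1" "pm f = alp * L.xc"
  using L.gen_mat[OF T.set_R1 p.fm_in[OF f]] by blast
 define w where "w = f - im alp * im L.xc"
 have ia: "im alp * im L.xc : T.hm [2] T.R1" using T.hm_comp[OF xin i.fm_in[OF alp(1)]] .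
 have w: "w : T.hm [2] T.R1" "pm w = 0"
  using T.hm_minus[OF f ia] p.fm_minus[OF f ia] p.fm_mult[OF xin i.fm_in[OF alp(1)]] alp(2)
  pm_im[OF L.xc_in] pm_im[OF alp(1)] by (auto simp: w_def)
 have pr: "T.ob L.R1 : T.hm T.R1 L.R1" "T.shd l [1] : T.hm T.R1 [1]" "T.shu l [1] : T.hm [1] T.R1"
  "T.ob L.R1 : T.hm L.R1 T.R1"
  unfolding R1_Suc using T.ob_inr T.ob_inl T.shd_in[of L.R1 "[1]"] T.shu_in[of L.R1 "[1]"] by auto
 have sum1: "T.ob L.R1 + T.shu l [1] * T.shd l [1] = T.ob T.R1"
  unfolding R1_Suc using T.ob_append[of L.R1 "[1]"] by simp
 have "pm (T.shd l [1] * w) = 0" using p.fm_mult[OF w(1) pr(2)] w(2) by simp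
 from W_row[OF T.hm_comp[OF w(1) pr(2)] _ this]
 obtain q where q: "q : L.hm [2] [2]" "T.shd l [1] * w = Y * im q" by auto
 have iq: "im q : T.hm [2] [2]" using i.fm_in[OF q(1)] .
 have "pm (T.ob L.R1 * w) = 0" using p.fm_mult[OF w(1) pr(1)] w(2) by simp
 from V_lift[OF _ T.hm_comp[OF w(1) pr(1)] this]
 obtain g where g: "g : T.hm [2] [2]" "pm g = 0" "im L.xc * g = T.ob L.R1 * w" by auto
 \<comment> \<open>Composing \<open>T.xc\<close> with \<open>im q\<close> also produces entries in
   the first l rows; \<open>bet\<close> writes them as a multiple of \<open>L.xc\<close>, to be
   subtracted in \<open>?b\<close>.\<close>
 obtain bet where bet: "bet : L.hm L.R1 L.R1" "L.xc * q = bet * L.xc"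
  using L.gen_mat[OF L.set_R1 L.hm_comp[OF q(1) L.xc_in]] by blast
 have xq: "im L.xc * im q = im bet * im L.xc"
  using i.fm_mult[OF q(1) L.xc_in] i.fm_mult[OF L.xc_in bet(1)] bet(2) by simp
 have Yg: "Y * g = 0" using W_mult[OF g(1) Y_in g(2) pm_Y] .
 let ?a = "g + im q" and ?b = "im alp - T.ob L.R1 * im bet"
 have "w = T.ob L.R1 * w + T.shu l [1] * (T.shd l [1] * w)"
 proof -
  have "w = (T.ob L.R1 + T.shu l [1] * T.shd l [1]) * w" using sum1 T.hm_l[OF w(1)] by simp
  thus ?thesis by (simp add: distrib_right mult.assoc)
 qed
 also have "... = T.xc * ?a - im bet * im L.xc"
  unfolding q(2) g(3)[symmetric] xc_split by (simp add: algebra_simps Yg xq)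
 also have "im bet * im L.xc = T.ob L.R1 * im bet * im L.xc" using T.hm_l[OF i.fm_in[OF bet(1)]] by simp
 finally have "f = T.xc * ?a + ?b * im L.xc" by (simp add: w_def algebra_simps)
 moreover have "?a : T.hm [2] [2]" using T.hm_add[OF g(1) iq] .
 moreover have "?b : T.hm L.R1 T.R1"
  using T.hm_minus[OF i.fm_in[OF alp(1)] T.hm_comp[OF i.fm_in[OF bet(1)] pr(4)]] .
 ultimately show "EX a:T.hm (cS (iT L.LL)) (cS T.LL). EX b:T.hm (cT (iT L.LL)) (cT T.LL).
  f = cD T.LL * a + b * cD (iT L.LL)" by (auto simp: L.LL_def T.LL_def)
qed

text \<open>Otherwise \<open>Y\<close> would be a combination of the old generators, although its
  coordinate at the new generator is 1.\<close>

lemma not_hz_iLL_PP1: "~ T.hz (iT L.LL) (T.PP 1)"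
proof
 assume "T.hz (iT L.LL) (T.PP 1)"
 then obtain b where b: "b : T.hm L.R1 [1]" "Y = b * im L.xc"
  using Y_in unfolding T.hz_def L.LL_def T.PP_def by auto
 have b': "b : T.hm T.R1 [1]" unfolding R1_Suc using T.hm_ext(1)[OF b(1)] .
 have "b * T.shu l [1] = 0" using T.cross_zero(1)[OF b(1), of "[1]"] by simp
 hence "b * T.xc = b * im L.xc" by (simp add: xc_split distrib_left flip: mult.assoc)
 hence "Y = b * T.xc" using b(2) by simp
 hence "ka' l (ent Y 0 0) = T.cx 1 b 0 l" using T.ka_row[OF b', of l] by simp
 moreover have "ka' l (ent Y 0 0) = 1" using T.ka_x[of l l] x_y by (simp add: ent_Y)
 moreover have "T.cx 1 b 0 l = 0" using T.cx_out[OF _ b(1), of 1 0 l] by simp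
 ultimately show False by simp
qed

lemma not_hz_iLL_PP2: "~ T.hz (iT L.LL) (T.PP 2)"
proof
 assume "T.hz (iT L.LL) (T.PP 2)"
 then obtain b where b: "b : T.hm L.R1 [2]" "T.ob [2] = b * im L.xc"
  using T.ob_in[of "[2]"] unfolding T.hz_def L.LL_def T.PP_def by auto
 have "b = 0" using T.hm_1_2[OF b(1) L.set_R1] by simp
 thus False using b(2) T.ob1_nz[of 2] by simp
qed

text \<open>The candidates are P_1, P_2, the old and the new approximation. The old one is
  compatible with neither projective and the new one not with P_2, which leaves three pairs.\<close>

lemma CC_hz_pT:
 assumes B: "T.psl B" "L.hz (pT B) (L.PP 1)"
 shows "EX X. T.CC B = convex_cone hull X & (X \<subseteq> {(1, 0), (0, 1)} \<or> X \<subseteq> {(1, 0), (real (Suc l), -1)} \<or>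
  X \<subseteq> {(real l, -1), (real (Suc l), -1)})"
proof (intro exI conjI)
 let ?X = "{gvc U | U. T.isum B U}"
 show "T.CC B = convex_cone hull ?X" by (simp add: coneP_def)
 have BO: "B : T.Obj" using B(1) by (simp add: T.psl_def)
 have cases: "T.K.ic U (T.PP 1) | T.K.ic U (T.PP 2) | T.K.ic U (iT L.LL) | T.K.ic U T.LL" if U: "T.isum B U" for U
 proof (rule hz_pT_cases[OF T.isum_is_indec[OF U] T.psl_isum[OF B(1) U]])
  have UO: "U : T.Obj" using T.isum_Obj[OF U] .
  show "L.hz (pT U) (L.PP 1)"
  using L.hz_ret[OF p.FT_ret[OF BO UO T.isum_ret[OF BO U]] L.K.ic_ret[OF L.K.ic_refl] B(2)
  p.FT_Obj[OF BO] L.PP_in p.FT_Obj[OF UO] L.PP_in] L.PP_in[of 1] by auto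
 qed
 have g: "T.K.ic U (T.PP 1) ==> gvc U = (1, 0)" "T.K.ic U (T.PP 2) ==> gvc U = (0, 1)"
  "T.K.ic U (iT L.LL) ==> gvc U = (real l, -1)" "T.K.ic U T.LL ==> gvc U = (real (Suc l), -1)"
  if "T.isum B U" for U
  using T.gvc_ic[OF T.isum_Obj[OF that] T.PP_in[of 1]] T.gvc_ic[OF T.isum_Obj[OF that] T.PP_in[of 2]]
  T.gvc_ic[OF T.isum_Obj[OF that] T.LL_Obj] T.gvc_ic[OF T.isum_Obj[OF that] iLL_Obj]
  T.gvc_PP T.gvc_LL gvc_iLL by auto
 have no: False if "T.isum B U" "T.isum B V" "T.K.ic U (iT L.LL)" "T.K.ic V (T.PP i)" "i : {1, 2}" for U V i
 proof -
  have "T.hz (iT L.LL) (T.PP i)"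
  using T.hz_ic[OF T.isum_Obj[OF that(1)] T.isum_Obj[OF that(2)] iLL_Obj T.PP_in[OF that(5)] that(3,4)
  T.hz_isum[OF B(1) that(1,2)]] .
  thus False using that(5) not_hz_iLL_PP1 not_hz_iLL_PP2 by blast
 qed
 show "?X \<subseteq> {(1, 0), (0, 1)} \<or> ?X \<subseteq> {(1, 0), (real (Suc l), -1)} \<or> ?X \<subseteq> {(real l, -1), (real (Suc l), -1)}"
 proof (cases "EX U. T.isum B U & T.K.ic U (iT L.LL)")
  case True
  then obtain V where V: "T.isum B V" "T.K.ic V (iT L.LL)" by blast
  have "gvc U : {(real l, -1), (real (Suc l), -1)}" if U: "T.isum B U" for U
  using cases[OF U] g(3,4)[OF U] no[OF V(1) U V(2), of 1] no[OF V(1) U V(2), of 2] by blast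
  thus ?thesis by blast
 next
  case noL: False
  show ?thesis
  proof (cases "EX U. T.isum B U & T.K.ic U T.LL")
  case True
  then obtain V where V: "T.isum B V" "T.K.ic V T.LL" by blast
  have "gvc U : {(1, 0), (real (Suc l), -1)}" if U: "T.isum B U" for U
  using cases[OF U] g(1,4)[OF U] noL U T.isum_not_PP2_LL[OF B(1) U _ V] by blast
  thus ?thesis by blast
  next
  case False
  have "gvc U : {(1, 0), (0, 1)}" if U: "T.isum B U" for U using cases[OF U] g(1,2)[OF U] noL False U by blast
  thus ?thesis by blast
  qed
 qed
qed

abbreviation "\<sigma> \<equiv> convex_cone hull {(1, 0), (real l, -1)}"

lemma sigma_mem: "(1, 0) : \<sigma>" "(real l, -1) : \<sigma>" by (auto intro: hull_inc)

text \<open>Suppose the cone comes from \<open>B\<close>. If the summands of \<open>B\<close> are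
  among the four known complexes, a half-plane misses one edge of the cone. If \<open>B\<close>
  satisfies \<open>RI\<close>, no generator lies on the ray of (1, 0): a minimal complex with such a
  g-vector is zero in degree -1 and has P_1 in degree 0, so \<open>RI\<close> would give
  \<open>Y = 0\<close>.\<close>

lemma sigma_not_SF: "\<sigma> ~: T.SF"
proof
 assume "\<sigma> : T.SF"
 then obtain B where B: "T.basc B" "T.psl B" "\<sigma> = T.CC B" unfolding SFP_def by blast
 have BO: "B : T.Obj" using B(2) by (simp add: T.psl_def)
 show False
 proof (cases "L.hz (pT B) (L.PP 1)")
  case True
  obtain X where X: "T.CC B = convex_cone hull X" "X \<subseteq> {(1, 0), (0, 1)} \<or> X \<subseteq> {(1, 0), (real (Suc l), -1)} \<or>
  X \<subseteq> {(real l, -1), (real (Suc l), -1)}" using CC_hz_pT[OF B(2) True] by blast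
  have m: "(1, 0) : convex_cone hull X" "(real l, -1) : convex_cone hull X" using sigma_mem B(3) X(1) by auto
  from X(2) show False
  proof (elim disjE)
  assume "X \<subseteq> {(1, 0), (0, 1)}"
  hence "0 <= 0 * fst p + 1 * snd p" if "p : X" for p using that by auto
  from hull_halfplane[of X 0 1, OF this m(2)] show False by simp
  next
  assume "X \<subseteq> {(1, 0), (real (Suc l), -1)}"
  \<comment> \<open>The half-plane with (l+1, -1) on its boundary that contains (1, 0); it leaves
    out (l, -1). The next case uses the opposite half-plane, which leaves out (1, 0).\<close>
  hence "0 <= 1 * fst p + (real l + 1) * snd p" if "p : X" for p using that by auto
  from hull_halfplane[of X 1 "real l + 1", OF this m(2)] show False by simp
  next
  assume "X \<subseteq> {(real l, -1), (real (Suc l), -1)}"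
  hence "0 <= (-1) * fst p + (- real l - 1) * snd p" if "p : X" for p using that by auto
  from hull_halfplane[of X "-1" "- real l - 1", OF this m(1)] show False by simp
  qed
 next
  case False
  hence R: "RI B" using RI_or_hz[OF psl_pT[OF B(2)]] RI_iT_pT[OF BO] by blast
  let ?X = "{gvc U | U. T.isum B U}"
  have hX: "\<sigma> = convex_cone hull ?X" using B(3) by (simp add: coneP_def)
  have "p = 0 | snd p < 0" if p: "p : ?X" for p
  proof (rule ccontr)
  assume a: "~ (p = 0 | snd p < 0)"
  have "p : \<sigma>" unfolding hX using p by (rule hull_inc)
  have "0 <= 0 * fst p + (-1) * snd p" by (rule hull_halfplane[OF _ \<open>p : \<sigma>\<close>]) auto
  moreover have "0 <= 1 * fst p + real l * snd p" by (rule hull_halfplane[OF _ \<open>p : \<sigma>\<close>]) auto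
  \<comment> \<open>The cone lies below the horizontal axis and meets it only in the ray of (1,
    0).\<close>
  ultimately have p2: "snd p = 0" "fst p > 0" using a by (auto simp: prod_eq_iff order_le_less)
  obtain U where U: "p = gvc U" "T.isum B U" using p by blast
  have UO: "U : T.Obj" using T.isum_Obj[OF U(2)] .
  obtain V where V: "V : T.Obj" "T.K.ic U V" "gvc V = gvc U" "T.rad V" using T.minimal_form[OF UO] by blast
  have pV: "T.psl V" using T.psl_ret[OF T.psl_isum[OF B(2) U(2)] T.K.ic_ret[OF V(2)] V(1)] .
  have RV: "RI V" using RI_ret[OF T.K.ret_trans[OF T.isum_ret[OF BO U(2)] T.K.ic_ret[OF V(2)]] BO V(1) R] .
  have dis: "count_list (cS V) i = 0 \<or> count_list (cT V) i = 0" if "i : {1, 2}" for i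
  using T.psl_rad_disjoint[OF pV V(4) that] by (auto simp: count_list_0_iff)
  have "count_list (cS V) 1 = 0" "count_list (cT V) 1 > 0" "count_list (cS V) 2 = 0"
  using dis[of 1] dis[of 2] p2 V(3) U(1) by (auto simp: gvc_def)
  hence ns: "1 ~: set (cS V)" "2 ~: set (cS V)" and one: "1 : set (cT V)"
  using count_list_0_iff[of "cS V" 1] count_list_0_iff[of "cS V" 2] count_list_0_iff[of "cT V" 1] by auto
  have "set (cS V) \<subseteq> {1, 2}" using V(1) by (simp add: T.Obj_def is_proj_def)
  hence "set (cS V) = {}" using ns by (intro equals0I) (metis insertE singletonD subsetD)
  obtain r where r: "r < length (cT V)" "cT V ! r = 1" using one by (auto simp: in_set_conv_nth)
  have su: "T.shu r [1] : T.hm [1] (cT V)" "T.shd r [1] : T.hm (cT V) [1]"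
  using T.inc_in[OF r(1)] T.prj_in[OF r(1)] r(2) by simp_all
  obtain g where g: "g : T.hm [2] (cS V)" "T.shu r [1] * Y = cD V * g" using RV su(1) unfolding RI_def by blast
  have "g = 0" using g(1) \<open>set (cS V) = {}\<close> by (simp add: T.hm_Nil2)
  hence "T.shd r [1] * (T.shu r [1] * Y) = 0" using g(2) by simp
  hence "Y = 0" using T.hm_l[OF Y_in] T.shd_shu by (simp flip: mult.assoc)
  hence "y = 0" using ent_Y[of 0 0] by simp
  thus False using T.ka_x[of l l] x_y T.ka_zero by simp
  qed
  hence "(1, 0) = (0 :: real \<times> real) | snd (1 :: real, 0 :: real) < 0"
  using hull_lower[of ?X "(1, 0)"] sigma_mem(1) hX by blast
  thus False by (simp add: zero_prod_def)
 qed
qed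

lemma SF_iLL_LL: "convex_cone hull {(real l, -1), (real (Suc l), -1)} : T.SF"
proof -
 let ?D = "T.dsc (iT L.LL) T.LL"
 have D: "T.psl ?D"
  using T.psl_dsc[OF psl_iLL T.psl_LL hz_iLL_LL] T.hz_LL_any[of "iT L.LL"] L.set_R1 by (simp add: L.LL_def)
 have ne: "~ T.K.ic (iT L.LL) T.LL" using T.gvc_ic[OF iLL_Obj T.LL_Obj] gvc_iLL T.gvc_LL by auto
 have s: "T.isum ?D (iT L.LL)" "T.isum ?D T.LL"
  using T.isum_dsc(1)[OF indec_iLL T.LL_Obj] T.isum_dsc(2)[OF T.indec_LL iLL_Obj] .
 have DO: "?D : T.Obj" using D by (simp add: T.psl_def)
 have bpD: "L.K.bip (pT ?D) L.LL (pT T.LL)"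
  using p.FT_bip[OF DO iLL_Obj T.LL_Obj T.K.bip_ds[OF iLL_Obj T.LL_Obj]] pT_iT[OF L.LL_Obj] by simp
 have "gvc U : {gvc (iT L.LL), gvc T.LL}" if U: "T.isum ?D U" for U
 proof -
  have UO: "U : T.Obj" using T.isum_Obj[OF U] .
  have "L.hz (pT T.LL) (L.PP 1)" unfolding L.hz_def
  proof
  fix f assume "f : L.hm (cS (pT T.LL)) (cT (L.PP 1))"
  hence f: "f : L.hm [2] [1]" by (simp add: T.LL_def L.PP_def)
  obtain alp where a: "alp : T.hm T.R1 [1]" "im f = alp * T.xc" using T.gen_mat[OF _ i.fm_in[OF f]] by auto
  have "f = pm alp * pm T.xc" using a(2) pm_im[OF f] p.fm_mult[OF T.xc_in a(1)] by simp
  thus "EX a:L.hm (cS (pT T.LL)) (cS (L.PP 1)). EX b:L.hm (cT (pT T.LL)) (cT (L.PP 1)).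
  f = cD (L.PP 1) * a + b * cD (pT T.LL)" using p.fm_in[OF a(1)] L.hm_zero by (auto simp: T.LL_def L.PP_def)
  qed
  hence "L.hz (pT ?D) (L.PP 1)"
  using L.hz_dsc_l[OF L.LL_Obj p.FT_Obj[OF T.LL_Obj] L.hz_LL_PP1] p.FT_dsc[OF iLL_Obj T.LL_Obj] pT_iT[OF L.LL_Obj]
  by simp
  hence "L.hz (pT U) (L.PP 1)"
  using L.hz_ret[OF p.FT_ret[OF DO UO T.isum_ret[OF DO U]] L.K.ic_ret[OF L.K.ic_refl] _
  p.FT_Obj[OF DO] L.PP_in p.FT_Obj[OF UO] L.PP_in] L.PP_in[of 1] by auto
  hence c: "T.K.ic U (T.PP 1) | T.K.ic U (T.PP 2) | T.K.ic U (iT L.LL) | T.K.ic U T.LL"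
  using hz_pT_cases[OF T.isum_is_indec[OF U] T.psl_isum[OF D U]] by blast
  have "~ T.K.ic U (T.PP i)" if "i : {1, 2}" for i
  proof
  assume a: "T.K.ic U (T.PP i)"
  have "T.hz (iT L.LL) (T.PP i)"
  using T.hz_ic[OF iLL_Obj UO iLL_Obj T.PP_in[OF that] T.K.ic_refl[OF iLL_Obj] a T.hz_isum[OF D s(1) U]] .
  thus False using that not_hz_iLL_PP1 not_hz_iLL_PP2 by blast
  qed
  thus ?thesis using c T.gvc_ic[OF UO iLL_Obj] T.gvc_ic[OF UO T.LL_Obj] by blast
 qed
 from T.SF_pair[OF indec_iLL T.indec_LL ne D this] show ?thesis using gvc_iLL T.gvc_LL by simp
qed

text \<open>Complexes with \<open>RI\<close> have the same cones over both algebras. The remaining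
  cones are spanned by subsets of explicit pairs of rays, so the comparison is reduced to finitely
  many cones.\<close>

theorem SF_extension:
 "T.SF = (L.SF - {\<sigma>}) \<union> {convex_cone hull {(real (Suc l), -1)},
  convex_cone hull {(1, 0), (real (Suc l), -1)}, convex_cone hull {(real l, -1), (real (Suc l), -1)}}"
 (is "_ = _ \<union> ?new")
proof (intro equalityI subsetI)
 fix c assume c: "c : T.SF"
 then obtain B where B: "T.basc B" "T.psl B" "c = T.CC B" unfolding SFP_def by blast
 have BO: "B : T.Obj" using B(2) by (simp add: T.psl_def)
 have "c : L.SF \<union> ?new"
 proof (cases "L.hz (pT B) (L.PP 1)")
  case True
  obtain X where X: "c = convex_cone hull X" "X \<subseteq> {(1, 0), (0, 1)} \<or> X \<subseteq> {(1, 0), (real (Suc l), -1)} \<or>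
  X \<subseteq> {(real l, -1), (real (Suc l), -1)}" using CC_hz_pT[OF B(2) True] B(3) by blast
  have m: "convex_cone hull {} : L.SF \<union> ?new" "convex_cone hull {(real l, -1)} : L.SF \<union> ?new"
  "convex_cone hull {(1, 0)} : L.SF \<union> ?new" "convex_cone hull {(0, 1)} : L.SF \<union> ?new"
  "convex_cone hull {(1, 0), (0, 1)} : L.SF \<union> ?new" using L.SF_zero L.SF_PP L.SF_LL by auto
  from X(2) show ?thesis unfolding X(1) by (elim disjE; elim hull_subset_pair; (intro m)?; simp)
 next
  case False
  hence R: "RI B" "RI (iT (pT B))" using RI_or_hz[OF psl_pT[OF B(2)]] RI_iT_pT[OF BO] by blast+
  have "T.CC B = T.CC (iT (pT B))" using T.CC_ic[OF BO i.FT_Obj[OF p.FT_Obj[OF BO]] RI_iso[OF B(2) R(1)]] .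
  hence "c = L.CC (pT B)" using B(3) CC_iT[OF psl_pT[OF B(2)] R(2)] by simp
  hence "c : L.SF" unfolding SFP_def using basc_pT[OF B(1,2) R(1)] psl_pT[OF B(2)] by blast
  thus ?thesis by blast
 qed
 thus "c : (L.SF - {\<sigma>}) \<union> ?new" using sigma_not_SF c by blast
next
 fix c assume "c : (L.SF - {\<sigma>}) \<union> ?new"
 thus "c : T.SF"
 proof
  assume c: "c : L.SF - {\<sigma>}"
  then obtain A where A: "L.basc A" "L.psl A" "c = L.CC A" unfolding SFP_def by blast
  from RI_or_hz[OF A(2)] show ?thesis
  proof
  assume R: "RI (iT A)"
  have "c = T.CC (iT A)" using CC_iT[OF A(2) R] A(3) by simp
  thus ?thesis unfolding SFP_def using basc_iT[OF A(1,2) R] psl_iT[OF A(2) R] by blast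
  next
  assume "L.hz A (L.PP 1)"
  then obtain X where X: "c = convex_cone hull X" "X \<subseteq> {(1, 0), (0, 1)} \<or> X \<subseteq> {(1, 0), (real l, -1)}"
  using L.CC_hz_PP1[OF A(2)] A(3) by blast
  have ne: "X ~= {(1, 0), (real l, -1)}" using X(1) c by blast
  have m: "convex_cone hull {} : T.SF" "convex_cone hull {(real l, -1)} : T.SF"
  "convex_cone hull {(1, 0)} : T.SF" "convex_cone hull {(0, 1)} : T.SF"
  "convex_cone hull {(1, 0), (0, 1)} : T.SF"
  using T.SF_zero T.SF_PP T.SF_single[OF indec_iLL psl_iLL] gvc_iLL by auto
  from X(2) show ?thesis
  proof
  assume "X \<subseteq> {(1, 0), (0, 1)}"
  thus ?thesis unfolding X(1) by (rule hull_subset_pair) (rule m)+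
  next
  assume "X \<subseteq> {(1, 0), (real l, -1)}"
  thus ?thesis unfolding X(1) by (rule hull_subset_pair) (use m ne in blast)+
  qed
  qed
 next
  assume "c : ?new"
  thus ?thesis using T.SF_LL T.SF_PP1_LL SF_iLL_LL by blast
 qed
qed

end

section \<open>Matrices over an algebra with a faithful representation\<close>

locale kalg_loc =
 fixes L :: "('k::field, 'a) kalg"
 assumes kalg: "kalgebra L"
begin

lemma zero_in: "azero L : acar L" and one_in: "aone L : acar L" using kalg unfolding kalgebra_def by blast+

lemma add_in: "x : acar L ==> y : acar L ==> aadd L x y : acar L"
 and mul_in: "x : acar L ==> y : acar L ==> amul L x y : acar L" and smul_in: "x : acar L ==> asmul L c x : acar L"
 using kalg unfolding kalgebra_def by blast+

lemma mul_assoc: "x : acar L ==> y : acar L ==> z : acar L ==>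
  amul L (amul L x y) z = amul L x (amul L y z)" and add_assoc: "x : acar L ==> y : acar L ==> z : acar L ==>
  aadd L (aadd L x y) z = aadd L x (aadd L y z)" and mul_add: "x : acar L ==> y : acar L ==> z : acar L ==>
  amul L x (aadd L y z) = aadd L (amul L x y) (amul L x z)"
 and add_mul: "x : acar L ==> y : acar L ==> z : acar L ==>
  amul L (aadd L x y) z = aadd L (amul L x z) (amul L y z)" using kalg unfolding kalgebra_def by blast+

lemma add_comm: "x : acar L ==> y : acar L ==> aadd L x y = aadd L y x"
 and add_zero: "x : acar L ==> aadd L (azero L) x = x" and one_mul: "x : acar L ==> amul L (aone L) x = x"
 and mul_one: "x : acar L ==> amul L x (aone L) = x" and neg_ex: "x : acar L ==> EX y:acar L. aadd L x y = azero L"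
 using kalg unfolding kalgebra_def by blast+

lemma smul_add: "x : acar L ==> y : acar L ==> asmul L c (aadd L x y) = aadd L (asmul L c x) (asmul L c y)"
 and add_smul: "x : acar L ==> asmul L (c + d) x = aadd L (asmul L c x) (asmul L d x)"
 and smul_smul: "x : acar L ==> asmul L (c * d) x = asmul L c (asmul L d x)"
 and smul_mul_l: "x : acar L ==> y : acar L ==> asmul L c (amul L x y) = amul L (asmul L c x) y"
 and smul_mul_r: "x : acar L ==> y : acar L ==> asmul L c (amul L x y) = amul L x (asmul L c y)"
 and one_smul: "x : acar L ==> asmul L 1 x = x" using kalg unfolding kalgebra_def by blast+

lemma add_cancel:
 assumes "x : acar L" "y : acar L" "z : acar L" "aadd L x y = aadd L x z"
 shows "y = z"
proof -
 obtain n where n: "n : acar L" "aadd L x n = azero L" using neg_ex[OF assms(1)] by blast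
 have *: "aadd L n (aadd L x w) = w" if "w : acar L" for w
  using add_assoc[OF n(1) assms(1) that] add_comm[OF n(1) assms(1)] n(2) add_zero[OF that] by simp
 show ?thesis by (rule trans[OF *[OF assms(2), symmetric]]) (simp only: assms(4) *[OF assms(3)])
qed

lemma smul_zero: "asmul L c (azero L) = azero L"
proof (rule add_cancel[OF smul_in[OF zero_in] smul_in[OF zero_in] zero_in])
 show "aadd L (asmul L c (azero L)) (asmul L c (azero L)) = aadd L (asmul L c (azero L)) (azero L)"
  using smul_add[OF zero_in zero_in, of c] add_zero[OF zero_in] add_comm[OF smul_in[OF zero_in] zero_in]
  add_zero[OF smul_in[OF zero_in]] by simp
qed

lemma zero_smul: assumes "x : acar L" shows "asmul L 0 x = azero L"
proof (rule add_cancel[OF smul_in[OF assms] smul_in[OF assms] zero_in])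
 show "aadd L (asmul L 0 x) (asmul L 0 x) = aadd L (asmul L 0 x) (azero L)"
  using add_smul[OF assms, of 0 0] add_comm[OF smul_in[OF assms] zero_in] add_zero[OF smul_in[OF assms]] by simp
qed

lemma mul_zero: assumes "x : acar L" shows "amul L x (azero L) = azero L"
 using smul_mul_r[OF assms zero_in, of 0] zero_smul[OF zero_in] zero_smul[OF mul_in[OF assms zero_in]] by simp

lemma zero_mul: assumes "x : acar L" shows "amul L (azero L) x = azero L"
 using smul_mul_l[OF zero_in assms, of 0] zero_smul[OF zero_in] zero_smul[OF mul_in[OF zero_in assms]] by simp

lemma asum_in: "(!!i. i < n ==> f i : acar L) ==> asum L f n : acar L" by (induction n) (auto simp: zero_in add_in)

end

text \<open>A faithful representation turns the operations of the record into those of a type of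
  class \<open>ring\<close>, where the preceding theory applies.\<close>

locale rawrep = kalg_loc L for L :: "('k::field, 'a) kalg" +
 fixes e :: "nat => 'a" and rp :: "'a => 'r::ring"
 assumes rp_add: "x : acar L ==> y : acar L ==> rp (aadd L x y) = rp x + rp y"
  and rp_mul: "x : acar L ==> y : acar L ==> rp (amul L x y) = rp x * rp y" and rp_inj: "inj_on rp (acar L)"
  and e_in: "i : {1, 2} ==> e i : acar L" and e_idem: "i : {1, 2} ==> amul L (e i) (e i) = e i"
begin

lemma rp_zero: "rp (azero L) = 0" using rp_add[OF zero_in zero_in] add_zero[OF zero_in] by simp

definition SS :: "'r set" where "SS = rp ` acar L"

definition ee :: "nat => 'r" where "ee i = (if i : {1, 2} then rp (e i) else 0)"

sublocale peirce SS ee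
proof
 fix x y assume x: "x : SS" and y: "y : SS"
 obtain a where a: "a : acar L" "x = rp a" using x unfolding SS_def by blast
 obtain b where b: "b : acar L" "y = rp b" using y unfolding SS_def by blast
 show "x + y : SS" using rp_add[OF a(1) b(1)] add_in[OF a(1) b(1)] a b unfolding SS_def by (metis imageI)
 show "x * y : SS" using rp_mul[OF a(1) b(1)] mul_in[OF a(1) b(1)] a b unfolding SS_def by (metis imageI)
 obtain b where b: "b : acar L" "aadd L a b = azero L" using neg_ex[OF a(1)] by blast
 have "x + rp b = 0" using rp_add[OF a(1) b(1)] rp_zero a(2) b(2) by simp
 hence "- x = rp b" by (rule minus_unique)
 thus "- x : SS" using b(1) unfolding SS_def by blast
next
 show "ee i : SS" for i using e_in[of i] zero_in rp_zero unfolding ee_def SS_def by (metis image_eqI)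
 show "ee i * ee i = ee i" for i using rp_mul[OF e_in[of i] e_in[of i]] e_idem[of i] by (auto simp: ee_def)
qed

text \<open>Entries outside the range are set to 0. Raw maps are compared by \<open>meq\<close>
  within the range only, and this normalisation makes \<open>meq\<close> an equality.\<close>

definition mt :: "nat list => nat list => 'a mat => 'r fmat" where
 "mt P Q M = Fmat (%r c. if r < length Q & c < length P then rp (M r c) else 0)"

lemma ent_mt: "ent (mt P Q M) r c = (if r < length Q & c < length P then rp (M r c) else 0)" unfolding mt_def
 by (rule ent_Fmat[of _ "length P + length Q", THEN fun_cong, THEN fun_cong]) (auto split: if_splits)

definition amat :: "nat list => nat list => 'a mat => bool" where
 "amat P Q M \<longleftrightarrow> (ALL r<length Q. ALL c<length P. M r c : acar L)"

lemma is_map_amat: "is_map L e P Q M ==> amat P Q M" by (simp add: is_map_def amat_def)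

lemma meq_iff: assumes "amat P Q M" "amat P Q N" shows "meq P Q M N \<longleftrightarrow> mt P Q M = mt P Q N"
proof
 assume "meq P Q M N"
 thus "mt P Q M = mt P Q N" by (intro fmat_eqI) (auto simp: ent_mt meq_def)
next
 assume h: "mt P Q M = mt P Q N"
 show "meq P Q M N" unfolding meq_def
 proof (intro allI impI)
  fix r c assume rc: "r < length Q" "c < length P"
  have "rp (M r c) = rp (N r c)" using arg_cong[OF h, of "%X. ent X r c"] rc by (simp add: ent_mt)
  thus "M r c = N r c" using rp_inj assms rc unfolding amat_def inj_on_def by blast
 qed
qed

lemma proj_nth: "is_proj P ==> r < length P ==> P ! r : {1, 2}" unfolding is_proj_def using nth_mem by blast

lemma mt_in:
 assumes "is_proj P" "is_proj Q" "is_map L e P Q M"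
 shows "mt P Q M : hm P Q" unfolding hm_iff
proof (intro allI)
 fix r c
 show "ent (mt P Q M) r c : SS & dia Q r * ent (mt P Q M) r c = ent (mt P Q M) r c &
  ent (mt P Q M) r c * dia P c = ent (mt P Q M) r c"
 proof (cases "r < length Q & c < length P")
  case True
  let ?m = "M r c" and ?a = "e (Q ! r)" and ?b = "e (P ! c)"
  have m: "?m : acar L" "amul L (amul L ?a ?m) ?b = ?m" using assms(3) True by (auto simp: is_map_def)
  have p: "Q ! r : {1, 2}" "P ! c : {1, 2}" using proj_nth assms True by auto
  note ab = e_in[OF p(1)] e_in[OF p(2)]
  have rm: "rp ?m = rp ?a * rp ?m * rp ?b"
  using rp_mul[OF mul_in[OF ab(1) m(1)] ab(2)] rp_mul[OF ab(1) m(1)] m(2) by simp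
  have i: "rp ?a * rp ?a = rp ?a" "rp ?b * rp ?b = rp ?b"
  using rp_mul[OF ab(1,1)] rp_mul[OF ab(2,2)] e_idem p by auto
  have "rp ?a * rp ?m = rp ?m"
  proof -
  have "rp ?a * rp ?m = rp ?a * (rp ?a * rp ?m * rp ?b)" using rm by simp
  also have "... = (rp ?a * rp ?a) * rp ?m * rp ?b" by (simp only: mult.assoc)
  finally show ?thesis using i rm by simp
  qed
  moreover have "rp ?m * rp ?b = rp ?m"
  proof -
  have "rp ?m * rp ?b = rp ?a * rp ?m * rp ?b * rp ?b" using rm by simp
  also have "... = rp ?a * rp ?m * (rp ?b * rp ?b)" by (simp only: mult.assoc)
  finally show ?thesis using i rm by simp
  qed
  ultimately show ?thesis using True m(1) p by (auto simp: ent_mt dia_def ee_def SS_def)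
 next
  case False
  hence "ent (mt P Q M) r c = 0" by (auto simp: ent_mt)
  thus ?thesis by (simp add: S_zero)
 qed
qed

lemma mt_surj:
 assumes "is_proj P" "is_proj Q" "N : hm P Q"
 shows "EX M. is_map L e P Q M & mt P Q M = N"
proof -
 define M where "M r c = inv_into (acar L) rp (ent N r c)" for r c
 have M: "M r c : acar L" "rp (M r c) = ent N r c" for r c using hm_S[OF assms(3), of r c] unfolding M_def SS_def
  by (simp_all add: inv_into_into f_inv_into_f)
 have "is_map L e P Q M" unfolding is_map_def
 proof (intro allI impI conjI)
  fix r c assume rc: "r < length Q" "c < length P"
  show "M r c : acar L" by (rule M)
  have p: "Q ! r : {1, 2}" "P ! c : {1, 2}" using proj_nth assms rc by auto
  have "rp (amul L (amul L (e (Q ! r)) (M r c)) (e (P ! c))) = ee (Q ! r) * ent N r c * ee (P ! c)"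
  using rp_mul[OF mul_in[OF e_in[OF p(1)] M(1)] e_in[OF p(2)]] rp_mul[OF e_in[OF p(1)] M(1)] M(2) p
  by (auto simp: ee_def)
  also have "... = rp (M r c)"
  proof -
  have "dia Q r * ent N r c = ent N r c" "ent N r c * dia P c = ent N r c"
  using assms(3) unfolding hm_iff by blast+
  thus ?thesis using rc M(2) by (simp add: dia_def)
  qed
  finally have eq: "rp (amul L (amul L (e (Q ! r)) (M r c)) (e (P ! c))) = rp (M r c)" .
  show "amul L (amul L (e (Q ! r)) (M r c)) (e (P ! c)) = M r c"
  by (rule inj_onD[OF rp_inj eq]) (intro mul_in e_in p M)+
 qed
 moreover have "mt P Q M = N"
  by (rule fmat_eqI) (use M(2) hm_out[OF assms(3)] in \<open>auto simp: ent_mt not_less\<close>)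
 ultimately show ?thesis by blast
qed

lemma rp_asum: "(!!i. i < n ==> f i : acar L) ==> rp (asum L f n) = (\<Sum>i<n. rp (f i))"
 by (induction n) (auto simp: rp_zero rp_add asum_in)

lemma amat_mcomp: "amat P Q M ==> amat Q R N ==> amat P R (mcomp L (length Q) N M)"
 unfolding amat_def mcomp_def by (auto intro!: asum_in mul_in)

lemma amat_madd: "amat P Q M ==> amat P Q N ==> amat P Q (madd L M N)"
 unfolding amat_def madd_def by (auto intro!: add_in)

lemma mt_mcomp:
 assumes "amat P Q M" "amat Q R N"
 shows "mt P R (mcomp L (length Q) N M) = mt Q R N * mt P Q M"
proof (rule fmat_eqI)
 fix r c
 have e: "ent (mt Q R N * mt P Q M) r c = (\<Sum>s<length Q. ent (mt Q R N) r s * ent (mt P Q M) s c)"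
  by (rule ent_times) (simp add: ent_mt)
 show "ent (mt P R (mcomp L (length Q) N M)) r c = ent (mt Q R N * mt P Q M) r c"
 proof (cases "r < length R & c < length P")
  case True
  have "rp (asum L (%s. amul L (N r s) (M s c)) (length Q)) = (\<Sum>s<length Q. rp (amul L (N r s) (M s c)))"
  using assms True by (intro rp_asum mul_in) (auto simp: amat_def)
  also have "... = (\<Sum>s<length Q. rp (N r s) * rp (M s c))"
  using assms True by (intro sum.cong rp_mul) (auto simp: amat_def)
  finally show ?thesis unfolding e using True by (simp add: ent_mt mcomp_def)
 next
  case False
  thus ?thesis unfolding e by (auto simp: ent_mt)
 qed
qed

lemma mt_madd: "amat P Q M ==> amat P Q N ==> mt P Q (madd L M N) = mt P Q M + mt P Q N"
 by (rule fmat_eqI) (auto simp: ent_mt madd_def amat_def rp_add)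

lemma amat_mid: "is_proj P ==> amat P P (mid L e P)" unfolding amat_def mid_def using proj_nth e_in zero_in by simp

lemma mt_mid: "is_proj P ==> mt P P (mid L e P) = ob P"
 by (rule fmat_eqI) (use proj_nth in \<open>auto simp: ent_mt mid_def ent_ob dia_def ee_def rp_zero\<close>)

section \<open>Raw complexes as objects of the homotopy category\<close>

definition Ph :: "'a cx => 'r fmat tcx" where
 "Ph T = (cs T, ct T, mt (cs T) (ct T) (cd T))"

lemma Ph_sel [simp]: "cS (Ph T) = cs T" "cT (Ph T) = ct T" "cD (Ph T) = mt (cs T) (ct T) (cd T)"
 by (simp_all add: Ph_def)

lemma valid_amat: "cx_valid L e T ==> amat (cs T) (ct T) (cd T)"
 and valid_proj: "cx_valid L e T ==> is_proj (cs T)" "cx_valid L e T ==> is_proj (ct T)"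
 by (auto simp: cx_valid_def is_map_amat)

lemma Ph_Obj: "cx_valid L e T ==> Ph T : Obj" by (simp add: Obj_def cx_valid_def mt_in)

lemma Ph_surj: assumes "T' : Obj" shows "EX T. cx_valid L e T & Ph T = T'"
proof -
 obtain P Q d where c: "T' = (P, Q, d)" by (cases T') auto
 have a: "is_proj P" "is_proj Q" "d : hm P Q" using assms by (auto simp: c Obj_def)
 obtain M where M: "is_map L e P Q M" "mt P Q M = d" using mt_surj[OF a] by blast
 show ?thesis
  by (rule exI[of _ "\<lparr>cs = P, ct = Q, cd = M\<rparr>"]) (use M a in \<open>simp add: cx_valid_def Ph_def c\<close>)
qed

lemma Ph_hz:
 assumes "cx_valid L e T" "cx_valid L e U"
 shows "hom_shift_zero L e T U \<longleftrightarrow> hz (Ph T) (Ph U)"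
proof -
 note v = valid_amat[OF assms(1)] valid_amat[OF assms(2)] valid_proj[OF assms(1)] valid_proj[OF assms(2)]
 have m: "meq (cs T) (ct U) f (madd L (mcomp L (length (cs U)) (cd U) a) (mcomp L (length (ct T)) b (cd T))) \<longleftrightarrow>
  mt (cs T) (ct U) f = mt (cs U) (ct U) (cd U) * mt (cs T) (cs U) a + mt (ct T) (ct U) b * mt (cs T) (ct T) (cd T)"
  if "is_map L e (cs T) (ct U) f" "is_map L e (cs T) (cs U) a" "is_map L e (ct T) (ct U) b" for f a b
  using v that[THEN is_map_amat] by (simp add: meq_iff amat_madd amat_mcomp mt_madd mt_mcomp)
 show ?thesis
 proof
  assume h: "hom_shift_zero L e T U"
  show "hz (Ph T) (Ph U)" unfolding hz_def
  proof
  fix f' assume "f' : hm (cS (Ph T)) (cT (Ph U))"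
  then obtain f where f: "is_map L e (cs T) (ct U) f" "mt (cs T) (ct U) f = f'" using mt_surj[OF v(3) v(6)] by auto
  then obtain a b where ab: "is_map L e (cs T) (cs U) a" "is_map L e (ct T) (ct U) b"
  "meq (cs T) (ct U) f (madd L (mcomp L (length (cs U)) (cd U) a) (mcomp L (length (ct T)) b (cd T)))"
  using h unfolding hom_shift_zero_def by blast
  have "f' = cD (Ph U) * mt (cs T) (cs U) a + mt (ct T) (ct U) b * cD (Ph T)"
  using m[OF f(1) ab(1,2)] ab(3) f(2) by simp
  thus "EX a:hm (cS (Ph T)) (cS (Ph U)). EX b:hm (cT (Ph T)) (cT (Ph U)). f' = cD (Ph U) * a + b * cD (Ph T)"
  using mt_in[OF v(3) v(5) ab(1)] mt_in[OF v(4) v(6) ab(2)] by auto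
  qed
 next
  assume h: "hz (Ph T) (Ph U)"
  show "hom_shift_zero L e T U" unfolding hom_shift_zero_def
  proof (intro allI impI)
  fix f assume f: "is_map L e (cs T) (ct U) f"
  obtain a' b' where ab': "a' : hm (cs T) (cs U)" "b' : hm (ct T) (ct U)"
  "mt (cs T) (ct U) f = cD (Ph U) * a' + b' * cD (Ph T)" using h mt_in[OF v(3) v(6) f] unfolding hz_def by auto
  obtain a where a: "is_map L e (cs T) (cs U) a" "mt (cs T) (cs U) a = a'" using mt_surj[OF v(3) v(5) ab'(1)] by blast
  obtain b where b: "is_map L e (ct T) (ct U) b" "mt (ct T) (ct U) b = b'" using mt_surj[OF v(4) v(6) ab'(2)] by blast
  show "EX a b. is_map L e (cs T) (cs U) a & is_map L e (ct T) (ct U) b &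
  meq (cs T) (ct U) f (madd L (mcomp L (length (cs U)) (cd U) a) (mcomp L (length (ct T)) b (cd T)))"
  using m[OF f a(1) b(1)] ab'(3) a b by auto
  qed
 qed
qed

lemma chain_map_iff:
 assumes "cx_valid L e T" "cx_valid L e U" "is_map L e (cs T) (cs U) f1" "is_map L e (ct T) (ct U) f2"
 shows "chain_map L e T U (f1, f2) \<longleftrightarrow> (mt (cs T) (cs U) f1, mt (ct T) (ct U) f2) : Chm (Ph T) (Ph U)"
proof -
 note v = valid_amat[OF assms(1)] valid_amat[OF assms(2)] valid_proj[OF assms(1)] valid_proj[OF assms(2)]
 note fm = assms(3,4)[THEN is_map_amat]
 show ?thesis using mt_in[OF v(3) v(5) assms(3)] mt_in[OF v(4) v(6) assms(4)] v fm assms(3,4)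
  by (simp add: chain_map_def Chm_def meq_iff amat_mcomp mt_mcomp)
qed

lemma homotopic_id_iff:
 assumes "cx_valid L e T" "cx_valid L e U" and f: "is_map L e (cs T) (cs U) f1" "is_map L e (ct T) (ct U) f2"
  and g: "is_map L e (cs U) (cs T) g1" "is_map L e (ct U) (ct T) g2"
 shows "homotopic L e T T (chain_comp L U (g1, g2) (f1, f2)) (mid L e (cs T), mid L e (ct T)) \<longleftrightarrow>
  (mt (cs U) (cs T) g1, mt (ct U) (ct T) g2) * (mt (cs T) (cs U) f1, mt (ct T) (ct U) f2) - idc (Ph T)
  : Nul (Ph T) (Ph T)" (is "?l \<longleftrightarrow> ?r")
proof -
 note v = valid_amat[OF assms(1)] valid_amat[OF assms(2)] valid_proj[OF assms(1)] valid_proj[OF assms(2)]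
 note fa = f[THEN is_map_amat] g[THEN is_map_amat]
 have *: "meq (cs T) (cs T) (mcomp L (length (cs U)) g1 f1) (madd L (mid L e (cs T)) (mcomp L (length (ct T)) h (cd T))) \<longleftrightarrow>
  mt (cs U) (cs T) g1 * mt (cs T) (cs U) f1 = ob (cs T) + mt (ct T) (cs T) h * mt (cs T) (ct T) (cd T)"
  "meq (ct T) (ct T) (mcomp L (length (ct U)) g2 f2) (madd L (mid L e (ct T)) (mcomp L (length (cs T)) (cd T) h)) \<longleftrightarrow>
  mt (ct U) (ct T) g2 * mt (ct T) (ct U) f2 = ob (ct T) + mt (cs T) (ct T) (cd T) * mt (ct T) (cs T) h"
  if "is_map L e (ct T) (cs T) h" for h using v fa is_map_amat[OF that]
  by (simp_all add: meq_iff amat_mcomp amat_madd amat_mid mt_mcomp mt_madd mt_mid)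
 have n: "?r \<longleftrightarrow> (EX h':hm (ct T) (cs T). mt (cs U) (cs T) g1 * mt (cs T) (cs U) f1 = ob (cs T) + h' * mt (cs T) (ct T) (cd T) &
  mt (ct U) (ct T) g2 * mt (ct T) (ct U) f2 = ob (ct T) + mt (cs T) (ct T) (cd T) * h')"
  unfolding Nul_def idc_def by (auto simp: algebra_simps)
 show ?thesis
 proof
  assume ?l
  then obtain h where h: "is_map L e (ct T) (cs T) h"
  "meq (cs T) (cs T) (mcomp L (length (cs U)) g1 f1) (madd L (mid L e (cs T)) (mcomp L (length (ct T)) h (cd T)))"
  "meq (ct T) (ct T) (mcomp L (length (ct U)) g2 f2) (madd L (mid L e (ct T)) (mcomp L (length (cs T)) (cd T) h))"
  unfolding homotopic_def chain_comp_def by auto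
  show ?r unfolding n using h *[OF h(1)] mt_in[OF v(4) v(3) h(1)] by blast
 next
  assume ?r
  then obtain h' where h': "h' : hm (ct T) (cs T)"
  "mt (cs U) (cs T) g1 * mt (cs T) (cs U) f1 = ob (cs T) + h' * mt (cs T) (ct T) (cd T)"
  "mt (ct U) (ct T) g2 * mt (ct T) (ct U) f2 = ob (ct T) + mt (cs T) (ct T) (cd T) * h'" unfolding n by blast
  obtain h where h: "is_map L e (ct T) (cs T) h" "mt (ct T) (cs T) h = h'" using mt_surj[OF v(4) v(3) h'(1)] by blast
  show ?l unfolding homotopic_def chain_comp_def using h *[OF h(1)] h' by auto
 qed
qed

lemma Ph_ic:
 assumes "cx_valid L e T" "cx_valid L e U"
 shows "K.ic (Ph T) (Ph U) \<longleftrightarrow> cx_iso L e T U"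
proof
 note v = valid_amat[OF assms(1)] valid_amat[OF assms(2)] valid_proj[OF assms(1)] valid_proj[OF assms(2)]
 assume "K.ic (Ph T) (Ph U)"
 then obtain f' g' where fg: "f' : Chm (Ph T) (Ph U)" "g' : Chm (Ph U) (Ph T)"
  "g' * f' - idc (Ph T) : Nul (Ph T) (Ph T)" "f' * g' - idc (Ph U) : Nul (Ph U) (Ph U)" unfolding K.ic_def by blast
 have h: "fst f' : hm (cs T) (cs U)" "snd f' : hm (ct T) (ct U)" "fst g' : hm (cs U) (cs T)" "snd g' : hm (ct U) (ct T)"
  using fg(1,2) by (auto simp: Chm_def)
 obtain f1 where f1: "is_map L e (cs T) (cs U) f1" "mt (cs T) (cs U) f1 = fst f'" using mt_surj[OF v(3) v(5) h(1)] by blast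
 obtain f2 where f2: "is_map L e (ct T) (ct U) f2" "mt (ct T) (ct U) f2 = snd f'" using mt_surj[OF v(4) v(6) h(2)] by blast
 obtain g1 where g1: "is_map L e (cs U) (cs T) g1" "mt (cs U) (cs T) g1 = fst g'" using mt_surj[OF v(5) v(3) h(3)] by blast
 obtain g2 where g2: "is_map L e (ct U) (ct T) g2" "mt (ct U) (ct T) g2 = snd g'" using mt_surj[OF v(6) v(4) h(4)] by blast
 have 1: "chain_map L e T U (f1, f2)" unfolding chain_map_iff[OF assms f1(1) f2(1)] f1(2) f2(2) using fg(1) by simp
 have 2: "chain_map L e U T (g1, g2)"
  unfolding chain_map_iff[OF assms(2,1) g1(1) g2(1)] g1(2) g2(2) using fg(2) by simp
 have 3: "homotopic L e T T (chain_comp L U (g1, g2) (f1, f2)) (mid L e (cs T), mid L e (ct T))"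
  unfolding homotopic_id_iff[OF assms f1(1) f2(1) g1(1) g2(1)] f1(2) f2(2) g1(2) g2(2) using fg(3) by simp
 have 4: "homotopic L e U U (chain_comp L T (f1, f2) (g1, g2)) (mid L e (cs U), mid L e (ct U))"
  unfolding homotopic_id_iff[OF assms(2,1) g1(1) g2(1) f1(1) f2(1)] f1(2) f2(2) g1(2) g2(2) using fg(4) by simp
 show "cx_iso L e T U" unfolding cx_iso_def using 1 2 3 4 by blast
next
 note v = valid_amat[OF assms(1)] valid_amat[OF assms(2)] valid_proj[OF assms(1)] valid_proj[OF assms(2)]
 assume "cx_iso L e T U"
 then obtain f g where fg: "chain_map L e T U f" "chain_map L e U T g"
  "homotopic L e T T (chain_comp L U g f) (mid L e (cs T), mid L e (ct T))"
  "homotopic L e U U (chain_comp L T f g) (mid L e (cs U), mid L e (ct U))" unfolding cx_iso_def by blast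
 obtain f1 f2 g1 g2 where c: "f = (f1, f2)" "g = (g1, g2)" by fastforce
 have m: "is_map L e (cs T) (cs U) f1" "is_map L e (ct T) (ct U) f2" "is_map L e (cs U) (cs T) g1" "is_map L e (ct U) (ct T) g2"
  using fg(1,2) by (auto simp: chain_map_def c)
 show "K.ic (Ph T) (Ph U)" unfolding K.ic_def
  using chain_map_iff[OF assms m(1,2)] chain_map_iff[OF assms(2,1) m(3,4)]
  homotopic_id_iff[OF assms m] homotopic_id_iff[OF assms(2,1) m(3,4,1,2)] fg unfolding c by blast
qed

lemma dsum_valid:
 assumes "cx_valid L e T" "cx_valid L e U"
 shows "cx_valid L e (dsum L T U)"
proof -
 have z: "amul L (amul L (e i) (azero L)) (e j) = azero L" if "i : {1, 2}" "j : {1, 2}" for i j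
  using mul_zero zero_mul e_in that by simp
 have p: "is_proj (cs T @ cs U)" "is_proj (ct T @ ct U)" using assms by (auto simp: cx_valid_def is_proj_def)
 have "is_map L e (cs T @ cs U) (ct T @ ct U) (cd (dsum L T U))" unfolding is_map_def
 proof (intro allI impI)
  fix r c assume rc: "r < length (ct T @ ct U)" "c < length (cs T @ cs U)"
  consider "r < length (ct T)" "c < length (cs T)" | "length (ct T) <= r" "length (cs T) <= c"
  | "r < length (ct T) \<longleftrightarrow> ~ c < length (cs T)" by linarith
  thus "cd (dsum L T U) r c : acar L &
  amul L (amul L (e ((ct T @ ct U) ! r)) (cd (dsum L T U) r c)) (e ((cs T @ cs U) ! c)) = cd (dsum L T U) r c"
  proof cases
  case 1
  thus ?thesis using assms(1) by (simp add: dsum_def nth_append cx_valid_def is_map_def)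
  next
  case 2
  thus ?thesis using assms(2) rc by (simp add: dsum_def nth_append cx_valid_def is_map_def)
  next
  case 3
  hence "cd (dsum L T U) r c = azero L" by (auto simp: dsum_def)
  thus ?thesis using z[OF proj_nth[OF p(2) rc(1)] proj_nth[OF p(1) rc(2)]] zero_in by simp
  qed
 qed
 thus ?thesis using p by (simp add: cx_valid_def dsum_def)
qed

lemma Ph_dsum:
 assumes "cx_valid L e T" "cx_valid L e U"
 shows "Ph (dsum L T U) = dsc (Ph T) (Ph U)"
proof -
 have d: "cD (Ph U) : hm (cs U) (ct U)" using ObjD[OF Ph_Obj[OF assms(2)]] by simp
 have de: "dia (ct U) r * ent (cD (Ph U)) r c = ent (cD (Ph U)) r c" "ent (cD (Ph U)) r c * dia (cs U) c = ent (cD (Ph U)) r c" for r c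
  using d unfolding hm_iff by blast+
 have "mt (cs T @ cs U) (ct T @ ct U) (cd (dsum L T U))
  = mt (cs T) (ct T) (cd T) + shu (length (ct T)) (ct U) * mt (cs U) (ct U) (cd U) * shd (length (cs T)) (cs U)"
 proof (rule fmat_eqI)
  fix r c
  have "ent (shu (length (ct T)) (ct U) * mt (cs U) (ct U) (cd U) * shd (length (cs T)) (cs U)) r c =
  (if length (cs T) <= c & length (ct T) <= r then ent (mt (cs U) (ct U) (cd U)) (r - length (ct T)) (c - length (cs T)) else 0)"
  using de by (simp add: ent_shd_r ent_shu_l)
  thus "ent (mt (cs T @ cs U) (ct T @ ct U) (cd (dsum L T U))) r c =
  ent (mt (cs T) (ct T) (cd T) + shu (length (ct T)) (ct U) * mt (cs U) (ct U) (cd U) * shd (length (cs T)) (cs U)) r c"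
  by (auto simp: ent_mt dsum_def rp_zero)
 qed
 thus ?thesis by (simp add: Ph_def dsc_def dsum_def)
qed

lemma zero_valid: "cx_valid L e (cx_zero L)" by (simp add: cx_valid_def cx_zero_def is_proj_def is_map_def)

lemma Ph_zero: "Ph (cx_zero L) = zrc" unfolding Ph_def zrc_def cx_zero_def by (auto intro: fmat_eqI simp: ent_mt)

sublocale tr: transport "Collect (cx_valid L e)" "cx_iso L e" "dsum L" "cx_zero L" Obj K.ic dsc zrc Ph
 by unfold_locales (auto simp: Ph_Obj Ph_ic dsum_valid Ph_dsum zero_valid Ph_zero dest!: Ph_surj)

end

lemma raw_notions:
 "indecomposable L e = indecP (Collect (cx_valid L e)) (cx_iso L e) (dsum L) (cx_zero L)"
 "ind_summand L e = isumP (Collect (cx_valid L e)) (cx_iso L e) (dsum L) (cx_zero L)"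
 "basic L e = basicP (Collect (cx_valid L e)) (cx_iso L e) (dsum L) (cx_zero L)"
 "Ccone L e = coneP (Collect (cx_valid L e)) (cx_iso L e) (dsum L) (cx_zero L) gvec"
 "SigmaFan L e = SFP (Collect (cx_valid L e)) (cx_iso L e) (dsum L) (cx_zero L) (presilting L e) gvec"
proof -
 show 1: "indecomposable L e = indecP (Collect (cx_valid L e)) (cx_iso L e) (dsum L) (cx_zero L)"
  by (intro ext) (simp add: indecomposable_def indecP_def)
 show 2: "ind_summand L e = isumP (Collect (cx_valid L e)) (cx_iso L e) (dsum L) (cx_zero L)"
  by (intro ext) (simp add: ind_summand_def isumP_def 1)
 show 3: "basic L e = basicP (Collect (cx_valid L e)) (cx_iso L e) (dsum L) (cx_zero L)"
  by (intro ext) (simp add: basic_def basicP_def 1)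
 show 4: "Ccone L e = coneP (Collect (cx_valid L e)) (cx_iso L e) (dsum L) (cx_zero L) gvec"
  by (intro ext) (simp add: Ccone_def coneP_def 2)
 show "SigmaFan L e = SFP (Collect (cx_valid L e)) (cx_iso L e) (dsum L) (cx_zero L) (presilting L e) gvec"
  by (simp add: SigmaFan_def SFP_def 3 4)
qed

context rawrep
begin

lemma gvc_Ph: "gvc (Ph T) = gvec T" by (simp add: gvc_def gvec_def)

lemma linear_id_plane: "linear (id :: real \<times> real => real \<times> real)" by (rule linearI) simp_all

lemma Ccone_Ph: "cx_valid L e T ==> Ccone L e T = coneP Obj K.ic dsc zrc gvc (Ph T)"
 using tr.Phi_cone[of T gvc id gvec] gvc_Ph by (simp add: raw_notions linear_id_plane)

lemma SigmaFan_eq: "SigmaFan L e = SFP Obj K.ic dsc zrc (%T. T : Obj & hz T T) gvc"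
 using tr.Phi_SFP[of gvc id gvec "%T. T : Obj & hz T T" "presilting L e"]
 by (simp add: gvc_Ph raw_notions presilting_def Ph_Obj Ph_hz linear_id_plane)

text \<open>Translates a raw mutation of P_2 + P_1 at P_2 into the hypotheses of
  \<open>mutation_cone\<close>.\<close>

lemma mutation_data:
 assumes "is_mutation L e (Pcx L 2) (Pcx L 1) T"
 obtains T' U V where "Ph T : Obj" "hz (Ph T) (Ph T)" "indecP Obj K.ic dsc zrc T'"
  "~ K.ic T' ([], [2], 0)" "K.ic (Ph T) (dsc T' ([], [1], 0))"
  "isumP Obj K.ic dsc zrc (Ph T) U" "isumP Obj K.ic dsc zrc (Ph T) V" "~ K.ic U V" "cx_valid L e T"
proof -
 have P: "cx_valid L e (Pcx L i)" "Ph (Pcx L i) = ([], [i], 0)" if "i : {1, 2}" for i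
  using that by (auto simp: Pcx_def cx_valid_def is_proj_def is_map_def Ph_def ent_mt intro!: fmat_eqI)
 obtain T' U V where h: "presilting L e T" "indecomposable L e T'" "~ cx_iso L e T' (Pcx L 2)"
  "cx_iso L e T (dsum L T' (Pcx L 1))" "ind_summand L e T U" "ind_summand L e T V" "~ cx_iso L e U V"
  using assms unfolding is_mutation_def silting2_def by blast
 have v: "cx_valid L e T" "cx_valid L e T'" "cx_valid L e U" "cx_valid L e V"
  using h by (auto simp: presilting_def indecomposable_def ind_summand_def)
 show thesis
 proof (rule that[of "Ph T'" "Ph U" "Ph V"])
  show "Ph T : Obj" "hz (Ph T) (Ph T)" using h(1) Ph_Obj Ph_hz by (auto simp: presilting_def)
  show "indecP Obj K.ic dsc zrc (Ph T')" using h(2) tr.Phi_indec v by (simp add: raw_notions)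
  show "isumP Obj K.ic dsc zrc (Ph T) (Ph U)" "isumP Obj K.ic dsc zrc (Ph T) (Ph V)"
  using h(5,6) tr.Phi_isum v by (simp_all add: raw_notions)
  show "~ K.ic (Ph U) (Ph V)" using h(7) Ph_ic v by simp
  show "~ K.ic (Ph T') ([], [2], 0)" using h(3) Ph_ic[OF v(2) P(1)[of 2]] P(2)[of 2] by simp
  show "K.ic (Ph T) (dsc (Ph T') ([], [1], 0))"
  using h(4) Ph_ic[OF v(1) dsum_valid[OF v(2) P(1)[of 1]]] Ph_dsum[OF v(2) P(1)[of 1]] P(2)[of 1] by simp
 qed (rule v)
qed

end

section \<open>Coordinates\<close>

text \<open>Coordinates on the quotient of k^n by \<open>K\<close>, with a basis of classes of unit
  vectors; elements of k^n are functions vanishing from n on. In the step to n + 1, an element of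
  \<open>K\<close> with nonzero entry n eliminates that entry; if there is none, entry n becomes a
  new coordinate.\<close>

lemma quotient_coordinates:
 fixes K :: "(nat => 'k::field) set"
 assumes zero: "(%_. 0) : K" and add[rule_format]: "ALL f:K. ALL g:K. (%i. f i + g i) : K"
  and smul[rule_format]: "ALL f:K. ALL c. (%i. c * f i) : K"
 shows "EX l t (kap :: (nat => 'k) => nat => 'k). (ALL i<l. t i < n) &
  (ALL f g j. kap (%i. f i + g i) j = kap f j + kap g j) & (ALL c f j. kap (%i. c * f i) j = c * kap f j) &
  (ALL i<l. ALL j<l. kap (%s. if s = t i then 1 else 0) j = (if i = j then 1 else 0)) &
  (ALL f j. l <= j \<longrightarrow> kap f j = 0) &
  (ALL f. (ALL i>=n. f i = 0) \<longrightarrow> (f : K \<longleftrightarrow> (ALL j. kap f j = 0)))"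
proof (induction n)
 case 0
 have "f : K" if "ALL i>=0. f i = 0" for f :: "nat => 'k" using zero that by (metis ext le0)
 thus ?case by (intro exI[of _ 0] exI[of _ "%_. 0"] exI[of _ "%_ _. 0"]) auto
next
 case (Suc n)
 obtain l t and kap :: "(nat => 'k) => nat => 'k" where q: "(ALL i<l. t i < n) &
  (ALL f g j. kap (%i. f i + g i) j = kap f j + kap g j) & (ALL c f j. kap (%i. c * f i) j = c * kap f j) &
  (ALL i<l. ALL j<l. kap (%s. if s = t i then 1 else 0) j = (if i = j then 1 else 0)) &
  (ALL f j. l <= j \<longrightarrow> kap f j = 0) &
  (ALL f. (ALL i>=n. f i = 0) \<longrightarrow> (f : K \<longleftrightarrow> (ALL j. kap f j = 0)))"
  using Suc by (elim exE) (rule that)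
 hence t: "ALL i<l. t i < n" and
  ka: "!!f g j. kap (%i. f i + g i) j = kap f j + kap g j" and ks: "!!c f j. kap (%i. c * f i) j = c * kap f j" and
  ku: "ALL i<l. ALL j<l. kap (%s. if s = t i then 1 else 0) j = (if i = j then 1 else 0)" and
  k0: "!!f j. l <= j ==> kap f j = 0" and
  ker: "!!f. (ALL i>=n. f i = 0) ==> (f : K \<longleftrightarrow> (ALL j. kap f j = 0))" by blast+
 have kz: "kap (%_. 0) j = 0" for j using ks[of 0 "%_. 0" j] by simp
 show ?case
 proof (cases "EX c:K. (ALL i>=Suc n. c i = 0) & c n ~= 0")
  case True
  then obtain c0 where c0: "c0 : K" "ALL i>=Suc n. c0 i = 0" "c0 n ~= 0" by blast
  define c where "c i = (1 / c0 n) * c0 i" for i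
  have c: "c : K" "ALL i>=Suc n. c i = 0" "c n = 1" using smul[OF c0(1), of "1 / c0 n"] c0 unfolding c_def by auto
  let ?k = "%f. kap (%i. f i + (- f n) * c i)"
  have km: "(f : K) = (ALL j. ?k f j = 0)" if f: "ALL i>=Suc n. f i = 0" for f
  proof -
  have s: "ALL i>=n. f i + (- f n) * c i = 0"
  using f c by (metis Suc_leI add.right_inverse le_neq_implies_less mult.right_neutral mult_zero_right add.right_neutral)
  have "f : K \<longleftrightarrow> (%i. f i + (- f n) * c i) : K"
  proof
  assume "f : K" thus "(%i. f i + (- f n) * c i) : K" using add smul[OF c(1)] by blast
  next
  assume "(%i. f i + (- f n) * c i) : K"
  from add[OF this smul[OF c(1), of "f n"]] show "f : K" by simp
  qed
  thus ?thesis using ker[OF s] by simp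
  qed
  have lin: "?k (%i. f i + g i) j = ?k f j + ?k g j" for f g j
  unfolding ka[symmetric] by (rule arg_cong[where f = "%h. kap h j"]) (auto simp: algebra_simps)
  have lins: "?k (%i. d * f i) j = d * ?k f j" for d f j
  unfolding ks[symmetric] by (rule arg_cong[where f = "%h. kap h j"]) (auto simp: algebra_simps)
  have un: "?k (%s. if s = t i then 1 else 0) j = (if i = j then 1 else 0)" if "i < l" "j < l" for i j
  proof -
  have "t i ~= n" using t that(1) by auto
  thus ?thesis using ku that by simp
  qed
  show ?thesis by (rule exI[of _ l], rule exI[of _ t], rule exI[of _ ?k])
  (use t lin lins un k0 km in \<open>auto intro: less_SucI\<close>)
 next
  case False
  let ?k = "%f j. if j = l then f n else kap (%i. if i = n then 0 else f i) j"
  let ?t = "%i. if i = l then n else t i"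
  have km: "(f : K) = (ALL j. ?k f j = 0)" if f: "ALL i>=Suc n. f i = 0" for f
  proof -
  have eq: "(%i. if i = n then 0 else f i) = f" if "f n = 0" using that by auto
  have s: "ALL i>=n. f i = 0" if "f n = 0" using that f by (metis Suc_leI le_neq_implies_less)
  show ?thesis
  proof
  assume "f : K"
  hence "f n = 0" using False f by blast
  thus "ALL j. ?k f j = 0" using ker[OF s] \<open>f : K\<close> eq by simp
  next
  assume a: "ALL j. ?k f j = 0"
  hence fn: "f n = 0" by (metis (mono_tags))
  have "kap f j = 0" for j using spec[OF a, of j] k0[of l f] eq[OF fn] by (cases "j = l") auto
  thus "f : K" using ker[OF s[OF fn]] by blast
  qed
  qed
  have lin: "?k (%i. f i + g i) j = ?k f j + ?k g j" for f g j
  proof -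
  have "kap (%i. if i = n then 0 else f i + g i) j = kap (%i. (if i = n then 0 else f i) + (if i = n then 0 else g i)) j"
  by (rule arg_cong[where f = "%h. kap h j"]) auto
  thus ?thesis by (simp add: ka)
  qed
  have lins: "?k (%i. d * f i) j = d * ?k f j" for d f j
  proof -
  have "kap (%i. if i = n then 0 else d * f i) j = kap (%i. d * (if i = n then 0 else f i)) j"
  by (rule arg_cong[where f = "%h. kap h j"]) auto
  thus ?thesis by (simp add: ks)
  qed
  have un: "?k (%s. if s = ?t i then 1 else 0) j = (if i = j then 1 else 0)" if "i < Suc l" "j < Suc l" for i j
  proof (cases "i = l")
  case True
  have "(%s. if s = n then 0 else if s = n then 1 else 0 :: 'k) = (%_. 0)" by auto
  hence "kap (%s. if s = n then 0 else if s = n then 1 else 0) j = 0" using kz by simp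
  thus ?thesis using True by auto
  next
  case False
  hence i: "i < l" "t i < n" using that t by auto
  have "(%s. if s = n then 0 else if s = t i then 1 else 0 :: 'k) = (%s. if s = t i then 1 else 0)" using i by auto
  hence "kap (%s. if s = n then 0 else if s = t i then 1 else 0) j = kap (%s. if s = t i then 1 else 0) j" by simp
  thus ?thesis using False i that ku by auto
  qed
  have tt: "?t i < Suc n" if "i < Suc l" for i using t that by (auto simp: less_Suc_eq)
  show ?thesis
  proof (rule exI[of _ "Suc l"], rule exI[of _ ?t], rule exI[of _ ?k], intro conjI)
  show "ALL i<Suc l. ?t i < Suc n" using tt by blast
  show "ALL i<Suc l. ALL j<Suc l. ?k (%s. if s = ?t i then 1 else 0) j = (if i = j then 1 else 0)"
  using un by blast
  show "ALL f j. Suc l <= j \<longrightarrow> ?k f j = 0" using k0 by simp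
  qed (use lin lins km in blast)+
 qed
qed

context kalg_loc
begin

definition lin :: "(nat => 'a) => nat => (nat => 'k) => 'a" where
 "lin b n c = asum L (%i. asmul L (c i) (b i)) n"

lemma lin_in: "(!!i. i < n ==> b i : acar L) ==> lin b n c : acar L" unfolding lin_def by (intro asum_in smul_in)

lemma add_add_comm:
 assumes "x : acar L" "y : acar L" "z : acar L" "w : acar L"
 shows "aadd L (aadd L x y) (aadd L z w) = aadd L (aadd L x z) (aadd L y w)"
proof -
 have "aadd L (aadd L x y) (aadd L z w) = aadd L x (aadd L (aadd L y z) w)"
  using assms by (simp add: add_assoc add_in)
 also have "aadd L y z = aadd L z y" using assms by (simp add: add_comm)
 also have "aadd L x (aadd L (aadd L z y) w) = aadd L (aadd L x z) (aadd L y w)"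
  using assms by (simp add: add_assoc add_in)
 finally show ?thesis .
qed

lemma lin_add: "(!!i. i < n ==> b i : acar L) ==> lin b n (%i. c i + d i) = aadd L (lin b n c) (lin b n d)"
proof (induction n)
 case 0
 thus ?case by (simp add: lin_def add_zero zero_in)
next
 case (Suc n)
 have "lin b n c : acar L" "lin b n d : acar L" using Suc.prems by (auto intro: lin_in)
 thus ?case using Suc add_add_comm[of "lin b n c" "lin b n d" "asmul L (c n) (b n)" "asmul L (d n) (b n)"]
  by (simp add: lin_def add_smul smul_in)
qed

lemma lin_smul: "(!!i. i < n ==> b i : acar L) ==> lin b n (%i. s * c i) = asmul L s (lin b n c)"
proof (induction n)
 case 0
 thus ?case by (simp add: lin_def smul_zero)
next
 case (Suc n)
 have "lin b n c : acar L" using Suc.prems by (auto intro: lin_in)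
 thus ?case using Suc by (simp add: lin_def smul_smul smul_add smul_in)
qed

lemma lin_cong: "(!!i. i < n ==> c i = d i) ==> lin b n c = lin b n d" unfolding lin_def by (induction n) auto

lemma lin_zero: "(!!i. i < n ==> b i : acar L) ==> lin b n (%_. 0) = azero L"
 unfolding lin_def by (induction n) (auto simp: zero_smul add_zero zero_in)

lemma lin_unit: "(!!i. i < n ==> b i : acar L) ==> j < n ==> lin b n (%i. if i = j then 1 else 0) = b j"
proof (induction n)
 case (Suc n)
 show ?case
 proof (cases "j = n")
  case True
  have "lin b n (%i. if i = j then 1 else 0) = lin b n (%_. 0)" using True by (intro lin_cong) auto
  thus ?thesis using Suc.prems True lin_zero[of n b] by (simp add: lin_def one_smul add_zero)
 next
  case False
  hence "lin b n (%i. if i = j then 1 else 0) = b j" using Suc by simp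
  moreover have "b j : acar L" using Suc.prems by simp
  ultimately show ?thesis
  using Suc.prems False add_comm[of "b j" "azero L"] by (simp add: lin_def zero_smul add_zero zero_in)
 qed
qed simp

text \<open>The basis of X/N is chosen among the \<open>b i\<close>, so it inherits their membership
  properties. The choice \<open>co\<close> of coefficients need not be linear, but two choices for
  the same element differ by a member of \<open>K\<close>, on which the coordinates vanish
  (\<open>ke\<close>).\<close>

lemma subquotient_basis:
 assumes b: "!!i. i < n ==> b i : acar L" and X: "X = range (lin b n)"
  and N: "azero L : N" "!!x y. x : N ==> y : N ==> aadd L x y : N" "!!c x. x : N ==> asmul L c x : N"
  and NX: "N \<subseteq> X"
 obtains l x kap where "!!i. i < l ==> x i : b ` {..<n}"
  "!!y z j. y : X ==> z : X ==> kap (aadd L y z) j = kap y j + kap z j"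
  "!!c z j. z : X ==> kap (asmul L c z) j = c * kap z j"
  "!!i j. i < l ==> j < l ==> kap (x i) j = (if i = j then 1 else (0::'k))"
  "!!z j. z : X ==> l <= j ==> kap z j = 0"
  "!!z. z : X ==> z : N \<longleftrightarrow> (ALL j. kap z j = 0)"
  "!!z. z : X ==> EX m:N. z = aadd L m (lin x l (kap z))"
proof -
 define K where "K = {c. lin b n c : N}"
 have K0: "(%_. 0) : K" using lin_zero[of n b] b N(1) by (simp add: K_def)
 have K1: "ALL f:K. ALL g:K. (%i. f i + g i) : K" using lin_add[of n b] b N(2) by (simp add: K_def)
 have K2: "ALL f:K. ALL c. (%i. c * f i) : K" using lin_smul[of n b] b N(3) by (simp add: K_def)
 obtain l t and k :: "(nat => 'k) => nat => 'k" where q: "(ALL i<l. t i < n) &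
  (ALL f g j. k (%i. f i + g i) j = k f j + k g j) & (ALL c f j. k (%i. c * f i) j = c * k f j) &
  (ALL i<l. ALL j<l. k (%s. if s = t i then 1 else 0) j = (if i = j then 1 else 0)) &
  (ALL f j. l <= j \<longrightarrow> k f j = 0) &
  (ALL f. (ALL i>=n. f i = 0) \<longrightarrow> (f : K \<longleftrightarrow> (ALL j. k f j = 0)))"
  using quotient_coordinates[OF K0 K1 K2, of n] by (elim exE) (rule that)
 hence t: "ALL i<l. t i < n" and
  ka: "!!f g j. k (%i. f i + g i) j = k f j + k g j" and ks: "!!c f j. k (%i. c * f i) j = c * k f j" and
  ku: "ALL i<l. ALL j<l. k (%s. if s = t i then 1 else 0) j = (if i = j then 1 else 0)" and
  k0: "!!f j. l <= j ==> k f j = 0" and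
  ker: "!!f. (ALL i>=n. f i = 0) ==> (f : K \<longleftrightarrow> (ALL j. k f j = 0))" by blast+
 define co where "co z = (SOME c. (ALL i>=n. c i = 0) & lin b n c = z)" for z
 have co: "ALL i>=n. co z i = 0" "lin b n (co z) = z" if z: "z : X" for z
 proof -
  obtain c where "lin b n c = z" using z X by blast
  hence "(ALL i>=n. (if i < n then c i else 0) = 0) & lin b n (%i. if i < n then c i else 0) = z"
  using lin_cong[of n "%i. if i < n then c i else 0" c b] by simp
  hence "(ALL i>=n. co z i = 0) & lin b n (co z) = z"
  unfolding co_def by (rule someI[of "%c. (ALL i>=n. c i = 0) & lin b n c = z"])
  thus "ALL i>=n. co z i = 0" "lin b n (co z) = z" by auto
 qed
 have ke: "k c j = k d j" if "ALL i>=n. c i = 0" "ALL i>=n. d i = 0" "lin b n c = lin b n d" for c d j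
 proof -
  have "lin b n (%i. c i + (-1) * d i) = lin b n (%i. 0)"
  proof -
  have "lin b n (%i. c i + (-1) * d i) = aadd L (lin b n d) (lin b n (%i. (-1) * d i))"
  using lin_add[of n b c "%i. (-1) * d i"] b that(3) by simp
  also have "... = lin b n (%i. d i + (-1) * d i)" using lin_add[of n b d "%i. (-1) * d i"] b by simp
  finally show ?thesis by simp
  qed
  hence "(%i. c i + (-1) * d i) : K" using lin_zero[of n b] b N(1) by (simp add: K_def)
  moreover have "ALL i>=n. c i + (-1) * d i = 0" using that by simp
  ultimately have "k (%i. c i + (-1) * d i) j = 0" using iffD1[OF ker] by simp
  thus ?thesis using ka[of c "%i. (-1) * d i" j] ks[of "-1" d j] by simp
 qed
 define kap where "kap z = k (co z)" for z
 define x where "x i = b (t i)" for i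
 have bX: "b i : X" if "i < n" for i 
  unfolding X using lin_unit[of n b i] b that by (intro range_eqI[of _ _ "%j. if j = i then 1 else 0"]) simp
 have Xadd: "aadd L y z : X" if "y : X" "z : X" for y z
  using co(2)[OF that(1)] co(2)[OF that(2)] lin_add[of n b "co y" "co z"] b
  unfolding X by (intro range_eqI[of _ _ "%i. co y i + co z i"]) simp
 have Xsmul: "asmul L c z : X" if "z : X" for c z using co(2)[OF that] lin_smul[of n b c "co z"] b
  unfolding X by (intro range_eqI[of _ _ "%i. c * co z i"]) simp
 have kapu: "kap (x i) j = (if i = j then 1 else 0)" if "i < l" "j < l" for i j
 proof -
  have ti: "t i < n" using t that by blast
  have "kap (x i) j = k (%s. if s = t i then 1 else 0) j"
  unfolding kap_def x_def using co[OF bX[OF ti]] lin_unit[of n b "t i"] b ti by (intro ke) auto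
  thus ?thesis using ku that by simp
 qed
 have kapa: "kap (aadd L y z) j = kap y j + kap z j" if "y : X" "z : X" for y z j unfolding kap_def ka[symmetric]
  using co[OF that(1)] co[OF that(2)] co[OF Xadd[OF that]] lin_add[of n b "co y" "co z"] b by (intro ke) auto
 have kaps: "kap (asmul L c z) j = c * kap z j" if "z : X" for c z j unfolding kap_def ks[symmetric]
  using co[OF that(1)] co[OF Xsmul[OF that]] lin_smul[of n b c "co z"] b by (intro ke) auto
 have kapN: "z : N \<longleftrightarrow> (ALL j. kap z j = 0)" if "z : X" for z
  using ker[OF co(1)[OF that]] co(2)[OF that] by (simp add: K_def kap_def)
 have xX: "x i : X" if "i < l" for i using bX t that by (simp add: x_def)
 have xin: "x i : acar L" if "i < l" for i using b t that by (simp add: x_def)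
 have linX: "lin x m c : X" if "m <= l" for m c
  using that by (induction m) (auto simp: lin_def intro!: Xadd Xsmul xX subsetD[OF NX N(1)])
 have kap0: "kap (azero L) j = 0" for j using kapN[OF subsetD[OF NX N(1)]] N(1) by blast
 have kapl: "kap (lin x m c) j = (if j < m then c j else 0)" if "m <= l" "j < l" for m c j using that(1)
 proof (induction m)
  case (Suc m)
  hence m: "m < l" by simp
  have "kap (lin x (Suc m) c) j = kap (lin x m c) j + c m * kap (x m) j"
  using kapa[OF linX Xsmul[OF xX[OF m]]] kaps[OF xX[OF m]] m by (simp add: lin_def)
  thus ?case using Suc kapu[OF m that(2)] by (auto simp: less_Suc_eq)
 qed (simp add: lin_def kap0)
 have rec: "EX m:N. z = aadd L m (lin x l (kap z))" if z: "z : X" for z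
 proof -
  let ?w = "lin x l (kap z)"
  let ?m = "aadd L z (asmul L (-1) ?w)"
  have w: "?w : X" using linX by simp
  have "kap ?m j = 0" for j
  using kapa[OF z Xsmul[OF w]] kaps[OF w] kapl[of l j "kap z"] k0 by (cases "j < l") (auto simp: kap_def)
  hence "?m : N" using kapN[OF Xadd[OF z Xsmul[OF w]]] by blast
  moreover have "z = aadd L ?m ?w"
  proof -
  have za: "z : acar L" using z X lin_in b by auto
  have wa: "?w : acar L" using lin_in xin by blast
  have "aadd L (asmul L (-1) ?w) ?w = azero L"
  using add_smul[OF wa, of "-1" 1] zero_smul[OF wa] one_smul[OF wa] by simp
  thus ?thesis using add_assoc[OF za smul_in[OF wa] wa] add_comm[OF za zero_in] add_zero[OF za] by simp
  qed
  ultimately show ?thesis by blast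
 qed
 show thesis
 proof (rule that[of l x kap])
  show "x i : b ` {..<n}" if "i < l" for i using t that by (auto simp: x_def)
  show "kap z j = 0" if "z : X" "l <= j" for z j using k0 that by (simp add: kap_def)
 qed (use kapa kaps kapu kapN rec in auto)
qed

lemma finite_span:
 assumes "fd_algebra L"
 obtains n b where "!!i. i < n ==> b i : acar L" "acar L = range (lin b n)"
proof -
 obtain B where B: "finite B" "B \<subseteq> acar L" "acar L \<subseteq> lincomb L B" using assms unfolding fd_algebra_def by blast
 obtain bs where bs: "set bs = B" using B(1) finite_list by blast
 let ?b = "%i. bs ! i" and ?n = "length bs"
 have b: "?b i : acar L" if "i < ?n" for i using that bs B(2) nth_mem by blast
 have "x : range (lin ?b ?n)" if "x : lincomb L B" for x using that
 proof induction
  case lc_zero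
  have "azero L = lin ?b ?n (%_. 0)" using lin_zero[of ?n ?b] b by simp
  thus ?case by (intro range_eqI[of _ _ "%_. 0"])
 next
  case (lc_step x y s)
  obtain c where c: "x = lin ?b ?n c" using lc_step by blast
  obtain j where j: "j < ?n" "y = ?b j" using lc_step(2) bs unfolding in_set_conv_nth[symmetric] by (metis in_set_conv_nth)
  have "aadd L (asmul L s y) x = lin ?b ?n (%i. s * (if i = j then 1 else 0) + c i)"
  using lin_add[of ?n ?b "%i. s * (if i = j then 1 else 0)" c] lin_smul[of ?n ?b s "%i. if i = j then 1 else 0"]
  lin_unit[of ?n ?b j] b c j by simp
  thus ?case by (intro range_eqI[of _ _ "%i. s * (if i = j then 1 else 0) + c i"])
 qed
 hence "acar L \<subseteq> range (lin ?b ?n)" using B(3) by auto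
 moreover have "range (lin ?b ?n) \<subseteq> acar L" using lin_in[of ?n ?b] b by auto
 ultimately show thesis using b that[of ?n ?b] by blast
qed

lemma faithful_coordinates:
 assumes "fd_algebra L"
 obtains phi :: "'a => nat => 'k" and psi where "!!x y. x : acar L ==> y : acar L ==> phi (aadd L x y) = phi x + phi y"
  "!!v. psi v : acar L" "!!v w. psi (v + w) = aadd L (psi v) (psi w)" "!!x. x : acar L ==> psi (phi x) = x"
  "!!c x. x : acar L ==> phi (asmul L c x) = (%i. c * phi x i)"
  "EX l. ALL x:acar L. ALL j>=l. phi x j = 0"
proof -
 obtain n b where b: "!!i. i < n ==> b i : acar L" "acar L = range (lin b n)" using finite_span[OF assms] by blast
 have N: "aadd L x y : {azero L}" "asmul L c x : {azero L}" if "x : {azero L}" "y : {azero L}" for x y c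
  using that add_zero[OF zero_in] smul_zero by auto
 obtain l x kap where x: "!!i. i < l ==> x i : b ` {..<n}"
  and k: "!!y z j. y : acar L ==> z : acar L ==> kap (aadd L y z) j = kap y j + kap z j"
  "!!c z j. z : acar L ==> kap (asmul L c z) j = c * kap z j"
  and k0: "!!z j. z : acar L ==> l <= j ==> kap z j = 0"
  and r: "!!z. z : acar L ==> EX m:{azero L}. z = aadd L m (lin x l (kap z))"
  using N zero_in by - (rule subquotient_basis[OF b(1) b(2), of "{azero L}"], blast+)
 have xin: "x i : acar L" if "i < l" for i using x[OF that] b by auto
 show thesis
 proof (rule that[of kap "lin x l"])
  show "lin x l (v + w) = aadd L (lin x l v) (lin x l w)" for v w
  using lin_add[of l x v w] xin by (simp add: plus_fun_def)
  show "lin x l (kap z) = z" if "z : acar L" for z using r[OF that] add_zero[OF lin_in[of l x "kap z"]] xin by auto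
  show "EX l. ALL x:acar L. ALL j>=l. kap x j = 0" using k0 by blast
 qed (use k xin lin_in in \<open>auto simp: fun_eq_iff\<close>)
qed

end

text \<open>The left regular representation in coordinates. \<open>psi\<close> is defined on all
  functions, so the group acted upon is a whole type; faithfulness is seen by evaluating at the
  coordinates of \<open>aone L\<close>.\<close>

lemma rawrep_exists:
 fixes L :: "('k::field, 'a) kalg"
 assumes "fd_algebra L" "complete_poi2 L e"
 shows "EX rp :: 'a => (nat => 'k) aend. rawrep L e rp"
proof -
 interpret kalg_loc L using assms(1) by (simp add: kalg_loc_def fd_algebra_def)
 obtain phi :: "'a => nat => 'k" and psi where phi: "!!x y. x : acar L ==> y : acar L ==> phi (aadd L x y) = phi x + phi y"
  and psi: "!!v. psi v : acar L" "!!v w. psi (v + w) = aadd L (psi v) (psi w)" "!!x. x : acar L ==> psi (phi x) = x"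
  by (rule faithful_coordinates[OF assms(1)]) (rule that)
 define rp where "rp a = Aend (%v. phi (amul L a (psi v)))" for a
 have ap: "app (rp a) v = phi (amul L a (psi v))" if "a : acar L" for a v
  unfolding rp_def using that by (subst app_Aend) (auto simp: psi mul_add phi mul_in)
 have "rawrep L e rp"
 proof unfold_locales
  show "rp (aadd L x y) = rp x + rp y" if "x : acar L" "y : acar L" for x y
  by (rule aend_eqI) (simp add: ap that add_in add_mul psi phi mul_in)
  show "rp (amul L x y) = rp x * rp y" if "x : acar L" "y : acar L" for x y
  by (rule aend_eqI) (simp add: ap that mul_in psi mul_assoc)
  show "inj_on rp (acar L)"
  proof (rule inj_onI)
  fix x y assume xy: "x : acar L" "y : acar L" "rp x = rp y"
  have "phi (amul L x (psi (phi (aone L)))) = phi (amul L y (psi (phi (aone L))))"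
  using ap[OF xy(1), of "phi (aone L)"] ap[OF xy(2), of "phi (aone L)"] xy(3) by simp
  hence "phi x = phi y" using xy by (simp add: psi(3) one_in mul_one)
  thus "x = y" using psi(3)[OF xy(1)] psi(3)[OF xy(2)] by metis
  qed
  show "e i : acar L" "amul L (e i) (e i) = e i" if "i : {1, 2}" for i
  using assms(2) that by (auto simp: complete_poi2_def primitive_idem_def idempotent_def)
 qed
 thus ?thesis by blast
qed

section \<open>Characters of elementary algebras\<close>

text \<open>\<open>pw x n\<close> is the power with exponent \<open>n + 1\<close>, so that no unit is needed.\<close>

primrec pw :: "'a::semigroup_mult => nat => 'a" where
 "pw x 0 = x"
| "pw x (Suc n) = x * pw x n"

lemma pw_commute: "y * x = x * y ==> y * pw x n = pw x n * y"
proof (induction n)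
 case (Suc n)
 have "y * (x * pw x n) = x * (y * pw x n)" by (simp only: mult.assoc[symmetric] Suc.prems)
 thus ?case using Suc by (simp add: mult.assoc)
qed simp

lemma pw_add: "pw x m * pw x n = pw x (Suc (m + n))" by (induction m) (simp_all add: mult.assoc)

lemma fitting_idempotent:
 fixes x z :: "'a::semigroup_mult"
 assumes c: "x * z = z * x" and r: "pw x r = pw x (Suc r) * z"
 shows "(pw x r * pw z r) * (pw x r * pw z r) = pw x r * pw z r" and "pw x r = pw x (Suc (r + r)) * pw z r"
proof -
 have "pw x r = pw x (Suc (r + k)) * pw z k" for k
 proof (induction k)
  case 0
  thus ?case using r by simp
 next
  case (Suc k)
  have E: "pw x (Suc (r + k)) = pw x (Suc (r + Suc k)) * z"
  proof -
  have "pw x (Suc (r + k)) = pw x k * pw x r" by (simp add: pw_add add.commute)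
  also have "... = pw x k * (pw x (Suc r) * z)" by (simp only: r[symmetric])
  also have "... = pw x (Suc (r + Suc k)) * z" by (simp only: mult.assoc[symmetric] pw_add) (simp add: add.commute)
  finally show ?thesis .
  qed
  show ?case by (subst Suc.IH) (simp only: E mult.assoc pw.simps(2)[of z])
 qed
 from this[of r] show e: "pw x r = pw x (Suc (r + r)) * pw z r" .
 have cc: "pw z r * pw x r = pw x r * pw z r" by (rule pw_commute, rule pw_commute[OF c, symmetric])
 have "(pw x r * pw z r) * (pw x r * pw z r) = pw x r * (pw z r * pw x r) * pw z r" by (simp only: mult.assoc)
 also have "... = (pw x (Suc (r + r)) * pw z r) * pw z r"
  by (simp only: cc) (simp only: mult.assoc[symmetric] pw_add)
 also have "... = pw x r * pw z r" by (simp only: e[symmetric])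
 finally show "(pw x r * pw z r) * (pw x r * pw z r) = pw x r * pw z r" .
qed

text \<open>\<open>y\<close> is the quasi-inverse of \<open>x\<close>: the condition says (1 - x)(1
  - y) = 1 = (1 - y)(1 - x).\<close>

definition qi :: "('k, 'a) kalg => 'a => bool" where
 "qi L x \<longleftrightarrow> (EX y:acar L. aadd L x y = amul L x y & aadd L x y = amul L y x)"

text \<open>A working form of being elementary of rank 2: two characters dual to the idempotents,
  with quasi-regular common kernel. The lemmas \<open>elementary\<close> and
  \<open>elementary_characters\<close> pass between the two forms.\<close>

locale charalg = kalg_loc L for L :: "('k::field, 'a) kalg" +
 fixes e :: "nat => 'a" and xi :: "nat => 'a => 'k"
 assumes poi: "complete_poi2 L e"
  and chi_add: "i : {1, 2} ==> x : acar L ==> y : acar L ==> xi i (aadd L x y) = xi i x + xi i y"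
  and chi_mul: "i : {1, 2} ==> x : acar L ==> y : acar L ==> xi i (amul L x y) = xi i x * xi i y"
  and chi_smul: "i : {1, 2} ==> x : acar L ==> xi i (asmul L c x) = c * xi i x"
  and chi_e: "i : {1, 2} ==> j : {1, 2} ==> xi i (e j) = (if i = j then 1 else 0)"
  and chi_qi: "x : acar L ==> xi 1 x = 0 ==> xi 2 x = 0 ==> qi L x"
begin

lemma ei_in: "i : {1, 2} ==> e i : acar L"
 using poi by (auto simp: complete_poi2_def primitive_idem_def idempotent_def)

lemma e_one: "aadd L (e 1) (e 2) = aone L" using poi by (simp add: complete_poi2_def)

lemma chi_one: "i : {1, 2} ==> xi i (aone L) = 1"
 using chi_add[of i "e 1" "e 2"] ei_in[of 1] ei_in[of 2] e_one chi_e[of i 1] chi_e[of i 2] by auto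

lemma chi_zero: "i : {1, 2} ==> xi i (azero L) = 0"
 using chi_add[of i "azero L" "azero L"] zero_in add_zero[OF zero_in] by (metis add.right_neutral add_left_cancel)

lemma right_ideal_neg:
 assumes K: "right_ideal L K" and "x : K" "y : acar L" "aadd L x y = azero L"
 shows "y : K"
proof -
 obtain w where "w : K" "aadd L x w = azero L" using K assms(2) unfolding right_ideal_def by blast
 moreover have "x : acar L" "w : acar L" using K assms(2) calculation unfolding right_ideal_def by blast+
 ultimately show ?thesis using add_cancel[of x y w] assms(3,4) by simp
qed

text \<open>Otherwise M + x\<Lambda> is the whole algebra, so 1 = m + z with m in M and z in the
  common kernel. The quasi-inverse of z then puts z, and with it 1, into M.\<close>

lemma kernel_in_maximal:
 assumes x: "x : acar L" "xi 1 x = 0" "xi 2 x = 0" and M: "maximal_right_ideal L M"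
 shows "x : M"
proof (rule ccontr)
 assume nx: "x ~: M"
 have R: "right_ideal L M" using M by (simp add: maximal_right_ideal_def)
 hence RM: "M \<subseteq> acar L" "azero L : M" "!!u v. u : M ==> v : M ==> aadd L u v : M"
  "!!u v. u : M ==> v : acar L ==> amul L u v : M" "!!u. u : M ==> EX v:M. aadd L u v = azero L"
  unfolding right_ideal_def by blast+
 let ?K = "{aadd L m (amul L x a) | m a. m : M & a : acar L}"
 have mem: "aadd L m (amul L x a) : ?K" if "m : M" "a : acar L" for m a using that by blast
 have "right_ideal L ?K" unfolding right_ideal_def
 proof (intro conjI ballI)
  show "?K \<subseteq> acar L" using RM(1) x(1) add_in mul_in by auto
  show "azero L : ?K" using mem[OF RM(2) zero_in] mul_zero[OF x(1)] add_zero[OF zero_in] by simp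
 next
  fix u v assume "u : ?K" "v : ?K"
  then obtain m a n b where u: "u = aadd L m (amul L x a)" "m : M" "a : acar L"
  and v: "v = aadd L n (amul L x b)" "n : M" "b : acar L" by blast
  have "aadd L u v = aadd L (aadd L m n) (amul L x (aadd L a b))"
  using u v RM(1) x(1) add_add_comm[of m "amul L x a" n "amul L x b"] mul_add mul_in by auto
  thus "aadd L u v : ?K" using mem RM(3) u v add_in by simp
 next
  fix u assume "u : ?K"
  then obtain m a where u: "u = aadd L m (amul L x a)" "m : M" "a : acar L" by blast
  obtain n where n: "n : M" "aadd L m n = azero L" using RM(5) u by blast
  obtain b where b: "b : acar L" "aadd L a b = azero L" using neg_ex u by blast
  have "aadd L u (aadd L n (amul L x b)) = aadd L (aadd L m n) (amul L x (aadd L a b))"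
  using u n(1) b(1) RM(1) x(1) add_add_comm[of m "amul L x a" n "amul L x b"] mul_add mul_in by auto
  hence "aadd L u (aadd L n (amul L x b)) = azero L" using n b mul_zero[OF x(1)] add_zero[OF zero_in] by simp
  thus "EX y:?K. aadd L u y = azero L" using mem[OF n(1) b(1)] by (rule bexI)
 next
  fix u c assume "u : ?K" and c: "c : acar L"
  then obtain m a where u: "u = aadd L m (amul L x a)" "m : M" "a : acar L" by blast
  have "amul L u c = aadd L (amul L m c) (amul L x (amul L a c))"
  using u c RM(1) x(1) add_mul mul_assoc mul_in by auto
  thus "amul L u c : ?K" using mem RM(4) u c mul_in by simp
 qed
 moreover have "M \<subseteq> ?K"
 proof
  fix m assume m: "m : M"
  hence "aadd L m (amul L x (azero L)) = m"
  using RM(1) mul_zero[OF x(1)] add_comm[of m "azero L"] zero_in add_zero[of m] by auto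
  thus "m : ?K" using mem[OF m zero_in] by simp
 qed
 moreover have "x : ?K" using mem[OF RM(2) one_in] mul_one[OF x(1)] add_zero[OF x(1)] by simp
 ultimately have "?K = acar L" using M nx unfolding maximal_right_ideal_def by blast
 then obtain m a where ma: "aone L = aadd L m (amul L x a)" "m : M" "a : acar L" using one_in by blast
 define z where "z = amul L x a"
 have z: "z : acar L" and m: "m : acar L" using z_def x ma RM(1) mul_in by auto
 have "xi 1 z = 0" "xi 2 z = 0" using x ma(3) chi_mul[of _ x a] by (auto simp: z_def)
 then obtain y where y: "y : acar L" "aadd L z y = amul L z y" using chi_qi[OF z] unfolding qi_def by blast
 \<comment> \<open>Multiplying 1 = m + z by y and inserting zy = z + y gives my + z = 0.\<close>
 have "aadd L y (azero L) = aadd L y (aadd L (amul L m y) z)"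
 proof -
  have "aadd L y (azero L) = y" using add_comm[OF y(1) zero_in] add_zero[OF y(1)] by simp
  also have "y = amul L (aadd L m z) y" using one_mul[OF y(1)] ma(1) by (simp add: z_def)
  also have "... = aadd L (amul L m y) (aadd L z y)" using add_mul[OF m z y(1)] y(2) by simp
  also have "... = aadd L y (aadd L (amul L m y) z)"
  using add_assoc[OF mul_in[OF m y(1)] z y(1)] add_comm[OF add_in[OF mul_in[OF m y(1)] z] y(1)] by simp
  finally show ?thesis .
 qed
 hence "aadd L (amul L m y) z = azero L" using add_cancel[OF y(1) zero_in add_in[OF mul_in[OF m y(1)] z]] by simp
 hence "z : M" using right_ideal_neg[OF R RM(4)[OF ma(2) y(1)] z] by blast
 hence "aone L : M" using ma RM(3) by (simp add: z_def)
 hence "amul L (aone L) c : M" if "c : acar L" for c using that RM(4) by blast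
 hence "acar L \<subseteq> M" using one_mul by force
 thus False using nx x by blast
qed

lemma kernel_maximal:
 assumes i: "i : {1, 2}"
 shows "maximal_right_ideal L {x \<in> acar L. xi i x = 0}" (is "maximal_right_ideal L ?K")
 unfolding maximal_right_ideal_def
proof (intro conjI allI impI)
 show "right_ideal L ?K" unfolding right_ideal_def
 proof (intro conjI ballI)
  fix x assume x: "x : ?K"
  obtain y where y: "y : acar L" "aadd L x y = azero L" using neg_ex x by blast
  hence "xi i y = 0" using chi_add[OF i, of x y] x chi_zero[OF i] by simp
  thus "EX y:?K. aadd L x y = azero L" using y by blast
 qed (use i in \<open>auto simp: zero_in chi_zero add_in chi_add mul_in chi_mul\<close>)
 show "?K ~= acar L" using ei_in[OF i] chi_e[OF i i] by (metis (mono_tags, lifting) mem_Collect_eq zero_neq_one)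
next
 fix K assume K: "right_ideal L K & ?K \<subseteq> K & K ~= acar L"
 hence R: "K \<subseteq> acar L" "!!u v. u : K ==> v : K ==> aadd L u v : K"
  "!!u v. u : K ==> v : acar L ==> amul L u v : K" unfolding right_ideal_def by blast+
 have "xi i x = 0" if x: "x : K" for x
 proof (rule ccontr)
  assume n: "xi i x ~= 0"
  have xa: "x : acar L" using x R(1) by blast
  define u where "u = amul L x (asmul L (1 / xi i x) (aone L))"
  have u: "u : K" "u : acar L" "xi i u = 1"
  using R(3)[OF x] smul_in[OF one_in] mul_in[OF xa] chi_mul[OF i xa] chi_smul[OF i one_in] chi_one[OF i] n
  by (auto simp: u_def)
  obtain w where w: "w : acar L" "aadd L u w = azero L" using neg_ex u by blast
  have "xi i w = - 1" using chi_add[OF i u(2) w(1)] w(2) chi_zero[OF i] u(3) by (simp add: eq_neg_iff_add_eq_0 add.commute)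
  hence "aadd L (aone L) w : ?K" using w one_in chi_add[OF i one_in w(1)] chi_one[OF i] add_in by simp
  hence "aadd L (aadd L (aone L) w) u : K" using R(2) u K by blast
  moreover have "aadd L (aadd L (aone L) w) u = aone L"
  using add_assoc[OF one_in w(1) u(2)] add_comm[OF w(1) u(2)] w(2) add_comm[OF one_in zero_in] add_zero[OF one_in]
  by simp
  ultimately have "acar L \<subseteq> K" using R(3)[of "aone L"] one_mul by force
  thus False using K R(1) by blast
 qed
 thus "K = ?K" using K R(1) by blast
qed

lemma elementary: "elementary L"
proof -
 define phi :: "'a => nat => 'k" where "phi x i = (if i = 0 then xi 1 x else if i = 1 then xi 2 x else 0)" for x i
 have i2: "(ALL i<2. P i) \<longleftrightarrow> P 0 & P (1::nat)" for P by (metis less_2_cases numeral_2_eq_2 One_nat_def lessI zero_less_Suc)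
 have e12: "e 1 : acar L" "e 2 : acar L" using ei_in by auto
 have sur: "EX x:acar L. phi x = v" if v: "ALL i>=2. v i = 0" for v :: "nat => 'k"
 proof (rule bexI)
  show "phi (aadd L (asmul L (v 0) (e 1)) (asmul L (v 1) (e 2))) = v"
  using e12 v chi_e[of 1 1] chi_e[of 1 2] chi_e[of 2 1] chi_e[of 2 2]
  by (auto simp: fun_eq_iff phi_def chi_add chi_smul smul_in)
  show "aadd L (asmul L (v 0) (e 1)) (asmul L (v 1) (e 2)) : acar L" using e12 by (simp add: add_in smul_in)
 qed
 have ker: "{x \<in> acar L. ALL i<2. phi x i = 0} = jacobson L"
 proof
  show "{x \<in> acar L. ALL i<2. phi x i = 0} \<subseteq> jacobson L"
  using kernel_in_maximal unfolding jacobson_def i2 by (auto simp: phi_def)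
  show "jacobson L \<subseteq> {x \<in> acar L. ALL i<2. phi x i = 0}"
  using kernel_maximal[of 1] kernel_maximal[of 2] unfolding jacobson_def i2 by (auto simp: phi_def)
 qed
 have c: "1 : {1, 2::nat}" "2 : {1, 2::nat}" by simp_all
 show ?thesis unfolding elementary_def
 proof (rule exI[of _ 2], rule exI[of _ phi], intro conjI)
  show "ALL v. (ALL i>=2. v i = 0) \<longrightarrow> (EX x:acar L. phi x = v)" using sur by blast
  show "{x \<in> acar L. ALL i<2. phi x i = 0} = jacobson L" by (rule ker)
 qed (auto simp: phi_def chi_add chi_mul chi_smul chi_one)
qed

end

section \<open>The Jacobson radical and idempotents of a finite-dimensional algebra\<close>

context rawrep
begin

lemma rp_eqI: "x : acar L ==> y : acar L ==> rp x = rp y ==> x = y" using rp_inj by (auto dest: inj_onD)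

lemma neg_obtain:
 assumes "x : acar L"
 obtains y where "y : acar L" "rp y = - rp x"
proof -
 obtain y where y: "y : acar L" "aadd L x y = azero L" using neg_ex[OF assms] by blast
 have "rp x + rp y = 0" using rp_add[OF assms y(1)] y(2) rp_zero by simp
 thus thesis using that y(1) by (metis minus_unique)
qed

definition scr :: "'k => 'r" where "scr c = rp (asmul L c (aone L))"

lemma scr_in: "scr c : SS" unfolding scr_def SS_def using smul_in[OF one_in] by blast

lemma scr_rp: "x : acar L ==> scr c * rp x = rp (asmul L c x)"
 and rp_scr: "x : acar L ==> rp x * scr c = rp (asmul L c x)" unfolding scr_def
 using smul_mul_l[of "aone L" x c] smul_mul_r[of x "aone L" c] smul_in[OF one_in]
 by (simp_all add: one_in one_mul mul_one rp_mul[symmetric])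

lemma scr_central: "s : SS ==> scr c * s = s * scr c" unfolding SS_def using scr_rp rp_scr by auto

lemma scr_add: "scr (c + d) = scr c + scr d" unfolding scr_def by (simp add: add_smul one_in rp_add smul_in)

lemma scr_mult: "scr (c * d) = scr c * scr d"
 using scr_rp[of "asmul L d (aone L)" c] smul_in[OF one_in] smul_smul[OF one_in, of c d] unfolding scr_def by simp

lemma scr_one: "s : SS ==> scr 1 * s = s" unfolding SS_def using scr_rp one_smul by auto

lemma scr_zero: "scr 0 = 0" unfolding scr_def by (simp add: zero_smul one_in rp_zero)

lemma pw_in: "s : SS ==> pw s n : SS" by (induction n) (auto intro: S_mult)

text \<open>\<open>I\<close> is the right ideal (1 - x)\<Lambda>. If it contains 1, say w = 1 with
  witness a, then z = -xa is as required. Otherwise Zorn's lemma gives a maximal right ideal above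
  \<open>I\<close>, which contains x as well and hence 1.\<close>

lemma jacobson_quasi:
 assumes x: "x : jacobson L"
 shows "EX z:acar L. aadd L x z = amul L x z"
proof -
 have xa: "x : acar L" using x by (simp add: jacobson_def)
 define I where "I = {w \<in> acar L. EX a:acar L. aadd L w (amul L x a) = a}"
 have Iiff: "w : I \<longleftrightarrow> w : acar L & (EX a:acar L. rp w + rp x * rp a = rp a)" for w
 proof -
  have "aadd L w (amul L x a) = a \<longleftrightarrow> rp w + rp x * rp a = rp a" if "w : acar L" "a : acar L" for a
  proof -
  have "rp (aadd L w (amul L x a)) = rp w + rp x * rp a" using that xa by (simp add: rp_add rp_mul mul_in)
  thus ?thesis using rp_eqI[OF add_in[OF that(1) mul_in[OF xa that(2)]] that(2)] by metis
  qed
  thus ?thesis unfolding I_def by blast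
 qed
 have RI: "right_ideal L I" unfolding right_ideal_def
 proof (intro conjI ballI)
  show "I \<subseteq> acar L" unfolding I_def by blast
  show "azero L : I" unfolding Iiff using zero_in rp_zero by force
 next
  fix u v assume "u : I" "v : I"
  then obtain a b where "u : acar L" "v : acar L" "a : acar L" "rp u + rp x * rp a = rp a"
  "b : acar L" "rp v + rp x * rp b = rp b" unfolding Iiff by blast
  moreover from calculation have "rp (aadd L u v) + rp x * rp (aadd L a b) = rp (aadd L a b)"
  by (simp add: rp_add distrib_left) (metis add.assoc add.commute)
  ultimately show "aadd L u v : I" unfolding Iiff using add_in by blast
 next
  fix u assume "u : I"
  then obtain a where u: "u : acar L" "a : acar L" "rp u + rp x * rp a = rp a" unfolding Iiff by blast
  obtain u' where u': "u' : acar L" "rp u' = - rp u" by (rule neg_obtain[OF u(1)])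
  obtain a' where a': "a' : acar L" "rp a' = - rp a" by (rule neg_obtain[OF u(2)])
  have "rp u' + rp x * rp a' = - (rp u + rp x * rp a)" using u'(2) a'(2) by simp
  hence "rp u' + rp x * rp a' = rp a'" by (simp only: u(3) a'(2))
  hence "u' : I" unfolding Iiff using u' a' by blast
  moreover have "aadd L u u' = azero L"
  by (rule rp_eqI) (use u u' zero_in in \<open>simp_all add: add_in rp_add rp_zero\<close>)
  ultimately show "EX y:I. aadd L u y = azero L" by blast
 next
  fix u c assume "u : I" and c: "c : acar L"
  then obtain a where u: "u : acar L" "a : acar L" "rp u + rp x * rp a = rp a" unfolding Iiff by blast
  have "rp (amul L u c) + rp x * rp (amul L a c) = (rp u + rp x * rp a) * rp c"
  using u(1,2) c by (simp add: rp_mul distrib_right mult.assoc)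
  hence "rp (amul L u c) + rp x * rp (amul L a c) = rp (amul L a c)" using u(2) c by (simp only: u(3) rp_mul)
  thus "amul L u c : I" unfolding Iiff using u c mul_in by blast
 qed
 show ?thesis
 proof (cases "aone L : I")
  case True
  then obtain a where a: "a : acar L" "rp (aone L) + rp x * rp a = rp a" unfolding Iiff by blast
  obtain z where z: "z : acar L" "rp z = - rp (amul L x a)" by (rule neg_obtain[OF mul_in[OF xa a(1)]])
  have "rp x * (rp (aone L) + rp x * rp a) = rp x * rp a" by (simp only: a(2))
  hence "rp x + rp x * (rp x * rp a) = rp x * rp a"
  using xa by (simp add: distrib_left rp_mul[symmetric] mul_one one_in)
  hence "rp x + rp z = rp x * rp z" using z a xa by (simp add: rp_mul algebra_simps eq_diff_eq)
  hence "aadd L x z = amul L x z"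
  by (intro rp_eqI) (use xa z in \<open>simp_all add: add_in mul_in rp_add rp_mul\<close>)
  thus ?thesis using z(1) by blast
 next
  case False
  let ?A = "{K. right_ideal L K & I \<subseteq> K & aone L ~: K}"
  have "EX M:?A. ALL X:?A. M \<subseteq> X \<longrightarrow> X = M"
  proof (rule subset_Zorn_nonempty)
  show "?A ~= {}" using RI False by blast
  fix C assume C: "C ~= {}" "subset.chain ?A C"
  have CA: "K : ?A" if "K : C" for K using C(2) that by (auto simp: subset.chain_def)
  have tot: "K \<subseteq> K' | K' \<subseteq> K" if "K : C" "K' : C" for K K'
  using C(2) that unfolding subset.chain_def by blast
  have RC: "right_ideal L K" if "K : C" for K using CA[OF that] by blast
  have "right_ideal L (\<Union>C)" unfolding right_ideal_def
  proof (intro conjI ballI)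
  show "\<Union>C \<subseteq> acar L" using RC unfolding right_ideal_def by blast
  show "azero L : \<Union>C" using RC C(1) unfolding right_ideal_def by blast
  next
  fix u v assume "u : \<Union>C" "v : \<Union>C"
  then obtain K K' where K: "K : C" "u : K" "K' : C" "v : K'" by blast
  then obtain K'' where "K'' : C" "u : K''" "v : K''" using tot[of K K'] by blast
  thus "aadd L u v : \<Union>C" using RC unfolding right_ideal_def by blast
  next
  fix u assume "u : \<Union>C"
  thus "EX y:\<Union>C. aadd L u y = azero L" using RC unfolding right_ideal_def by blast
  next
  fix u c assume "u : \<Union>C" "c : acar L"
  thus "amul L u c : \<Union>C" using RC unfolding right_ideal_def by blast
  qed
  moreover have "I \<subseteq> \<Union>C" using CA C(1) by blast
  moreover have "aone L ~: \<Union>C" using CA by blast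
  ultimately show "\<Union>C \<in> ?A" by blast
  qed
  then obtain M where MA: "M : ?A" "ALL X:?A. M \<subseteq> X \<longrightarrow> X = M" by (rule bexE)
  hence M: "right_ideal L M" "I \<subseteq> M" "aone L ~: M"
  and mx: "!!X. right_ideal L X ==> I \<subseteq> X ==> aone L ~: X ==> M \<subseteq> X ==> X = M" by simp_all
  have "maximal_right_ideal L M" unfolding maximal_right_ideal_def
  proof (intro conjI allI impI)
  show "M ~= acar L" using M(3) one_in by blast
  next
  fix K assume K: "right_ideal L K & M \<subseteq> K & K ~= acar L"
  have "aone L ~: K"
  proof
  assume "aone L : K"
  hence "amul L (aone L) c : K" if "c : acar L" for c using K that unfolding right_ideal_def by blast
  hence "acar L \<subseteq> K" using one_mul by force
  thus False using K unfolding right_ideal_def by blast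
  qed
  moreover have "I \<subseteq> K" using K M(2) by (meson subset_trans)
  ultimately show "K = M" using mx K by blast
  qed (rule M(1))
  hence xM: "x : M" using x by (auto simp: jacobson_def)
  obtain x' where x': "x' : acar L" "rp x' = - rp x" by (rule neg_obtain[OF xa])
  have "rp (aadd L (aone L) x') + rp x * rp (aone L) = rp (aone L)"
  using x' xa by (simp add: rp_add one_in rp_mul[symmetric] mul_one)
  hence "aadd L (aone L) x' : I" unfolding Iiff using add_in one_in x' by blast
  hence "aadd L (aadd L (aone L) x') x : M" using M xM unfolding right_ideal_def by blast
  moreover have "aadd L (aadd L (aone L) x') x = aone L"
  by (rule rp_eqI) (use x' xa in \<open>simp_all add: add_in one_in rp_add\<close>)
  ultimately show ?thesis using M(3) by simp
 qed
qed


text \<open>A right quasi-inverse that has a right quasi-inverse itself is two-sided: left and right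
  inverse of \<open>z\<close> under the circle operation coincide.\<close>

lemma qi_el:
 assumes x: "x : acar L" and y: "y : acar L" and z: "z : acar L"
  and xz: "aadd L x z = amul L x z" and zw: "aadd L z y = amul L z y"
 shows "qi L x"
proof -
 define X Y Z where "X = rp x" and "Y = rp y" and "Z = rp z"
 have 1: "X + Z = X * Z" using xz rp_add[OF x z] rp_mul[OF x z] by (simp add: X_def Z_def)
 have 2: "Z + Y = Z * Y" using zw rp_add[OF z y] rp_mul[OF z y] by (simp add: Y_def Z_def)
 have "X * Z + X * Y = X * (Z * Y)" by (simp only: distrib_left[symmetric] 2)
 also have "... = (X + Z) * Y" by (simp only: mult.assoc[symmetric] 1)
 finally have "X * Z = Z * Y" by (simp add: distrib_right)
 hence "X + Z = Z + Y" by (simp only: 1 2)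
 hence "X = Y" by simp
 hence "x = y" using rp_eqI[OF x y] by (simp add: X_def Y_def)
 thus ?thesis unfolding qi_def using xz zw add_comm[OF x z] by (intro bexI[OF _ z]) simp
qed

lemma rp_lin: "(!!i. i < n ==> b i : acar L) ==> rp (lin b n c) = (\<Sum>i<n. scr (c i) * rp (b i))"
 unfolding lin_def by (simp add: rp_asum smul_in scr_rp)

text \<open>The powers of \<open>a\<close> are linearly dependent. Dividing a relation by its lowest
  nonzero coefficient writes that power as the next one times a polynomial in
  \<open>a\<close>.\<close>

lemma fitting_exists:
 assumes fd: "fd_algebra L" and a: "a : acar L"
 shows "EX r. EX z:SS. rp a * z = z * rp a & pw (rp a) r = pw (rp a) (Suc r) * z"
proof -
 let ?A = "rp a"
 have AS: "?A : SS" using a by (simp add: SS_def)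
 define p where "p n = inv_into (acar L) rp (pw ?A n)" for n
 have p: "p n : acar L" "rp (p n) = pw ?A n" for n
  using pw_in[OF AS, of n] unfolding SS_def p_def by (auto intro: inv_into_into f_inv_into_f)
 obtain phi :: "'a => nat => 'k" and psi where phi: "!!x y. x : acar L ==> y : acar L ==> phi (aadd L x y) = phi x + phi y"
  and psi: "!!x. x : acar L ==> psi (phi x) = x"
  and phis: "!!c x. x : acar L ==> phi (asmul L c x) = (%i. c * phi x i)"
  and "EX l. ALL x:acar L. ALL j>=l. phi x j = 0" by (rule faithful_coordinates[OF fd]) (rule that)
 then obtain l where l: "!!x j. x : acar L ==> l <= j ==> phi x j = 0" by blast
 have phi0: "phi (azero L) = (%_. 0)" using phis[OF zero_in, of 0] smul_zero by simp
 have phil: "phi (lin p n c) j = (\<Sum>i<n. c i * phi (p i) j)" for n c j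
 proof (induction n)
  case (Suc n)
  have "phi (lin p (Suc n) c) j = phi (lin p n c) j + c n * phi (p n) j"
  using phi[OF lin_in[of n p c] smul_in[OF p(1)[of n], of "c n"]] phis[OF p(1)[of n]] p(1) by (simp add: lin_def)
  thus ?case using Suc by simp
 qed (simp add: lin_def phi0)
 obtain c where c: "EX i:{..<Suc l}. c i ~= 0" "ALL j:{..<l}. (\<Sum>i<Suc l. c i * phi (p i) j) = 0"
  using left_null_vector[of "{..<l}" "{..<Suc l}" "%i. phi (p i)"] by auto
 have pin: "lin p (Suc l) c : acar L" using lin_in p(1) by blast
 have "phi (lin p (Suc l) c) j = phi (azero L) j" for j
  using l[OF pin, of j] phil[of "Suc l" c j] c(2) phi0 by (cases "j < l") auto
 hence "lin p (Suc l) c = azero L" using psi[OF pin] psi[OF zero_in] by (metis ext)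
 hence sum0: "(\<Sum>i<Suc l. scr (c i) * pw ?A i) = 0" using rp_lin[of "Suc l" p c] p rp_zero by simp
 define r where "r = (LEAST i. c i ~= 0)"
 obtain i0 where i0: "i0 < Suc l" "c i0 ~= 0" using c(1) by blast
 have r1: "c r ~= 0" unfolding r_def by (rule LeastI[of "%i. c i ~= 0", OF i0(2)])
 have "r <= i0" unfolding r_def by (rule Least_le[of "%i. c i ~= 0", OF i0(2)])
 hence r2: "r < Suc l" using i0(1) by simp
 have r3: "c i = 0" if "i < r" for i using not_less_Least[of i "%i. c i ~= 0"] that by (simp add: r_def)
 note r = r1 r2 r3
 have cen: "?A * scr d = scr d * ?A" for d using scr_central[OF AS] by simp
 have "EX z:SS. ?A * z = z * ?A &
  (\<Sum>i<n. scr (c i) * pw ?A i) = (if r < n then scr (c r) * pw ?A r + pw ?A (Suc r) * z else 0)" for n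
 proof (induction n)
  case 0
  show ?case by (rule bexI[of _ 0]) (auto simp: S_zero)
 next
  case (Suc n)
  then obtain z where z: "z : SS" "?A * z = z * ?A"
  "(\<Sum>i<n. scr (c i) * pw ?A i) = (if r < n then scr (c r) * pw ?A r + pw ?A (Suc r) * z else 0)" by blast
  \<comment> \<open>The term right after the lowest one contributes a bare scalar to z, and
    \<open>pw\<close> has no exponent 0; hence it forms a case of its own.\<close>
  consider "n < r" | "n = r" | "n = Suc r" | k where "n = Suc (Suc (r + k))"
  using that less_imp_Suc_add[of "Suc r" n] by (cases n "Suc r" rule: linorder_cases) (auto simp: less_Suc_eq)
  thus ?case
  proof cases
  case 1
  thus ?thesis using z r(3)[of n] scr_zero by (intro bexI[of _ 0]) (auto simp: S_zero)
  next
  case 2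
  thus ?thesis using z by (intro bexI[of _ 0]) (auto simp: S_zero)
  next
  case 3
  have "pw ?A (Suc r) * (z + scr (c n)) = pw ?A (Suc r) * z + scr (c n) * pw ?A (Suc r)"
  using scr_central[OF pw_in[OF AS], of "c n" "Suc r"] by (simp add: distrib_left del: pw.simps)
  thus ?thesis using 3 z S_add[OF z(1) scr_in] cen
  by (intro bexI[of _ "z + scr (c n)"]) (simp_all add: add.assoc distrib_left distrib_right del: pw.simps)
  next
  case (4 k)
  have "pw ?A (Suc r) * (scr (c n) * pw ?A k) = scr (c n) * pw ?A n"
  proof -
  have "pw ?A (Suc r) * (scr (c n) * pw ?A k) = scr (c n) * (pw ?A (Suc r) * pw ?A k)"
  by (simp only: mult.assoc[symmetric] scr_central[OF pw_in[OF AS], of "c n" "Suc r"])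
  thus ?thesis using 4 pw_add[of ?A "Suc r" k] by (simp del: pw.simps)
  qed
  moreover have "?A * (scr (c n) * pw ?A k) = scr (c n) * pw ?A k * ?A"
  by (simp only: mult.assoc[symmetric] cen) (simp only: mult.assoc pw_commute[of ?A ?A k])
  ultimately show ?thesis using 4 z S_add[OF z(1) S_mult[OF scr_in pw_in[OF AS]]]
  by (intro bexI[of _ "z + scr (c n) * pw ?A k"])
  (simp_all add: add.assoc distrib_left distrib_right del: pw.simps)
  qed
 qed
 from this[of "Suc l"] obtain z where z: "z : SS" "?A * z = z * ?A" "scr (c r) * pw ?A r + pw ?A (Suc r) * z = 0"
  using sum0 r(2) by auto
 let ?z = "- (scr (1 / c r) * z)"
 have "scr (1 / c r) * (scr (c r) * pw ?A r) + scr (1 / c r) * (pw ?A (Suc r) * z) = 0"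
  using arg_cong[OF z(3), of "%u. scr (1 / c r) * u"] by (simp only: distrib_left mult_zero_right)
 moreover have "scr (1 / c r) * (scr (c r) * pw ?A r) = pw ?A r"
  using r(1) scr_one[OF pw_in[OF AS]] by (simp add: mult.assoc[symmetric] scr_mult[symmetric])
 moreover have "scr (1 / c r) * (pw ?A (Suc r) * z) = pw ?A (Suc r) * (scr (1 / c r) * z)"
  using scr_central[OF pw_in[OF AS], of "1 / c r" "Suc r"] by (simp only: mult.assoc[symmetric])
 ultimately have "pw ?A r = pw ?A (Suc r) * ?z" by (simp add: eq_neg_iff_add_eq_0 del: pw.simps)
 moreover have "?A * ?z = ?z * ?A"
 proof -
  have "?A * (scr (1 / c r) * z) = scr (1 / c r) * z * ?A"
  by (simp only: mult.assoc[symmetric] cen) (simp only: mult.assoc z(2))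
  thus ?thesis by simp
 qed
 ultimately show ?thesis using S_uminus[OF S_mult[OF scr_in z(1)]] by blast
qed


text \<open>Each \<open>e j\<close> is 1 in some coordinate, because a nonzero idempotent is not
  quasi-regular, and in only one, because otherwise an idempotent could be lifted by Fitting's lemma
  and split \<open>e j\<close>. As the two idempotents add up to 1, these two coordinates are
  all.\<close>

lemma elementary_characters:
 assumes fd: "fd_algebra L" and el: "elementary L" and poi: "complete_poi2 L e"
 shows "EX xi. charalg L e xi"
proof -
 obtain m and phi :: "'a => nat => 'k" where
  surj: "ALL v. (ALL i>=m. v i = 0) \<longrightarrow> (EX x:acar L. phi x = v)" and
  hom: "ALL x:acar L. ALL y:acar L. ALL i<m. phi (aadd L x y) i = phi x i + phi y i & phi (amul L x y) i = phi x i * phi y i" and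
  homs: "ALL c. ALL x:acar L. ALL i<m. phi (asmul L c x) i = c * phi x i" and
  hom1: "ALL i<m. phi (aone L) i = 1" and
  ker: "{x\<in>acar L. ALL i<m. phi x i = 0} = jacobson L"
  using el unfolding elementary_def by (elim exE conjE) (rule that)
 have phia: "phi (aadd L x y) i = phi x i + phi y i" and phim: "phi (amul L x y) i = phi x i * phi y i"
  if "x : acar L" "y : acar L" "i < m" for x y i using hom that by simp_all
 have kerI: "x : jacobson L" if "x : acar L" "!!i. i < m ==> phi x i = 0" for x
  using that unfolding ker[symmetric] by simp
 have jq: "qi L x" if x: "x : jacobson L" for x
 proof -
  have x0: "x : acar L" "!!i. i < m ==> phi x i = 0" using x unfolding ker[symmetric] by simp_all
  obtain z where z: "z : acar L" "aadd L x z = amul L x z" using jacobson_quasi[OF x] by blast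
  have "phi z i = 0" if "i < m" for i
  using phia[OF x0(1) z(1) that] phim[OF x0(1) z(1) that] x0(2)[OF that] z(2) by simp
  hence "z : jacobson L" using kerI z(1) by blast
  then obtain w where w: "w : acar L" "aadd L z w = amul L z w" using jacobson_quasi by blast
  show ?thesis by (rule qi_el[OF x0(1) w(1) z(1) z(2) w(2)])
 qed
 have prim: "primitive_idem L (e j)" if "j : {1, 2}" for j using poi that by (auto simp: complete_poi2_def)
 have nz: "e j ~= azero L" if "j : {1, 2}" for j using prim[OF that] by (simp add: primitive_idem_def)
 have phie: "phi (e j) i = 0 \<or> phi (e j) i = 1" if "j : {1, 2}" "i < m" for i j
  using phim[OF e_in[OF that(1)] e_in[OF that(1)] that(2)] e_idem[OF that(1)] by simp
 have ex: "EX i<m. phi (e j) i = 1" if j: "j : {1, 2}" for j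
 proof (rule ccontr)
  assume "~ (EX i<m. phi (e j) i = 1)"
  hence "phi (e j) i = 0" if "i < m" for i using phie[OF j that] that by blast
  hence "qi L (e j)" using jq kerI e_in[OF j] by blast
  then obtain y where y: "y : acar L" "aadd L (e j) y = amul L (e j) y" unfolding qi_def by blast
  define E Y where "E = rp (e j)" and "Y = rp y"
  have EY: "E + Y = E * Y" using y rp_add[OF e_in[OF j] y(1)] rp_mul[OF e_in[OF j] y(1)] by (simp add: E_def Y_def)
  have EE: "E * E = E" using rp_mul[OF e_in[OF j] e_in[OF j]] e_idem[OF j] by (simp add: E_def)
  have "E * E + E * Y = E * (E * Y)" by (simp only: distrib_left[symmetric] EY)
  also have "... = E * Y" by (simp only: mult.assoc[symmetric] EE)
  finally have "E = 0" using EE by simp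
  hence "e j = azero L" using rp_eqI[OF e_in[OF j] zero_in] rp_zero by (simp add: E_def)
  thus False using nz[OF j] by blast
 qed
 have uniq: "i = i'" if j: "j : {1, 2}" and i: "i < m" "phi (e j) i = 1" and i': "i' < m" "phi (e j) i' = 1" for i i' j
 proof (rule ccontr)
  assume ne: "i ~= i'"
  \<comment> \<open>A preimage of the i-th unit vector. Compressed by \<open>e j\<close> it is 1 at
    i and 0 at i', so its Fitting idempotent \<open>F\<close> is a proper part of
    \<open>e j\<close>.\<close>
  obtain a0 where a0: "a0 : acar L" "phi a0 = (%s. if s = i then 1 else 0)"
  using spec[OF surj, of "%s. if s = i then 1 else 0"] i(1) by auto
  define a where "a = amul L (amul L (e j) a0) (e j)"
  have ea: "amul L (e j) a0 : acar L" by (rule mul_in[OF e_in[OF j] a0(1)])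
  have a: "a : acar L" unfolding a_def by (rule mul_in[OF ea e_in[OF j]])
  have phiaa: "phi a s = phi (e j) s * phi a0 s * phi (e j) s" if "s < m" for s
  unfolding a_def using phim[OF ea e_in[OF j] that] phim[OF e_in[OF j] a0(1) that] by simp
  define h where "h s t = phi (inv_into (acar L) rp t) s" for s t
  have hr: "h s (rp x) = phi x s" if "x : acar L" for s x
  unfolding h_def by (simp add: inv_into_f_f[OF rp_inj that])
  have hm': "h s (t * u) = h s t * h s u" if sm: "s < m" and tu: "t : SS" "u : SS" for s t u
  proof -
  obtain x y where "x : acar L" "t = rp x" "y : acar L" "u = rp y" using tu unfolding SS_def by blast
  thus ?thesis using phim[of x y s] sm hr mul_in[of x y] by (simp add: rp_mul[symmetric])
  qed
  define A E where "A = rp a" and "E = rp (e j)"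
  have AS: "A : SS" and ES: "E : SS" using a e_in[OF j] by (auto simp: A_def E_def SS_def)
  have EE: "E * E = E" using rp_mul[OF e_in[OF j] e_in[OF j]] e_idem[OF j] by (simp add: E_def)
  have AE: "A = E * rp a0 * E"
  unfolding A_def a_def E_def using rp_mul[OF ea e_in[OF j]] rp_mul[OF e_in[OF j] a0(1)] by simp
  have EA: "E * A = A" unfolding AE by (simp only: mult.assoc[symmetric] EE)
  have AE': "A * E = A" unfolding AE by (simp only: mult.assoc EE)
  obtain r z where z: "z : SS" "A * z = z * A" "pw A r = pw A (Suc r) * z"
  using fitting_exists[OF fd a] unfolding A_def by blast
  define F where "F = pw A r * pw z r"
  have FF: "F * F = F" unfolding F_def by (rule fitting_idempotent(1)[OF z(2,3)])
  have Fr: "pw A r = pw A (Suc (r + r)) * pw z r" by (rule fitting_idempotent(2)[OF z(2,3)])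
  have FS: "F : SS" unfolding F_def by (intro S_mult pw_in AS z(1))
  have EP: "E * pw A r = pw A r" using EA by (cases r) (simp_all add: mult.assoc[symmetric])
  have PE: "pw A r * E = pw A r" using pw_commute[of E A r] EA AE' EP by simp
  have cc: "pw z r * pw A r = pw A r * pw z r" by (rule pw_commute, rule pw_commute[OF z(2), symmetric])
  have EF: "E * F = F" unfolding F_def by (simp only: mult.assoc[symmetric] EP)
  have FE: "F * E = F" unfolding F_def cc[symmetric] by (simp only: mult.assoc PE)
  have hA: "h i (pw A n) = 1" "h i' (pw A n) = 0" for n
  proof -
  have 0: "h i A = 1" "h i' A = 0" unfolding A_def using hr[OF a] phiaa i i' a0(2) ne by simp_all
  show "h i (pw A n) = 1" by (induction n) (use 0 hm'[OF i(1) AS pw_in[OF AS]] in simp_all)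
  show "h i' (pw A n) = 0" by (induction n) (use 0 hm'[OF i'(1) AS pw_in[OF AS]] in simp_all)
  qed
  have "h i (pw A r) = h i (pw A (Suc (r + r))) * h i (pw z r)"
  by (subst Fr) (rule hm'[OF i(1) pw_in[OF AS] pw_in[OF z(1)]])
  hence "h i (pw z r) = 1" using hA(1)[of r] hA(1)[of "Suc (r + r)"] by simp
  hence hF: "h i F = 1" "h i' F = 0"
  unfolding F_def using hm'[OF i(1) pw_in[OF AS] pw_in[OF z(1)]] hm'[OF i'(1) pw_in[OF AS] pw_in[OF z(1)]] hA
  by simp_all
  obtain f where f: "f : acar L" "rp f = F" using FS unfolding SS_def by blast
  obtain g where g: "g : acar L" "rp g = E - F" using S_minus[OF ES FS] unfolding SS_def by (metis imageE)
  have "f ~= azero L"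
  proof
  assume "f = azero L"
  hence "phi (azero L) i = 1" using hF(1) hr[OF f(1), of i] f(2) by simp
  moreover have "phi (azero L) i = 0" using phia[OF zero_in zero_in i(1)] add_zero[OF zero_in] by (metis add.right_neutral add_left_cancel)
  ultimately show False by simp
  qed
  moreover have "g ~= azero L"
  proof
  assume "g = azero L"
  hence "E = F" using g(2) rp_zero by simp
  hence "phi (e j) i' = 0" using hF(2) hr[OF e_in[OF j], of i'] by (simp add: E_def)
  thus False using i'(2) by simp
  qed
  moreover have "idempotent L f"
  unfolding idempotent_def using rp_eqI[OF mul_in[OF f(1) f(1)] f(1)] rp_mul[OF f(1) f(1)] f FF by simp
  moreover have "idempotent L g"
  unfolding idempotent_def using rp_eqI[OF mul_in[OF g(1) g(1)] g(1)] rp_mul[OF g(1) g(1)] g FF EE EF FE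
  by (simp add: algebra_simps)
  moreover have "amul L f g = azero L"
  using rp_eqI[OF mul_in[OF f(1) g(1)] zero_in] rp_mul[OF f(1) g(1)] rp_zero f g FF FE by (simp add: right_diff_distrib)
  moreover have "amul L g f = azero L"
  using rp_eqI[OF mul_in[OF g(1) f(1)] zero_in] rp_mul[OF g(1) f(1)] rp_zero f g FF EF by (simp add: left_diff_distrib)
  moreover have "aadd L f g = e j"
  using rp_eqI[OF add_in[OF f(1) g(1)] e_in[OF j]] rp_add[OF f(1) g(1)] f g by (simp add: E_def)
  ultimately show False using prim[OF j] unfolding primitive_idem_def by blast
 qed
 obtain i1 where i1: "i1 < m" "phi (e 1) i1 = 1" using ex[of 1] by auto
 obtain i2 where i2: "i2 < m" "phi (e 2) i2 = 1" using ex[of 2] by auto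
 have e12: "e 1 : acar L" "e 2 : acar L" using e_in by auto
 have sum1: "phi (e 1) i + phi (e 2) i = 1" if "i < m" for i
  using phia[OF e12 that] hom1 that poi by (simp add: complete_poi2_def)
 have cover: "i = i1 | i = i2" if i: "i < m" for i
 proof (cases "phi (e 1) i = 1")
  case True
  thus ?thesis using uniq[of 1 i i1] i i1 by simp
 next
  case False
  hence "phi (e 2) i = 1" using phie[of 1 i] sum1[OF i] i by auto
  thus ?thesis using uniq[of 2 i i2] i i2 by simp
 qed
 define xi where "xi j x = phi x (if j = (1::nat) then i1 else i2)" for j x
 have "charalg L e xi"
 proof
  show "complete_poi2 L e" by (rule poi)
  fix i :: nat and x y
  show "xi i (aadd L x y) = xi i x + xi i y" if "x : acar L" "y : acar L"
  using phia[OF that] i1 i2 by (simp add: xi_def)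
  show "xi i (amul L x y) = xi i x * xi i y" if "x : acar L" "y : acar L"
  using phim[OF that] i1 i2 by (simp add: xi_def)
  show "xi i (asmul L c x) = c * xi i x" if "x : acar L" for c using homs that i1 i2 by (simp add: xi_def)
  show "qi L x" if "x : acar L" "xi 1 x = 0" "xi 2 x = 0"
  proof (rule jq, rule kerI[OF that(1)])
  fix i assume "i < m"
  thus "phi x i = 0" using cover that by (auto simp: xi_def)
  qed
 next
  fix i j :: nat assume "i : {1, 2}" "j : {1, 2}"
  thus "xi i (e j) = (if i = j then 1 else 0)" using i1 i2 sum1[OF i1(1)] sum1[OF i2(1)] by (auto simp: xi_def)
 qed
 thus ?thesis by blast
qed

end

section \<open>The bimodule \<open>e\<^sub>1\<Lambda>e\<^sub>2\<close>\<close>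

locale charrep = charalg L e xi + rawrep L e rp
 for L :: "('k::field, 'a) kalg" and e :: "nat => 'a" and xi :: "nat => 'a => 'k" and rp :: "'a => 'r::ring" +
 assumes tri_raw: "x : acar L ==> amul L (amul L (e 2) x) (e 1) = azero L"
begin

definition ch :: "nat => 'r => 'k" where "ch i s = xi i (inv_into (acar L) rp s)"

lemma inv_rp: "x : acar L ==> inv_into (acar L) rp (rp x) = x" by (rule inv_into_f_f[OF rp_inj])

lemma ch_rp: "x : acar L ==> ch i (rp x) = xi i x" by (simp add: ch_def inv_rp)

lemma SS_E: assumes "s : SS" obtains x where "x : acar L" "s = rp x" using assms unfolding SS_def by blast

lemma rp_SS: "x : acar L ==> rp x : SS" by (simp add: SS_def)

lemma ee12: "ee 1 = rp (e 1)" "ee 2 = rp (e 2)" by (simp_all add: ee_def)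

lemma ee_sum: "ee 1 + ee 2 = rp (aone L)" using rp_add[OF e_in[of 1] e_in[of 2]] e_one by (simp add: ee_def)

text \<open>The other character vanishes on a corner element, so the element has a quasi-inverse
  \<open>Y\<close> in the whole algebra; cut down to the corner, \<open>E - E * Y * E\<close>
  inverts \<open>E - X\<close>.\<close>

lemma ee_qr:
 assumes i: "i : {1, 2}" and s: "s : SS" "ee i * s = s" "s * ee i = s" "ch i s = 0"
 shows "EX t:SS. ee i * t = t & t * ee i = t & t * (ee i - s) = ee i & (ee i - s) * t = ee i"
proof -
 obtain x where x: "x : acar L" "s = rp x" by (rule SS_E[OF s(1)])
 have ei: "ee i = rp (e i)" using i by (simp add: ee_def)
 have "rp (amul L (e i) x) = rp x" using s(2) x ei rp_mul[OF e_in[OF i] x(1)] by simp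
 hence ex: "amul L (e i) x = x" by (rule rp_eqI[OF mul_in[OF e_in[OF i] x(1)] x(1)])
 have z: "xi j x = 0" if j: "j : {1, 2}" for j
 proof (cases "j = i")
  case True
  thus ?thesis using s(4) x ch_rp by simp
 next
  case False
  thus ?thesis using chi_mul[OF j e_in[OF i] x(1)] chi_e[OF j i] ex by simp
 qed
 obtain y where y: "y : acar L" "aadd L x y = amul L x y" "aadd L x y = amul L y x"
  using chi_qi[OF x(1)] z unfolding qi_def by auto
 define E X Y where "E = ee i" and "X = rp x" and "Y = rp y"
 have XY: "X + Y = X * Y" "X + Y = Y * X"
  using y(2,3) rp_add[OF x(1) y(1)] rp_mul[OF x(1) y(1)] rp_mul[OF y(1) x(1)] by (simp_all add: X_def Y_def)
 have EX: "E * X = X" "X * E = X" "E * E = E" using s(2,3) x(2) ep_idem[of i] by (simp_all add: E_def X_def)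
 have c1: "E * Y * X = X + E * Y * E"
 proof -
  have "E * Y * X = E * (Y * X) * E" by (simp only: mult.assoc EX)
  also have "... = X + E * Y * E" by (simp only: XY(2)[symmetric] distrib_left distrib_right EX)
  finally show ?thesis .
 qed
 have c2: "X * (Y * E) = X + E * Y * E"
 proof -
  have "X * (Y * E) = E * (X * Y) * E" by (simp only: mult.assoc[symmetric] EX)
  also have "... = X + E * Y * E" by (simp only: XY(1)[symmetric] distrib_left distrib_right EX)
  finally show ?thesis .
 qed
 let ?t = "E - E * Y * E"
 have "?t : SS" unfolding E_def Y_def by (intro S_minus S_mult ep_in rp_SS y)
 moreover have "E * ?t = ?t" by (simp only: right_diff_distrib mult.assoc[symmetric] EX)
 moreover have "?t * E = ?t" by (simp only: left_diff_distrib mult.assoc EX)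
 moreover have "?t * (E - X) = E"
 proof -
  have "?t * (E - X) = E - X - (E * Y * E - E * Y * X)"
  by (simp only: left_diff_distrib right_diff_distrib mult.assoc EX; simp)
  thus ?thesis by (simp add: c1)
 qed
 moreover have "(E - X) * ?t = E"
 proof -
  have "(E - X) * ?t = E - X - (E * Y * E - X * (Y * E))"
  by (simp only: left_diff_distrib right_diff_distrib mult.assoc[symmetric] EX; simp add: mult.assoc)
  thus ?thesis by (simp add: c2)
 qed
 ultimately show ?thesis unfolding E_def X_def x(2)[symmetric] by blast
qed

sublocale E: ealg SS ee ch scr
proof
 show "ee i * ee j = 0" if "i ~= j" for i j
 proof (cases "i : {1, 2} & j : {1, 2}")
  case True
  hence "amul L (e i) (e j) = azero L" using poi that by (auto simp: complete_poi2_def)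
  thus ?thesis using True rp_mul[OF e_in[of i] e_in[of j]] rp_zero by (simp add: ee_def)
 qed (auto simp: ee_def)
 show "(ee 1 + ee 2) * s = s" "s * (ee 1 + ee 2) = s" if "s : SS" for s
  using that by (auto elim!: SS_E simp: ee_sum rp_mul[symmetric] one_in one_mul mul_one)
 show "ee 2 * s * ee 1 = 0" if "s : SS" for s
  using that tri_raw e_in by (auto elim!: SS_E simp: ee12 rp_mul[symmetric] mul_in rp_zero)
 show "ch i (s + t) = ch i s + ch i t" if i: "i : {1, 2}" and s: "s : SS" and t: "t : SS" for i s t
 proof -
  obtain x y where "x : acar L" "s = rp x" "y : acar L" "t = rp y" using SS_E[OF s] SS_E[OF t] by metis
  thus ?thesis using ch_rp[OF add_in[of x y], of i] by (simp add: rp_add ch_rp chi_add[OF i])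
 qed
 show "ch i (s * t) = ch i s * ch i t" if i: "i : {1, 2}" and s: "s : SS" and t: "t : SS" for i s t
 proof -
  obtain x y where "x : acar L" "s = rp x" "y : acar L" "t = rp y" using SS_E[OF s] SS_E[OF t] by metis
  thus ?thesis using ch_rp[OF mul_in[of x y], of i] by (simp add: rp_mul ch_rp chi_mul[OF i])
 qed
 show "ch i (ee i) = 1" if "i : {1, 2}" for i
  using ch_rp[OF e_in[OF that], of i] chi_e[OF that that] that by (simp add: ee_def)
 show "scr c : SS" for c by (rule scr_in)
 show "scr c * s = s * scr c" if "s : SS" for s c using that by (rule scr_central)
 show "ch i (scr c) = c" if "i : {1, 2}" for i c
  unfolding scr_def using ch_rp[OF smul_in[OF one_in], of i c] chi_smul[OF that one_in] chi_one[OF that] by simp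
qed (rule ee_qr)

definition XX :: "'a set" where
 "XX = {z \<in> acar L. amul L (e 1) z = z & amul L z (e 2) = z}"

lemma XX_iff: "z : acar L ==> z : XX \<longleftrightarrow> ee 1 * rp z = rp z & rp z * ee 2 = rp z"
 using rp_eqI[of "amul L (e 1) z" z] rp_eqI[of "amul L z (e 2)" z] e_in[of 1] e_in[of 2]
 by (auto simp: XX_def ee12 rp_mul[symmetric] mul_in)

lemma XXD: "z : XX ==> z : acar L & ee 1 * rp z = rp z & rp z * ee 2 = rp z" using XX_iff XX_def by blast

definition AA :: "'a set" where
 "AA = {a \<in> acar L. amul L (e 1) a = a & amul L a (e 1) = a}"

lemma AA_iff: "a : acar L ==> a : AA \<longleftrightarrow> ee 1 * rp a = rp a & rp a * ee 1 = rp a"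
 using rp_eqI[of "amul L (e 1) a" a] rp_eqI[of "amul L a (e 1)" a] e_in[of 1]
 by (auto simp: AA_def ee12 rp_mul[symmetric] mul_in)

lemma AAD: "a : AA ==> a : acar L & ee 1 * rp a = rp a & rp a * ee 1 = rp a" using AA_iff AA_def by blast

lemma XX_add: assumes "y : XX" "z : XX" shows "aadd L y z : XX"
 using XX_iff[OF add_in] XXD[OF assms(1)] XXD[OF assms(2)] by (simp add: rp_add distrib_left distrib_right)

lemma rp_smul: "x : acar L ==> rp (asmul L c x) = scr c * rp x" by (simp add: scr_rp)

lemma smul_left: "s : SS ==> s * (scr c * t) = scr c * (s * t)" by (simp only: mult.assoc[symmetric] scr_central)

lemma XX_smul: assumes "z : XX" shows "asmul L c z : XX"
 using XX_iff[OF smul_in] XXD[OF assms] smul_left[OF ep_in[of 1]] by (simp add: rp_smul mult.assoc)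

lemma AA_smul: assumes "z : AA" shows "asmul L c z : AA"
 using AA_iff[OF smul_in] AAD[OF assms] smul_left[OF ep_in[of 1]] by (simp add: rp_smul mult.assoc)

lemma AA_add: assumes "y : AA" "z : AA" shows "aadd L y z : AA"
 using AA_iff[OF add_in] AAD[OF assms(1)] AAD[OF assms(2)] by (simp add: rp_add distrib_left distrib_right)

lemma AA_XX: assumes "a : AA" "z : XX" shows "amul L a z : XX"
proof -
 have a: "a : acar L" "ee 1 * rp a = rp a" and z: "z : acar L" "rp z * ee 2 = rp z"
  using AAD[OF assms(1)] XXD[OF assms(2)] by auto
 have "ee 1 * (rp a * rp z) = rp a * rp z" by (simp only: mult.assoc[symmetric] a)
 moreover have "rp a * rp z * ee 2 = rp a * rp z" by (simp only: mult.assoc z)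
 ultimately show ?thesis using XX_iff[OF mul_in[OF a(1) z(1)]] rp_mul[OF a(1) z(1)] by simp
qed

text \<open>Triangularity makes e_1\<Lambda>e_2 a right module over the whole algebra: the part of
  the product ending in e_1 contains a factor from e_2\<Lambda>e_1.\<close>

lemma XX_mul: assumes "z : XX" "b : acar L" shows "amul L z b : XX"
proof -
 have z: "z : acar L" "ee 1 * rp z = rp z" "rp z * ee 2 = rp z" using XXD[OF assms(1)] by auto
 have "ee 1 * (rp z * rp b) = rp z * rp b" by (simp only: mult.assoc[symmetric] z)
 moreover have "rp z * rp b * ee 2 = rp z * rp b"
 proof -
  have "rp z * rp b * ee 1 = rp z * (ee 2 * rp b * ee 1)" by (simp only: mult.assoc[symmetric] z)
  hence "rp z * rp b * ee 1 = 0" using E.tri[OF rp_SS[OF assms(2)]] by simp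
  thus ?thesis using E.unit_r[OF S_mult[OF rp_SS[OF z(1)] rp_SS[OF assms(2)]]] by (simp add: distrib_left)
 qed
 ultimately show ?thesis using XX_iff[OF mul_in[OF z(1) assms(2)]] rp_mul[OF z(1) assms(2)] by simp
qed

text \<open>Coordinates on e_1\<Lambda>e_2 modulo \<open>N\<close>, which is J_A e_1\<Lambda>e_2.
  Right multiplication preserves \<open>N\<close>, so it is given by matrices on the quotient, and
  lifts of a basis of the quotient generate over A by Nakayama.\<close>

lemma trix_data:
 assumes fd: "fd_algebra L"
 obtains l :: nat and x kap where "!!i. i < l ==> x i : XX"
  "!!y z j. y : XX ==> z : XX ==> kap (aadd L y z) j = kap y j + kap z j"
  "!!c z j. z : XX ==> kap (asmul L c z) j = c * kap z j"
  "!!i j. i < l ==> j < l ==> kap (x i) j = (if i = j then 1 else (0::'k))"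
  "!!a z j. a : AA ==> z : XX ==> kap (amul L a z) j = xi 1 a * kap z j"
  "!!z b j. z : XX ==> b : acar L ==> kap (amul L z b) j = (\<Sum>k<l. kap z k * kap (amul L (x k) b) j)"
  "!!z. z : XX ==> EX a. (ALL i<l. a i : AA) & rp z = (\<Sum>i<l. rp (a i) * rp (x i))"
proof -
 obtain n b where b: "!!i. i < n ==> b i : acar L" "acar L = range (lin b n)" by (rule finite_span[OF fd]) (rule that)
 define b' where "b' i = amul L (amul L (e 1) (b i)) (e 2)" for i
 have e1: "e 1 : acar L" and e2: "e 2 : acar L" using e_in by auto
 have rb': "rp (b' i) = ee 1 * rp (b i) * ee 2" if "i < n" for i
  unfolding b'_def ee12 using b(1)[OF that] e1 e2 by (simp add: rp_mul mul_in)
 have b'in: "b' i : acar L" if "i < n" for i unfolding b'_def by (intro mul_in e1 e2 b(1) that)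
 have b'X: "b' i : XX" if "i < n" for i
 proof -
  have "ee 1 * (ee 1 * rp (b i) * ee 2) = ee 1 * rp (b i) * ee 2" by (simp only: mult.assoc[symmetric] ep_idem)
  moreover have "ee 1 * rp (b i) * ee 2 * ee 2 = ee 1 * rp (b i) * ee 2" by (simp only: mult.assoc ep_idem)
  ultimately show ?thesis using XX_iff[OF b'in[OF that]] rb'[OF that] by simp
 qed
 have linX: "lin z m c : XX" if "!!i. i < m ==> z i : XX" for z m c
 proof -
  have "0 < Suc 0" by simp
  have zX: "azero L : XX" using XX_iff[OF zero_in] rp_zero by simp
  show ?thesis using that by (induction m) (auto simp: lin_def zX intro: XX_add XX_smul)
 qed
 have XR: "XX = range (lin b' n)"
 proof
  show "range (lin b' n) \<subseteq> XX" using linX b'X by blast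
  show "XX \<subseteq> range (lin b' n)"
  proof
  fix z assume z: "z : XX"
  then obtain c where c: "z = lin b n c" using XXD b(2) by blast
  have "rp z = ee 1 * rp z * ee 2" using XXD[OF z] by simp
  also have "... = (\<Sum>i<n. ee 1 * (scr (c i) * rp (b i)) * ee 2)"
  using rp_lin[of n b c] b(1) c by (simp add: sum_distrib_left sum_distrib_right)
  also have "... = (\<Sum>i<n. scr (c i) * rp (b' i))"
  by (rule sum.cong) (auto simp: rb' smul_left[OF ep_in] mult.assoc)
  also have "... = rp (lin b' n c)" using rp_lin[of n b' c] b'in by simp
  finally have "z = lin b' n c" using rp_eqI[of z "lin b' n c"] XXD[OF z] lin_in[of n b' c] b'in by blast
  thus "z : range (lin b' n)" by (intro range_eqI[of _ _ c])
  qed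
 qed
 define J where "J = {a \<in> AA. xi 1 a = 0}"
 have J_add: "aadd L a c : J" if "a : J" "c : J" for a c
  using that AA_add[of a c] AAD[of a] AAD[of c] chi_add[of 1 a c] by (simp add: J_def)
 have J_smul: "asmul L d a : J" if "a : J" for a d
  using that AA_smul[of a d] AAD[of a] chi_smul[of 1 a d] by (simp add: J_def)
 have J_in: "a : acar L" if "a : J" for a using that AAD[of a] by (simp add: J_def)
 have J_zero: "azero L : J" using AA_iff[OF zero_in] rp_zero chi_zero[of 1] by (simp add: J_def)
 define N where "N = {z \<in> acar L. EX a. (ALL j<n. a j : J) & rp z = (\<Sum>j<n. rp (a j) * rp (b' j))}"
 have NI: "z : N" if "z : acar L" "!!j. j < n ==> a j : J" "rp z = (\<Sum>j<n. rp (a j) * rp (b' j))" for z a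
  unfolding N_def using that by blast
 have NE: "EX a. (ALL j<n. a j : J) & rp z = (\<Sum>j<n. rp (a j) * rp (b' j)) & z : acar L" if "z : N" for z
  using that unfolding N_def by blast
 have N0: "azero L : N" by (rule NI[of _ "%_. azero L"]) (auto simp: zero_in J_zero rp_zero)
 have Na: "aadd L y z : N" if yz: "y : N" "z : N" for y z
 proof -
  obtain a a' where a: "ALL j<n. a j : J" "rp y = (\<Sum>j<n. rp (a j) * rp (b' j))" "y : acar L"
  and a': "ALL j<n. a' j : J" "rp z = (\<Sum>j<n. rp (a' j) * rp (b' j))" "z : acar L"
  using NE[OF yz(1)] NE[OF yz(2)] by blast
  show ?thesis by (rule NI[of _ "%j. aadd L (a j) (a' j)"])
  (use a a' in \<open>auto simp: add_in J_add rp_add J_in distrib_right sum.distrib\<close>)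
 qed
 have Ns: "asmul L c z : N" if zN: "z : N" for c z
 proof -
  obtain a where a: "ALL j<n. a j : J" "rp z = (\<Sum>j<n. rp (a j) * rp (b' j))" "z : acar L"
  using NE[OF zN] by blast
  show ?thesis by (rule NI[of _ "%j. asmul L c (a j)"])
  (use a in \<open>auto simp: smul_in J_smul rp_smul J_in sum_distrib_left mult.assoc\<close>)
 qed
 have JX: "amul L a z : N" if a: "a : J" and z: "z : XX" for a z
 proof -
  obtain c where c: "z = lin b' n c" using z XR by blast
  have "rp (amul L a z) = rp a * (\<Sum>j<n. scr (c j) * rp (b' j))"
  using rp_mul[OF J_in[OF a]] XXD[OF z] rp_lin[of n b' c] b'in c by simp
  also have "... = (\<Sum>j<n. rp (asmul L (c j) a) * rp (b' j))"
  by (simp add: sum_distrib_left smul_left[OF rp_SS[OF J_in[OF a]]] rp_smul[OF J_in[OF a]] mult.assoc)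
  finally show ?thesis
  using J_smul[OF a] mul_in[OF J_in[OF a]] XXD[OF z] by (intro NI[of _ "%j. asmul L (c j) a"]) auto
 qed
 have NX: "N \<subseteq> XX"
 proof
  fix z assume "z : N"
  then obtain a where a: "ALL j<n. a j : J" "rp z = (\<Sum>j<n. rp (a j) * rp (b' j))" "z : acar L"
  using NE by blast
  have t: "ee 1 * (rp (a j) * rp (b' j)) = rp (a j) * rp (b' j)" "rp (a j) * rp (b' j) * ee 2 = rp (a j) * rp (b' j)"
  if "j < n" for j
  proof -
  have "amul L (a j) (b' j) : XX" using a(1) that AA_XX b'X by (auto simp: J_def)
  thus "ee 1 * (rp (a j) * rp (b' j)) = rp (a j) * rp (b' j)" "rp (a j) * rp (b' j) * ee 2 = rp (a j) * rp (b' j)"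
  using XXD[of "amul L (a j) (b' j)"] rp_mul[of "a j" "b' j"] a(1) J_in b'in that by auto
  qed
  show "z : XX" unfolding XX_iff[OF a(3)] a(2) sum_distrib_left sum_distrib_right by (simp add: t)
 qed
 have Nm: "amul L z d : N" if zN: "z : N" and d: "d : acar L" for z d
 proof -
  obtain a where a: "ALL j<n. a j : J" "rp z = (\<Sum>j<n. rp (a j) * rp (b' j))" "z : acar L"
  using NE[OF zN] by blast
  have "EX y:N. rp y = (\<Sum>j<m. rp (a j) * rp (b' j) * rp d)" if "m <= n" for m using that
  proof (induction m)
  case 0
  thus ?case using N0 rp_zero by auto
  next
  case (Suc m)
  then obtain y where y: "y : N" "rp y = (\<Sum>j<m. rp (a j) * rp (b' j) * rp d)" by auto
  have m: "m < n" using Suc.prems by simp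
  have w: "amul L (a m) (amul L (b' m) d) : N" using JX XX_mul[OF b'X[OF m] d] a(1) m by blast
  have aj: "a m : acar L" using a(1) m J_in by blast
  have "rp (amul L (a m) (amul L (b' m) d)) = rp (a m) * rp (b' m) * rp d"
  using rp_mul[OF aj mul_in[OF b'in[OF m] d]] rp_mul[OF b'in[OF m] d] by (simp add: mult.assoc)
  moreover have "rp (aadd L y (amul L (a m) (amul L (b' m) d))) = rp y + rp (amul L (a m) (amul L (b' m) d))"
  using rp_add NE[OF y(1)] NE[OF w] by blast
  ultimately show ?case using y Na[OF y(1) w] by (intro bexI[of _ "aadd L y (amul L (a m) (amul L (b' m) d))"]) simp_all
  qed
  then obtain y where y: "y : N" "rp y = (\<Sum>j<n. rp (a j) * rp (b' j) * rp d)" by blast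
  have "rp y = rp (amul L z d)" unfolding y(2) rp_mul[OF a(3) d] a(2) sum_distrib_right ..
  thus ?thesis using y(1) rp_eqI[OF _ mul_in[OF a(3) d], of y] NE[OF y(1)] by auto
 qed
 obtain l x kap where x: "!!i. i < l ==> x i : b' ` {..<n}"
  and ka: "!!y z j. y : XX ==> z : XX ==> kap (aadd L y z) j = kap y j + kap z j"
  and ks: "!!c z j. z : XX ==> kap (asmul L c z) j = c * kap z j"
  and kx: "!!i j. i < l ==> j < l ==> kap (x i) j = (if i = j then 1 else (0::'k))"
  and "!!z j. z : XX ==> l <= j ==> kap z j = 0"
  and kN: "!!z. z : XX ==> z : N \<longleftrightarrow> (ALL j. kap z j = 0)"
  and rec: "!!z. z : XX ==> EX m:N. z = aadd L m (lin x l (kap z))"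
  by (rule subquotient_basis[OF b'in XR N0 Na Ns NX]; (assumption | rule that))
 have xX: "x i : XX" if "i < l" for i using x[OF that] b'X by auto
 have xin: "x i : acar L" if "i < l" for i using XXD[OF xX[OF that]] by blast
 have kmul: "kap (amul L a z) j = xi 1 a * kap z j" if a: "a : AA" and z: "z : XX" for a z j
 proof -
  have ai: "a : acar L" and zi: "z : acar L" using AAD[OF a] XXD[OF z] by auto
  \<comment> \<open>Splitting off the residue times e_1 leaves a radical element, which acts as 0 on
    the quotient; so \<open>a\<close> acts by its residue.\<close>
  define a0 where "a0 = aadd L a (asmul L (- xi 1 a) (e 1))"
  have e1A: "e 1 : AA" using AA_iff[OF e1] ee12 ep_idem[of 1] by simp
  have "a0 : AA" unfolding a0_def by (intro AA_add AA_smul a e1A)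
  moreover have "xi 1 a0 = 0"
  unfolding a0_def using chi_add[of 1 a] chi_smul[of 1 "e 1"] chi_e[of 1 1] ai e1 smul_in by simp
  ultimately have a0: "a0 : J" by (simp add: J_def)
  have p: "amul L a0 z : N" by (rule JX[OF a0 z])
  have pX: "amul L a0 z : XX" using p NX by blast
  have "rp (aadd L (amul L a0 z) (asmul L (xi 1 a) z)) = rp (amul L a z)"
  proof -
  have "rp a0 = rp a + scr (- xi 1 a) * ee 1"
  unfolding a0_def using rp_add[OF ai smul_in[OF e1]] rp_smul[OF e1] ee12 by simp
  hence "rp (amul L a0 z) = rp a * rp z + scr (- xi 1 a) * rp z"
  using rp_mul[OF J_in[OF a0] zi] XXD[OF z] by (simp add: distrib_right mult.assoc)
  moreover have "scr (- xi 1 a) * rp z + scr (xi 1 a) * rp z = 0"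
  unfolding distrib_right[symmetric] scr_add[symmetric] by (simp add: scr_zero)
  moreover have "rp (aadd L (amul L a0 z) (asmul L (xi 1 a) z)) = rp (amul L a0 z) + scr (xi 1 a) * rp z"
  using rp_add XXD[OF pX] smul_in[OF zi] rp_smul[OF zi] by simp
  ultimately show ?thesis using rp_mul[OF ai zi] by (simp add: add.assoc)
  qed
  hence "amul L a z = aadd L (amul L a0 z) (asmul L (xi 1 a) z)"
  using rp_eqI[OF mul_in[OF ai zi] add_in[OF _ smul_in[OF zi]]] XXD[OF pX] by simp
  thus ?thesis using ka[OF pX XX_smul[OF z]] ks[OF z] kN[OF pX] p by simp
 qed
 have krep: "kap (amul L z d) j = (\<Sum>k<l. kap z k * kap (amul L (x k) d) j)" if z: "z : XX" and d: "d : acar L" for z d j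
 proof -
  obtain m where m: "m : N" "z = aadd L m (lin x l (kap z))" using rec[OF z] by blast
  have mX: "m : XX" using m NX by blast
  have li: "kap (amul L (lin x q c) d) j = (\<Sum>k<q. c k * kap (amul L (x k) d) j)" if "q <= l" for q c
  using that
  proof (induction q)
  case 0
  have "kap (azero L) j = 0" using kN[of "azero L"] N0 NX by blast
  thus ?case using zero_mul[OF d] by (simp add: lin_def)
  next
  case (Suc q)
  hence q: "q < l" by simp
  have lq: "lin x q c : XX" using linX xX q by simp
  have "amul L (lin x (Suc q) c) d = aadd L (amul L (lin x q c) d) (asmul L (c q) (amul L (x q) d))"
  using add_mul[OF _ smul_in[OF xin[OF q]] d, of "lin x q c"] XXD[OF lq] smul_mul_l[OF xin[OF q] d]
  by (simp add: lin_def)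
  thus ?case
  using ka[OF XX_mul[OF lq d] XX_smul[OF XX_mul[OF xX[OF q] d]]] ks[OF XX_mul[OF xX[OF q] d]] Suc by simp
  qed
  have lX: "lin x l (kap z) : XX" using linX xX by blast
  have "amul L z d = aadd L (amul L m d) (amul L (lin x l (kap z)) d)"
  by (subst m(2)) (rule add_mul, use XXD[OF mX] XXD[OF lX] d in auto)
  moreover have "kap (amul L m d) j = 0" using kN[OF XX_mul[OF mX d]] Nm[OF m(1) d] by blast
  ultimately show ?thesis using ka[OF XX_mul[OF mX d] XX_mul[OF lX d]] li[of l "kap z"] by simp
 qed
 let ?A = "rp ` AA" and ?J = "rp ` J"
 define N2 where "N2 = {m. EX s. (ALL i<l. s i : ?A) & m = (\<Sum>i<l. s i * rp (x i))}"
 have N2I: "m : N2" if "!!i. i < l ==> s i : ?A" "m = (\<Sum>i<l. s i * rp (x i))" for m s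
  unfolding N2_def using that by blast
 have N2E: "EX s. (ALL i<l. s i : ?A) & m = (\<Sum>i<l. s i * rp (x i))" if "m : N2" for m
  using that unfolding N2_def by blast
 have AS: "s : ?A \<longleftrightarrow> s : SS & ee 1 * s = s & s * ee 1 = s" for s
  using AA_iff AAD unfolding SS_def by (auto intro!: image_eqI)
 have Aadd: "s + t : ?A" if "s : ?A" "t : ?A" for s t
  using that unfolding AS by (simp add: S_add distrib_left distrib_right)
 have Amul: "s * t : ?A" if "s : ?A" "t : ?A" for s t using that unfolding AS by (metis S_mult mult.assoc)
 have A0: "0 : ?A" unfolding AS by (simp add: S_zero)
 have JS: "s : ?J \<longleftrightarrow> s : ?A & ch 1 s = 0" for s
  using AAD ch_rp[of _ 1] unfolding J_def by (auto intro!: image_eqI)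
 have N_add: "m + q : N2" if mq: "m : N2" "q : N2" for m q
 proof -
  obtain s t where s: "ALL i<l. s i : ?A" "m = (\<Sum>i<l. s i * rp (x i))"
  and t: "ALL i<l. t i : ?A" "q = (\<Sum>i<l. t i * rp (x i))" using N2E[OF mq(1)] N2E[OF mq(2)] by blast
  show ?thesis
  by (rule N2I[of "%i. s i + t i"]) (use s t Aadd in \<open>auto simp: sum.distrib distrib_right\<close>)
 qed
 have A_N: "a * m : N2" if a: "a : ?A" and m: "m : N2" for a m
 proof -
  obtain s where s: "ALL i<l. s i : ?A" "m = (\<Sum>i<l. s i * rp (x i))" using N2E[OF m] by blast
  show ?thesis
  by (rule N2I[of "%i. a * s i"]) (use s a Amul in \<open>auto simp: sum_distrib_left mult.assoc\<close>)
 qed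
 have scA: "scr c * ee 1 : ?A" for c
  unfolding AS using S_mult[OF scr_in ep_in] smul_left[OF ep_in[of 1]] ep_idem[of 1] by (simp add: mult.assoc)
 have N_lin: "rp (lin x l c) : N2" for c
 proof -
  have "rp (lin x l c) = (\<Sum>i<l. scr (c i) * rp (x i))" by (rule rp_lin, rule xin)
  also have "... = (\<Sum>i<l. (scr (c i) * ee 1) * rp (x i))"
  using XXD[OF xX] by (intro sum.cong) (auto simp: mult.assoc)
  finally show ?thesis by (intro N2I[of "%i. scr (c i) * ee 1"] scA)
 qed
 have N_zero: "0 : N2" using N_lin[of "%_. 0"] lin_zero[of l x] xin rp_zero by simp
 have "ALL i:{..<n}. rp (b' i) : N2"
 proof (rule nakayama[of "{..<n}" ?A ?J "ee 1"])
  show "a * c : ?A" if "a : ?A" "c : ?A" for a c by (rule Amul[OF that])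
  show "?J \<subseteq> ?A" unfolding J_def by blast
  show "a + c : ?J" if "a : ?J" "c : ?J" for a c using that Aadd[of a c] E.ch_add[of 1 a c] AS unfolding JS by auto
  show "a * c : ?J" if "a : ?A" "c : ?J" for a c
  using that Amul[of a c] E.ch_mult[of 1 a c] AS unfolding JS by auto
  show "EX t:?A. t * (ee 1 - a) = ee 1" if "a : ?J" for a
  proof -
  obtain t where "t : SS" "ee 1 * t = t" "t * ee 1 = t" "t * (ee 1 - a) = ee 1"
  using ee_qr[of 1 a] \<open>a : ?J\<close>[unfolded JS AS] by auto
  thus ?thesis using AS[of t] by blast
  qed
  show "ee 1 * rp (b' i) = rp (b' i)" if "i : {..<n}" for i using XXD[OF b'X[of i]] that by simp
  show "EX a. (ALL j:{..<n}. a j : ?J) & rp (b' i) - (\<Sum>j\<in>{..<n}. a j * rp (b' j)) : N2" if "i : {..<n}" for i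
  proof -
  have i: "i < n" using that by simp
  obtain m where m: "m : N" "b' i = aadd L m (lin x l (kap (b' i)))" using rec[OF b'X[OF i]] by blast
  obtain a where a: "ALL j<n. a j : J" "rp m = (\<Sum>j<n. rp (a j) * rp (b' j))" "m : acar L"
  using NE[OF m(1)] by blast
  have "rp (b' i) = rp m + rp (lin x l (kap (b' i)))" by (subst m(2)) (rule rp_add[OF a(3) lin_in[OF xin]])
  hence "rp (b' i) - (\<Sum>j<n. rp (a j) * rp (b' j)) = rp (lin x l (kap (b' i)))" unfolding a(2) by simp
  thus ?thesis using a(1) N_lin by (intro exI[of _ "%j. rp (a j)"]) auto
  qed
 qed (use N_zero N_add A_N in auto)
 hence bN: "rp (b' i) : N2" if "i < n" for i using that by blast
 have gen: "EX a. (ALL i<l. a i : AA) & rp z = (\<Sum>i<l. rp (a i) * rp (x i))" if z: "z : XX" for z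
 proof -
  obtain c where c: "z = lin b' n c" using z XR by blast
  have "(\<Sum>j<m. scr (c j) * rp (b' j)) : N2" if "m <= n" for m using that
  proof (induction m)
  case (Suc m)
  have "scr (c m) * ee 1 * rp (b' m) : N2" using A_N[OF scA bN] Suc.prems by simp
  hence "scr (c m) * rp (b' m) : N2" using XXD[OF b'X[of m]] Suc.prems by (simp add: mult.assoc)
  thus ?case using N_add Suc by simp
  qed (use N_zero in simp)
  hence "rp z : N2" using rp_lin[of n b' c] b'in c by simp
  then obtain s where s: "rp z = (\<Sum>i<l. s i * rp (x i))" "ALL i<l. s i : ?A" using N2E by blast
  have a: "inv_into AA rp (s i) : AA" "rp (inv_into AA rp (s i)) = s i" if "i < l" for i
  using s(2) that by (auto intro: inv_into_into f_inv_into_f)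
  thus ?thesis using s(1) by (intro exI[of _ "%i. inv_into AA rp (s i)"]) simp
 qed
 show thesis by (rule that[of l x kap]) (fact xX ka ks kx kmul krep gen)+
qed

end

section \<open>The extension of the algebra by a dual bimodule\<close>

locale triext = charrep L e xi rp
 for L :: "('k::field, 'a) kalg" and e :: "nat => 'a" and xi :: "nat => 'a => 'k" and rp :: "'a => 'r::ring" +
 fixes l :: nat and x :: "nat => 'a" and kap :: "'a => nat => 'k" and phi :: "'a => nat => 'k" and psi :: "(nat => 'k) => 'a"
 assumes fd: "fd_algebra L" and x_XX: "i < l ==> x i : XX"
  and k_add: "y : XX ==> z : XX ==> kap (aadd L y z) j = kap y j + kap z j"
  and k_smul: "z : XX ==> kap (asmul L c z) j = c * kap z j"
  and k_x: "i < l ==> j < l ==> kap (x i) j = (if i = j then 1 else 0)"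
  and k_AA: "a : AA ==> z : XX ==> kap (amul L a z) j = xi 1 a * kap z j"
  and k_rep: "z : XX ==> b : acar L ==> kap (amul L z b) j = (\<Sum>k<l. kap z k * kap (amul L (x k) b) j)"
  and gen_XX: "z : XX ==> EX a. (ALL i<l. a i : AA) & rp z = (\<Sum>i<l. rp (a i) * rp (x i))"
  and psi_phi: "a : acar L ==> psi (phi a) = a"
begin

definition cut :: "'a => 'a" where "cut a = amul L (amul L (e 1) a) (e 2)"

lemma e12_in: "e 1 : acar L" "e 2 : acar L" using e_in by auto

lemma rp_cut: "a : acar L ==> rp (cut a) = ee 1 * rp a * ee 2" by (simp add: cut_def rp_mul mul_in e12_in ee12)

lemma cut_in: "a : acar L ==> cut a : acar L" by (simp add: cut_def mul_in e12_in)

lemma cut_XX: assumes "a : acar L" shows "cut a : XX"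
proof -
 have "ee 1 * (ee 1 * rp a * ee 2) = ee 1 * rp a * ee 2" by (simp only: mult.assoc[symmetric] ep_idem)
 moreover have "ee 1 * rp a * ee 2 * ee 2 = ee 1 * rp a * ee 2" by (simp only: mult.assoc ep_idem)
 ultimately show ?thesis using XX_iff[OF cut_in[OF assms]] rp_cut[OF assms] by simp
qed

lemma cut_id: "z : XX ==> cut z = z" using XXD by (intro rp_eqI cut_in) (auto simp: rp_cut)

lemma cut_add: "a : acar L ==> b : acar L ==> cut (aadd L a b) = aadd L (cut a) (cut b)"
 by (simp add: cut_def mul_add add_mul mul_in e12_in)

lemma cut_smul: "a : acar L ==> cut (asmul L c a) = asmul L c (cut a)"
 by (simp add: cut_def smul_mul_l[symmetric] smul_mul_r[symmetric] mul_in e12_in smul_in)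

definition cor :: "'a => 'a" where "cor a = amul L (amul L (e 1) a) (e 1)"

lemma rp_cor: "a : acar L ==> rp (cor a) = ee 1 * rp a * ee 1" by (simp add: cor_def rp_mul mul_in e12_in ee12)

lemma cor_in: "a : acar L ==> cor a : acar L" by (simp add: cor_def mul_in e12_in)

lemma cor_AA: assumes "a : acar L" shows "cor a : AA"
proof -
 have "ee 1 * (ee 1 * rp a * ee 1) = ee 1 * rp a * ee 1" by (simp only: mult.assoc[symmetric] ep_idem)
 moreover have "ee 1 * rp a * ee 1 * ee 1 = ee 1 * rp a * ee 1" by (simp only: mult.assoc ep_idem)
 ultimately show ?thesis using AA_iff[OF cor_in[OF assms]] rp_cor[OF assms] by simp
qed

lemma chi_cor: "a : acar L ==> xi 1 (cor a) = xi 1 a" by (simp add: cor_def chi_mul mul_in e12_in chi_e)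

text \<open>Insert e_1 + e_2 between the factors; since e_2\<Lambda>e_1 = 0, the second factor of
  the e_2-part needs no cutting on the right.\<close>

lemma cut_mul: assumes a: "a : acar L" and b: "b : acar L"
 shows "cut (amul L a b) = aadd L (amul L (cor a) (cut b)) (amul L (cut a) b)"
proof (rule rp_eqI)
 have B: "ee 2 * rp b = ee 2 * rp b * ee 2"
  using E.unit_r[OF S_mult[OF ep_in[of 2] rp_SS[OF b]]] E.tri[OF rp_SS[OF b]] by (simp add: distrib_left)
 have A: "rp a = rp a * ee 1 + rp a * ee 2" using E.unit_r[OF rp_SS[OF a]] by (simp add: distrib_left)
 have "rp (aadd L (amul L (cor a) (cut b)) (amul L (cut a) b))
  = ee 1 * rp a * ee 1 * (ee 1 * rp b * ee 2) + ee 1 * rp a * ee 2 * rp b"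
  using a b by (simp add: rp_add rp_mul mul_in cut_in cor_in rp_cut rp_cor)
 also have "ee 1 * rp a * ee 1 * (ee 1 * rp b * ee 2) = ee 1 * (rp a * ee 1) * rp b * ee 2"
 proof -
  have "ee 1 * rp a * ee 1 * (ee 1 * rp b * ee 2) = ee 1 * rp a * (ee 1 * ee 1) * rp b * ee 2"
  by (simp only: mult.assoc)
  thus ?thesis by (simp only: ep_idem mult.assoc)
 qed
 also have "ee 1 * rp a * ee 2 * rp b = ee 1 * (rp a * ee 2) * rp b * ee 2"
 proof -
  have "ee 1 * rp a * ee 2 * rp b = ee 1 * rp a * (ee 2 * rp b)" by (simp only: mult.assoc)
  also have "... = ee 1 * rp a * (ee 2 * rp b * ee 2)" by (subst B) (rule refl)
  also have "... = ee 1 * (rp a * ee 2) * rp b * ee 2" by (simp only: mult.assoc)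
  finally show ?thesis .
 qed
 also have "ee 1 * (rp a * ee 1) * rp b * ee 2 + ee 1 * (rp a * ee 2) * rp b * ee 2
  = ee 1 * (rp a * ee 1 + rp a * ee 2) * rp b * ee 2" by (simp only: distrib_left distrib_right)
 also have "... = ee 1 * rp a * rp b * ee 2" by (simp only: A[symmetric])
 also have "... = rp (cut (amul L a b))" using a b by (simp add: rp_cut mul_in rp_mul mult.assoc)
 finally show "rp (cut (amul L a b)) = rp (aadd L (amul L (cor a) (cut b)) (amul L (cut a) b))" by simp
qed (use a b in \<open>simp_all add: cut_in cor_in mul_in add_in\<close>)

text \<open>The matrix of right multiplication by \<open>a\<close> on \<open>e\<^sub>1\<Lambda>/J\<^sub>Ae\<^sub>1\<Lambda>\<close>, with \<open>A = e\<^sub>1\<Lambda>e\<^sub>1\<close> and \<open>J\<^sub>A\<close> its radical, in the basis \<open>e\<^sub>1, x\<^sub>0, x\<^sub>1, ...\<close>.\<close>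

definition th :: "'a => nat => nat => 'k" where
 "th a i j = (case i of 0 => (case j of 0 => xi 1 a | Suc j' => kap (cut a) j')
  | Suc i' => (case j of 0 => 0 | Suc j' => kap (amul L (x i') a) j'))"

lemma th_simps [simp]: "th a 0 0 = xi 1 a" "th a 0 (Suc j) = kap (cut a) j"
 "th a (Suc i) 0 = 0" "th a (Suc i) (Suc j) = kap (amul L (x i) a) j" by (simp_all add: th_def)

lemma x_in_car: "i < l ==> x i : acar L" using XXD[OF x_XX] by blast

lemma k_zero: "kap (azero L) j = 0"
proof -
 have "azero L : XX" using XX_iff[OF zero_in] rp_zero by simp
 thus ?thesis using k_smul[of "azero L" 0 j] smul_zero by simp
qed

lemma th_add: assumes "a : acar L" "b : acar L" "i <= l" shows "th (aadd L a b) i j = th a i j + th b i j"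
 using assms x_in_car by (cases i; cases j) (auto simp: chi_add cut_add k_add cut_XX mul_add XX_mul x_XX)

lemma th_smul: assumes "a : acar L" "i <= l" shows "th (asmul L c a) i j = c * th a i j" using assms x_in_car
 by (cases i; cases j) (auto simp: chi_smul cut_smul k_smul cut_XX smul_mul_r[symmetric] XX_mul x_XX)

lemma th_one: assumes "i <= l" "j <= l" shows "th (aone L) i j = (if i = j then 1 else 0)"
proof -
 have "cut (aone L) = azero L" using poi by (simp add: cut_def mul_one e12_in complete_poi2_def)
 thus ?thesis using assms x_in_car by (cases i; cases j) (auto simp: chi_one k_zero mul_one k_x)
qed

text \<open>Row vectors make right multiplication a homomorphism without reversing factors. Row 0
  follows from \<open>cut_mul\<close>, the other rows from \<open>k_rep\<close>.\<close>

lemma th_mul: assumes a: "a : acar L" and b: "b : acar L" and i: "i <= l"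
 shows "th (amul L a b) i j = (\<Sum>k\<le>l. th a i k * th b k j)"
proof (cases i)
 case 0
 show ?thesis
 proof (cases j)
  case (Suc j')
  have "kap (cut (amul L a b)) j' = xi 1 a * kap (cut b) j' + (\<Sum>k<l. kap (cut a) k * kap (amul L (x k) b) j')"
  using a b k_AA[OF cor_AA[OF a] cut_XX[OF b]] k_rep[OF cut_XX[OF a] b] chi_cor[OF a]
  by (simp add: cut_mul k_add AA_XX XX_mul cor_AA cut_XX)
  thus ?thesis using 0 Suc by (simp add: sum.atMost_shift)
 qed (use 0 a b in \<open>simp add: sum.atMost_shift chi_mul\<close>)
next
 case (Suc i')
 hence i': "i' < l" using i by simp
 have "kap (amul L (x i') (amul L a b)) j' = (\<Sum>k<l. kap (amul L (x i') a) k * kap (amul L (x k) b) j')" for j'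
  using k_rep[OF XX_mul[OF x_XX[OF i'] a] b] mul_assoc[OF x_in_car[OF i'] a b] by simp
 thus ?thesis using Suc by (cases j) (simp_all add: sum.atMost_shift)
qed

section \<open>The dual bimodule and the trivial extension\<close>

definition WW :: "(nat => 'k) set" where "WW = {w. ALL i>l. w i = 0}"

text \<open>The matrices \<open>th a\<close> act on column vectors, that is on linear forms on the
  module they describe; this gives the left module structure of the dual.\<close>

definition act :: "'a => (nat => 'k) => nat => 'k" where
 "act a w i = (if i <= l then \<Sum>j\<le>l. th a i j * w j else 0)"

lemma act_in: "act a w : WW" and WW_zero: "(%_. 0) : WW"
 and WW_add: "v : WW ==> w : WW ==> (%i. v i + w i) : WW" and WW_smul: "w : WW ==> (%i. c * w i) : WW"
 by (auto simp: act_def WW_def)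

lemma act_addw: "act a (%i. v i + w i) i = act a v i + act a w i"
 and act_smulw: "act a (%i. c * w i) i = c * act a w i" and act_zerow: "act a (%_. 0) i = 0"
 by (simp_all add: act_def sum.distrib distrib_left sum_distrib_left mult.left_commute)

lemma act_add: "a : acar L ==> b : acar L ==> act (aadd L a b) w i = act a w i + act b w i"
 by (simp add: act_def th_add sum.distrib distrib_right)

lemma act_smul: "a : acar L ==> act (asmul L c a) w i = c * act a w i"
 by (simp add: act_def th_smul sum_distrib_left mult.assoc)

lemma act_zero: "act (azero L) w i = 0" using act_smul[OF zero_in, of 0] smul_zero by simp

lemma act_one: assumes "w : WW" shows "act (aone L) w i = w i"
proof (cases "i <= l")
 case True
 have "(\<Sum>j\<le>l. th (aone L) i j * w j) = (\<Sum>j\<le>l. if i = j then w j else 0)"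
  using True by (intro sum.cong) (auto simp: th_one)
 thus ?thesis using True by (simp add: act_def)
qed (use assms in \<open>simp add: act_def WW_def\<close>)

lemma act_mul: assumes "a : acar L" "b : acar L" shows "act (amul L a b) w i = act a (act b w) i"
proof (cases "i <= l")
 case True
 have "(\<Sum>j\<le>l. th (amul L a b) i j * w j) = (\<Sum>j\<le>l. \<Sum>k\<le>l. th a i k * th b k j * w j)"
  using True assms by (simp add: th_mul sum_distrib_right)
 also have "... = (\<Sum>k\<le>l. \<Sum>j\<le>l. th a i k * th b k j * w j)" by (rule sum.swap)
 also have "... = (\<Sum>k\<le>l. th a i k * act b w k)"
  by (intro sum.cong) (auto simp: act_def sum_distrib_left mult.assoc)
 finally show ?thesis using True by (simp add: act_def)
qed (simp add: act_def)

text \<open>A pair packed into one function, with the coordinates of \<open>a\<close> at even and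
  those of \<open>w\<close> at odd places. Thus the extension has elements of type
  \<open>nat => 'k\<close>, whatever the type of the elements of \<Lambda>.\<close>

definition mk :: "'a => (nat => 'k) => nat => 'k" where
 "mk a w i = (if even i then phi a (i div 2) else w (i div 2))"

definition fa :: "(nat => 'k) => 'a" where "fa g = psi (%i. g (2 * i))"

definition wd :: "(nat => 'k) => nat => 'k" where "wd g i = g (2 * i + 1)"

lemma fa_mk: "a : acar L ==> fa (mk a w) = a" by (simp add: fa_def mk_def psi_phi)

lemma wd_mk: "wd (mk a w) = w" by (simp add: wd_def mk_def fun_eq_iff)

lemma mk_inj: "a : acar L ==> b : acar L ==> mk a w = mk b v \<longleftrightarrow> a = b & w = v"
 using fa_mk wd_mk by metis

text \<open>The trivial extension \<open>\<Lambda> \<oplus> W\<close> by the \<open>\<Lambda>\<close>-bimodule \<open>W\<close>, the dual of \<open>e\<^sub>1\<Lambda>/J\<^sub>Ae\<^sub>1\<Lambda>\<close> on the left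
 and a multiple of the simple module of \<open>e\<^sub>2\<close> on the right.\<close>

definition GG :: "('k, nat => 'k) kalg" where
 "GG = \<lparr>acar = {mk a w | a w. a : acar L & w : WW},
  aadd = (%g h. mk (aadd L (fa g) (fa h)) (%i. wd g i + wd h i)),
  amul = (%g h. mk (amul L (fa g) (fa h)) (%i. act (fa g) (wd h) i + xi 2 (fa h) * wd g i)),
  azero = mk (azero L) (%_. 0), aone = mk (aone L) (%_. 0),
  asmul = (%c g. mk (asmul L c (fa g)) (%i. c * wd g i))\<rparr>"

lemma GI: "a : acar L ==> w : WW ==> mk a w : acar GG" by (auto simp: GG_def)

lemma GE: assumes "g : acar GG" obtains a w where "a : acar L" "w : WW" "g = mk a w"
 using assms by (auto simp: GG_def)

lemma Gadd: "a : acar L ==> b : acar L ==> aadd GG (mk a w) (mk b v) = mk (aadd L a b) (%i. w i + v i)"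
 and Gmul: "a : acar L ==> b : acar L ==> amul GG (mk a w) (mk b v) = mk (amul L a b) (%i. act a v i + xi 2 b * w i)"
 and Gsmul: "a : acar L ==> asmul GG c (mk a w) = mk (asmul L c a) (%i. c * w i)"
 and Gzero: "azero GG = mk (azero L) (%_. 0)" and Gone: "aone GG = mk (aone L) (%_. 0)"
 by (simp_all add: GG_def fa_mk wd_mk)

lemma ball_GG: "(ALL g:acar GG. P g) \<longleftrightarrow> (ALL a:acar L. ALL w:WW. P (mk a w))"
 using GI by (auto elim: GE)

lemma kalgebra_GG: "kalgebra GG"
proof -
 have two: "2 : {1, 2::nat}" by simp
 note G = Gadd Gmul Gsmul Gzero Gone
 note inn = add_in mul_in smul_in zero_in one_in
 have WWm: "(%i. act a v i + c * w i) : WW" if "w : WW" for a v c w using that WW_add[OF act_in WW_smul] by simp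
 have neg: "EX h:acar GG. aadd GG (mk a w) h = azero GG" if a: "a : acar L" and w: "w : WW" for a w
 proof -
  obtain b where b: "b : acar L" "aadd L a b = azero L" using neg_ex[OF a] by blast
  have "aadd GG (mk a w) (mk b (%i. (-1) * w i)) = azero GG" using a b by (simp add: G)
  thus ?thesis using GI[OF b(1) WW_smul[OF w, of "-1"]] by blast
 qed
 show ?thesis unfolding kalgebra_def ball_GG
 proof (intro conjI ballI allI)
  show "azero GG : acar GG" "aone GG : acar GG" unfolding Gzero Gone by (intro GI inn WW_zero)+
 next
  fix a b w v assume "a : acar L" "w : WW" "b : acar L" "v : WW"
  thus "aadd GG (mk a w) (mk b v) : acar GG" "amul GG (mk a w) (mk b v) : acar GG"
  by (simp_all add: G GI inn WW_add WWm)
  show "aadd GG (mk a w) (mk b v) = aadd GG (mk b v) (mk a w)"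
  using \<open>a : acar L\<close> \<open>b : acar L\<close> by (simp add: G add_comm add.commute)
 next
  fix a w c assume "a : acar L" "w : WW"
  thus "asmul GG c (mk a w) : acar GG" by (simp add: G GI inn WW_smul)
 next
  fix a b c w v u assume as: "a : acar L" "w : WW" "b : acar L" "v : WW" "c : acar L" "u : WW"
  show "aadd GG (aadd GG (mk a w) (mk b v)) (mk c u) = aadd GG (mk a w) (aadd GG (mk b v) (mk c u))"
  using as by (simp add: G inn add_assoc add.assoc)
  show "amul GG (amul GG (mk a w) (mk b v)) (mk c u) = amul GG (mk a w) (amul GG (mk b v) (mk c u))"
  using as by (simp add: G inn mul_assoc act_mul act_addw act_smulw chi_mul; simp add: algebra_simps)
  show "amul GG (mk a w) (aadd GG (mk b v) (mk c u)) = aadd GG (amul GG (mk a w) (mk b v)) (amul GG (mk a w) (mk c u))"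
  using as by (simp add: G inn mul_add act_addw chi_add; simp add: algebra_simps)
  show "amul GG (aadd GG (mk a w) (mk b v)) (mk c u) = aadd GG (amul GG (mk a w) (mk c u)) (amul GG (mk b v) (mk c u))"
  using as by (simp add: G inn add_mul act_add algebra_simps)
 next
  fix a w assume as: "a : acar L" "w : WW"
  show "aadd GG (azero GG) (mk a w) = mk a w" using as by (simp add: G inn add_zero)
  show "amul GG (aone GG) (mk a w) = mk a w" using as by (simp add: G inn one_mul act_one)
  show "amul GG (mk a w) (aone GG) = mk a w" using as by (simp add: G inn mul_one act_zerow chi_one)
  show "EX h:acar GG. aadd GG (mk a w) h = azero GG" by (rule neg[OF as])
  show "asmul GG 1 (mk a w) = mk a w" using as by (simp add: G inn one_smul)
 next
  fix c d a b w v assume as: "a : acar L" "w : WW" "b : acar L" "v : WW"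
  show "asmul GG c (aadd GG (mk a w) (mk b v)) = aadd GG (asmul GG c (mk a w)) (asmul GG c (mk b v))"
  using as by (simp add: G inn smul_add algebra_simps)
  show "asmul GG (c + d) (mk a w) = aadd GG (asmul GG c (mk a w)) (asmul GG d (mk a w))"
  using as by (simp add: G inn add_smul algebra_simps)
  show "asmul GG (c * d) (mk a w) = asmul GG c (asmul GG d (mk a w))"
  using as by (simp add: G inn smul_smul mult.assoc)
  show "asmul GG c (amul GG (mk a w) (mk b v)) = amul GG (asmul GG c (mk a w)) (mk b v)"
  using as by (simp add: G inn smul_mul_l act_smul algebra_simps)
  show "asmul GG c (amul GG (mk a w) (mk b v)) = amul GG (mk a w) (asmul GG c (mk b v))"
  using as by (simp add: G inn smul_mul_r act_smulw chi_smul algebra_simps)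
 qed
qed

lemma fd_GG: "fd_algebra GG"
proof -
 interpret G: kalg_loc GG by unfold_locales (rule kalgebra_GG)
 obtain B where B: "finite B" "B \<subseteq> acar L" "acar L \<subseteq> lincomb L B" using fd unfolding fd_algebra_def by blast
 let ?d = "%i j. if j = i then 1 else (0::'k)"
 let ?B = "(%b. mk b (%_. 0)) ` B \<union> (%i. mk (azero L) (?d i)) ` {..l}"
 have w: "mk (azero L) (%i. if i < m then w i else 0) : lincomb GG ?B" if "m <= Suc l" for m w using that
 proof (induction m)
  case 0
  show ?case using lc_zero[of GG ?B] by (simp add: Gzero)
 next
  case (Suc m)
  hence IH: "mk (azero L) (%i. if i < m then w i else 0) : lincomb GG ?B" by simp
  have "aadd GG (asmul GG (w m) (mk (azero L) (?d m))) (mk (azero L) (%i. if i < m then w i else 0))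
  = mk (azero L) (%i. if i < Suc m then w i else 0)"
  proof -
  have eq: "(%i. w m * ?d m i + (if i < m then w i else 0)) = (%i. if i < Suc m then w i else 0)"
  by (auto simp: fun_eq_iff less_Suc_eq)
  show ?thesis unfolding eq[symmetric] by (simp add: Gadd Gsmul zero_in smul_zero add_zero)
  qed
  moreover have "mk (azero L) (?d m) : ?B" using Suc.prems by auto
  ultimately show ?case using lc_step[OF IH, of "mk (azero L) (?d m)" "w m"] by simp
 qed
 have base: "mk (azero L) w : lincomb GG ?B" if "w : WW" for w
 proof -
  have "(%i. if i < Suc l then w i else 0) = w" using that by (auto simp: WW_def)
  thus ?thesis using w[of "Suc l" w] by simp
 qed
 have "y : acar L & mk y w : lincomb GG ?B" if "y : lincomb L B" and W: "w : WW" for y w using that(1)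
 proof induction
  case lc_zero
  show ?case using base[OF W] zero_in by blast
 next
  case (lc_step y b c)
  hence b: "b : acar L" using B by blast
  have "aadd GG (asmul GG c (mk b (%_. 0))) (mk y w) = mk (aadd L (asmul L c b) y) w"
  using b lc_step by (simp add: Gadd Gsmul smul_in)
  moreover have "mk b (%_. 0) : ?B" using lc_step by blast
  ultimately show ?case
  using lincomb.lc_step[of "mk y w" GG ?B "mk b (%_. 0)" c] lc_step b by (auto simp: smul_in add_in)
 qed
 hence "acar GG \<subseteq> lincomb GG ?B" using B(3) by (auto elim!: GE)
 moreover have "?B \<subseteq> acar GG" using B(2) by (auto intro!: GI WW_zero zero_in simp: WW_def)
 moreover have "finite ?B" using B(1) by simp
 ultimately show ?thesis unfolding fd_algebra_def using kalgebra_GG by blast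
qed

definition ff :: "nat => nat => 'k" where "ff i = mk (e i) (%_. 0)"

definition xiG :: "nat => (nat => 'k) => 'k" where "xiG i g = xi i (fa g)"

text \<open>An idempotent of the extension projects to an idempotent of \<Lambda>, and one that
  projects to 0 is 0 because the kernel has square zero; so primitivity is inherited.\<close>

lemma poi_GG: "complete_poi2 GG ff"
proof -
 have prim: "primitive_idem GG (ff i)" if i: "i : {1, 2}" for i
 proof -
  have ei: "e i : acar L" and pe: "primitive_idem L (e i)" using e_in[OF i] poi i by (auto simp: complete_poi2_def)
  have idm: "idempotent L p" if "p : acar L" "w : WW" "idempotent GG (mk p w)" for p w
  using that by (simp add: idempotent_def Gmul mk_inj mul_in)
  have zer: "w = (%_. 0)" if "idempotent GG (mk (azero L) w)" for w
  using that chi_zero[of 2] by (auto simp: idempotent_def Gmul mk_inj mul_in zero_in act_zero)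
  have "False" if h: "idempotent GG g" "idempotent GG h" "g ~= azero GG" "h ~= azero GG"
  "amul GG g h = azero GG" "amul GG h g = azero GG" "aadd GG g h = ff i" for g h
  proof -
  obtain p w where p: "p : acar L" "w : WW" "g = mk p w" using h(1) by (auto simp: idempotent_def elim: GE)
  obtain q v where q: "q : acar L" "v : WW" "h = mk q v" using h(2) by (auto simp: idempotent_def elim: GE)
  have "amul L p q = azero L" "amul L q p = azero L" "aadd L p q = e i"
  using h(5-7) p q ei by (simp_all add: Gmul Gadd Gzero mk_inj mul_in add_in zero_in ff_def)
  moreover have "idempotent L p" "idempotent L q" using idm h(1,2) p q by blast+
  ultimately have "p = azero L | q = azero L" using pe unfolding primitive_idem_def by blast
  thus False using zer[of w] zer[of v] h(1-4) p q by (auto simp: Gzero)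
  qed
  moreover have "idempotent GG (ff i)"
  using GI[OF ei WW_zero] ei e_idem[OF i] by (simp add: idempotent_def ff_def Gmul act_zerow)
  moreover have "ff i ~= azero GG" using pe ei by (simp add: ff_def Gzero mk_inj zero_in primitive_idem_def)
  ultimately show ?thesis unfolding primitive_idem_def by blast
 qed
 show ?thesis using prim[of 1] prim[of 2] poi e12_in
  by (simp add: complete_poi2_def ff_def Gmul Gadd Gzero Gone act_zerow)
qed

lemma charalg_GG: "charalg GG ff xiG"
proof
 show "kalgebra GG" by (rule kalgebra_GG)
 show "complete_poi2 GG ff" by (rule poi_GG)
 fix i :: nat assume i: "i : {1, 2}"
 show "xiG i (aadd GG g h) = xiG i g + xiG i h" "xiG i (amul GG g h) = xiG i g * xiG i h"
  if g: "g : acar GG" and h: "h : acar GG" for g h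
 proof -
  obtain a w b v where "a : acar L" "w : WW" "g = mk a w" "b : acar L" "v : WW" "h = mk b v"
  using GE[OF g] GE[OF h] by metis
  thus "xiG i (aadd GG g h) = xiG i g + xiG i h" "xiG i (amul GG g h) = xiG i g * xiG i h"
  by (simp_all add: xiG_def Gadd Gmul fa_mk add_in mul_in chi_add[OF i] chi_mul[OF i])
 qed
 show "xiG i (asmul GG c g) = c * xiG i g" if g: "g : acar GG" for g c
  using chi_smul[OF i] by (rule_tac GE[OF g]) (simp add: xiG_def Gsmul fa_mk smul_in)
 show "xiG i (ff j) = (if i = j then 1 else 0)" if "j : {1, 2}" for j
  using chi_e[OF i that] e_in[OF that] by (simp add: xiG_def ff_def fa_mk)
next
 fix g assume g: "g : acar GG" "xiG 1 g = 0" "xiG 2 g = 0"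
 obtain a w where a: "a : acar L" "w : WW" "g = mk a w" by (rule GE[OF g(1)])
 have c: "xi 1 a = 0" "xi 2 a = 0" using g a by (simp_all add: xiG_def fa_mk)
 obtain b where b: "b : acar L" "aadd L a b = amul L a b" "aadd L a b = amul L b a"
  using chi_qi[OF a(1) c] unfolding qi_def by blast
 have "xi 2 (aadd L a b) = 0" unfolding b(2) using chi_mul[of 2 a b] a b c by simp
 hence cb: "xi 2 b = 0" using chi_add[of 2 a b] a b c by simp
 \<comment> \<open>\<open>b\<close> is the quasi-inverse of \<open>a\<close>, and
   \<open>xi 2\<close> vanishes on both. For \<open>mk b v\<close> to be the quasi-inverse of
   \<open>mk a w\<close>, the second components must satisfy \<open>act b w = w + v\<close> and
   \<open>act a v = w + v\<close>; the first determines v and implies the second.\<close>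
 define v where "v i = act b w i + (-1) * w i" for i
 have "v = (%i. act b w i + (-1) * w i)" by (simp add: v_def fun_eq_iff)
 hence v: "v : WW" using WW_add[OF act_in[of b w] WW_smul[OF a(2), of "-1"]] by (simp only:)
 have v1: "act a v i = w i + v i" for i
 proof -
  have "act a v i = act (amul L a b) w i - act a w i"
  unfolding v_def act_addw act_smulw using act_mul[OF a(1) b(1)] by simp
  thus ?thesis using act_add[OF a(1) b(1), of w i] b(2) by (simp add: v_def)
 qed
 have "aadd GG g (mk b v) = amul GG g (mk b v)" "aadd GG g (mk b v) = amul GG (mk b v) g"
  using a b c cb v1 by (simp_all add: Gadd Gmul v_def)
 thus "qi GG g" unfolding qi_def using GI[OF b(1) v] by blast
qed

lemma tri_GG: assumes "g : acar GG" shows "amul GG (amul GG (ff 2) g) (ff 1) = azero GG"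
proof -
 obtain a w where a: "a : acar L" "w : WW" "g = mk a w" by (rule GE[OF assms])
 thus ?thesis using tri_raw[OF a(1)] e12_in chi_e[of 2 1] by (simp add: ff_def Gmul Gzero mul_in act_zerow)
qed

end

context triext
begin

text \<open>The unit vectors of \<open>W\<close>, dual to the basis e_1, x_0, x_1, ...:
  \<open>de 0\<close> gives the element y and \<open>de (Suc j)\<close> the element v_j.\<close>

definition de :: "nat => nat => 'k" where "de m i = (if i = m then 1 else 0)"

lemma de_in: "m <= l ==> de m : WW" by (auto simp: de_def WW_def)

lemma act_de: assumes "m <= l" shows "act a (de m) i = (if i <= l then th a i m else 0)"
proof -
 have "(\<Sum>j\<le>l. th a i j * de m j) = (\<Sum>j\<le>l. if j = m then th a i j else 0)"
  by (intro sum.cong) (auto simp: de_def)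
 thus ?thesis using assms by (simp add: act_def)
qed

lemma e1e2: "amul L (e 1) (e 2) = azero L" "amul L (e 2) (e 1) = azero L"
 using poi by (simp_all add: complete_poi2_def)

lemma XX_raw: "z : XX ==> z : acar L & amul L (e 1) z = z & amul L z (e 2) = z" by (simp add: XX_def)

lemma XX_e1: assumes "z : XX" shows "amul L z (e 1) = azero L"
proof -
 have "amul L z (e 1) = amul L (amul L z (e 2)) (e 1)" using XX_raw[OF assms] by simp
 also have "... = amul L z (amul L (e 2) (e 1))" by (rule mul_assoc) (use XX_raw[OF assms] e12_in in auto)
 finally show ?thesis using e1e2 mul_zero XX_raw[OF assms] by simp
qed

lemma XX_XX: assumes "y : XX" "z : XX" shows "amul L y z = azero L"
proof -
 have "amul L y z = amul L y (amul L (e 1) z)" using XX_raw[OF assms(2)] by simp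
 also have "... = amul L (amul L y (e 1)) z" by (rule mul_assoc[symmetric]) (use XX_raw[OF assms(1)] XX_raw[OF assms(2)] e12_in in auto)
 finally show ?thesis using XX_e1[OF assms(1)] zero_mul XX_raw[OF assms(2)] by simp
qed

lemma act_de0: "act a (de 0) = (%i. xi 1 a * de 0 i)"
proof
 show "act a (de 0) i = xi 1 a * de 0 i" for i by (cases i) (simp_all add: act_de de_def)
qed

lemma act_e2_de: assumes "j < l" shows "act (e 2) (de (Suc j)) = de (Suc j)"
proof
 fix i
 have "cut (e 2) = azero L" using e1e2 zero_mul e12_in by (simp add: cut_def)
 thus "act (e 2) (de (Suc j)) i = de (Suc j) i"
  using assms XX_raw[OF x_XX] k_x by (cases i) (auto simp: act_de de_def k_zero)
qed

lemma act_XX_de: assumes "z : XX" "j < l" shows "act z (de (Suc j)) = (%i. kap z j * de 0 i)"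
proof
 fix i show "act z (de (Suc j)) i = kap z j * de 0 i"
  using assms XX_XX[OF x_XX assms(1)] by (cases i) (auto simp: act_de de_def k_zero cut_id)
qed

lemma act_e1_top: assumes "w : WW" "act (e 1) w = w" shows "w = (%i. w 0 * de 0 i)"
proof
 fix i show "w i = w 0 * de 0 i"
 proof (cases i)
  case (Suc i')
  have "act (e 1) w i = 0" using Suc XX_e1[OF x_XX] by (auto simp: act_def sum.atMost_shift k_zero)
  thus ?thesis using assms(2) Suc by (simp add: de_def)
 qed (simp add: de_def)
qed

definition xr :: "nat => 'r" where "xr i = rp (x i)"

definition kr :: "nat => 'r => 'k" where "kr j s = kap (inv_into (acar L) rp s) j"

lemma kr_rp: "z : acar L ==> kr j (rp z) = kap z j" by (simp add: kr_def inv_rp)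

lemma top_el: assumes "s : SS" "ee 1 * s = s" "s * ee 2 = s" obtains z where "z : XX" "s = rp z"
 using assms SS_E[OF assms(1)] XX_iff by metis

lemma cor_el: assumes "s : SS" "ee 1 * s = s" "s * ee 1 = s" obtains z where "z : AA" "s = rp z"
 using assms SS_E[OF assms(1)] AA_iff by metis

sublocale LT: trix SS ee ch scr l xr kr
proof
 show "xr i : SS & ee 1 * xr i = xr i & xr i * ee 2 = xr i" if "i < l" for i
  using XXD[OF x_XX[OF that]] by (auto simp: xr_def SS_def)
next
 fix s assume "s : SS" "ee 1 * s = s" "s * ee 2 = s"
 then obtain z where z: "z : XX" "s = rp z" by (rule top_el)
 obtain a where a: "ALL i<l. a i : AA" "rp z = (\<Sum>i<l. rp (a i) * rp (x i))" using gen_XX[OF z(1)] by blast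
 show "EX a. (ALL i<l. a i : SS & ee 1 * a i = a i & a i * ee 1 = a i) & s = (\<Sum>i<l. a i * xr i)"
  by (rule exI[of _ "%i. rp (a i)"]) (use a z AAD in \<open>auto simp: xr_def SS_def\<close>)
next
 fix s t i assume s: "s : SS" "ee 1 * s = s" "s * ee 2 = s" and t: "t : SS" "ee 1 * t = t" "t * ee 2 = t"
 obtain y where y: "y : XX" "s = rp y" by (rule top_el[OF s])
 obtain z where z: "z : XX" "t = rp z" by (rule top_el[OF t])
 show "kr i (s + t) = kr i s + kr i t"
  using y z XXD[OF y(1)] XXD[OF z(1)] k_add[OF y(1) z(1)] by (simp add: rp_add[symmetric] kr_rp add_in)
next
 fix a s i assume a: "a : SS" "ee 1 * a = a" "a * ee 1 = a" and s: "s : SS" "ee 1 * s = s" "s * ee 2 = s"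
 obtain y where y: "y : AA" "a = rp y" by (rule cor_el[OF a])
 obtain z where z: "z : XX" "s = rp z" by (rule top_el[OF s])
 show "kr i (a * s) = ch 1 a * kr i s"
  using y z AAD[OF y(1)] XXD[OF z(1)] k_AA[OF y(1) z(1)] by (simp add: rp_mul[symmetric] kr_rp mul_in ch_rp)
next
 show "kr j (xr i) = (if i = j then 1 else 0)" if "i < l" "j < l" for i j
  using k_x[OF that] x_in_car[OF that(1)] by (simp add: xr_def kr_rp)
qed

lemma minus_cone:
 assumes "is_mutation L e (Pcx L 2) (Pcx L 1) T"
 shows "Ccone L e T = convex_cone hull {(1, 0), (real l, -1)}"
proof -
 obtain T' U V where h: "Ph T : Obj" "hz (Ph T) (Ph T)" "indecP Obj K.ic dsc zrc T'"
  "~ K.ic T' ([], [2], 0)" "K.ic (Ph T) (dsc T' ([], [1], 0))"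
  "isumP Obj K.ic dsc zrc (Ph T) U" "isumP Obj K.ic dsc zrc (Ph T) V" "~ K.ic U V" "cx_valid L e T"
  by (rule mutation_data[OF assms]) (rule that)
 have "E.psl (Ph T)" using h(1,2) by (simp add: E.psl_def)
 from LT.mutation_cone[OF this h(3-8)[folded E.PP_def]] show ?thesis using Ccone_Ph[OF h(9)] by simp
qed

end

section \<open>The trivial extension satisfies the assumptions of \<open>ext\<close>\<close>

locale triext2 = triext L e xi rp l x kap phi psi
 for L :: "('k::field, 'a) kalg" and e :: "nat => 'a" and xi :: "nat => 'a => 'k" and rp :: "'a => 'r::ring"
  and l :: nat and x :: "nat => 'a" and kap :: "'a => nat => 'k" and phi :: "'a => nat => 'k" and psi :: "(nat => 'k) => 'a" +
 fixes rq :: "(nat => 'k) => 's::ring"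
 assumes rawrep_GG: "rawrep GG ff rq"
begin

sublocale G: charrep GG ff xiG rq
 by (rule charrep.intro[OF charalg_GG rawrep_GG]) (unfold charrep_axioms_def, use tri_GG in blast)

abbreviation "z0 \<equiv> %_::nat. 0::'k"

definition mq :: "'a => (nat => 'k) => 's" where "mq a w = rq (mk a w)"

lemma mq_SS: "a : acar L ==> w : WW ==> mq a w : G.SS" unfolding mq_def by (intro G.rp_SS GI)

lemma mq_E: assumes "s : G.SS" obtains a w where "a : acar L" "w : WW" "s = mq a w"
 using assms G.SS_E GE unfolding mq_def by metis

lemma mq_add: "a : acar L ==> b : acar L ==> w : WW ==> v : WW ==> mq a w + mq b v = mq (aadd L a b) (%i. w i + v i)"
 using G.rp_add[OF GI GI, of a w b v] by (simp add: mq_def Gadd)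

lemma mq_mul: "a : acar L ==> b : acar L ==> w : WW ==> v : WW ==>
  mq a w * mq b v = mq (amul L a b) (%i. act a v i + xi 2 b * w i)"
 using G.rp_mul[OF GI GI, of a w b v] by (simp add: mq_def Gmul)

lemma mq_inj: "a : acar L ==> b : acar L ==> w : WW ==> v : WW ==> mq a w = mq b v \<longleftrightarrow> a = b & w = v"
 using G.rp_eqI[OF GI GI, of a w b v] mk_inj[of a b w v] by (auto simp: mq_def)

lemma mq_zero: "mq (azero L) z0 = 0" using G.rp_zero by (simp add: mq_def Gzero)

lemma mq_ee: "G.ee i = (if i : {1, 2} then mq (e i) z0 else 0)" by (simp add: G.ee_def mq_def ff_def)

lemma mq_ee12: "G.ee 1 = mq (e 1) z0" "G.ee 2 = mq (e 2) z0" by (simp_all add: mq_ee)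

lemma mq_scr: "G.scr c = mq (asmul L c (aone L)) z0" by (simp add: G.scr_def mq_def Gone Gsmul one_in)

lemma mq_ch: "a : acar L ==> w : WW ==> G.ch i (mq a w) = xi i a"
 using G.ch_rp[OF GI, of a w i] by (simp add: mq_def xiG_def fa_mk)

lemma mq_e1: assumes "a : acar L" "w : WW"
 shows "G.ee 1 * mq a w = mq a w \<longleftrightarrow> amul L (e 1) a = a & act (e 1) w = w"
proof -
 have "G.ee 1 * mq a w = mq (amul L (e 1) a) (act (e 1) w)"
  unfolding mq_ee12 using assms e12_in WW_zero by (simp add: mq_mul)
 thus ?thesis using assms e12_in by (simp add: mq_inj mul_in act_in)
qed

lemma mq_e2: assumes "a : acar L" "w : WW"
 shows "G.ee 2 * mq a w = mq a w \<longleftrightarrow> amul L (e 2) a = a & act (e 2) w = w"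
proof -
 have "G.ee 2 * mq a w = mq (amul L (e 2) a) (act (e 2) w)"
  unfolding mq_ee12 using assms e12_in WW_zero by (simp add: mq_mul)
 thus ?thesis using assms e12_in by (simp add: mq_inj mul_in act_in)
qed

lemma mq_r1: assumes "a : acar L" "w : WW"
 shows "mq a w * G.ee 1 = mq a w \<longleftrightarrow> amul L a (e 1) = a & w = z0"
proof -
 have "mq a w * G.ee 1 = mq (amul L a (e 1)) z0"
  unfolding mq_ee12 using assms e12_in WW_zero chi_e[of 2 1] by (simp add: mq_mul act_zerow)
 thus ?thesis using assms e12_in WW_zero by (auto simp: mq_inj mul_in)
qed

lemma mq_r2: assumes "a : acar L" "w : WW"
 shows "mq a w * G.ee 2 = mq a w \<longleftrightarrow> amul L a (e 2) = a"
proof -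
 have "mq a w * G.ee 2 = mq (amul L a (e 2)) w"
  unfolding mq_ee12 using assms e12_in WW_zero chi_e[of 2 2] by (simp add: mq_mul act_zerow)
 thus ?thesis using assms e12_in by (simp add: mq_inj mul_in)
qed

definition pr :: "'s => 'r" where "pr s = rp (fa (inv_into (acar GG) rq s))"

definition inc :: "'r => 's" where "inc s = mq (inv_into (acar L) rp s) z0"

lemma pr_mq: "a : acar L ==> w : WW ==> pr (mq a w) = rp a"
 using G.inv_rp[OF GI, of a w] by (simp add: pr_def mq_def fa_mk)

lemma inc_rp: "a : acar L ==> inc (rp a) = mq a z0" by (simp add: inc_def inv_rp)

lemma pr_mq_zero: "a : acar L ==> w : WW ==> pr (mq a w) = 0 \<longleftrightarrow> a = azero L"
 using rp_eqI[OF _ zero_in, of a] rp_zero by (auto simp: pr_mq)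

definition yy :: 's where "yy = mq (azero L) (de 0)"

definition vv :: "nat => 's" where "vv j = mq (azero L) (de (Suc j))"

definition x' :: "nat => 's" where "x' j = (if j < l then mq (x j) z0 else yy)"

text \<open>The old coordinates, followed at index l by the coefficient of the new generator
  y.\<close>

definition k' :: "nat => 's => 'k" where
 "k' j s = (let g = inv_into (acar GG) rq s in if j < l then kap (fa g) j else wd g 0)"

lemma k'_mq: "a : acar L ==> w : WW ==> k' j (mq a w) = (if j < l then kap a j else w 0)"
 using G.inv_rp[OF GI, of a w] by (simp add: k'_def mq_def fa_mk wd_mk)

lemma yy_scr: "yy * G.scr c = mq (azero L) (%i. c * de 0 i)"
 unfolding yy_def mq_scr using de_in[of 0] WW_zero chi_smul[of 2 "aone L" c] chi_one[of 2]
 by (simp add: mq_mul zero_in smul_in one_in act_zerow zero_mul)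

lemma top_mq:
 assumes "s : G.SS" "G.ee 1 * s = s" "s * G.ee 2 = s"
 obtains z c where "z : XX" "s = mq z (%i. c * de 0 i)"
proof -
 obtain a w where a: "a : acar L" "w : WW" "s = mq a w" by (rule mq_E[OF assms(1)])
 have "amul L (e 1) a = a" "act (e 1) w = w" "amul L a (e 2) = a"
  using assms(2,3) a mq_e1[OF a(1,2)] mq_r2[OF a(1,2)] by auto
 thus thesis using that[of a "w 0"] a act_e1_top[OF a(2)] by (simp add: XX_def)
qed

lemma cor_mq:
 assumes "s : G.SS" "G.ee 1 * s = s" "s * G.ee 1 = s"
 obtains a where "a : AA" "s = mq a z0"
proof -
 obtain a w where a: "a : acar L" "w : WW" "s = mq a w" by (rule mq_E[OF assms(1)])
 have "amul L (e 1) a = a" "w = z0" "amul L a (e 1) = a"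
  using assms(2,3) a mq_e1[OF a(1,2)] mq_r1[OF a(1,2)] by auto
 thus thesis using that[of a] a by (simp add: AA_def)
qed

lemma de0_in: "(%i. c * de 0 i) : WW" using WW_smul[OF de_in[of 0]] by simp

lemma AA_raw: "a : AA ==> a : acar L" by (simp add: AA_def)

lemma XX_car: "a : XX ==> a : acar L" by (simp add: XX_def)

lemma act_cde0: "act a (%i. c * de 0 i) = (%i. c * xi 1 a * de 0 i)"
 by (rule HOL.ext) (simp add: act_smulw act_de0)

sublocale GT: trix G.SS G.ee G.ch G.scr "Suc l" x' k'
proof
 have e1z: "amul L (e 1) (azero L) = azero L" and ze2: "amul L (azero L) (e 2) = azero L"
  using e12_in by (simp_all add: mul_zero zero_mul)
 show "x' i : G.SS & G.ee 1 * x' i = x' i & x' i * G.ee 2 = x' i" if "i < Suc l" for i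
 proof (cases "i < l")
  case True
  have "x i : acar L" "amul L (e 1) (x i) = x i" "amul L (x i) (e 2) = x i" using XX_raw[OF x_XX[OF True]] by auto
  thus ?thesis using True WW_zero by (simp add: x'_def mq_SS mq_e1 mq_r2 fun_eq_iff act_zerow)
 next
  case False
  have "act (e 1) (de 0) = de 0" using act_de0[of "e 1"] chi_e[of 1 1] by simp
  thus ?thesis using False de_in[of 0] zero_in e1z ze2 by (simp add: x'_def yy_def mq_SS mq_e1 mq_r2)
 qed
next
 fix s assume s: "s : G.SS" "G.ee 1 * s = s" "s * G.ee 2 = s"
 obtain z c where z: "z : XX" "s = mq z (%i. c * de 0 i)" by (rule top_mq[OF s])
 obtain a where a: "ALL i<l. a i : AA" "rp z = (\<Sum>i<l. rp (a i) * rp (x i))" using gen_XX[OF z(1)] by blast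
 have "EX b:acar L. rp b = (\<Sum>i<m. rp (a i) * rp (x i)) & (\<Sum>i<m. mq (a i) z0 * mq (x i) z0) = mq b z0" if "m <= l" for m
  using that
 proof (induction m)
  case 0
  thus ?case using zero_in rp_zero mq_zero by (intro bexI[of _ "azero L"]) auto
 next
  case (Suc m)
  then obtain b where b: "b : acar L" "rp b = (\<Sum>i<m. rp (a i) * rp (x i))"
  "(\<Sum>i<m. mq (a i) z0 * mq (x i) z0) = mq b z0" by auto
  have am: "a m : acar L" "x m : acar L" using a(1) Suc.prems AA_raw x_in_car by auto
  have "mq (a m) z0 * mq (x m) z0 = mq (amul L (a m) (x m)) z0" using am WW_zero by (simp add: mq_mul act_zerow)
  hence "(\<Sum>i<Suc m. mq (a i) z0 * mq (x i) z0) = mq (aadd L b (amul L (a m) (x m))) z0"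
  using b am WW_zero by (simp add: mq_add mul_in)
  thus ?case using b am by (intro bexI[of _ "aadd L b (amul L (a m) (x m))"]) (simp_all add: rp_add rp_mul mul_in add_in)
 qed
 then obtain b where b: "b : acar L" "rp b = (\<Sum>i<l. rp (a i) * rp (x i))"
  "(\<Sum>i<l. mq (a i) z0 * mq (x i) z0) = mq b z0" by blast
 have bz: "b = z" using rp_eqI[OF b(1) XX_car[OF z(1)]] a(2) b(2) by simp
 let ?a = "%i. if i < l then mq (a i) z0 else mq (asmul L c (e 1)) z0"
 have e1A: "e 1 : AA" using e12_in e_idem[of 1] by (simp add: AA_def)
 have qA: "mq d z0 : G.SS & G.ee 1 * mq d z0 = mq d z0 & mq d z0 * G.ee 1 = mq d z0" if "d : AA" for d
  using that WW_zero by (simp add: AA_def mq_SS mq_e1 mq_r1 fun_eq_iff act_zerow)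
 have "mq (asmul L c (e 1)) z0 * yy = mq (azero L) (%i. c * de 0 i)"
  unfolding yy_def using e12_in WW_zero de_in[of 0] chi_smul[of 1 "e 1" c] chi_e[of 1 1]
  by (simp add: mq_mul smul_in zero_in act_de0 mul_zero)
 moreover have "(\<Sum>i<l. ?a i * x' i) = mq z z0" using b(3) bz by (simp add: x'_def)
 ultimately have "(\<Sum>i<Suc l. ?a i * x' i) = s"
  using z de0_in[of c] WW_zero XX_car[OF z(1)] add_comm[OF XX_car[OF z(1)] zero_in] add_zero[OF XX_car[OF z(1)]]
  by (simp add: x'_def mq_add zero_in)
 moreover have "ALL i<Suc l. ?a i : G.SS & G.ee 1 * ?a i = ?a i & ?a i * G.ee 1 = ?a i"
  using qA a(1) qA[OF AA_smul[OF e1A]] by simp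
 ultimately show "EX a. (ALL i<Suc l. a i : G.SS & G.ee 1 * a i = a i & a i * G.ee 1 = a i) & s = (\<Sum>i<Suc l. a i * x' i)"
  by (intro exI[of _ ?a] conjI) (assumption, rule sym)
next
 fix s t i assume s: "s : G.SS" "G.ee 1 * s = s" "s * G.ee 2 = s" and t: "t : G.SS" "G.ee 1 * t = t" "t * G.ee 2 = t"
 obtain y c where y: "y : XX" "s = mq y (%i. c * de 0 i)" by (rule top_mq[OF s])
 obtain z d where z: "z : XX" "t = mq z (%i. d * de 0 i)" by (rule top_mq[OF t])
 show "k' i (s + t) = k' i s + k' i t"
  using y z XX_car k_add[OF y(1) z(1)] de0_in WW_add[OF de0_in[of c] de0_in[of d]]
  by (simp add: mq_add k'_mq add_in)
next
 fix a s i assume a: "a : G.SS" "G.ee 1 * a = a" "a * G.ee 1 = a" and s: "s : G.SS" "G.ee 1 * s = s" "s * G.ee 2 = s"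
 obtain b where b: "b : AA" "a = mq b z0" by (rule cor_mq[OF a])
 obtain z c where z: "z : XX" "s = mq z (%i. c * de 0 i)" by (rule top_mq[OF s])
 have "a * s = mq (amul L b z) (%i. c * xi 1 b * de 0 i)"
  using b z AA_raw XX_car WW_zero de0_in by (simp add: mq_mul act_cde0)
 thus "k' i (a * s) = G.ch 1 a * k' i s"
  using b z AA_raw XX_car WW_zero de0_in[of c] de0_in[of "c * xi 1 b"] k_AA[OF b(1) z(1)]
  by (simp add: k'_mq mq_ch mul_in)
next
 fix i j assume "i < Suc l" "j < Suc l"
 thus "k' j (x' i) = (if i = j then 1 else 0)" using x_in_car k_x WW_zero de_in[of 0] zero_in k_zero
  by (auto simp: x'_def yy_def k'_mq de_def less_Suc_eq)
qed

sublocale X: ext SS ee ch scr l xr kr G.SS G.ee G.ch G.scr x' k' pr inc yy vv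
proof
 fix s t assume s: "s : G.SS" and t: "t : G.SS"
 obtain a w where a: "a : acar L" "w : WW" "s = mq a w" by (rule mq_E[OF s])
 obtain b v where b: "b : acar L" "v : WW" "t = mq b v" by (rule mq_E[OF t])
 have m: "(%i. act a v i + xi 2 b * w i) : WW" using WW_add[OF act_in WW_smul[OF a(2)]] by simp
 show "pr s : SS" using a by (simp add: pr_mq rp_SS)
 show "pr (s + t) = pr s + pr t" using a b by (simp add: mq_add pr_mq add_in WW_add rp_add)
 show "pr (s * t) = pr s * pr t" using a b m by (simp add: mq_mul pr_mq mul_in rp_mul)
 show "s * t = 0" if "pr s = 0" "pr t = 0"
  using that a b chi_zero[of 2] mq_zero by (simp add: pr_mq_zero mq_mul act_zero mul_zero zero_in)
 show "s * G.ee 2 = s" if "pr s = 0" using that a mq_r2[OF a(1,2)] zero_mul e12_in by (simp add: pr_mq_zero)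
 show "EX c. s = yy * G.scr c" if "pr s = 0" "G.ee 1 * s = s"
 proof -
  have "a = azero L" "act (e 1) w = w" using that a mq_e1[OF a(1,2)] by (auto simp: pr_mq_zero)
  thus ?thesis unfolding yy_scr a(3) using act_e1_top[OF a(2)] by (intro exI[of _ "w 0"]) metis
 qed
 show "G.ch i s = ch i (pr s)" for i using a by (simp add: mq_ch pr_mq ch_rp)
 show "s * yy = yy * G.scr (G.ch 1 s)" if "G.ee 1 * s = s" "s * G.ee 1 = s"
  using a de_in[of 0] chi_zero[of 2] unfolding yy_scr by (simp add: yy_def mq_mul zero_in act_de0 mul_zero mq_ch)
 show "yy * s = yy * G.scr (G.ch 2 s)" if "G.ee 2 * s = s" "s * G.ee 2 = s"
  using a de_in[of 0] unfolding yy_scr by (simp add: yy_def mq_mul zero_in act_zero zero_mul mq_ch)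
 show "s * vv j = yy * G.scr (kr j (pr s))" if "G.ee 1 * s = s" "s * G.ee 2 = s" "j < l" for j
 proof -
  have "a : XX" using that a mq_e1[OF a(1,2)] mq_r2[OF a(1,2)] by (simp add: XX_def)
  thus ?thesis using a de_in[of "Suc j"] that(3) chi_zero[of 2] unfolding yy_scr
  by (simp add: vv_def mq_mul zero_in act_XX_de mul_zero pr_mq kr_rp)
 qed
next
 show "pr (G.ee i) = ee i" for i
  using pr_mq[OF zero_in WW_zero] pr_mq[OF e_in WW_zero, of i] mq_zero rp_zero by (auto simp: mq_ee ee_def)
 show "inc (ee i) = G.ee i" for i
  using inc_rp[OF zero_in] inc_rp[OF e_in, of i] mq_zero rp_zero by (auto simp: mq_ee ee_def)
next
 fix s t assume s: "s : SS" and t: "t : SS"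
 obtain a where a: "a : acar L" "s = rp a" by (rule SS_E[OF s])
 obtain b where b: "b : acar L" "t = rp b" by (rule SS_E[OF t])
 show "inc s : G.SS" using a WW_zero by (simp add: inc_rp mq_SS)
 show "inc (s + t) = inc s + inc t" using a b WW_zero by (simp add: rp_add[symmetric] inc_rp add_in mq_add)
 show "inc (s * t) = inc s * inc t" using a b WW_zero by (simp add: rp_mul[symmetric] inc_rp mul_in mq_mul act_zerow)
 show "pr (inc s) = s" using a WW_zero by (simp add: inc_rp pr_mq)
next
 show "yy : G.SS" "pr yy = 0" using de_in[of 0] zero_in rp_zero by (simp_all add: yy_def mq_SS pr_mq)
 show "G.ee 1 * yy = yy" using GT.x_in[of l] by (simp add: x'_def)
next
 fix j assume j: "j < l"
 show "vv j : G.SS & pr (vv j) = 0 & G.ee 2 * vv j = vv j"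
  using j de_in[of "Suc j"] zero_in rp_zero e12_in act_e2_de[OF j] by (simp add: vv_def mq_SS pr_mq mq_e2 mul_zero)
 show "x' j = inc (xr j)" using j x_in_car by (simp add: x'_def xr_def inc_rp)
next
 show "x' l = yy" by (simp add: x'_def)
 show "G.scr (c + d) = G.scr c + G.scr d" "G.scr (c * d) = G.scr c * G.scr d" for c d
  by (rule G.scr_add, rule G.scr_mult)
qed

lemma fan_GG:
 "SigmaFan GG ff = (SigmaFan L e - {convex_cone hull {(1, 0), (real l, -1)}}) \<union> {convex_cone hull {(real (Suc l), -1)},
  convex_cone hull {(1, 0), (real (Suc l), -1)}, convex_cone hull {(real l, -1), (real (Suc l), -1)}}"
proof -
 have 1: "E.psl = (%T. T : Obj & hz T T)" by (rule HOL.ext) (simp add: E.psl_def)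
 have 2: "G.E.psl = (%T. T : G.Obj & G.hz T T)" by (rule HOL.ext) (simp add: G.E.psl_def)
 show ?thesis using X.SF_extension unfolding 1 2 SigmaFan_eq[symmetric] G.SigmaFan_eq[symmetric] .
qed

end

theorem fan_of_left_mutation:
 fixes L :: "('k::field, 'a) kalg"
 assumes fd: "fd_algebra L" and ca: "charalg L e xi"
  and tri: "ALL x:acar L. amul L (amul L (e 2) x) (e 1) = azero L" and mut: "is_mutation L e (Pcx L 2) (Pcx L 1) T"
 obtains G :: "('k, nat => 'k) kalg" and f xi' and l :: nat where "fd_algebra G" "charalg G f xi'"
  "Ccone L e T = convex_cone hull {(1, 0), (real l, -1)}"
  "SigmaFan G f = (SigmaFan L e - {convex_cone hull {(1, 0), (real l, -1)}}) \<union> {convex_cone hull {(real (Suc l), -1)},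
  convex_cone hull {(1, 0), (real (Suc l), -1)}, convex_cone hull {(real l, -1), (real (Suc l), -1)}}"
proof -
 obtain rp :: "'a => (nat => 'k) aend" where rp: "rawrep L e rp"
  using rawrep_exists[OF fd charalg.poi[OF ca]] by blast
 interpret C: charrep L e xi rp by (rule charrep.intro[OF ca rp]) (unfold charrep_axioms_def, use tri in blast)
 obtain l :: nat and x kap where k: "!!i. i < l ==> x i : C.XX"
  "!!y z j. y : C.XX ==> z : C.XX ==> kap (aadd L y z) j = kap y j + kap z j"
  "!!c z j. z : C.XX ==> kap (asmul L c z) j = c * kap z j"
  "!!i j. i < l ==> j < l ==> kap (x i) j = (if i = j then 1 else (0::'k))"
  "!!a z j. a : C.AA ==> z : C.XX ==> kap (amul L a z) j = xi 1 a * kap z j"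
  "!!z b j. z : C.XX ==> b : acar L ==> kap (amul L z b) j = (\<Sum>k<l. kap z k * kap (amul L (x k) b) j)"
  "!!z. z : C.XX ==> EX a. (ALL i<l. a i : C.AA) & rp z = (\<Sum>i<l. rp (a i) * rp (x i))"
  by (rule C.trix_data[OF fd]) (rule that)
 obtain phi :: "'a => nat => 'k" and psi where ps: "!!a. a : acar L ==> psi (phi a) = a"
  by (rule C.faithful_coordinates[OF fd]) (rule that)
 interpret triext L e xi rp l x kap phi psi by unfold_locales (fact fd k ps)+
 obtain rq :: "(nat => 'k) => (nat => 'k) aend" where rq: "rawrep GG ff rq"
  using rawrep_exists[OF fd_GG poi_GG] by blast
 interpret triext2 L e xi rp l x kap phi psi rq 
  by (rule triext2.intro, rule triext_axioms, unfold triext2_axioms_def, rule rq)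
 show thesis by (rule that[OF fd_GG charalg_GG minus_cone[OF mut] fan_GG])
qed

section \<open>The opposite algebra\<close>

definition op :: "('k, 'a) kalg => ('k, 'a) kalg" where
 "op L = L\<lparr>amul := (%x y. amul L y x)\<rparr>"

lemma op_simps [simp]: "acar (op L) = acar L" "aadd (op L) = aadd L" "azero (op L) = azero L" "aone (op L) = aone L"
 "asmul (op L) = asmul L" "amul (op L) x y = amul L y x" by (simp_all add: op_def)

lemma op_op: "op (op L) = L" by (simp add: op_def)

text \<open>In the opposite algebra the vanishing corner is the one from e_1 to e_2; exchanging the
  indices restores the triangular shape.\<close>

definition sw :: "nat => nat" where "sw i = (if i = 1 then 2 else if i = 2 then 1 else i)"

lemma sw_sw [simp]: "sw (sw i) = i" by (simp add: sw_def)

lemma sw_eq_iff [simp]: "sw i = sw j \<longleftrightarrow> i = j" by (metis sw_sw)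

lemma sw_o_sw [simp]: "sw \<circ> sw = id" by (simp add: fun_eq_iff)

lemma sw_12: "sw 1 = 2" "sw 2 = 1" "i : {1, 2} ==> sw i : {1, 2}" by (auto simp: sw_def)

lemma kalgebra_op: "kalgebra L ==> kalgebra (op L)"
 unfolding kalgebra_def op_simps by (elim conjE, intro conjI) (blast | metis)+

lemma lincomb_op: "lincomb (op L) B = lincomb L B"
proof -
 have "x : lincomb L B" if "x : lincomb (op L) B" for x using that
 proof induction
  case lc_zero
  thus ?case by (simp add: lincomb.lc_zero)
 next
  case (lc_step x b c)
  thus ?case by (simp add: lincomb.lc_step)
 qed
 moreover have "x : lincomb (op L) B" if "x : lincomb L B" for x using that
 proof induction
  case lc_zero
  thus ?case using lincomb.lc_zero[of "op L" B] by simp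
 next
  case (lc_step x b c)
  thus ?case using lincomb.lc_step[of x "op L" B b c] by simp
 qed
 ultimately show ?thesis by blast
qed

lemma fd_op: "fd_algebra L ==> fd_algebra (op L)" unfolding fd_algebra_def by (simp add: lincomb_op kalgebra_op)

lemma primitive_op: "primitive_idem (op L) x \<longleftrightarrow> primitive_idem L x"
 unfolding primitive_idem_def idempotent_def op_simps by blast

lemma charalg_op:
 assumes "charalg L e xi"
 shows "charalg (op L) (e \<circ> sw) (xi \<circ> sw)"
proof -
 interpret charalg L e xi by (rule assms)
 have s: "sw i : {1, 2}" if "i : {1, 2}" for i using sw_12 that by blast
 show ?thesis
 proof
  show "kalgebra (op L)" by (rule kalgebra_op[OF kalg])
  show "complete_poi2 (op L) (e \<circ> sw)" using poi add_comm[OF ei_in[of 1] ei_in[of 2]]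
  by (simp add: complete_poi2_def primitive_op sw_12)
  fix i :: nat assume i: "i : {1, 2}"
  show "(xi \<circ> sw) i ((e \<circ> sw) j) = (if i = j then 1 else 0)" if "j : {1, 2}" for j
  using chi_e[OF s[OF i] s[OF that]] by simp
  show "(xi \<circ> sw) i (aadd (op L) x y) = (xi \<circ> sw) i x + (xi \<circ> sw) i y"
  "(xi \<circ> sw) i (amul (op L) x y) = (xi \<circ> sw) i x * (xi \<circ> sw) i y"
  if "x : acar (op L)" "y : acar (op L)" for x y
  using chi_add[OF s[OF i], of x y] chi_mul[OF s[OF i], of y x] that by simp_all
  show "(xi \<circ> sw) i (asmul (op L) c x) = c * (xi \<circ> sw) i x" if "x : acar (op L)" for c x
  using chi_smul[OF s[OF i], of x c] that by simp
 next
  show "qi (op L) x" if "x : acar (op L)" "(xi \<circ> sw) 1 x = 0" "(xi \<circ> sw) 2 x = 0" for x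
  proof -
  have "xi 1 x = 0" "xi 2 x = 0" "x : acar L" using that by (simp_all add: sw_12)
  then obtain y where "y : acar L" "aadd L x y = amul L x y" "aadd L x y = amul L y x"
  using chi_qi[of x] unfolding qi_def by blast
  thus ?thesis unfolding qi_def by (intro bexI[of _ y]) simp_all
  qed
 qed
qed

section \<open>Transposed complexes over the opposite algebra\<close>

definition tr :: "'a mat => 'a mat" where "tr M = (%r c. M c r)"

lemma tr_tr [simp]: "tr (tr M) = M" by (simp add: tr_def)

text \<open>The duality Hom(-, \<Lambda>) followed by a shift: it exchanges the two degrees and so
  preserves two-term complexes.\<close>

definition Dc :: "'a cx => 'a cx" where
 "Dc T = \<lparr>cs = map sw (ct T), ct = map sw (cs T), cd = tr (cd T)\<rparr>"

lemma Dc_sel [simp]: "cs (Dc T) = map sw (ct T)" "ct (Dc T) = map sw (cs T)" "cd (Dc T) = tr (cd T)"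
 by (simp_all add: Dc_def)

lemma Dc_Dc [simp]: "Dc (Dc T) = T" by (simp add: Dc_def)

lemma is_proj_sw: "is_proj (map sw P) \<longleftrightarrow> is_proj P"
proof -
 have "is_proj (map sw Q)" if "is_proj Q" for Q using that sw_12(3) unfolding is_proj_def by auto
 from this[of P] this[of "map sw P"] show ?thesis by (auto simp: comp_def)
qed

lemma asum_op: "asum (op L) f n = asum L f n" by (induction n) auto

lemma mcomp_op: "mcomp (op L) n (tr M) (tr N) = tr (mcomp L n N M)" by (simp add: mcomp_def tr_def asum_op)

lemma madd_op: "madd (op L) (tr M) (tr N) = tr (madd L M N)" by (simp add: madd_def tr_def)

lemma meq_tr: "meq (map sw Q) (map sw P) (tr M) (tr N) \<longleftrightarrow> meq P Q M N"
 by (auto simp: meq_def tr_def)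

lemma mid_op: "meq (map sw P) (map sw P) (mid (op L) (e \<circ> sw) (map sw P)) (tr (mid L e P))"
 by (auto simp: meq_def tr_def mid_def)

definition fl :: "real \<times> real => real \<times> real" where "fl v = (- snd v, - fst v)"

lemma linear_fl: "linear fl" by (rule linearI) (auto simp: fl_def)

lemma count_sw: "count_list (map sw P) 1 = count_list P 2" "count_list (map sw P) 2 = count_list P 1"
 by (induction P) (auto simp: sw_def)

lemma gvec_Dc: "gvec (Dc T) = fl (gvec T)"
 using count_sw[of "cs T"] count_sw[of "ct T"] by (simp add: gvec_def fl_def)

lemma Dc_dsum: "Dc (dsum L T U) = dsum (op L) (Dc T) (Dc U)" by (auto simp: Dc_def dsum_def tr_def fun_eq_iff)

lemma Dc_zero: "Dc (cx_zero L) = cx_zero (op L)" by (simp add: Dc_def cx_zero_def tr_def)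

lemma Dc_Pshift: "Dc (Pshift L 1) = Pcx (op L) 2" "Dc (Pshift L 2) = Pcx (op L) 1"
 by (simp_all add: Dc_def Pshift_def Pcx_def tr_def sw_def)

context charalg
begin

lemma is_map_op:
 assumes "is_proj P" "is_proj Q" "is_map L e P Q M"
 shows "is_map (op L) (e \<circ> sw) (map sw Q) (map sw P) (tr M)" unfolding is_map_def
proof (intro allI impI)
 fix r c assume "r < length (map sw P)" "c < length (map sw Q)"
 hence rc: "r < length P" "c < length Q" by simp_all
 hence "P ! r : {1, 2}" "Q ! c : {1, 2}" using assms unfolding is_proj_def by (meson nth_mem subset_iff)+
 hence "e (P ! r) : acar L" "e (Q ! c) : acar L" using ei_in by blast+
 moreover have "M c r : acar L" "amul L (amul L (e (Q ! c)) (M c r)) (e (P ! r)) = M c r"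
  using assms(3) rc by (auto simp: is_map_def)
 ultimately show "tr M r c : acar (op L) & amul (op L) (amul (op L) ((e \<circ> sw) (map sw P ! r)) (tr M r c))
  ((e \<circ> sw) (map sw Q ! c)) = tr M r c" using rc mul_assoc by (simp add: tr_def)
qed

lemma mat_in: "is_map L e P Q M ==> r < length Q ==> c < length P ==> M r c : acar L" by (simp add: is_map_def)

lemma mcomp_in:
 assumes "is_map L e P Q M" "is_map L e Q R N" "r < length R" "c < length P"
 shows "mcomp L (length Q) N M r c : acar L"
 unfolding mcomp_def by (intro asum_in mul_in mat_in[OF assms(2,3)] mat_in[OF assms(1) _ assms(4)])

lemma valid_parts: "cx_valid L e T ==> is_proj (cs T) & is_proj (ct T) & is_map L e (cs T) (ct T) (cd T)"
 by (simp add: cx_valid_def)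

lemma valid_op: "cx_valid L e T ==> cx_valid (op L) (e \<circ> sw) (Dc T)"
 unfolding cx_valid_def using is_map_op[of "cs T" "ct T" "cd T"] by (simp add: is_proj_sw)

text \<open>Transposition interchanges the two summands of a null-homotopy. The hypothesis
  \<open>inv\<close> is \<open>is_map_op\<close> of the opposite algebra, supplied where both
  interpretations are present.\<close>

lemma hom_shift_op:
 assumes T: "cx_valid L e T" and U: "cx_valid L e U" and h: "hom_shift_zero L e T U"
  and inv: "!!P Q M. is_proj P ==> is_proj Q ==> is_map (op L) (e \<circ> sw) P Q M ==>
  is_map L e (map sw Q) (map sw P) (tr M)"
 shows "hom_shift_zero (op L) (e \<circ> sw) (Dc U) (Dc T)" unfolding hom_shift_zero_def
proof (intro allI impI)
 fix f assume f: "is_map (op L) (e \<circ> sw) (cs (Dc U)) (ct (Dc T)) f"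
 have v: "is_proj (cs T)" "is_proj (ct T)" "is_map L e (cs T) (ct T) (cd T)"
  "is_proj (cs U)" "is_proj (ct U)" "is_map L e (cs U) (ct U) (cd U)"
  using valid_parts[OF T] valid_parts[OF U] by auto
 have "is_map L e (cs T) (ct U) (tr f)" using inv[OF _ _ f] v by (simp add: is_proj_sw comp_def)
 then obtain a b where ab: "is_map L e (cs T) (cs U) a" "is_map L e (ct T) (ct U) b"
  "meq (cs T) (ct U) (tr f) (madd L (mcomp L (length (cs U)) (cd U) a) (mcomp L (length (ct T)) b (cd T)))"
  using h unfolding hom_shift_zero_def by blast
 have "meq (cs T) (ct U) (tr f) (madd L (mcomp L (length (ct T)) b (cd T)) (mcomp L (length (cs U)) (cd U) a))"
  using ab(3) add_comm[OF mcomp_in[OF ab(1) v(6)] mcomp_in[OF v(3) ab(2)]] by (simp add: meq_def madd_def)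
 hence "meq (map sw (ct U)) (map sw (cs T)) f
  (madd (op L) (mcomp (op L) (length (ct T)) (tr (cd T)) (tr b)) (mcomp (op L) (length (cs U)) (tr a) (tr (cd U))))"
  unfolding mcomp_op madd_op using meq_tr[of "ct U" "cs T" "tr f"] by simp
 moreover have "is_map (op L) (e \<circ> sw) (map sw (ct U)) (map sw (ct T)) (tr b)" by (rule is_map_op[OF v(2,5) ab(2)])
 moreover have "is_map (op L) (e \<circ> sw) (map sw (cs U)) (map sw (cs T)) (tr a)" by (rule is_map_op[OF v(1,4) ab(1)])
 ultimately show "EX a b. is_map (op L) (e \<circ> sw) (cs (Dc U)) (cs (Dc T)) a &
  is_map (op L) (e \<circ> sw) (ct (Dc U)) (ct (Dc T)) b &
  meq (cs (Dc U)) (ct (Dc T)) f (madd (op L) (mcomp (op L) (length (cs (Dc T))) (cd (Dc T)) a)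
  (mcomp (op L) (length (ct (Dc U))) b (cd (Dc U))))" by (intro exI[of _ "tr b"] exI[of _ "tr a"]) simp
qed

definition dm :: "'a mat \<times> 'a mat => 'a mat \<times> 'a mat" where "dm f = (tr (snd f), tr (fst f))"

lemma chain_map_op:
 assumes T: "cx_valid L e T" and U: "cx_valid L e U" and f: "chain_map L e T U f"
 shows "chain_map (op L) (e \<circ> sw) (Dc U) (Dc T) (dm f)"
proof -
 have v: "is_proj (cs T)" "is_proj (ct T)" "is_proj (cs U)" "is_proj (ct U)"
  using valid_parts[OF T] valid_parts[OF U] by auto
 have f': "is_map L e (cs T) (cs U) (fst f)" "is_map L e (ct T) (ct U) (snd f)"
  "meq (cs T) (ct U) (mcomp L (length (cs U)) (cd U) (fst f)) (mcomp L (length (ct T)) (snd f) (cd T))"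
  using f by (simp_all add: chain_map_def)
 have "meq (cs T) (ct U) (mcomp L (length (ct T)) (snd f) (cd T)) (mcomp L (length (cs U)) (cd U) (fst f))"
  using f'(3) by (simp add: meq_def)
 thus ?thesis unfolding chain_map_def using is_map_op[OF v(1,3) f'(1)] is_map_op[OF v(2,4) f'(2)]
  by (simp add: dm_def mcomp_op meq_tr)
qed

lemma homotopic_op:
 assumes T: "cx_valid L e T" and h: "homotopic L e T T f (mid L e (cs T), mid L e (ct T))"
 shows "homotopic (op L) (e \<circ> sw) (Dc T) (Dc T) (dm f)
  (mid (op L) (e \<circ> sw) (cs (Dc T)), mid (op L) (e \<circ> sw) (ct (Dc T)))"
proof -
 have v: "is_proj (cs T)" "is_proj (ct T)" using valid_parts[OF T] by auto
 obtain h where h: "is_map L e (ct T) (cs T) h"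
  "meq (cs T) (cs T) (fst f) (madd L (mid L e (cs T)) (mcomp L (length (ct T)) h (cd T)))"
  "meq (ct T) (ct T) (snd f) (madd L (mid L e (ct T)) (mcomp L (length (cs T)) (cd T) h))"
  using h unfolding homotopic_def by auto
 have m: "meq (map sw P) (map sw P) (tr g) (madd (op L) (mid (op L) (e \<circ> sw) (map sw P)) (tr k))"
  if "meq P P g (madd L (mid L e P) k)" for P g k
  using that mid_op[of P L e] by (auto simp: meq_def madd_def tr_def)
 show ?thesis unfolding homotopic_def using is_map_op[OF v(2,1) h(1)] m[OF h(2)] m[OF h(3)]
  by (intro exI[of _ "tr h"]) (simp add: dm_def mcomp_op)
qed

lemma cx_iso_op:
 assumes T: "cx_valid L e T" and U: "cx_valid L e U" and i: "cx_iso L e T U"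
 shows "cx_iso (op L) (e \<circ> sw) (Dc T) (Dc U)"
proof -
 obtain f g where f: "chain_map L e T U f" and g: "chain_map L e U T g"
  and gf: "homotopic L e T T (chain_comp L U g f) (mid L e (cs T), mid L e (ct T))"
  and fg: "homotopic L e U U (chain_comp L T f g) (mid L e (cs U), mid L e (ct U))"
  using i unfolding cx_iso_def by blast
 have c: "chain_comp (op L) (Dc V) (dm p) (dm q) = dm (chain_comp L V q p)" for V p q
  by (simp add: chain_comp_def dm_def mcomp_op)
 show ?thesis unfolding cx_iso_def
  using chain_map_op[OF U T g] chain_map_op[OF T U f] homotopic_op[OF T gf] homotopic_op[OF U fg]
  by (intro exI[of _ "dm g"] exI[of _ "dm f"]) (simp only: c)
qed

end

context
 fixes L :: "('k::field, 'a) kalg" and e :: "nat => 'a" and xi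
 assumes ca: "charalg L e xi"
begin

interpretation A: charalg L e xi by (rule ca)
interpretation B: charalg "op L" "e \<circ> sw" "xi \<circ> sw" by (rule charalg_op[OF ca])

lemma op_back: "op (op L) = L" "(e \<circ> sw) \<circ> sw = e" by (simp_all add: op_op comp_assoc)

lemma valid_op_iff: "cx_valid (op L) (e \<circ> sw) (Dc T) \<longleftrightarrow> cx_valid L e T"
 using A.valid_op[of T] B.valid_op[of "Dc T", unfolded op_back Dc_Dc] by blast

lemma hom_shift_op_iff:
 assumes T: "cx_valid L e T" and U: "cx_valid L e U"
 shows "hom_shift_zero (op L) (e \<circ> sw) (Dc U) (Dc T) \<longleftrightarrow> hom_shift_zero L e T U"
proof
 assume h: "hom_shift_zero (op L) (e \<circ> sw) (Dc U) (Dc T)"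
 show "hom_shift_zero L e T U"
  using B.hom_shift_op[of "Dc U" "Dc T", unfolded op_back Dc_Dc, OF _ _ h A.is_map_op] T U
  by (simp add: valid_op_iff)
next
 assume h: "hom_shift_zero L e T U"
 show "hom_shift_zero (op L) (e \<circ> sw) (Dc U) (Dc T)"
  by (rule A.hom_shift_op[OF T U h]) (rule B.is_map_op[unfolded op_back])
qed

lemma cx_iso_op_iff:
 assumes T: "cx_valid L e T" and U: "cx_valid L e U"
 shows "cx_iso (op L) (e \<circ> sw) (Dc T) (Dc U) \<longleftrightarrow> cx_iso L e T U"
proof
 assume h: "cx_iso (op L) (e \<circ> sw) (Dc T) (Dc U)"
 show "cx_iso L e T U"
  using B.cx_iso_op[of "Dc T" "Dc U", unfolded op_back Dc_Dc, OF _ _ h] T U by (simp add: valid_op_iff)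
qed (rule A.cx_iso_op[OF T U])

lemma dual_transport:
 assumes "fd_algebra L"
 shows "transport (Collect (cx_valid L e)) (cx_iso L e) (dsum L) (cx_zero L)
  (Collect (cx_valid (op L) (e \<circ> sw))) (cx_iso (op L) (e \<circ> sw)) (dsum (op L)) (cx_zero (op L)) Dc"
proof -
 obtain rp :: "'a => (nat => 'k) aend" where "rawrep L e rp" using rawrep_exists[OF assms A.poi] by blast
 then interpret R: rawrep L e rp .
 show ?thesis
 proof
  fix T' assume "T' : Collect (cx_valid (op L) (e \<circ> sw))"
  hence "Dc T' : Collect (cx_valid L e)" using valid_op_iff[of "Dc T'"] by simp
  thus "EX T:Collect (cx_valid L e). Dc T = T'" by (intro bexI[of _ "Dc T'"]) simp_all
 qed (auto simp: valid_op_iff cx_iso_op_iff R.dsum_valid Dc_dsum R.zero_valid Dc_zero)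
qed

lemma fan_op:
 assumes "fd_algebra L"
 shows "SigmaFan (op L) (e \<circ> sw) = (`) fl ` SigmaFan L e" unfolding raw_notions
 by (rule transport.Phi_SFP[OF dual_transport[OF assms]])
  (auto simp: gvec_Dc linear_fl presilting_def valid_op_iff hom_shift_op_iff)

lemma cone_op:
 assumes "fd_algebra L" "cx_valid L e T"
 shows "Ccone (op L) (e \<circ> sw) (Dc T) = fl ` Ccone L e T" unfolding raw_notions
 by (rule transport.Phi_cone[OF dual_transport[OF assms(1)]]) (use assms in \<open>auto simp: gvec_Dc linear_fl\<close>)

lemma mutation_op:
 assumes fd: "fd_algebra L" and m: "is_mutation L e (Pshift L 1) (Pshift L 2) T"
 shows "is_mutation (op L) (e \<circ> sw) (Pcx (op L) 2) (Pcx (op L) 1) (Dc T)" and "cx_valid L e T"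
proof -
 interpret D: transport "Collect (cx_valid L e)" "cx_iso L e" "dsum L" "cx_zero L"
  "Collect (cx_valid (op L) (e \<circ> sw))" "cx_iso (op L) (e \<circ> sw)" "dsum (op L)" "cx_zero (op L)" Dc
  by (rule dual_transport[OF fd])
 have pv: "cx_valid L e (Pshift L i)" if "i : {1, 2}" for i
  using that by (auto simp: cx_valid_def Pshift_def is_proj_def is_map_def)
 obtain T' U V where h: "basic L e T" "presilting L e T" "indecomposable L e T'" "~ cx_iso L e T' (Pshift L 1)"
  "cx_iso L e T (dsum L T' (Pshift L 2))" "ind_summand L e T U" "ind_summand L e T V" "~ cx_iso L e U V"
  using m unfolding is_mutation_def silting2_def by blast
 have v: "cx_valid L e T" "cx_valid L e T'" "cx_valid L e U" "cx_valid L e V"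
  using h by (auto simp: presilting_def indecomposable_def ind_summand_def)
 show "cx_valid L e T" by (rule v(1))
 have "basic (op L) (e \<circ> sw) (Dc T)" using D.Phi_basic[of T] h(1) v by (simp add: raw_notions)
 moreover have "presilting (op L) (e \<circ> sw) (Dc T)"
  using h(2) v(1) by (simp add: presilting_def valid_op_iff hom_shift_op_iff)
 moreover have "indecomposable (op L) (e \<circ> sw) (Dc T')" using D.Phi_indec[of T'] h(3) v by (simp add: raw_notions)
 moreover have "ind_summand (op L) (e \<circ> sw) (Dc T) (Dc U)" "ind_summand (op L) (e \<circ> sw) (Dc T) (Dc V)"
  using D.Phi_isum[of T U] D.Phi_isum[of T V] h(6,7) v by (simp_all add: raw_notions)
 moreover have "~ cx_iso (op L) (e \<circ> sw) (Dc U) (Dc V)" using h(8) v by (simp add: cx_iso_op_iff)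
 moreover have "~ cx_iso (op L) (e \<circ> sw) (Dc T') (Pcx (op L) 2)"
  using h(4) cx_iso_op_iff[OF v(2) pv[of 1]] by (simp add: Dc_Pshift)
 moreover have "cx_iso (op L) (e \<circ> sw) (Dc T) (dsum (op L) (Dc T') (Pcx (op L) 1))"
  using h(5) cx_iso_op_iff[OF v(1), of "dsum L T' (Pshift L 2)"] D.ds_Ob[of T' "Pshift L 2"] v(2) pv[of 2]
  by (simp add: Dc_dsum Dc_Pshift)
 ultimately show "is_mutation (op L) (e \<circ> sw) (Pcx (op L) 2) (Pcx (op L) 1) (Dc T)"
  unfolding is_mutation_def silting2_def by blast
qed

end

section \<open>Subdivision of plane fans\<close>

lemma hull_pair:
 fixes u v :: "real \<times> real"
 shows "convex_cone hull {u, v} = {a *\<^sub>R u + b *\<^sub>R v | a b. 0 <= a & 0 <= b}" (is "_ = ?S")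
proof
 have m: "a *\<^sub>R u + b *\<^sub>R v : ?S" if "0 <= a" "0 <= b" for a b using that by blast
 have "convex_cone ?S" unfolding convex_cone_iff
 proof (intro conjI ballI allI impI)
  show "0 : ?S" using m[of 0 0] by simp
 next
  fix x y assume "x : ?S" "y : ?S"
  then obtain a b c d where "x = a *\<^sub>R u + b *\<^sub>R v" "0 <= a" "0 <= b" "y = c *\<^sub>R u + d *\<^sub>R v" "0 <= c" "0 <= d" by blast
  thus "x + y : ?S" using m[of "a + c" "b + d"] by (simp add: algebra_simps)
 next
  fix x and t :: real assume "x : ?S" "0 <= t"
  then obtain a b where "x = a *\<^sub>R u + b *\<^sub>R v" "0 <= a" "0 <= b" by blast
  thus "t *\<^sub>R x : ?S" using m[of "t * a" "t * b"] \<open>0 <= t\<close> by (simp add: algebra_simps)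
 qed
 moreover have "{u, v} \<subseteq> ?S" using m[of 1 0] m[of 0 1] by simp
 ultimately show "convex_cone hull {u, v} \<subseteq> ?S" by (intro hull_minimal)
 show "?S \<subseteq> convex_cone hull {u, v}"
 proof
  fix x assume "x : ?S"
  then obtain a b where x: "x = a *\<^sub>R u + b *\<^sub>R v" "0 <= a" "0 <= b" by blast
  show "x : convex_cone hull {u, v}"
  unfolding x(1) by (intro convex_cone_hull_add convex_cone_hull_mul x hull_inc) simp_all
 qed
qed

text \<open>Bezout's identity for the entries of \<open>u\<close> makes the factor an integer, and
  the one for the entries of the multiple makes it a divisor of 1.\<close>

lemma primitive_scale:
 assumes u: "primitive_vec u" and au: "primitive_vec (a *\<^sub>R u)" and a: "0 < a"
 shows "a = 1"
proof -
 obtain m n :: int where m: "u = (of_int m, of_int n)" "gcd m n = 1" 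
  using u unfolding primitive_vec_def by (elim exE conjE) (rule that)
 obtain p q :: int where p: "a *\<^sub>R u = (of_int p, of_int q)" "gcd p q = 1" 
  using au unfolding primitive_vec_def by (elim exE conjE) (rule that)
 have e: "a * of_int m = of_int p" "a * of_int n = of_int q" using p(1) m(1) by auto
 obtain s t where s: "s * m + t * n = 1" using bezout_int[of m n] m(2) by auto
 obtain s' t' where s': "s' * p + t' * q = 1" using bezout_int[of p q] p(2) by auto
 have "a = a * of_int (s * m + t * n)" by (simp add: s)
 also have "... = of_int s * (a * of_int m) + of_int t * (a * of_int n)" by (simp add: algebra_simps)
 also have "... = of_int (s * p + t * q)" by (simp add: e)
 finally have k: "a = of_int (s * p + t * q)" .
 have "1 = (of_int (s' * p + t' * q) :: real)" by (simp add: s')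
 also have "... = of_int s' * (a * of_int m) + of_int t' * (a * of_int n)" by (simp add: e)
 also have "... = a * of_int (s' * m + t' * n)" by (simp add: algebra_simps)
 also have "... = of_int ((s * p + t * q) * (s' * m + t' * n))" by (subst k) simp
 finally have "(s * p + t * q) * (s' * m + t' * n) = 1" by (metis of_int_1 of_int_eq_iff)
 moreover have "0 < s * p + t * q"
 proof -
  have "0 < (of_int (s * p + t * q) :: real)" using a by (simp only: k[symmetric])
  thus ?thesis by (simp only: of_int_0_less_iff)
 qed
 ultimately have "s * p + t * q = 1" using pos_zmult_eq_1_iff by blast
 thus ?thesis using k by simp
qed

lemma plane_independent:
 fixes u v :: "real \<times> real"
 assumes det: "fst u * snd v - fst v * snd u ~= 0" and e: "a *\<^sub>R u + b *\<^sub>R v = c *\<^sub>R u + d *\<^sub>R v"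
 shows "a = c" "b = d"
proof -
 have f: "a * fst u + b * fst v = c * fst u + d * fst v" using arg_cong[OF e, of fst] by simp
 have s: "a * snd u + b * snd v = c * snd u + d * snd v" using arg_cong[OF e, of snd] by simp
 have "(a - c) * (fst u * snd v - fst v * snd u)
  = snd v * ((a * fst u + b * fst v) - (c * fst u + d * fst v)) - fst v * ((a * snd u + b * snd v) - (c * snd u + d * snd v))"
  by (simp add: algebra_simps)
 thus "a = c" using det by (simp only: f s) simp
 have "(b - d) * (fst u * snd v - fst v * snd u)
  = fst u * ((a * snd u + b * snd v) - (c * snd u + d * snd v)) - snd u * ((a * fst u + b * fst v) - (c * fst u + d * fst v))"
  by (simp add: algebra_simps)
 thus "b = d" using det by (simp only: f s) simp
qed

text \<open>\<open>subdiv\<close> selects generators by \<open>SOME\<close>, so they have to be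
  determined up to order. Each pair is a nonnegative combination of the other; the product of the
  two coefficient matrices is the identity, so both are monomial, and primitivity makes the factors
  1.\<close>

lemma hull_pair_unique:
 fixes u v p q :: "real \<times> real"
 assumes prim: "primitive_vec u" "primitive_vec v" "primitive_vec p" "primitive_vec q"
  and det: "fst u * snd v - fst v * snd u ~= 0" and hull: "convex_cone hull {u, v} = convex_cone hull {p, q}"
 shows "p = u & q = v | p = v & q = u"
proof -
 have "p : convex_cone hull {u, v}" "q : convex_cone hull {u, v}" unfolding hull by (simp_all add: hull_inc)
 then obtain a b c d where p: "p = a *\<^sub>R u + b *\<^sub>R v" "0 <= a" "0 <= b" and q: "q = c *\<^sub>R u + d *\<^sub>R v" "0 <= c" "0 <= d"
  unfolding hull_pair by blast
 have "u : convex_cone hull {p, q}" "v : convex_cone hull {p, q}" unfolding hull[symmetric] by (simp_all add: hull_inc)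
 then obtain alp bet \<gamma> \<delta> where u: "u = alp *\<^sub>R p + bet *\<^sub>R q" "0 <= alp" "0 <= bet" and v: "v = \<gamma> *\<^sub>R p + \<delta> *\<^sub>R q" "0 <= \<gamma>" "0 <= \<delta>"
  unfolding hull_pair by blast
 have "(alp * a + bet * c) *\<^sub>R u + (alp * b + bet * d) *\<^sub>R v = alp *\<^sub>R p + bet *\<^sub>R q" by (simp add: p q algebra_simps)
 also have "... = 1 *\<^sub>R u + 0 *\<^sub>R v" by (simp flip: u(1))
 finally have 1: "alp * a + bet * c = 1" "alp * b + bet * d = 0" using plane_independent[OF det] by blast+
 have "(\<gamma> * a + \<delta> * c) *\<^sub>R u + (\<gamma> * b + \<delta> * d) *\<^sub>R v = \<gamma> *\<^sub>R p + \<delta> *\<^sub>R q" by (simp add: p q algebra_simps)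
 also have "... = 0 *\<^sub>R u + 1 *\<^sub>R v" by (simp flip: v(1))
 finally have 2: "\<gamma> * a + \<delta> * c = 0" "\<gamma> * b + \<delta> * d = 1" using plane_independent[OF det] by blast+
 have z: "alp * b = 0" "bet * d = 0" "\<gamma> * a = 0" "\<delta> * c = 0"
  using 1(2) 2(1) add_nonneg_eq_0_iff[of "alp * b" "bet * d"] add_nonneg_eq_0_iff[of "\<gamma> * a" "\<delta> * c"]
  p(2,3) q(2,3) u(2,3) v(2,3) by simp_all
 show ?thesis
 proof (cases "alp = 0")
  case False
  hence b0: "b = 0" using z by simp
  hence d0: "d ~= 0" "\<delta> ~= 0" using 2(2) by auto
  hence c0: "c = 0" using z by simp
  hence "a ~= 0" using 1(1) by auto
  hence "a = 1" "d = 1" using p q d0 b0 c0 prim primitive_scale[of u a] primitive_scale[of v d] by simp_all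
  thus ?thesis using p q b0 c0 by simp
 next
  case True
  hence bc: "bet ~= 0" "c ~= 0" using 1(1) by auto
  hence d0: "d = 0" and "\<delta> = 0" using z by simp_all
  hence b: "\<gamma> ~= 0" "b ~= 0" using 2(2) by auto
  hence a0: "a = 0" using z by simp
  hence "b = 1" "c = 1" using p q b bc d0 prim primitive_scale[of v b] primitive_scale[of u c] by simp_all
  thus ?thesis using p q a0 d0 by simp
 qed
qed

lemma dim_hull_pair:
 fixes u v :: "real \<times> real"
 assumes det: "fst u * snd v - fst v * snd u ~= 0"
 shows "dim (convex_cone hull {u, v}) = 2"
proof -
 have ne: "u ~= v" using det by auto
 have "v ~= 0" using det by auto
 have "u ~: span {v}"
 proof
  assume "u : span {v}"
  then obtain k where "u = k *\<^sub>R v" by (auto simp: span_singleton)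
  thus False using det by simp
 qed
 hence "independent {u, v}" using \<open>v ~= 0\<close> ne by (simp add: independent_insert)
 hence "dim {u, v} = 2" using dim_eq_card_independent[of "{u, v}"] ne by simp
 moreover have "dim {u, v} <= dim (convex_cone hull {u, v})" by (rule dim_subset) (rule hull_subset)
 moreover have "dim (convex_cone hull {u, v}) <= 2" using dim_subset_UNIV[of "convex_cone hull {u, v}"] by simp
 ultimately show ?thesis by simp
qed

text \<open>\<open>subdiv\<close> retains cones sorted by dimension. Since every cone contains 0 and
  the plane has dimension 2, dimensions 0, 1 and 2 together exhaust the fan, and only the subdivided
  cone is lost.\<close>

lemma subdiv_formula:
 fixes u v :: "real \<times> real"
 assumes prim: "primitive_vec u" "primitive_vec v" and det: "fst u * snd v - fst v * snd u ~= 0"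
  and zero: "{0} : \<Sigma>" "!!c. c : \<Sigma> ==> 0 : c"
 shows "subdiv \<Sigma> (convex_cone hull {u, v}) = (\<Sigma> - {convex_cone hull {u, v}}) \<union>
  {convex_cone hull {u + v}, convex_cone hull {u, u + v}, convex_cone hull {v, u + v}}"
proof -
 let ?\<sigma> = "convex_cone hull {u, v}"
 let ?P = "%(p, q). primitive_vec p & primitive_vec q & ?\<sigma> = convex_cone hull {p, q}"
 obtain p q where pq: "(SOME w. ?P w) = (p, q)" by (cases "SOME w. ?P w")
 have "?P (SOME w. ?P w)" by (rule someI[of ?P "(u, v)"]) (use prim in simp)
 hence "primitive_vec p" "primitive_vec q" "?\<sigma> = convex_cone hull {p, q}" unfolding pq by auto
 hence "p = u & q = v | p = v & q = u" using hull_pair_unique[OF prim _ _ det] by blast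
 hence "subdiv \<Sigma> ?\<sigma> = {{0}} \<union> {c \<in> \<Sigma>. dim c = 1} \<union> {convex_cone hull {u + v}} \<union>
  ({c \<in> \<Sigma>. dim c = 2} - {?\<sigma>}) \<union> {convex_cone hull {u, u + v}, convex_cone hull {v, u + v}}"
 proof (elim disjE conjE)
  assume "p = u" "q = v"
  thus ?thesis using pq by (simp add: subdiv_def)
 next
  assume "p = v" "q = u"
  thus ?thesis
  using pq by (simp add: subdiv_def add.commute[of v u] insert_commute[of "convex_cone hull {v, u + v}"])
 qed
 moreover have "{{0}} \<union> {c \<in> \<Sigma>. dim c = 1} \<union> ({c \<in> \<Sigma>. dim c = 2} - {?\<sigma>}) = \<Sigma> - {?\<sigma>}"
 proof -
  have d: "c = {0} \<or> dim c = 1 \<or> dim c = 2" if "c : \<Sigma>" for c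
  proof -
  have "dim c <= 2" using dim_subset_UNIV[of c] by simp
  moreover have "c = {0}" if "dim c = 0" using that zero(2)[OF \<open>c : \<Sigma>\<close>] by (auto simp: dim_eq_0)
  ultimately show ?thesis by linarith
  qed
  have "dim ?\<sigma> = 2" by (rule dim_hull_pair[OF det])
  moreover have "?\<sigma> ~= {0}"
  proof
  assume "?\<sigma> = {0}"
  hence "dim ?\<sigma> = dim {0 :: real \<times> real}" by simp
  thus False using \<open>dim ?\<sigma> = 2\<close> by simp
  qed
  ultimately show ?thesis using d zero(1) by auto
 qed
 moreover have "A \<union> B \<union> {x} \<union> D \<union> {y, z} = (A \<union> B \<union> D) \<union> {x, y, z}" for A B D and x y z :: "(real \<times> real) set"
  by blast
 ultimately show ?thesis by (simp only:)
qed

lemma (in charrep) zero_in_fan: "{0} : SigmaFan L e"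
proof -
 have "E.psl = (%T. T : Obj & hz T T)" by (rule ext) (simp add: E.psl_def)
 thus ?thesis using E.SF_zero by (simp add: SigmaFan_eq)
qed

lemma fan_cone_zero: "c : SigmaFan L e ==> 0 : c"
 by (auto simp: SigmaFan_def Ccone_def convex_cone_hull_contains_0)

lemma fl_fl [simp]: "fl (fl v) = v" by (simp add: fl_def)

lemma fl_pair: "fl (a, b) = (- b, - a)" by (simp add: fl_def)

lemma fl_image_image [simp]: "fl ` fl ` c = c" by (simp add: image_image)

lemma fl_hull: "fl ` (convex_cone hull X) = convex_cone hull (fl ` X)"
 by (simp add: convex_cone_hull_linear_image linear_fl)

lemma involution_image_diff:
 assumes "!!c. h (h c) = c"
 shows "h ` (h ` S - {s}) = S - {h s}"
proof
 show "h ` (h ` S - {s}) \<subseteq> S - {h s}" using assms by auto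
 show "S - {h s} \<subseteq> h ` (h ` S - {s})"
 proof
  fix c assume c: "c : S - {h s}"
  hence "h c : h ` S - {s}" using assms by auto
  hence "h (h c) : h ` (h ` S - {s})" by (rule imageI)
  thus "c : h ` (h ` S - {s})" by (simp only: assms)
 qed
qed

theorem theorem4p10:
  fixes L :: "('k::field, 'a) kalg" and e :: "nat \<Rightarrow> 'a" and T :: "'a cx"
  assumes "fd_algebra L" and "elementary L" and "complete_poi2 L e"
    and "\<forall>x\<in>acar L. amul L (amul L (e 2) x) (e 1) = azero L"
    and "mu_plus L e (Pshift L 1) (Pshift L 2) T \<or> mu_minus L e (Pcx L 2) (Pcx L 1) T"
  shows "\<exists>(G :: ('k, nat \<Rightarrow> 'k) kalg) f. fd_algebra G \<and> elementary G \<and> complete_poi2 G f \<and>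
           SigmaFan G f = subdiv (SigmaFan L e) (Ccone L e T)"
proof -
 note fd = assms(1)
 obtain rp :: "'a => (nat => 'k) aend" where rp: "rawrep L e rp" using rawrep_exists[OF fd assms(3)] by blast
 obtain xi where ca: "charalg L e xi" using rawrep.elementary_characters[OF rp fd assms(2,3)] by blast
 interpret charrep L e xi rp by (rule charrep.intro[OF ca rp]) (unfold charrep_axioms_def, use assms(4) in blast)
 have sub: "subdiv (SigmaFan L e) (convex_cone hull {u, v}) = (SigmaFan L e - {convex_cone hull {u, v}}) \<union>
  {convex_cone hull {u + v}, convex_cone hull {u, u + v}, convex_cone hull {v, u + v}}"
  if "primitive_vec u" "primitive_vec v" "fst u * snd v - fst v * snd u ~= 0" for u v
  by (rule subdiv_formula[OF that zero_in_fan]) (rule fan_cone_zero)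
 from assms(5) show ?thesis
 proof
  assume "mu_minus L e (Pcx L 2) (Pcx L 1) T"
  hence mut: "is_mutation L e (Pcx L 2) (Pcx L 1) T" by (simp add: mu_minus_def)
  obtain G :: "('k, nat => 'k) kalg" and f xi' and l :: nat where G: "fd_algebra G" "charalg G f xi'"
  "Ccone L e T = convex_cone hull {(1, 0), (real l, -1)}"
  "SigmaFan G f = (SigmaFan L e - {convex_cone hull {(1, 0), (real l, -1)}}) \<union> {convex_cone hull {(real (Suc l), -1)},
  convex_cone hull {(1, 0), (real (Suc l), -1)}, convex_cone hull {(real l, -1), (real (Suc l), -1)}}"
  by (rule fan_of_left_mutation[OF fd ca assms(4) mut]) (rule that)
  have "primitive_vec (1, 0)" unfolding primitive_vec_def by (intro exI[of _ 1] exI[of _ 0]) simp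
  moreover have "primitive_vec (real l, -1)" unfolding primitive_vec_def
  by (intro exI[of _ "int l"] exI[of _ "-1"]) simp
  ultimately have "SigmaFan G f = subdiv (SigmaFan L e) (Ccone L e T)"
  unfolding G(3,4) using sub[of "(1, 0)" "(real l, -1)"] by (simp add: add.commute)
  thus ?thesis using G(1,2) charalg.elementary charalg.poi by blast
 next
  assume "mu_plus L e (Pshift L 1) (Pshift L 2) T"
  hence m: "is_mutation L e (Pshift L 1) (Pshift L 2) T" by (simp add: mu_plus_def)
  have tri: "ALL x:acar (op L). amul (op L) (amul (op L) ((e \<circ> sw) 2) x) ((e \<circ> sw) 1) = azero (op L)"
  using assms(4) mul_assoc[OF ei_in[of 2] _ ei_in[of 1]] sw_12 by simp
  obtain G :: "('k, nat => 'k) kalg" and f xi' and l :: nat where G: "fd_algebra G" "charalg G f xi'"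
  "Ccone (op L) (e \<circ> sw) (Dc T) = convex_cone hull {(1, 0), (real l, -1)}"
  "SigmaFan G f = (SigmaFan (op L) (e \<circ> sw) - {convex_cone hull {(1, 0), (real l, -1)}}) \<union> {convex_cone hull {(real (Suc l), -1)},
  convex_cone hull {(1, 0), (real (Suc l), -1)}, convex_cone hull {(real l, -1), (real (Suc l), -1)}}"
  by (rule fan_of_left_mutation[OF fd_op[OF fd] charalg_op[OF ca] tri mutation_op(1)[OF ca fd m]]) (rule that)
  have "fl ` Ccone L e T = convex_cone hull {(1, 0), (real l, -1)}"
  using cone_op[OF ca fd mutation_op(2)[OF ca fd m]] G(3) by simp
  hence "Ccone L e T = fl ` (convex_cone hull {(1, 0), (real l, -1)})" using fl_image_image by metis
  hence C: "Ccone L e T = convex_cone hull {(0, -1), (1, - real l)}" by (simp add: fl_hull fl_pair insert_commute)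
  \<comment> \<open>The extension was built over the opposite algebra. Taking its opposite applies
    \<open>fl\<close> once more, which returns the cones of \<Lambda> that were kept and reflects
    the three new ones.\<close>
  have "SigmaFan (op G) (f \<circ> sw) = (SigmaFan L e - {fl ` (convex_cone hull {(1, 0), (real l, -1)})}) \<union>
  {fl ` (convex_cone hull {(real (Suc l), -1)}), fl ` (convex_cone hull {(1, 0), (real (Suc l), -1)}),
  fl ` (convex_cone hull {(real l, -1), (real (Suc l), -1)})}"
  unfolding fan_op[OF G(2,1)] G(4) fan_op[OF ca fd] image_Un
  involution_image_diff[of "(`) fl", OF fl_image_image] by simp
  hence S: "SigmaFan (op G) (f \<circ> sw) = (SigmaFan L e - {convex_cone hull {(0, -1), (1, - real l)}}) \<union>
  {convex_cone hull {(1, - real (Suc l))}, convex_cone hull {(0, -1), (1, - real (Suc l))},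
  convex_cone hull {(1, - real l), (1, - real (Suc l))}}" by (simp add: fl_hull fl_pair insert_commute)
  have "primitive_vec (0, -1)" unfolding primitive_vec_def by (intro exI[of _ 0] exI[of _ "-1"]) simp
  moreover have "primitive_vec (1, - real l)" unfolding primitive_vec_def
  by (intro exI[of _ 1] exI[of _ "- int l"]) simp
  ultimately have "SigmaFan (op G) (f \<circ> sw) = subdiv (SigmaFan L e) (Ccone L e T)"
  unfolding C S using sub[of "(0, -1)" "(1, - real l)"] by (simp add: algebra_simps)
  thus ?thesis
  using fd_op[OF G(1)] charalg.elementary[OF charalg_op[OF G(2)]] charalg.poi[OF charalg_op[OF G(2)]] by blast
 qed
qed

end
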